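(* If $\mathsf{Rel}$ is a $p$-dimensional parametric model of System F, then the forgetful functor $\int_n|\mathsf{Rel}|^n\to\mathsf{Rel}\ \longrightarrow\ \mathsf{Ctx}(\mathsf{Rel})$, sending $(n,\mathcal{F})\mapsto n$ and $(\mathbf{F},\eta)\mapsto\mathbf{F}$, is a split $\lambda2$-fibration.
   Context: Fix a finitely complete, locally small category $\mathcal{C}$; $\mathsf{Cat}(\mathcal{C})$ is the category of categories internal to $\mathcal{C}$, and all categories, functors, natural transformations, terminal objects, products and exponentials below are internal to $\mathcal{C}$ (for an internal category $\mathcal{X}$, $\mathcal{X}_0,\mathcal{X}_1$ are its objects of objects and of morphisms). Fix $p\in\mathbb{N}\cup\{\infty\}$. The category $\square$ has as objects the levels $l=\{0,\dots,l-1\}$ ($l\in\mathbb{N}$); a morphism $l_1\to l_2$ is a function $l_1\to l_2+\{\top,\bot\}$; identities are inclusions; $(g\circ f)(i)=\star$ if $f(i)=\star\in\{\top,\bot\}$ and $=g(j)$ if $f(i)=j\in\mathbb{N}$. For $\star\in\{\top,\bot\}$ and $k\le l$ the face map $\mathbf{f}_\star(l,k):l+1\to l$ sends $i\mapsto i$ ($i<k$), $k\mapsto\star$, $i\mapsto i-1$ ($i>k$); the degeneracy $\mathbf{d}(l,k):l\to l+1$ sends $i\mapsto i$ ($i<k$), $i\mapsto i+1$ ($i\ge k$). $\square_p$ is the subcategory of $\square$ generated by the levels $l\le p$ and the face maps and degeneracies with $l<p$. A ($p$-dimensional) cubical category is a functor $\mathcal{X}:\square_p\to\mathsf{Cat}(\mathcal{C})$;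 $|\mathcal{X}|$ is its levelwise discrete version and $\mathcal{X}^n$ its levelwise $n$-fold product. A cubical functor $\mathcal{F}:\mathcal{X}\to\mathcal{Y}$ is a family of functors $\mathcal{F}(l):\mathcal{X}(l)\to\mathcal{Y}(l)$, $l\le p$; it is face map-preserving if $\mathcal{Y}(h)\circ\mathcal{F}(l_1)=\mathcal{F}(l_2)\circ\mathcal{X}(h)$ for each face map $h:l_1\to l_2$ of $\square_p$, and degeneracy-preserving if for each degeneracy $h:l_1\to l_2$ of $\square_p$ it comes with a chosen natural isomorphism $\varepsilon_\mathcal{F}(h):\mathcal{Y}(h)\circ\mathcal{F}(l_1)\to\mathcal{F}(l_2)\circ\mathcal{X}(h)$. A cubical natural transformation $\eta:\mathcal{F}\to\mathcal{G}$ is a family of natural transformations $\eta(l):\mathcal{F}(l)\to\mathcal{G}(l)$; it is face map-preserving if $\mathcal{F},\mathcal{G}$ are and $\mathcal{Y}(h)(\eta(l_1)X)=\eta(l_2)(\mathcal{X}(h)X)$ for every face map $h:l_1\to l_2$ and object $X$ of $\mathcal{X}(l_1)$; it is degeneracy-preserving if $\mathcal{F},\mathcal{G}$ are and $\eta(l_2)(\mathcal{X}(h)X)\circ\varepsilon_\mathcal{F}(h)X=\varepsilon_\mathcal{G}(h)X\circ\mathcal{Y}(h)(\eta(l_1)X)$ for every degeneracy $h:l_1\to l_2$ and object $X$ of $\mathcal{X}(l_1)$. $\mathsf{Rel}$ is a $p$-dimensional cubical category equipped with a class $M=\sum_{l\le p}M(l)$ of good isomorphisms: $M(l)$ consists of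 morphisms $J\to\mathsf{Rel}(l)_1$ in $\mathcal{C}$ that are isomorphisms of $\mathsf{Rel}(l)$, contains all identities, and is closed under composition, inverses and reindexing by morphisms of $\mathcal{C}$. The category $|\mathsf{Rel}|^n\to\mathsf{Rel}$ has objects triples $(\mathcal{F},\varepsilon_\mathcal{F},\upsilon_\mathcal{F})$: $\mathcal{F}$ a face map-preserving cubical functor $|\mathsf{Rel}|^n\to\mathsf{Rel}$; $\varepsilon_\mathcal{F}$ natural isomorphisms witnessing degeneracy-preservation with $\varepsilon_\mathcal{F}(h)\in M(l_2)$ for each degeneracy $h:l_1\to l_2$; $\upsilon_\mathcal{F}$ assigns to each isomorphism $f:\mathsf{Rel}(l)_0^m\to\mathsf{Rel}(l)_1^n$ with all $\pi_k\circ f\in M(l)$ an isomorphism $\upsilon_\mathcal{F}(f):\mathsf{Rel}(l)_0^m\to\mathsf{Rel}(l)_1$ in $M(l)$, respecting source, target, identities, composition and reindexing. Its morphisms are face map- and degeneracy-preserving cubical natural transformations. $\mathsf{Ctx}(\mathsf{Rel})$ has natural numbers as objects; morphisms $n\to m$ are $m$-tuples of objects of $|\mathsf{Rel}|^n\to\mathsf{Rel}$ (composition by substitution); products $m\times1:=m+1$. $\int_n|\mathsf{Rel}|^n\to\mathsf{Rel}$ has objects pairs $(n,\mathcal{F})$ with $\mathcal{F}$ an object of $|\mathsf{Rel}|^n\to\mathsf{Rel}$, and morphisms $(n,\mathcal{F})\to(m,\mathcal{G})$ pairs $(\mathbf{F},\eta)$ with $\mathbf{F}:n\to m$ in $\mathsf{Ctx}(\mathsf{Rel})$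 and $\eta:\mathcal{F}\to\mathcal{G}\circ\mathbf{F}$ in $|\mathsf{Rel}|^n\to\mathsf{Rel}$. $\mathsf{Rel}$ has terminal objects stable under face maps and degeneracies if there are chosen terminal objects $1_l$ of $\mathsf{Rel}(l)$ with $\mathsf{Rel}(h)1_{l_1}=1_{l_2}$ for face maps $h$, and up to an isomorphism in $M(l_2)$ for degeneracies $h$. It has products stable under face maps and degeneracies if there are chosen products $(\times_l,\mathsf{fst}_l,\mathsf{snd}_l)$ in each $\mathsf{Rel}(l)$, each $M(l)$ closed under products, such that for face maps $h:l_1\to l_2$: $\mathsf{Rel}(h)(A\times_{l_1}B)=\mathsf{Rel}(h)A\times_{l_2}\mathsf{Rel}(h)B$, $\mathsf{Rel}(h)(\mathsf{fst}_{l_1}[A,B])=\mathsf{fst}_{l_2}[\mathsf{Rel}(h)A,\mathsf{Rel}(h)B]$ and likewise for $\mathsf{snd}$; and for degeneracies $h$ the first equation holds up to an isomorphism $\varepsilon(h,A,B)\in M(l_2)$ with $\mathsf{fst}_{l_2}[\ldots]\circ\varepsilon(h,A,B)=\mathsf{Rel}(h)(\mathsf{fst}_{l_1}[A,B])$ and likewise for $\mathsf{snd}$. It has exponentials stable under face maps and degeneracies if additionally there are chosen exponentials $(\Rightarrow_l,\mathsf{eval}_l)$ in each $\mathsf{Rel}(l)$, each $M(l)$ closed under exponentials, with $\mathsf{Rel}(h)(A\Rightarrow_{l_1}B)=\mathsf{Rel}(h)A\Rightarrow_{l_2}\mathsf{Rel}(h)B$ and $\mathsf{Rel}(h)(\mathsf{eval}_{l_1}[A,B])=\mathsf{eval}_{l_2}[\mathsf{Rel}(h)A,\mathsf{Rel}(h)B]$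 for face maps $h$, and for degeneracies $h$ the first equation holding up to an isomorphism $\upsilon(h,A,B)\in M(l_2)$ with $\mathsf{eval}_{l_2}[\mathsf{Rel}(h)A,\mathsf{Rel}(h)B]\circ(\upsilon(h,A,B)\times_{l_2}1)\circ\varepsilon(h,A\Rightarrow_{l_1}B,A)=\mathsf{Rel}(h)(\mathsf{eval}_{l_1}[A,B])$. A split fibration is a fibration with chosen cartesian lifts such that reindexing is strictly functorial. A split generic object $\Omega$ is an object of the base with bijections $\mathcal{B}(A,\Omega)\cong\mathrm{Ob}(\mathcal{E}_A)$ natural in $A$ (precomposition corresponding strictly to reindexing). A split cartesian closed fibration is a split fibration whose fibres have chosen cartesian closed structure strictly preserved by reindexing. A split fibration $U:\mathcal{E}\to\mathcal{B}$ with distinguished object $\Omega$ and chosen products $(-)\times\Omega$ in $\mathcal{B}$ has split simple $\Omega$-products if there are chosen right adjoints $\forall_A:\mathcal{E}_{A\times\Omega}\to\mathcal{E}_A$ to the weakening functors $\mathsf{fst}[A,\Omega]^*$, with units $\eta_A$ and counits $\varepsilon_A$, such that for every $f:A\to B$: $f^*\circ\forall_B=\forall_A\circ(f\times1)^*$, $f^*(\eta_B(X))=\eta_A(f^*X)$, $(f\times1)^*(\varepsilon_B(X))=\varepsilon_A((f\times1)^*X)$. A split $\lambda2$-fibration is a split cartesian closed fibration $U:\mathcal{E}\to\mathcal{B}$ with a terminal object in $\mathcal{B}$, a split generic object $\Omega$, chosen products $(-)\times\Omega$ in $\mathcal{B}$, and split simple $\Omega$-products. $\mathsf{Rel}$ is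 a $p$-dimensional parametric model of System F if it has terminal objects, products and exponentials, all stable under face maps and degeneracies, and the forgetful functor $\int_n|\mathsf{Rel}|^n\to\mathsf{Rel}\ \longrightarrow\ \mathsf{Ctx}(\mathsf{Rel})$ has split simple $1$-products.
   Formalization: The definition of a parametric model here additionally requires that ∫ₙ|Rel|ⁿ→Rel be a category; with the stated morphisms, which need not respect υ, composites can fail to be degeneracy-preserving, so this does not hold automatically. *)

theory Defs
  imports "HOL-Library.Extended_Nat"
begin

section \<open>Categories\<close>

text \<open>The composite \<open>g \<cdot> f\<close> is in applicative order. Hom-collections are sets of elements of a type,
  so local smallness is built in.\<close>

record ('o, 'a) cat =
  Ob :: "'o set"
  Ar :: "'a set"
  Dom :: "'a \<Rightarrow> 'o"
  Cod :: "'a \<Rightarrow> 'o"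
  Ident :: "'o \<Rightarrow> 'a"
  Comp :: "'a \<Rightarrow> 'a \<Rightarrow> 'a"  (infixl "\<cdot>\<index>" 70)

definition hom :: "('o, 'a) cat \<Rightarrow> 'o \<Rightarrow> 'o \<Rightarrow> 'a set" where
  "hom C A B = {f \<in> Ar C. Dom C f = A \<and> Cod C f = B}"

definition category :: "('o, 'a) cat \<Rightarrow> bool" where
  "category C \<longleftrightarrow>
     (\<forall>f\<in>Ar C. Dom C f \<in> Ob C \<and> Cod C f \<in> Ob C) \<and>
     (\<forall>A\<in>Ob C. Ident C A \<in> hom C A A) \<and>
     (\<forall>f\<in>Ar C. \<forall>g\<in>Ar C. Dom C g = Cod C f \<longrightarrow> g \<cdot>\<^bsub>C\<^esub> f \<in> hom C (Dom C f) (Cod C g)) \<and>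
     (\<forall>f\<in>Ar C. f \<cdot>\<^bsub>C\<^esub> Ident C (Dom C f) = f \<and> Ident C (Cod C f) \<cdot>\<^bsub>C\<^esub> f = f) \<and>
     (\<forall>f\<in>Ar C. \<forall>g\<in>Ar C. \<forall>h\<in>Ar C. Dom C g = Cod C f \<and> Dom C h = Cod C g \<longrightarrow>
        (h \<cdot>\<^bsub>C\<^esub> g) \<cdot>\<^bsub>C\<^esub> f = h \<cdot>\<^bsub>C\<^esub> (g \<cdot>\<^bsub>C\<^esub> f))"

record ('o, 'a, 'x, 'y) fctr =
  FO :: "'o \<Rightarrow> 'x"
  FA :: "'a \<Rightarrow> 'y"

definition is_functor :: "('o, 'a) cat \<Rightarrow> ('x, 'y) cat \<Rightarrow> ('o, 'a, 'x, 'y) fctr \<Rightarrow> bool" where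
  "is_functor A B F \<longleftrightarrow>
     (\<forall>X\<in>Ob A. FO F X \<in> Ob B) \<and>
     (\<forall>f\<in>Ar A. FA F f \<in> hom B (FO F (Dom A f)) (FO F (Cod A f))) \<and>
     (\<forall>X\<in>Ob A. FA F (Ident A X) = Ident B (FO F X)) \<and>
     (\<forall>f\<in>Ar A. \<forall>g\<in>Ar A. Dom A g = Cod A f \<longrightarrow> FA F (g \<cdot>\<^bsub>A\<^esub> f) = FA F g \<cdot>\<^bsub>B\<^esub> FA F f)"

definition is_cone ::
  "('j, 'k) cat \<Rightarrow> ('o, 'a) cat \<Rightarrow> ('j, 'k, 'o, 'a) fctr \<Rightarrow> 'o \<Rightarrow> ('j \<Rightarrow> 'a) \<Rightarrow> bool" where
  "is_cone J C D L c \<longleftrightarrow>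
     L \<in> Ob C \<and> (\<forall>j\<in>Ob J. c j \<in> hom C L (FO D j)) \<and>
     (\<forall>u\<in>Ar J. FA D u \<cdot>\<^bsub>C\<^esub> c (Dom J u) = c (Cod J u))"

definition is_limit ::
  "('j, 'k) cat \<Rightarrow> ('o, 'a) cat \<Rightarrow> ('j, 'k, 'o, 'a) fctr \<Rightarrow> 'o \<Rightarrow> ('j \<Rightarrow> 'a) \<Rightarrow> bool" where
  "is_limit J C D L c \<longleftrightarrow>
     is_cone J C D L c \<and>
     (\<forall>L' c'. is_cone J C D L' c' \<longrightarrow>
        (\<exists>!k. k \<in> hom C L' L \<and> (\<forall>j\<in>Ob J. c j \<cdot>\<^bsub>C\<^esub> k = c' j)))"

text \<open>Every finite category is isomorphic to one whose objects and arrows are natural numbers.\<close>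

definition finitely_complete :: "('o, 'a) cat \<Rightarrow> bool" where
  "finitely_complete C \<longleftrightarrow> category C \<and>
     (\<forall>(J :: (nat, nat) cat) D. category J \<and> finite (Ob J) \<and> finite (Ar J) \<and> is_functor J C D \<longrightarrow>
        (\<exists>L c. is_limit J C D L c))"

definition is_terminal :: "('o, 'a) cat \<Rightarrow> 'o \<Rightarrow> bool" where
  "is_terminal C T \<longleftrightarrow> T \<in> Ob C \<and> (\<forall>A\<in>Ob C. \<exists>!f. f \<in> hom C A T)"

definition one :: "('o, 'a) cat \<Rightarrow> 'o" where
  "one C = (SOME T. is_terminal C T)"

definition bang :: "('o, 'a) cat \<Rightarrow> 'o \<Rightarrow> 'a" where
  "bang C A = (THE f. f \<in> hom C A (one C))"

subsection \<open>Finite powers and pullbacks in a finitely complete category\<close>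

definition is_power :: "('o, 'a) cat \<Rightarrow> nat \<Rightarrow> 'o \<Rightarrow> 'o \<Rightarrow> (nat \<Rightarrow> 'a) \<Rightarrow> bool" where
  "is_power C n A P pr \<longleftrightarrow>
     P \<in> Ob C \<and> (\<forall>i<n. pr i \<in> hom C P A) \<and>
     (\<forall>Q q. Q \<in> Ob C \<and> (\<forall>i<n. q i \<in> hom C Q A) \<longrightarrow>
        (\<exists>!k. k \<in> hom C Q P \<and> (\<forall>i<n. pr i \<cdot>\<^bsub>C\<^esub> k = q i)))"

definition power_cone :: "('o, 'a) cat \<Rightarrow> nat \<Rightarrow> 'o \<Rightarrow> 'o \<times> (nat \<Rightarrow> 'a)" where
  "power_cone C n A = (SOME c. is_power C n A (fst c) (snd c))"

definition pow_ob :: "('o, 'a) cat \<Rightarrow> nat \<Rightarrow> 'o \<Rightarrow> 'o" where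
  "pow_ob C n A = fst (power_cone C n A)"

definition pow_pr :: "('o, 'a) cat \<Rightarrow> nat \<Rightarrow> 'o \<Rightarrow> nat \<Rightarrow> 'a" where
  "pow_pr C n A = snd (power_cone C n A)"

definition tuple :: "('o, 'a) cat \<Rightarrow> nat \<Rightarrow> 'o \<Rightarrow> 'o \<Rightarrow> (nat \<Rightarrow> 'a) \<Rightarrow> 'a" where
  "tuple C n A Q q =
     (THE k. k \<in> hom C Q (pow_ob C n A) \<and> (\<forall>i<n. pow_pr C n A i \<cdot>\<^bsub>C\<^esub> k = q i))"

definition pow_map :: "('o, 'a) cat \<Rightarrow> nat \<Rightarrow> 'a \<Rightarrow> 'a" where
  "pow_map C n f =
     tuple C n (Cod C f) (pow_ob C n (Dom C f)) (\<lambda>i. f \<cdot>\<^bsub>C\<^esub> pow_pr C n (Dom C f) i)"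

definition pair :: "('o, 'a) cat \<Rightarrow> 'a \<Rightarrow> 'a \<Rightarrow> 'a" where
  "pair C f g = tuple C 2 (Cod C f) (Dom C f) (\<lambda>i. if i = 0 then f else g)"

definition is_pullback :: "('o, 'a) cat \<Rightarrow> 'a \<Rightarrow> 'a \<Rightarrow> 'o \<Rightarrow> 'a \<Rightarrow> 'a \<Rightarrow> bool" where
  "is_pullback C f g P q r \<longleftrightarrow>
     q \<in> hom C P (Dom C f) \<and> r \<in> hom C P (Dom C g) \<and> f \<cdot>\<^bsub>C\<^esub> q = g \<cdot>\<^bsub>C\<^esub> r \<and>
     (\<forall>Q u v. u \<in> hom C Q (Dom C f) \<and> v \<in> hom C Q (Dom C g) \<and> f \<cdot>\<^bsub>C\<^esub> u = g \<cdot>\<^bsub>C\<^esub> v \<longrightarrow>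
        (\<exists>!k. k \<in> hom C Q P \<and> q \<cdot>\<^bsub>C\<^esub> k = u \<and> r \<cdot>\<^bsub>C\<^esub> k = v))"

definition pullback_cone :: "('o, 'a) cat \<Rightarrow> 'a \<Rightarrow> 'a \<Rightarrow> 'o \<times> 'a \<times> 'a" where
  "pullback_cone C f g = (SOME c. is_pullback C f g (fst c) (fst (snd c)) (snd (snd c)))"

definition pb_ob :: "('o, 'a) cat \<Rightarrow> 'a \<Rightarrow> 'a \<Rightarrow> 'o" where
  "pb_ob C f g = fst (pullback_cone C f g)"

definition pb_fst :: "('o, 'a) cat \<Rightarrow> 'a \<Rightarrow> 'a \<Rightarrow> 'a" where
  "pb_fst C f g = fst (snd (pullback_cone C f g))"

definition pb_snd :: "('o, 'a) cat \<Rightarrow> 'a \<Rightarrow> 'a \<Rightarrow> 'a" where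
  "pb_snd C f g = snd (snd (pullback_cone C f g))"

definition pb_pair :: "('o, 'a) cat \<Rightarrow> 'a \<Rightarrow> 'a \<Rightarrow> 'a \<Rightarrow> 'a \<Rightarrow> 'a" where
  "pb_pair C f g u v =
     (THE k. k \<in> hom C (Dom C u) (pb_ob C f g) \<and>
             pb_fst C f g \<cdot>\<^bsub>C\<^esub> k = u \<and> pb_snd C f g \<cdot>\<^bsub>C\<^esub> k = v)"

section \<open>Internal categories\<close>

record ('o, 'a) icat =
  iob :: 'o
  imor :: 'o
  src :: 'a
  tgt :: 'a
  idn :: 'a
  cmp :: 'a

text \<open>\<open>cmp\<close> has as domain the pullback of \<open>src\<close> along \<open>tgt\<close>, i.e. the object of pairs \<open>(g, f)\<close> with
  \<open>src g = tgt f\<close>. The operations below act on generalized elements \<open>J \<rightarrow> imor X\<close>.\<close>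

definition icomp :: "('o, 'a) cat \<Rightarrow> ('o, 'a) icat \<Rightarrow> 'a \<Rightarrow> 'a \<Rightarrow> 'a" where
  "icomp C X g f = cmp X \<cdot>\<^bsub>C\<^esub> pb_pair C (src X) (tgt X) g f"

definition ihom :: "('o, 'a) cat \<Rightarrow> ('o, 'a) icat \<Rightarrow> 'a \<Rightarrow> 'a \<Rightarrow> 'a set" where
  "ihom C X A B = {f \<in> hom C (Dom C A) (imor X). src X \<cdot>\<^bsub>C\<^esub> f = A \<and> tgt X \<cdot>\<^bsub>C\<^esub> f = B}"

definition internal_category :: "('o, 'a) cat \<Rightarrow> ('o, 'a) icat \<Rightarrow> bool" where
  "internal_category C X \<longleftrightarrow>
     iob X \<in> Ob C \<and> imor X \<in> Ob C \<and>
     src X \<in> hom C (imor X) (iob X) \<and> tgt X \<in> hom C (imor X) (iob X) \<and>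
     idn X \<in> hom C (iob X) (imor X) \<and>
     cmp X \<in> hom C (pb_ob C (src X) (tgt X)) (imor X) \<and>
     src X \<cdot>\<^bsub>C\<^esub> idn X = Ident C (iob X) \<and> tgt X \<cdot>\<^bsub>C\<^esub> idn X = Ident C (iob X) \<and>
     src X \<cdot>\<^bsub>C\<^esub> cmp X = src X \<cdot>\<^bsub>C\<^esub> pb_snd C (src X) (tgt X) \<and>
     tgt X \<cdot>\<^bsub>C\<^esub> cmp X = tgt X \<cdot>\<^bsub>C\<^esub> pb_fst C (src X) (tgt X) \<and>
     (\<forall>J. \<forall>f\<in>hom C J (imor X).
        icomp C X f (idn X \<cdot>\<^bsub>C\<^esub> (src X \<cdot>\<^bsub>C\<^esub> f)) = f \<and> icomp C X (idn X \<cdot>\<^bsub>C\<^esub> (tgt X \<cdot>\<^bsub>C\<^esub> f)) f = f) \<and>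
     (\<forall>J. \<forall>f\<in>hom C J (imor X). \<forall>g\<in>hom C J (imor X). \<forall>h\<in>hom C J (imor X).
        src X \<cdot>\<^bsub>C\<^esub> g = tgt X \<cdot>\<^bsub>C\<^esub> f \<and> src X \<cdot>\<^bsub>C\<^esub> h = tgt X \<cdot>\<^bsub>C\<^esub> g \<longrightarrow>
        icomp C X (icomp C X h g) f = icomp C X h (icomp C X g f))"

definition inverse_pair :: "('o, 'a) cat \<Rightarrow> ('o, 'a) icat \<Rightarrow> 'a \<Rightarrow> 'a \<Rightarrow> bool" where
  "inverse_pair C X f g \<longleftrightarrow>
     f \<in> Ar C \<and> Cod C f = imor X \<and> g \<in> ihom C X (tgt X \<cdot>\<^bsub>C\<^esub> f) (src X \<cdot>\<^bsub>C\<^esub> f) \<and>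
     icomp C X g f = idn X \<cdot>\<^bsub>C\<^esub> (src X \<cdot>\<^bsub>C\<^esub> f) \<and> icomp C X f g = idn X \<cdot>\<^bsub>C\<^esub> (tgt X \<cdot>\<^bsub>C\<^esub> f)"

definition iiso :: "('o, 'a) cat \<Rightarrow> ('o, 'a) icat \<Rightarrow> 'a \<Rightarrow> bool" where
  "iiso C X f \<longleftrightarrow> (\<exists>g. inverse_pair C X f g)"

definition iinv :: "('o, 'a) cat \<Rightarrow> ('o, 'a) icat \<Rightarrow> 'a \<Rightarrow> 'a" where
  "iinv C X f = (THE g. inverse_pair C X f g)"

record ('o, 'a) ifun =
  idom :: "('o, 'a) icat"
  icod :: "('o, 'a) icat"
  fo :: 'a
  fm :: 'a

definition internal_functor :: "('o, 'a) cat \<Rightarrow> ('o, 'a) ifun \<Rightarrow> bool" where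
  "internal_functor C F \<longleftrightarrow> (let X = idom F; Y = icod F in
     internal_category C X \<and> internal_category C Y \<and>
     fo F \<in> hom C (iob X) (iob Y) \<and> fm F \<in> hom C (imor X) (imor Y) \<and>
     src Y \<cdot>\<^bsub>C\<^esub> fm F = fo F \<cdot>\<^bsub>C\<^esub> src X \<and> tgt Y \<cdot>\<^bsub>C\<^esub> fm F = fo F \<cdot>\<^bsub>C\<^esub> tgt X \<and>
     fm F \<cdot>\<^bsub>C\<^esub> idn X = idn Y \<cdot>\<^bsub>C\<^esub> fo F \<and>
     fm F \<cdot>\<^bsub>C\<^esub> cmp X =
       icomp C Y (fm F \<cdot>\<^bsub>C\<^esub> pb_fst C (src X) (tgt X)) (fm F \<cdot>\<^bsub>C\<^esub> pb_snd C (src X) (tgt X)))"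

definition CAT :: "('o, 'a) cat \<Rightarrow> (('o, 'a) icat, ('o, 'a) ifun) cat" where
  "CAT C = \<lparr>
     Ob = {X. internal_category C X},
     Ar = {F. internal_functor C F},
     Dom = idom,
     Cod = icod,
     Ident = (\<lambda>X. \<lparr>idom = X, icod = X, fo = Ident C (iob X), fm = Ident C (imor X)\<rparr>),
     Comp = (\<lambda>G F. \<lparr>idom = idom F, icod = icod G, fo = fo G \<cdot>\<^bsub>C\<^esub> fo F, fm = fm G \<cdot>\<^bsub>C\<^esub> fm F\<rparr>)\<rparr>"

definition internal_nat ::
  "('o, 'a) cat \<Rightarrow> ('o, 'a) ifun \<Rightarrow> ('o, 'a) ifun \<Rightarrow> 'a \<Rightarrow> bool" where
  "internal_nat C F G t \<longleftrightarrow> (let X = idom F; Y = icod F in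
     internal_functor C F \<and> internal_functor C G \<and> idom G = X \<and> icod G = Y \<and>
     t \<in> ihom C Y (fo F) (fo G) \<and>
     icomp C Y (t \<cdot>\<^bsub>C\<^esub> tgt X) (fm F) = icomp C Y (fm G) (t \<cdot>\<^bsub>C\<^esub> src X))"

definition internal_nat_iso ::
  "('o, 'a) cat \<Rightarrow> ('o, 'a) ifun \<Rightarrow> ('o, 'a) ifun \<Rightarrow> 'a \<Rightarrow> bool" where
  "internal_nat_iso C F G t \<longleftrightarrow> internal_nat C F G t \<and> iiso C (icod F) t"

text \<open>The discrete internal category on the objects of \<open>X\<close>: its only composable pairs are \<open>(f, f)\<close>.\<close>

definition idisc :: "('o, 'a) cat \<Rightarrow> ('o, 'a) icat \<Rightarrow> ('o, 'a) icat" where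
  "idisc C X = (let i = Ident C (iob X) in
     \<lparr>iob = iob X, imor = iob X, src = i, tgt = i, idn = i, cmp = pb_fst C i i\<rparr>)"

definition fdisc :: "('o, 'a) cat \<Rightarrow> ('o, 'a) ifun \<Rightarrow> ('o, 'a) ifun" where
  "fdisc C F = \<lparr>idom = idisc C (idom F), icod = idisc C (icod F), fo = fo F, fm = fo F\<rparr>"

definition ipow :: "('o, 'a) cat \<Rightarrow> nat \<Rightarrow> ('o, 'a) icat \<Rightarrow> ('o, 'a) icat" where
  "ipow C n X = (let s = pow_map C n (src X); t = pow_map C n (tgt X) in
     \<lparr>iob = pow_ob C n (iob X), imor = pow_ob C n (imor X), src = s, tgt = t,
      idn = pow_map C n (idn X),
      cmp = tuple C n (imor X) (pb_ob C s t)
        (\<lambda>i. icomp C X (pow_pr C n (imor X) i \<cdot>\<^bsub>C\<^esub> pb_fst C s t)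
                       (pow_pr C n (imor X) i \<cdot>\<^bsub>C\<^esub> pb_snd C s t))\<rparr>)"

definition fpow :: "('o, 'a) cat \<Rightarrow> nat \<Rightarrow> ('o, 'a) ifun \<Rightarrow> ('o, 'a) ifun" where
  "fpow C n F = \<lparr>idom = ipow C n (idom F), icod = ipow C n (icod F),
     fo = pow_map C n (fo F), fm = pow_map C n (fm F)\<rparr>"

subsection \<open>Terminal objects, products and exponentials inside an internal category\<close>

definition iterminal :: "('o, 'a) cat \<Rightarrow> ('o, 'a) icat \<Rightarrow> 'a \<Rightarrow> bool" where
  "iterminal C X t \<longleftrightarrow>
     t \<in> hom C (one C) (iob X) \<and>
     (\<forall>J. \<forall>Z\<in>hom C J (iob X). \<exists>!k. k \<in> ihom C X Z (t \<cdot>\<^bsub>C\<^esub> bang C J))"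

text \<open>\<open>iprd, iexp : X\<^sub>0\<^sup>2 \<rightarrow> X\<^sub>0\<close> and \<open>ifst, isnd, ievl : X\<^sub>0\<^sup>2 \<rightarrow> X\<^sub>1\<close>; the value \<open>m[A, B]\<close> of such an \<open>m\<close> at
  generalized objects \<open>A, B : J \<rightarrow> X\<^sub>0\<close> is \<open>m \<cdot> pair A B\<close>.\<close>

record 'a icc =
  iprd :: 'a
  ifst :: 'a
  isnd :: 'a
  iexp :: 'a
  ievl :: 'a

definition at2 :: "('o, 'a) cat \<Rightarrow> 'a \<Rightarrow> 'a \<Rightarrow> 'a \<Rightarrow> 'a" where
  "at2 C m A B = m \<cdot>\<^bsub>C\<^esub> pair C A B"

definition iproducts :: "('o, 'a) cat \<Rightarrow> ('o, 'a) icat \<Rightarrow> 'a icc \<Rightarrow> bool" where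
  "iproducts C X P \<longleftrightarrow>
     iprd P \<in> hom C (pow_ob C 2 (iob X)) (iob X) \<and>
     ifst P \<in> hom C (pow_ob C 2 (iob X)) (imor X) \<and>
     isnd P \<in> hom C (pow_ob C 2 (iob X)) (imor X) \<and>
     (\<forall>J. \<forall>A\<in>hom C J (iob X). \<forall>B\<in>hom C J (iob X).
        at2 C (ifst P) A B \<in> ihom C X (at2 C (iprd P) A B) A \<and>
        at2 C (isnd P) A B \<in> ihom C X (at2 C (iprd P) A B) B \<and>
        (\<forall>Z\<in>hom C J (iob X). \<forall>f\<in>ihom C X Z A. \<forall>g\<in>ihom C X Z B.
           \<exists>!k. k \<in> ihom C X Z (at2 C (iprd P) A B) \<and>
                icomp C X (at2 C (ifst P) A B) k = f \<and> icomp C X (at2 C (isnd P) A B) k = g))"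

definition iprod_map :: "('o, 'a) cat \<Rightarrow> ('o, 'a) icat \<Rightarrow> 'a icc \<Rightarrow> 'a \<Rightarrow> 'a \<Rightarrow> 'a" where
  "iprod_map C X P f g =
     (let A = src X \<cdot>\<^bsub>C\<^esub> f; A' = tgt X \<cdot>\<^bsub>C\<^esub> f; B = src X \<cdot>\<^bsub>C\<^esub> g; B' = tgt X \<cdot>\<^bsub>C\<^esub> g in
      THE k. k \<in> ihom C X (at2 C (iprd P) A B) (at2 C (iprd P) A' B') \<and>
             icomp C X (at2 C (ifst P) A' B') k = icomp C X f (at2 C (ifst P) A B) \<and>
             icomp C X (at2 C (isnd P) A' B') k = icomp C X g (at2 C (isnd P) A B))"

definition iexponentials :: "('o, 'a) cat \<Rightarrow> ('o, 'a) icat \<Rightarrow> 'a icc \<Rightarrow> bool" where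
  "iexponentials C X P \<longleftrightarrow>
     iexp P \<in> hom C (pow_ob C 2 (iob X)) (iob X) \<and>
     ievl P \<in> hom C (pow_ob C 2 (iob X)) (imor X) \<and>
     (\<forall>J. \<forall>A\<in>hom C J (iob X). \<forall>B\<in>hom C J (iob X).
        at2 C (ievl P) A B \<in> ihom C X (at2 C (iprd P) (at2 C (iexp P) A B) A) B \<and>
        (\<forall>Z\<in>hom C J (iob X). \<forall>f\<in>ihom C X (at2 C (iprd P) Z A) B.
           \<exists>!k. k \<in> ihom C X Z (at2 C (iexp P) A B) \<and>
                icomp C X (at2 C (ievl P) A B) (iprod_map C X P k (idn X \<cdot>\<^bsub>C\<^esub> A)) = f))"

text \<open>For isomorphisms \<open>f : A \<rightarrow> A'\<close> and \<open>g : B \<rightarrow> B'\<close>, the isomorphism \<open>(A \<Rightarrow> B) \<rightarrow> (A' \<Rightarrow> B')\<close> obtained by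
  precomposing with the inverse of \<open>f\<close> and postcomposing with \<open>g\<close>.\<close>

definition iexp_map :: "('o, 'a) cat \<Rightarrow> ('o, 'a) icat \<Rightarrow> 'a icc \<Rightarrow> 'a \<Rightarrow> 'a \<Rightarrow> 'a" where
  "iexp_map C X P f g =
     (let A = src X \<cdot>\<^bsub>C\<^esub> f; A' = tgt X \<cdot>\<^bsub>C\<^esub> f; B = src X \<cdot>\<^bsub>C\<^esub> g; B' = tgt X \<cdot>\<^bsub>C\<^esub> g;
          E = at2 C (iexp P) A B in
      THE k. k \<in> ihom C X E (at2 C (iexp P) A' B') \<and>
             icomp C X (at2 C (ievl P) A' B') (iprod_map C X P k (idn X \<cdot>\<^bsub>C\<^esub> A')) =
             icomp C X g (icomp C X (at2 C (ievl P) A B)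
                (iprod_map C X P (idn X \<cdot>\<^bsub>C\<^esub> E) (iinv C X f))))"

section \<open>The cube category\<close>

text \<open>A morphism \<open>l\<^sub>1 \<rightarrow> l\<^sub>2\<close>, i.e. a function from \<open>{0..<l\<^sub>1}\<close> to \<open>{0..<l\<^sub>2} + {\<top>, \<bottom>}\<close>, is encoded as the list of
  its \<open>l\<^sub>1\<close> values together with \<open>l\<^sub>2\<close>.\<close>

datatype cube_val = Coord nat | Top | Bot

type_synonym cube_ar = "cube_val list \<times> nat"

definition box :: "(nat, cube_ar) cat" where
  "box = \<lparr>
     Ob = UNIV,
     Ar = {(xs, n). \<forall>j. Coord j \<in> set xs \<longrightarrow> j < n},
     Dom = (\<lambda>(xs, n). length xs),
     Cod = snd,
     Ident = (\<lambda>n. (map Coord [0..<n], n)),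
     Comp = (\<lambda>(ys, n) (xs, m).
       (map (\<lambda>x. case x of Coord j \<Rightarrow> ys ! j | Top \<Rightarrow> Top | Bot \<Rightarrow> Bot) xs, n))\<rparr>"

definition face :: "cube_val \<Rightarrow> nat \<Rightarrow> nat \<Rightarrow> cube_ar" where
  "face s l k =
     (map (\<lambda>i. if i < k then Coord i else if i = k then s else Coord (i - 1)) [0..<l + 1], l)"

definition degen :: "nat \<Rightarrow> nat \<Rightarrow> cube_ar" where
  "degen l k = (map (\<lambda>i. if i < k then Coord i else Coord (i + 1)) [0..<l], l + 1)"

definition levels :: "enat \<Rightarrow> nat set" where
  "levels p = {l. enat l \<le> p}"

definition faces :: "enat \<Rightarrow> cube_ar set" where
  "faces p = {face s l k | s l k. s \<in> {Top, Bot} \<and> enat l < p \<and> k \<le> l}"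

definition degens :: "enat \<Rightarrow> cube_ar set" where
  "degens p = {degen l k | l k. enat l < p \<and> k \<le> l}"

inductive_set box_ars :: "enat \<Rightarrow> cube_ar set" for p :: enat where
  ident: "l \<in> levels p \<Longrightarrow> Ident box l \<in> box_ars p"
| face: "h \<in> faces p \<Longrightarrow> h \<in> box_ars p"
| degen: "h \<in> degens p \<Longrightarrow> h \<in> box_ars p"
| comp: "f \<in> box_ars p \<Longrightarrow> g \<in> box_ars p \<Longrightarrow> Dom box g = Cod box f \<Longrightarrow> g \<cdot>\<^bsub>box\<^esub> f \<in> box_ars p"

definition box_upto :: "enat \<Rightarrow> (nat, cube_ar) cat" where
  "box_upto p = box\<lparr>Ob := levels p, Ar := box_ars p\<rparr>"

section \<open>Cubical categories, functors and natural transformations\<close>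

type_synonym ('o, 'a) cubcat = "(nat, cube_ar, ('o, 'a) icat, ('o, 'a) ifun) fctr"

definition cubical_category :: "('o, 'a) cat \<Rightarrow> enat \<Rightarrow> ('o, 'a) cubcat \<Rightarrow> bool" where
  "cubical_category C p X \<longleftrightarrow> is_functor (box_upto p) (CAT C) X"

definition disc :: "('o, 'a) cat \<Rightarrow> ('o, 'a) cubcat \<Rightarrow> ('o, 'a) cubcat" where
  "disc C X = \<lparr>FO = (\<lambda>l. idisc C (FO X l)), FA = (\<lambda>h. fdisc C (FA X h))\<rparr>"

definition cpow :: "('o, 'a) cat \<Rightarrow> nat \<Rightarrow> ('o, 'a) cubcat \<Rightarrow> ('o, 'a) cubcat" where
  "cpow C n X = \<lparr>FO = (\<lambda>l. ipow C n (FO X l)), FA = (\<lambda>h. fpow C n (FA X h))\<rparr>"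

definition cubical_functor ::
  "('o, 'a) cat \<Rightarrow> enat \<Rightarrow> ('o, 'a) cubcat \<Rightarrow> ('o, 'a) cubcat \<Rightarrow> (nat \<Rightarrow> ('o, 'a) ifun) \<Rightarrow> bool" where
  "cubical_functor C p X Y F \<longleftrightarrow> (\<forall>l\<in>levels p. F l \<in> hom (CAT C) (FO X l) (FO Y l))"

definition face_preserving ::
  "('o, 'a) cat \<Rightarrow> enat \<Rightarrow> ('o, 'a) cubcat \<Rightarrow> ('o, 'a) cubcat \<Rightarrow> (nat \<Rightarrow> ('o, 'a) ifun) \<Rightarrow> bool" where
  "face_preserving C p X Y F \<longleftrightarrow>
     (\<forall>h\<in>faces p. FA Y h \<cdot>\<^bsub>CAT C\<^esub> F (Dom box h) = F (Cod box h) \<cdot>\<^bsub>CAT C\<^esub> FA X h)"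

definition degen_preserving ::
  "('o, 'a) cat \<Rightarrow> enat \<Rightarrow> ('o, 'a) cubcat \<Rightarrow> ('o, 'a) cubcat \<Rightarrow> (nat \<Rightarrow> ('o, 'a) ifun) \<Rightarrow>
     (cube_ar \<Rightarrow> 'a) \<Rightarrow> bool" where
  "degen_preserving C p X Y F e \<longleftrightarrow>
     (\<forall>h\<in>degens p. internal_nat_iso C
        (FA Y h \<cdot>\<^bsub>CAT C\<^esub> F (Dom box h)) (F (Cod box h) \<cdot>\<^bsub>CAT C\<^esub> FA X h) (e h))"

definition cubical_nat ::
  "('o, 'a) cat \<Rightarrow> enat \<Rightarrow> (nat \<Rightarrow> ('o, 'a) ifun) \<Rightarrow> (nat \<Rightarrow> ('o, 'a) ifun) \<Rightarrow> (nat \<Rightarrow> 'a) \<Rightarrow> bool" where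
  "cubical_nat C p F G t \<longleftrightarrow> (\<forall>l\<in>levels p. internal_nat C (F l) (G l) (t l))"

text \<open>The equations below are stated at the generic object (the identity generalized element of
  \<open>X(l\<^sub>1)\<^sub>0\<close>), hence hold at every generalized object by precomposition.\<close>

definition face_preserving_nat ::
  "('o, 'a) cat \<Rightarrow> enat \<Rightarrow> ('o, 'a) cubcat \<Rightarrow> ('o, 'a) cubcat \<Rightarrow>
     (nat \<Rightarrow> ('o, 'a) ifun) \<Rightarrow> (nat \<Rightarrow> ('o, 'a) ifun) \<Rightarrow> (nat \<Rightarrow> 'a) \<Rightarrow> bool" where
  "face_preserving_nat C p X Y F G t \<longleftrightarrow>
     face_preserving C p X Y F \<and> face_preserving C p X Y G \<and>
     (\<forall>h\<in>faces p. fm (FA Y h) \<cdot>\<^bsub>C\<^esub> t (Dom box h) = t (Cod box h) \<cdot>\<^bsub>C\<^esub> fo (FA X h))"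

definition degen_preserving_nat ::
  "('o, 'a) cat \<Rightarrow> enat \<Rightarrow> ('o, 'a) cubcat \<Rightarrow> ('o, 'a) cubcat \<Rightarrow>
     (nat \<Rightarrow> ('o, 'a) ifun) \<Rightarrow> (cube_ar \<Rightarrow> 'a) \<Rightarrow>
     (nat \<Rightarrow> ('o, 'a) ifun) \<Rightarrow> (cube_ar \<Rightarrow> 'a) \<Rightarrow> (nat \<Rightarrow> 'a) \<Rightarrow> bool" where
  "degen_preserving_nat C p X Y F eF G eG t \<longleftrightarrow>
     degen_preserving C p X Y F eF \<and> degen_preserving C p X Y G eG \<and>
     (\<forall>h\<in>degens p.
        icomp C (FO Y (Cod box h)) (t (Cod box h) \<cdot>\<^bsub>C\<^esub> fo (FA X h)) (eF h) =
        icomp C (FO Y (Cod box h)) (eG h) (fm (FA Y h) \<cdot>\<^bsub>C\<^esub> t (Dom box h)))"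

section \<open>Good isomorphisms and the categories \<open>|Rel|\<^sup>n \<rightarrow> Rel\<close>\<close>

definition good_isos :: "('o, 'a) cat \<Rightarrow> enat \<Rightarrow> ('o, 'a) cubcat \<Rightarrow> (nat \<Rightarrow> 'a set) \<Rightarrow> bool" where
  "good_isos C p R M \<longleftrightarrow> (\<forall>l\<in>levels p. let X = FO R l in
     (\<forall>f\<in>M l. f \<in> Ar C \<and> Cod C f = imor X \<and> iiso C X f) \<and>
     (\<forall>J. \<forall>A\<in>hom C J (iob X). idn X \<cdot>\<^bsub>C\<^esub> A \<in> M l) \<and>
     (\<forall>f\<in>M l. \<forall>g\<in>M l. Dom C g = Dom C f \<and> src X \<cdot>\<^bsub>C\<^esub> g = tgt X \<cdot>\<^bsub>C\<^esub> f \<longrightarrow> icomp C X g f \<in> M l) \<and>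
     (\<forall>f\<in>M l. \<forall>g. inverse_pair C X f g \<longrightarrow> g \<in> M l) \<and>
     (\<forall>f\<in>M l. \<forall>J. \<forall>u\<in>hom C J (Dom C f). f \<cdot>\<^bsub>C\<^esub> u \<in> M l))"

record ('o, 'a) relob =
  rfun :: "nat \<Rightarrow> ('o, 'a) ifun"
  reps :: "cube_ar \<Rightarrow> 'a"
  rups :: "nat \<Rightarrow> 'a \<Rightarrow> 'a"

abbreviation dpow :: "('o, 'a) cat \<Rightarrow> ('o, 'a) cubcat \<Rightarrow> nat \<Rightarrow> ('o, 'a) cubcat" where
  "dpow C R n \<equiv> cpow C n (disc C R)"

definition ups_dom ::
  "('o, 'a) cat \<Rightarrow> ('o, 'a) cubcat \<Rightarrow> (nat \<Rightarrow> 'a set) \<Rightarrow> nat \<Rightarrow> nat \<Rightarrow> nat \<Rightarrow> 'a set" where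
  "ups_dom C R M l m n =
     {f \<in> hom C (pow_ob C m (iob (FO R l))) (pow_ob C n (imor (FO R l))).
        iiso C (ipow C n (FO R l)) f \<and> (\<forall>k<n. pow_pr C n (imor (FO R l)) k \<cdot>\<^bsub>C\<^esub> f \<in> M l)}"

definition respects_isos ::
  "('o, 'a) cat \<Rightarrow> ('o, 'a) cubcat \<Rightarrow> (nat \<Rightarrow> 'a set) \<Rightarrow> nat \<Rightarrow> nat \<Rightarrow> ('o, 'a) ifun \<Rightarrow> ('a \<Rightarrow> 'a) \<Rightarrow> bool" where
  "respects_isos C R M n l F u \<longleftrightarrow> (let X = FO R l; Xn = ipow C n X in
     (\<forall>m. \<forall>f\<in>ups_dom C R M l m n.
        u f \<in> M l \<and> u f \<in> ihom C X (fo F \<cdot>\<^bsub>C\<^esub> (src Xn \<cdot>\<^bsub>C\<^esub> f)) (fo F \<cdot>\<^bsub>C\<^esub> (tgt Xn \<cdot>\<^bsub>C\<^esub> f))) \<and>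
     (\<forall>m. \<forall>A\<in>hom C (pow_ob C m (iob X)) (iob Xn).
        u (idn Xn \<cdot>\<^bsub>C\<^esub> A) = idn X \<cdot>\<^bsub>C\<^esub> (fo F \<cdot>\<^bsub>C\<^esub> A)) \<and>
     (\<forall>m. \<forall>f\<in>ups_dom C R M l m n. \<forall>g\<in>ups_dom C R M l m n.
        src Xn \<cdot>\<^bsub>C\<^esub> g = tgt Xn \<cdot>\<^bsub>C\<^esub> f \<longrightarrow> u (icomp C Xn g f) = icomp C X (u g) (u f)) \<and>
     (\<forall>m m'. \<forall>f\<in>ups_dom C R M l m n. \<forall>k\<in>hom C (pow_ob C m' (iob X)) (pow_ob C m (iob X)).
        u (f \<cdot>\<^bsub>C\<^esub> k) = u f \<cdot>\<^bsub>C\<^esub> k))"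

text \<open>The last three conjuncts fix the value \<open>undefined\<close> outside the intended domains, so that equality
  of objects is equality of the three components there.\<close>

definition is_relob ::
  "('o, 'a) cat \<Rightarrow> enat \<Rightarrow> ('o, 'a) cubcat \<Rightarrow> (nat \<Rightarrow> 'a set) \<Rightarrow> nat \<Rightarrow> ('o, 'a) relob \<Rightarrow> bool" where
  "is_relob C p R M n F \<longleftrightarrow>
     cubical_functor C p (dpow C R n) R (rfun F) \<and>
     face_preserving C p (dpow C R n) R (rfun F) \<and>
     degen_preserving C p (dpow C R n) R (rfun F) (reps F) \<and>
     (\<forall>h\<in>degens p. reps F h \<in> M (Cod box h)) \<and>
     (\<forall>l\<in>levels p. respects_isos C R M n l (rfun F l) (rups F l)) \<and>
     (\<forall>l. l \<notin> levels p \<longrightarrow> rfun F l = undefined) \<and>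
     (\<forall>h. h \<notin> degens p \<longrightarrow> reps F h = undefined) \<and>
     (\<forall>l f. \<not> (l \<in> levels p \<and> (\<exists>m. f \<in> ups_dom C R M l m n)) \<longrightarrow> rups F l f = undefined)"

definition is_relar ::
  "('o, 'a) cat \<Rightarrow> enat \<Rightarrow> ('o, 'a) cubcat \<Rightarrow> nat \<Rightarrow> ('o, 'a) relob \<Rightarrow> (nat \<Rightarrow> 'a) \<Rightarrow> ('o, 'a) relob \<Rightarrow> bool" where
  "is_relar C p R n F t G \<longleftrightarrow>
     cubical_nat C p (rfun F) (rfun G) t \<and>
     face_preserving_nat C p (dpow C R n) R (rfun F) (rfun G) t \<and>
     degen_preserving_nat C p (dpow C R n) R (rfun F) (reps F) (rfun G) (reps G) t \<and>
     (\<forall>l. l \<notin> levels p \<longrightarrow> t l = undefined)"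

definition nat_ident ::
  "('o, 'a) cat \<Rightarrow> enat \<Rightarrow> ('o, 'a) cubcat \<Rightarrow> ('o, 'a) relob \<Rightarrow> nat \<Rightarrow> 'a" where
  "nat_ident C p R F l =
     (if l \<in> levels p then idn (FO R l) \<cdot>\<^bsub>C\<^esub> fo (rfun F l) else undefined)"

definition nat_comp ::
  "('o, 'a) cat \<Rightarrow> enat \<Rightarrow> ('o, 'a) cubcat \<Rightarrow> (nat \<Rightarrow> 'a) \<Rightarrow> (nat \<Rightarrow> 'a) \<Rightarrow> nat \<Rightarrow> 'a" where
  "nat_comp C p R t s l = (if l \<in> levels p then icomp C (FO R l) (t l) (s l) else undefined)"

definition RelCat ::
  "('o, 'a) cat \<Rightarrow> enat \<Rightarrow> ('o, 'a) cubcat \<Rightarrow> (nat \<Rightarrow> 'a set) \<Rightarrow> nat \<Rightarrow>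
     (('o, 'a) relob, ('o, 'a) relob \<times> (nat \<Rightarrow> 'a) \<times> ('o, 'a) relob) cat" where
  "RelCat C p R M n = \<lparr>
     Ob = {F. is_relob C p R M n F},
     Ar = {(F, t, G). is_relob C p R M n F \<and> is_relob C p R M n G \<and> is_relar C p R n F t G},
     Dom = (\<lambda>(F, t, G). F),
     Cod = (\<lambda>(F, t, G). G),
     Ident = (\<lambda>F. (F, nat_ident C p R F, F)),
     Comp = (\<lambda>(G, t, H) (F, s, G'). (F, nat_comp C p R t s, H))\<rparr>"

section \<open>Contexts and substitution\<close>

definition proj :: "('o, 'a) cat \<Rightarrow> enat \<Rightarrow> ('o, 'a) cubcat \<Rightarrow> (nat \<Rightarrow> 'a set) \<Rightarrow> nat \<Rightarrow> nat \<Rightarrow> ('o, 'a) relob" where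
  "proj C p R M n i = \<lparr>
     rfun = (\<lambda>l. if l \<in> levels p then
        (let q = pow_pr C n (iob (FO R l)) i in
         \<lparr>idom = FO (dpow C R n) l, icod = FO R l, fo = q, fm = idn (FO R l) \<cdot>\<^bsub>C\<^esub> q\<rparr>)
        else undefined),
     reps = (\<lambda>h. if h \<in> degens p then
        idn (FO R (Cod box h)) \<cdot>\<^bsub>C\<^esub> (fo (FA R h) \<cdot>\<^bsub>C\<^esub> pow_pr C n (iob (FO R (Dom box h))) i)
        else undefined),
     rups = (\<lambda>l f. if l \<in> levels p \<and> (\<exists>m. f \<in> ups_dom C R M l m n) then
        pow_pr C n (imor (FO R l)) i \<cdot>\<^bsub>C\<^esub> f
        else undefined)\<rparr>"

definition tuple_ob ::
  "('o, 'a) cat \<Rightarrow> ('o, 'a) cubcat \<Rightarrow> nat \<Rightarrow> ('o, 'a) relob list \<Rightarrow> nat \<Rightarrow> 'a" where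
  "tuple_ob C R m Fs l =
     tuple C (length Fs) (iob (FO R l)) (pow_ob C m (iob (FO R l))) (\<lambda>i. fo (rfun (Fs ! i) l))"

text \<open>For a degeneracy \<open>h : l\<^sub>1 \<rightarrow> l\<^sub>2\<close> the witness of \<open>F \<circ> (F\<^sub>1, \<dots>, F\<^sub>n)\<close> is the composite of
  \<open>\<epsilon>\<^sub>F(h)[F\<^sub>1, \<dots>, F\<^sub>n]\<close> with the image under \<open>F\<close> of the tuple \<open>e = (\<epsilon>\<^bsub>F\<^sub>1\<^esub>(h), \<dots>, \<epsilon>\<^bsub>F\<^sub>n\<^esub>(h))\<close>. Now
  \<open>e : Rel(l\<^sub>1)\<^sub>0\<^sup>m \<rightarrow> Rel(l\<^sub>2)\<^sub>1\<^sup>n\<close>, whereas \<open>\<upsilon>\<^sub>F\<close> is given on isomorphisms with domain \<open>Rel(l\<^sub>2)\<^sub>0\<^sup>m\<close>. The object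
  \<open>Rel(l\<^sub>1)\<^sub>0\<^sup>m\<close> is a retract of \<open>Rel(l\<^sub>2)\<^sub>0\<^sup>m\<close> via \<open>h\<close> and any face map \<open>r\<close> with \<open>r \<circ> h = 1\<close>; since
  \<open>\<upsilon>\<^sub>F\<close> respects reindexing, \<open>\<upsilon>\<^sub>F(e \<circ> Rel(r)) \<circ> Rel(h)\<close> does not depend on the choice of \<open>r\<close> and is
  the value forced by stability under reindexing.\<close>

definition retraction :: "enat \<Rightarrow> cube_ar \<Rightarrow> cube_ar" where
  "retraction p h = (SOME r. r \<in> faces p \<and> Dom box r = Cod box h \<and> Cod box r = Dom box h \<and>
                             r \<cdot>\<^bsub>box\<^esub> h = Ident box (Dom box h))"

definition subst ::
  "('o, 'a) cat \<Rightarrow> enat \<Rightarrow> ('o, 'a) cubcat \<Rightarrow> (nat \<Rightarrow> 'a set) \<Rightarrow> ('o, 'a) relob \<Rightarrow>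
     nat \<times> ('o, 'a) relob list \<Rightarrow> ('o, 'a) relob" where
  "subst C p R M F = (\<lambda>(m, Fs). let n = length Fs in \<lparr>
     rfun = (\<lambda>l. if l \<in> levels p then
        \<lparr>idom = FO (dpow C R m) l, icod = FO R l,
         fo = fo (rfun F l) \<cdot>\<^bsub>C\<^esub> tuple_ob C R m Fs l, fm = fm (rfun F l) \<cdot>\<^bsub>C\<^esub> tuple_ob C R m Fs l\<rparr>
        else undefined),
     reps = (\<lambda>h. if h \<in> degens p then
        (let l1 = Dom box h; l2 = Cod box h;
             e = tuple C n (imor (FO R l2)) (pow_ob C m (iob (FO R l1))) (\<lambda>i. reps (Fs ! i) h)
         in icomp C (FO R l2)
              (rups F l2 (e \<cdot>\<^bsub>C\<^esub> fo (FA (dpow C R m) (retraction p h))) \<cdot>\<^bsub>C\<^esub> fo (FA (dpow C R m) h))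
              (reps F h \<cdot>\<^bsub>C\<^esub> tuple_ob C R m Fs l1))
        else undefined),
     rups = (\<lambda>l f. if l \<in> levels p \<and> (\<exists>m'. f \<in> ups_dom C R M l m' m) then
        rups F l (tuple C n (imor (FO R l)) (Dom C f) (\<lambda>i. rups (Fs ! i) l f))
        else undefined)\<rparr>)"

text \<open>An arrow \<open>n \<rightarrow> m\<close> of \<open>Ctx\<close> is a pair of \<open>n\<close> and a list of length \<open>m\<close>.\<close>

definition Ctx ::
  "('o, 'a) cat \<Rightarrow> enat \<Rightarrow> ('o, 'a) cubcat \<Rightarrow> (nat \<Rightarrow> 'a set) \<Rightarrow> (nat, nat \<times> ('o, 'a) relob list) cat" where
  "Ctx C p R M = \<lparr>
     Ob = UNIV,
     Ar = {(n, Fs). \<forall>F\<in>set Fs. F \<in> Ob (RelCat C p R M n)},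
     Dom = fst,
     Cod = (\<lambda>(n, Fs). length Fs),
     Ident = (\<lambda>n. (n, map (proj C p R M n) [0..<n])),
     Comp = (\<lambda>(m, Gs) (n, Fs). (n, map (\<lambda>G. subst C p R M G (n, Fs)) Gs))\<rparr>"

definition ctx_fst :: "('o, 'a) cat \<Rightarrow> enat \<Rightarrow> ('o, 'a) cubcat \<Rightarrow> (nat \<Rightarrow> 'a set) \<Rightarrow> nat \<Rightarrow> nat \<times> ('o, 'a) relob list" where
  "ctx_fst C p R M n = (n + 1, map (proj C p R M (n + 1)) [0..<n])"

definition ctx_snd :: "('o, 'a) cat \<Rightarrow> enat \<Rightarrow> ('o, 'a) cubcat \<Rightarrow> (nat \<Rightarrow> 'a set) \<Rightarrow> nat \<Rightarrow> nat \<times> ('o, 'a) relob list" where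
  "ctx_snd C p R M n = (n + 1, [proj C p R M (n + 1) n])"

type_synonym ('o, 'a) intob = "nat \<times> ('o, 'a) relob"

type_synonym ('o, 'a) intar =
  "('o, 'a) intob \<times> ((nat \<times> ('o, 'a) relob list) \<times> (nat \<Rightarrow> 'a)) \<times> ('o, 'a) intob"

text \<open>The category \<open>\<integral>\<^sub>n |Rel|\<^sup>n \<rightarrow> Rel\<close>; arrows carry their domain and codomain, and
  \<open>(G, t) \<circ> (F, s) = (G \<circ> F, t[F] \<circ> s)\<close>.\<close>

definition IntRel ::
  "('o, 'a) cat \<Rightarrow> enat \<Rightarrow> ('o, 'a) cubcat \<Rightarrow> (nat \<Rightarrow> 'a set) \<Rightarrow> (('o, 'a) intob, ('o, 'a) intar) cat" where
  "IntRel C p R M = \<lparr>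
     Ob = {(n, F). F \<in> Ob (RelCat C p R M n)},
     Ar = {((n, F), (u, t), (m, G)).
        F \<in> Ob (RelCat C p R M n) \<and> G \<in> Ob (RelCat C p R M m) \<and>
        u \<in> hom (Ctx C p R M) n m \<and> (F, t, subst C p R M G u) \<in> Ar (RelCat C p R M n)},
     Dom = (\<lambda>(a, _, b). a),
     Cod = (\<lambda>(a, _, b). b),
     Ident = (\<lambda>(n, F). ((n, F), (Ident (Ctx C p R M) n, nat_ident C p R F), (n, F))),
     Comp = (\<lambda>(_, (v, t), c) (a, ((n, Fs), s), _).
        (a, (v \<cdot>\<^bsub>Ctx C p R M\<^esub> (n, Fs),
             nat_comp C p R (\<lambda>l. t l \<cdot>\<^bsub>C\<^esub> tuple_ob C R n Fs l) s), c))\<rparr>"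

definition forget :: "(('o, 'a) intob, ('o, 'a) intar, nat, nat \<times> ('o, 'a) relob list) fctr" where
  "forget = \<lparr>FO = fst, FA = (\<lambda>(a, (u, t), b). u)\<rparr>"

definition subst_lift ::
  "('o, 'a) cat \<Rightarrow> enat \<Rightarrow> ('o, 'a) cubcat \<Rightarrow> (nat \<Rightarrow> 'a set) \<Rightarrow>
     nat \<times> ('o, 'a) relob list \<Rightarrow> ('o, 'a) intob \<Rightarrow> ('o, 'a) intar" where
  "subst_lift C p R M u = (\<lambda>(m, G). let F = subst C p R M G u in
     ((fst u, F), (u, nat_ident C p R F), (m, G)))"

section \<open>Split fibrations\<close>

definition cartesian ::
  "('e, 'f) cat \<Rightarrow> ('b, 'c) cat \<Rightarrow> ('e, 'f, 'b, 'c) fctr \<Rightarrow> 'f \<Rightarrow> bool" where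
  "cartesian E B U f \<longleftrightarrow> f \<in> Ar E \<and>
     (\<forall>g\<in>Ar E. Cod E g = Cod E f \<longrightarrow>
       (\<forall>w\<in>hom B (FO U (Dom E g)) (FO U (Dom E f)). FA U f \<cdot>\<^bsub>B\<^esub> w = FA U g \<longrightarrow>
         (\<exists>!k. k \<in> hom E (Dom E g) (Dom E f) \<and> FA U k = w \<and> f \<cdot>\<^bsub>E\<^esub> k = g)))"

text \<open>\<open>lift u X\<close> is the chosen cartesian arrow over \<open>u\<close> with codomain \<open>X\<close>. Strict functoriality of
  reindexing is expressed, as usual, by closure of the chosen lifts under identities and composition.\<close>

definition split_fibration ::
  "('e, 'f) cat \<Rightarrow> ('b, 'c) cat \<Rightarrow> ('e, 'f, 'b, 'c) fctr \<Rightarrow> ('c \<Rightarrow> 'e \<Rightarrow> 'f) \<Rightarrow> bool" where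
  "split_fibration E B U lift \<longleftrightarrow>
     category E \<and> category B \<and> is_functor E B U \<and>
     (\<forall>u\<in>Ar B. \<forall>X\<in>Ob E. FO U X = Cod B u \<longrightarrow>
        cartesian E B U (lift u X) \<and> Cod E (lift u X) = X \<and> FA U (lift u X) = u) \<and>
     (\<forall>X\<in>Ob E. lift (Ident B (FO U X)) X = Ident E X) \<and>
     (\<forall>u\<in>Ar B. \<forall>v\<in>Ar B. \<forall>X\<in>Ob E. Dom B v = Cod B u \<and> FO U X = Cod B v \<longrightarrow>
        lift (v \<cdot>\<^bsub>B\<^esub> u) X = lift v X \<cdot>\<^bsub>E\<^esub> lift u (Dom E (lift v X)))"

definition fibre ::
  "('e, 'f) cat \<Rightarrow> ('b, 'c) cat \<Rightarrow> ('e, 'f, 'b, 'c) fctr \<Rightarrow> 'b \<Rightarrow> ('e, 'f) cat" where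
  "fibre E B U A = E\<lparr>Ob := {X \<in> Ob E. FO U X = A}, Ar := {f \<in> Ar E. FA U f = Ident B A}\<rparr>"

definition reindex ::
  "('e, 'f) cat \<Rightarrow> ('b, 'c) cat \<Rightarrow> ('e, 'f, 'b, 'c) fctr \<Rightarrow> ('c \<Rightarrow> 'e \<Rightarrow> 'f) \<Rightarrow> 'c \<Rightarrow> ('e, 'f, 'e, 'f) fctr" where
  "reindex E B U lift u = \<lparr>
     FO = (\<lambda>X. Dom E (lift u X)),
     FA = (\<lambda>f. THE g.
       g \<in> hom (fibre E B U (Dom B u)) (Dom E (lift u (Dom E f))) (Dom E (lift u (Cod E f))) \<and>
       lift u (Cod E f) \<cdot>\<^bsub>E\<^esub> g = f \<cdot>\<^bsub>E\<^esub> lift u (Dom E f))\<rparr>"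

definition split_generic_object ::
  "('e, 'f) cat \<Rightarrow> ('b, 'c) cat \<Rightarrow> ('e, 'f, 'b, 'c) fctr \<Rightarrow> ('c \<Rightarrow> 'e \<Rightarrow> 'f) \<Rightarrow> 'b \<Rightarrow> bool" where
  "split_generic_object E B U lift W \<longleftrightarrow> W \<in> Ob B \<and>
     (\<exists>th. (\<forall>A\<in>Ob B. bij_betw (th A) (hom B A W) (Ob (fibre E B U A))) \<and>
       (\<forall>u\<in>Ar B. \<forall>w\<in>hom B (Cod B u) W.
          th (Dom B u) (w \<cdot>\<^bsub>B\<^esub> u) = FO (reindex E B U lift u) (th (Cod B u) w)))"

subsection \<open>Cartesian closed structure\<close>

record ('o, 'a) ccs =
  cone1 :: 'o
  cprd :: "'o \<Rightarrow> 'o \<Rightarrow> 'o"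
  cfst :: "'o \<Rightarrow> 'o \<Rightarrow> 'a"
  csnd :: "'o \<Rightarrow> 'o \<Rightarrow> 'a"
  cexp :: "'o \<Rightarrow> 'o \<Rightarrow> 'o"
  cevl :: "'o \<Rightarrow> 'o \<Rightarrow> 'a"

definition is_product :: "('o, 'a) cat \<Rightarrow> 'o \<Rightarrow> 'o \<Rightarrow> 'o \<Rightarrow> 'a \<Rightarrow> 'a \<Rightarrow> bool" where
  "is_product C A B P q r \<longleftrightarrow>
     P \<in> Ob C \<and> q \<in> hom C P A \<and> r \<in> hom C P B \<and>
     (\<forall>Z\<in>Ob C. \<forall>f\<in>hom C Z A. \<forall>g\<in>hom C Z B.
        \<exists>!k. k \<in> hom C Z P \<and> q \<cdot>\<^bsub>C\<^esub> k = f \<and> r \<cdot>\<^bsub>C\<^esub> k = g)"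

text \<open>\<open>f \<times> 1\<^sub>A\<close> for \<open>f : Z \<rightarrow> Z'\<close>.\<close>

definition cprod_left :: "('o, 'a) cat \<Rightarrow> ('o, 'a) ccs \<Rightarrow> 'a \<Rightarrow> 'o \<Rightarrow> 'a" where
  "cprod_left C S f A = (let Z = Dom C f; Z' = Cod C f in
     THE k. k \<in> hom C (cprd S Z A) (cprd S Z' A) \<and>
            cfst S Z' A \<cdot>\<^bsub>C\<^esub> k = f \<cdot>\<^bsub>C\<^esub> cfst S Z A \<and> csnd S Z' A \<cdot>\<^bsub>C\<^esub> k = csnd S Z A)"

definition cartesian_closed :: "('o, 'a) cat \<Rightarrow> ('o, 'a) ccs \<Rightarrow> bool" where
  "cartesian_closed C S \<longleftrightarrow>
     category C \<and> is_terminal C (cone1 S) \<and>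
     (\<forall>A\<in>Ob C. \<forall>B\<in>Ob C. is_product C A B (cprd S A B) (cfst S A B) (csnd S A B)) \<and>
     (\<forall>A\<in>Ob C. \<forall>B\<in>Ob C. cexp S A B \<in> Ob C \<and> cevl S A B \<in> hom C (cprd S (cexp S A B) A) B \<and>
        (\<forall>Z\<in>Ob C. \<forall>f\<in>hom C (cprd S Z A) B.
           \<exists>!k. k \<in> hom C Z (cexp S A B) \<and> cevl S A B \<cdot>\<^bsub>C\<^esub> cprod_left C S k A = f))"

definition strictly_preserves_ccs ::
  "('o, 'a) cat \<Rightarrow> ('o, 'a, 'x, 'y) fctr \<Rightarrow> ('o, 'a) ccs \<Rightarrow> ('x, 'y) ccs \<Rightarrow> bool" where
  "strictly_preserves_ccs C F S T \<longleftrightarrow>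
     FO F (cone1 S) = cone1 T \<and>
     (\<forall>A\<in>Ob C. \<forall>B\<in>Ob C.
        FO F (cprd S A B) = cprd T (FO F A) (FO F B) \<and>
        FA F (cfst S A B) = cfst T (FO F A) (FO F B) \<and>
        FA F (csnd S A B) = csnd T (FO F A) (FO F B) \<and>
        FO F (cexp S A B) = cexp T (FO F A) (FO F B) \<and>
        FA F (cevl S A B) = cevl T (FO F A) (FO F B))"

definition split_ccc_fibration ::
  "('e, 'f) cat \<Rightarrow> ('b, 'c) cat \<Rightarrow> ('e, 'f, 'b, 'c) fctr \<Rightarrow> ('c \<Rightarrow> 'e \<Rightarrow> 'f) \<Rightarrow> bool" where
  "split_ccc_fibration E B U lift \<longleftrightarrow> split_fibration E B U lift \<and>
     (\<exists>S. (\<forall>A\<in>Ob B. cartesian_closed (fibre E B U A) (S A)) \<and>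
       (\<forall>u\<in>Ar B. strictly_preserves_ccs (fibre E B U (Cod B u)) (reindex E B U lift u)
                   (S (Cod B u)) (S (Dom B u))))"

subsection \<open>Simple products\<close>

definition adjunction ::
  "('o, 'a) cat \<Rightarrow> ('x, 'y) cat \<Rightarrow> ('o, 'a, 'x, 'y) fctr \<Rightarrow> ('x, 'y, 'o, 'a) fctr \<Rightarrow>
     ('o \<Rightarrow> 'a) \<Rightarrow> ('x \<Rightarrow> 'y) \<Rightarrow> bool" where
  "adjunction C D L R un co \<longleftrightarrow>
     is_functor C D L \<and> is_functor D C R \<and>
     (\<forall>X\<in>Ob C. un X \<in> hom C X (FO R (FO L X))) \<and>
     (\<forall>f\<in>Ar C. un (Cod C f) \<cdot>\<^bsub>C\<^esub> f = FA R (FA L f) \<cdot>\<^bsub>C\<^esub> un (Dom C f)) \<and>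
     (\<forall>Y\<in>Ob D. co Y \<in> hom D (FO L (FO R Y)) Y) \<and>
     (\<forall>g\<in>Ar D. co (Cod D g) \<cdot>\<^bsub>D\<^esub> FA L (FA R g) = g \<cdot>\<^bsub>D\<^esub> co (Dom D g)) \<and>
     (\<forall>X\<in>Ob C. co (FO L X) \<cdot>\<^bsub>D\<^esub> FA L (un X) = Ident D (FO L X)) \<and>
     (\<forall>Y\<in>Ob D. FA R (co Y) \<cdot>\<^bsub>C\<^esub> un (FO R Y) = Ident C (FO R Y))"

text \<open>Chosen products \<open>(-) \<times> W\<close> are given by \<open>pr\<close>, \<open>q1\<close>, \<open>q2\<close>: the object \<open>pr A\<close> with projections
  \<open>q1 A : pr A \<rightarrow> A\<close> and \<open>q2 A : pr A \<rightarrow> W\<close>.\<close>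

definition products_with ::
  "('b, 'c) cat \<Rightarrow> 'b \<Rightarrow> ('b \<Rightarrow> 'b) \<Rightarrow> ('b \<Rightarrow> 'c) \<Rightarrow> ('b \<Rightarrow> 'c) \<Rightarrow> bool" where
  "products_with B W pr q1 q2 \<longleftrightarrow> (\<forall>A\<in>Ob B. is_product B A W (pr A) (q1 A) (q2 A))"

definition times1 ::
  "('b, 'c) cat \<Rightarrow> ('b \<Rightarrow> 'b) \<Rightarrow> ('b \<Rightarrow> 'c) \<Rightarrow> ('b \<Rightarrow> 'c) \<Rightarrow> 'c \<Rightarrow> 'c" where
  "times1 B pr q1 q2 u = (let A = Dom B u; A' = Cod B u in
     THE k. k \<in> hom B (pr A) (pr A') \<and> q1 A' \<cdot>\<^bsub>B\<^esub> k = u \<cdot>\<^bsub>B\<^esub> q1 A \<and> q2 A' \<cdot>\<^bsub>B\<^esub> k = q2 A)"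

definition has_split_simple_products ::
  "('e, 'f) cat \<Rightarrow> ('b, 'c) cat \<Rightarrow> ('e, 'f, 'b, 'c) fctr \<Rightarrow> ('c \<Rightarrow> 'e \<Rightarrow> 'f) \<Rightarrow>
     ('b \<Rightarrow> 'b) \<Rightarrow> ('b \<Rightarrow> 'c) \<Rightarrow> ('b \<Rightarrow> 'c) \<Rightarrow> bool" where
  "has_split_simple_products E B U lift pr q1 q2 \<longleftrightarrow>
     (\<exists>All un co.
       (\<forall>A\<in>Ob B. adjunction (fibre E B U A) (fibre E B U (pr A))
                   (reindex E B U lift (q1 A)) (All A) (un A) (co A)) \<and>
       (\<forall>u\<in>Ar B. let A = Dom B u; A' = Cod B u;
                     r = reindex E B U lift u; r1 = reindex E B U lift (times1 B pr q1 q2 u) in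
         (\<forall>Y\<in>Ob (fibre E B U (pr A')). FO r (FO (All A') Y) = FO (All A) (FO r1 Y)) \<and>
         (\<forall>g\<in>Ar (fibre E B U (pr A')). FA r (FA (All A') g) = FA (All A) (FA r1 g)) \<and>
         (\<forall>X\<in>Ob (fibre E B U A'). FA r (un A' X) = un A (FO r X)) \<and>
         (\<forall>Y\<in>Ob (fibre E B U (pr A')). FA r1 (co A' Y) = co A (FO r1 Y))))"

definition split_lambda2_fibration ::
  "('e, 'f) cat \<Rightarrow> ('b, 'c) cat \<Rightarrow> ('e, 'f, 'b, 'c) fctr \<Rightarrow> ('c \<Rightarrow> 'e \<Rightarrow> 'f) \<Rightarrow>
     'b \<Rightarrow> ('b \<Rightarrow> 'b) \<Rightarrow> ('b \<Rightarrow> 'c) \<Rightarrow> ('b \<Rightarrow> 'c) \<Rightarrow> bool" where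
  "split_lambda2_fibration E B U lift W pr q1 q2 \<longleftrightarrow>
     split_ccc_fibration E B U lift \<and>
     (\<exists>T. is_terminal B T) \<and>
     split_generic_object E B U lift W \<and>
     products_with B W pr q1 q2 \<and>
     has_split_simple_products E B U lift pr q1 q2"

section \<open>Parametric models\<close>

definition stable_terminals :: "('o, 'a) cat \<Rightarrow> enat \<Rightarrow> ('o, 'a) cubcat \<Rightarrow> (nat \<Rightarrow> 'a set) \<Rightarrow> bool" where
  "stable_terminals C p R M \<longleftrightarrow>
     (\<exists>t. (\<forall>l\<in>levels p. iterminal C (FO R l) (t l)) \<and>
       (\<forall>h\<in>faces p. fo (FA R h) \<cdot>\<^bsub>C\<^esub> t (Dom box h) = t (Cod box h)) \<and>
       (\<forall>h\<in>degens p. \<exists>i\<in>M (Cod box h).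
          i \<in> ihom C (FO R (Cod box h)) (fo (FA R h) \<cdot>\<^bsub>C\<^esub> t (Dom box h)) (t (Cod box h))))"

text \<open>\<open>e h A B\<close> is the isomorphism \<open>Rel(h)(A \<times> B) \<rightarrow> Rel(h)A \<times> Rel(h)B\<close>, for generalized objects \<open>A, B\<close>.\<close>

definition stable_products ::
  "('o, 'a) cat \<Rightarrow> enat \<Rightarrow> ('o, 'a) cubcat \<Rightarrow> (nat \<Rightarrow> 'a set) \<Rightarrow> (nat \<Rightarrow> 'a icc) \<Rightarrow>
     (cube_ar \<Rightarrow> 'a \<Rightarrow> 'a \<Rightarrow> 'a) \<Rightarrow> bool" where
  "stable_products C p R M P e \<longleftrightarrow>
     (\<forall>l\<in>levels p. iproducts C (FO R l) (P l) \<and>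
        (\<forall>f\<in>M l. \<forall>g\<in>M l. Dom C f = Dom C g \<longrightarrow> iprod_map C (FO R l) (P l) f g \<in> M l)) \<and>
     (\<forall>h\<in>faces p. let l1 = Dom box h; l2 = Cod box h; H = FA R h in
        \<forall>J. \<forall>A\<in>hom C J (iob (FO R l1)). \<forall>B\<in>hom C J (iob (FO R l1)).
          fo H \<cdot>\<^bsub>C\<^esub> at2 C (iprd (P l1)) A B = at2 C (iprd (P l2)) (fo H \<cdot>\<^bsub>C\<^esub> A) (fo H \<cdot>\<^bsub>C\<^esub> B) \<and>
          fm H \<cdot>\<^bsub>C\<^esub> at2 C (ifst (P l1)) A B = at2 C (ifst (P l2)) (fo H \<cdot>\<^bsub>C\<^esub> A) (fo H \<cdot>\<^bsub>C\<^esub> B) \<and>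
          fm H \<cdot>\<^bsub>C\<^esub> at2 C (isnd (P l1)) A B = at2 C (isnd (P l2)) (fo H \<cdot>\<^bsub>C\<^esub> A) (fo H \<cdot>\<^bsub>C\<^esub> B)) \<and>
     (\<forall>h\<in>degens p. let l1 = Dom box h; l2 = Cod box h; H = FA R h in
        \<forall>J. \<forall>A\<in>hom C J (iob (FO R l1)). \<forall>B\<in>hom C J (iob (FO R l1)).
          e h A B \<in> M l2 \<and>
          e h A B \<in> ihom C (FO R l2) (fo H \<cdot>\<^bsub>C\<^esub> at2 C (iprd (P l1)) A B)
                                      (at2 C (iprd (P l2)) (fo H \<cdot>\<^bsub>C\<^esub> A) (fo H \<cdot>\<^bsub>C\<^esub> B)) \<and>
          icomp C (FO R l2) (at2 C (ifst (P l2)) (fo H \<cdot>\<^bsub>C\<^esub> A) (fo H \<cdot>\<^bsub>C\<^esub> B)) (e h A B) =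
            fm H \<cdot>\<^bsub>C\<^esub> at2 C (ifst (P l1)) A B \<and>
          icomp C (FO R l2) (at2 C (isnd (P l2)) (fo H \<cdot>\<^bsub>C\<^esub> A) (fo H \<cdot>\<^bsub>C\<^esub> B)) (e h A B) =
            fm H \<cdot>\<^bsub>C\<^esub> at2 C (isnd (P l1)) A B)"

definition stable_exponentials ::
  "('o, 'a) cat \<Rightarrow> enat \<Rightarrow> ('o, 'a) cubcat \<Rightarrow> (nat \<Rightarrow> 'a set) \<Rightarrow> (nat \<Rightarrow> 'a icc) \<Rightarrow>
     (cube_ar \<Rightarrow> 'a \<Rightarrow> 'a \<Rightarrow> 'a) \<Rightarrow> bool" where
  "stable_exponentials C p R M P e \<longleftrightarrow>
     (\<forall>l\<in>levels p. iexponentials C (FO R l) (P l) \<and>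
        (\<forall>f\<in>M l. \<forall>g\<in>M l. Dom C f = Dom C g \<longrightarrow> iexp_map C (FO R l) (P l) f g \<in> M l)) \<and>
     (\<forall>h\<in>faces p. let l1 = Dom box h; l2 = Cod box h; H = FA R h in
        \<forall>J. \<forall>A\<in>hom C J (iob (FO R l1)). \<forall>B\<in>hom C J (iob (FO R l1)).
          fo H \<cdot>\<^bsub>C\<^esub> at2 C (iexp (P l1)) A B = at2 C (iexp (P l2)) (fo H \<cdot>\<^bsub>C\<^esub> A) (fo H \<cdot>\<^bsub>C\<^esub> B) \<and>
          fm H \<cdot>\<^bsub>C\<^esub> at2 C (ievl (P l1)) A B = at2 C (ievl (P l2)) (fo H \<cdot>\<^bsub>C\<^esub> A) (fo H \<cdot>\<^bsub>C\<^esub> B)) \<and>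
     (\<forall>h\<in>degens p. let l1 = Dom box h; l2 = Cod box h; H = FA R h in
        \<forall>J. \<forall>A\<in>hom C J (iob (FO R l1)). \<forall>B\<in>hom C J (iob (FO R l1)).
          \<exists>v\<in>M l2.
            v \<in> ihom C (FO R l2) (fo H \<cdot>\<^bsub>C\<^esub> at2 C (iexp (P l1)) A B)
                                  (at2 C (iexp (P l2)) (fo H \<cdot>\<^bsub>C\<^esub> A) (fo H \<cdot>\<^bsub>C\<^esub> B)) \<and>
            icomp C (FO R l2) (at2 C (ievl (P l2)) (fo H \<cdot>\<^bsub>C\<^esub> A) (fo H \<cdot>\<^bsub>C\<^esub> B))
              (icomp C (FO R l2) (iprod_map C (FO R l2) (P l2) v (idn (FO R l2) \<cdot>\<^bsub>C\<^esub> (fo H \<cdot>\<^bsub>C\<^esub> A)))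
                 (e h (at2 C (iexp (P l1)) A B) A)) =
            fm H \<cdot>\<^bsub>C\<^esub> at2 C (ievl (P l1)) A B)"

text \<open>Speaking of the forgetful functor out of \<open>\<integral>\<^sub>n |Rel|\<^sup>n \<rightarrow> Rel\<close> presupposes that the latter is a
  category. This is recorded explicitly, because it does not follow from the conditions on
  terminal objects, products and exponentials: the composite \<open>(G, t) \<circ> (F, s)\<close> is
  degeneracy-preserving only if \<open>t\<close> is compatible with the isomorphisms \<open>\<upsilon>(\<epsilon>\<^sub>F(h))\<close>, and morphisms of
  \<open>|Rel|\<^sup>n \<rightarrow> Rel\<close> are not required to be natural with respect to \<open>\<upsilon>\<close>.\<close>

definition parametric_model :: "('o, 'a) cat \<Rightarrow> enat \<Rightarrow> ('o, 'a) cubcat \<Rightarrow> (nat \<Rightarrow> 'a set) \<Rightarrow> bool" where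
  "parametric_model C p R M \<longleftrightarrow>
     stable_terminals C p R M \<and>
     (\<exists>P e. stable_products C p R M P e \<and> stable_exponentials C p R M P e) \<and>
     category (IntRel C p R M) \<and>
     has_split_simple_products (IntRel C p R M) (Ctx C p R M) forget (subst_lift C p R M)
       (\<lambda>n. n + 1) (ctx_fst C p R M) (ctx_snd C p R M)"

end

theory Submission
  imports Defs
begin

text \<open>
  Terminal object, product and exponential are themselves relational types \<open>1\<close>, \<open>\<times>\<close>, \<open>\<Rightarrow>\<close> of arities 0, 2, 2, and the
  product of \<open>F\<close> and \<open>G\<close> in a fibre is the substitution of \<open>(F, G)\<close> into \<open>\<times>\<close>. Strict preservation of the cartesian
  closed structure by reindexing is therefore an instance of associativity of substitution, which also
  makes contexts a category and the chosen lifts split. Associativity holds for the witnesses of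
  degeneracy-preservation because the extension of \<open>\<upsilon>\<^sub>F\<close> along a retraction of a degeneracy is again
  functorial and stable under reindexing, even though relational types commute with degeneracies only up
  to isomorphism.

  Universal properties are verified levelwise; uniqueness at each level forces the mediating families to
  preserve face maps and degeneracies. For transposes \<open>k : Z \<rightarrow> (F \<Rightarrow> G)\<close> and a degeneracy \<open>h\<close>, the two composites
  to be compared become equal after evaluation and precomposition with the isomorphism
  \<open>Rel(h)(Z \<times> F) \<rightarrow> Rel(h)Z \<times> Rel(h)F\<close>, where both reduce to the condition on the given map \<open>Z \<times> F \<rightarrow> G\<close>.
\<close>

section \<open>Finitely complete categories\<close>

text \<open>Two decisions shape the calculations. The domain \<open>|Rel|\<^sup>n\<close> is
  levelwise discrete, so a functor out of it is a single arrow of \<open>C\<close> and naturality is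
  empty. A relational type thus reduces to an object arrow for each level, a witness for each
  degeneracy and an action on good isomorphisms. The action is handled on families of isomorphisms
  (\<open>iso_action\<close>) instead of on arrows into a power, so that substitution becomes
  nesting of functions. The obstacle is that the data are given unevenly. Morphisms of relational
  types need not commute with \<upsilon>, so the reindexing \<open>t[U]\<close> of a fibre arrow is
  not visibly degeneracy-preserving; that it is comes from the hypothesis that \<open>IntRel\<close>
  is a category, by composing with a lift. The product comparisons come without naturality, which
  has to be derived from the projections. The exponential comparisons exist for each pair of objects
  separately, so they are chosen once, at the generic pair, and reindexed. Simple products belong to
  the hypothesis; what remains is the splitting, the structure of the base and the cartesian closed
  structure.\<close>

lemma homD:
  assumes "f \<in> hom C A B"
  shows "f \<in> Ar C" "Dom C f = A" "Cod C f = B"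
  using assms by (simp_all add: hom_def)

text \<open>Split off from finite completeness so that the total category \<open>GRO\<close> and its
  fibres, for which only the category axioms are available, can use the same calculus.\<close>

locale ccat =
  fixes C :: "('o, 'a) cat" (structure)
  assumes cat: "category C"
begin

lemma Dom_Ob [simp]: "f \<in> Ar C \<Longrightarrow> Dom C f \<in> Ob C"
  and Cod_Ob [simp]: "f \<in> Ar C \<Longrightarrow> Cod C f \<in> Ob C"
  using cat unfolding category_def by blast+

lemma hom_Ob:
  assumes "f \<in> hom C A B"
  shows "A \<in> Ob C" "B \<in> Ob C"
  using assms by (auto simp: hom_def)

lemma ident_hom [simp]: "A \<in> Ob C \<Longrightarrow> Ident C A \<in> hom C A A"
  using cat unfolding category_def by blast

lemma ident_Ar [simp]: "A \<in> Ob C \<Longrightarrow> Ident C A \<in> Ar C"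
  and ident_Dom [simp]: "A \<in> Ob C \<Longrightarrow> Dom C (Ident C A) = A"
  and ident_Cod [simp]: "A \<in> Ob C \<Longrightarrow> Cod C (Ident C A) = A"
  using ident_hom by (auto simp: hom_def)

lemma comp_hom [intro]:
  "g \<in> hom C B D \<Longrightarrow> f \<in> hom C A B \<Longrightarrow> g \<cdot> f \<in> hom C A D"
  using cat unfolding category_def hom_def by auto

lemma comp_Ar [simp]: "f \<in> Ar C \<Longrightarrow> g \<in> Ar C \<Longrightarrow> Dom C g = Cod C f \<Longrightarrow> g \<cdot> f \<in> Ar C"
  and comp_Dom [simp]: "f \<in> Ar C \<Longrightarrow> g \<in> Ar C \<Longrightarrow> Dom C g = Cod C f \<Longrightarrow> Dom C (g \<cdot> f) = Dom C f"
  and comp_Cod [simp]: "f \<in> Ar C \<Longrightarrow> g \<in> Ar C \<Longrightarrow> Dom C g = Cod C f \<Longrightarrow> Cod C (g \<cdot> f) = Cod C g"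
  using comp_hom[of g "Dom C g" "Cod C g" f "Dom C f"] by (auto simp: hom_def)

lemma id_right [simp]: "f \<in> Ar C \<Longrightarrow> A = Dom C f \<Longrightarrow> f \<cdot> Ident C A = f"
  and id_left [simp]: "f \<in> Ar C \<Longrightarrow> A = Cod C f \<Longrightarrow> Ident C A \<cdot> f = f"
  using cat unfolding category_def by blast+

lemma assoc:
  assumes "f \<in> Ar C" "g \<in> Ar C" "h \<in> Ar C" "Dom C g = Cod C f" "Dom C h = Cod C g"
  shows "h \<cdot> (g \<cdot> f) = h \<cdot> g \<cdot> f"
  using cat assms unfolding category_def by metis

lemma comp_assoc:
  assumes "f \<in> hom C A B" "g \<in> hom C B D" "h \<in> hom C D E"
  shows "h \<cdot> (g \<cdot> f) = h \<cdot> g \<cdot> f"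
  using assoc assms by (auto simp: hom_def)

end

section \<open>Finite products, powers and pullbacks from limits of finite diagrams\<close>

locale fincat =
  fixes C :: "('o, 'a) cat" (structure)
  assumes fin_complete: "finitely_complete C"
begin

sublocale ccat C
  by unfold_locales (use fin_complete in \<open>simp add: finitely_complete_def\<close>)

lemma ex_limit:
  fixes J :: "(nat, nat) cat"
  assumes "category J" "finite (Ob J)" "finite (Ar J)" "is_functor J C D"
  obtains L c where "is_limit J C D L c"
  using fin_complete assms unfolding finitely_complete_def by blast

text \<open>Limits over the discrete diagram on \<open>{..<n}\<close>: its only arrows are
  identities, so a cone is a bare family of arrows. Arity 0 yields the terminal object and a
  constant family yields the powers.\<close>

lemma ex_finite_product:
  fixes n :: nat
  assumes F: "\<And>i. i < n \<Longrightarrow> F i \<in> Ob C"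
  shows "\<exists>L c. L \<in> Ob C \<and> (\<forall>i<n. c i \<in> hom C L (F i)) \<and>
    (\<forall>Q q. Q \<in> Ob C \<and> (\<forall>i<n. q i \<in> hom C Q (F i)) \<longrightarrow>
       (\<exists>!k. k \<in> hom C Q L \<and> (\<forall>i<n. c i \<cdot> k = q i)))"
proof -
  define J :: "(nat, nat) cat" where
    "J = \<lparr>Ob = {..<n::nat}, Ar = {..<n}, Dom = \<lambda>i. i, Cod = \<lambda>i. i, Ident = \<lambda>i. i, Comp = \<lambda>g f. f\<rparr>"
  define D where "D = \<lparr>FO = F, FA = \<lambda>i. Ident C (F i)\<rparr>"
  have "category J"
    by (auto simp: category_def J_def hom_def)
  moreover have "is_functor J C D"
    using F by (auto simp: is_functor_def J_def D_def)
  moreover have "finite (Ob J)" "finite (Ar J)"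
    by (simp_all add: J_def)
  ultimately obtain L c where lim: "is_limit J C D L c"
    using ex_limit by blast
  have cone: "is_cone J C D L' c' \<longleftrightarrow> L' \<in> Ob C \<and> (\<forall>i<n. c' i \<in> hom C L' (F i))" for L' c'
    by (auto simp: is_cone_def J_def D_def hom_def)
  have "Ob J = {..<n}" by (simp add: J_def)
  then have "L \<in> Ob C \<and> (\<forall>i<n. c i \<in> hom C L (F i)) \<and>
    (\<forall>Q q. Q \<in> Ob C \<and> (\<forall>i<n. q i \<in> hom C Q (F i)) \<longrightarrow>
       (\<exists>!k. k \<in> hom C Q L \<and> (\<forall>i<n. c i \<cdot> k = q i)))"
    using lim unfolding is_limit_def cone by (simp add: Ball_def conj_assoc)
  then show ?thesis by blast
qed

lemma one_terminal: "is_terminal C (one C)"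
proof -
  have "\<exists>T. is_terminal C T"
  proof -
    \<comment> \<open>With no factors, any family serves, even \<open>undefined\<close>.\<close>
    have "i < 0 \<Longrightarrow> undefined i \<in> Ob C" for i :: nat by simp
    from ex_finite_product[of 0 undefined, OF this]
    have "\<exists>T. T \<in> Ob C \<and> (\<forall>Q. Q \<in> Ob C \<longrightarrow> (\<exists>!k. k \<in> hom C Q T))"
      by simp
    then show ?thesis
      unfolding is_terminal_def Ball_def .
  qed
  then show ?thesis
    unfolding one_def by (rule someI_ex)
qed

lemma one_Ob [simp]: "one C \<in> Ob C"
  using one_terminal by (simp add: is_terminal_def)

lemma bang_hom [simp]: "A \<in> Ob C \<Longrightarrow> bang C A \<in> hom C A (one C)"
  unfolding bang_def using one_terminal by (rule_tac theI') (simp add: is_terminal_def)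

lemma bang_eqI: "f \<in> hom C A (one C) \<Longrightarrow> f = bang C A"
  using one_terminal bang_hom[of A] hom_Ob[of f A] unfolding is_terminal_def by blast

lemma bang_comp: "u \<in> hom C Q A \<Longrightarrow> bang C A \<cdot> u = bang C Q"
  by (rule bang_eqI) (auto intro: comp_hom bang_hom dest: hom_Ob)

lemma is_power_pow:
  assumes "A \<in> Ob C"
  shows "is_power C n A (pow_ob C n A) (pow_pr C n A)"
proof -
  have "\<exists>c. is_power C n A (fst c) (snd c)"
    using ex_finite_product[of n "\<lambda>_. A"] assms by (simp add: is_power_def)
  then show ?thesis
    unfolding pow_ob_def pow_pr_def power_cone_def by (rule someI_ex)
qed

lemma pow_ob_Ob [simp]: "A \<in> Ob C \<Longrightarrow> pow_ob C n A \<in> Ob C"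
  using is_power_pow by (simp add: is_power_def)

lemma pow_pr_hom [simp]: "A \<in> Ob C \<Longrightarrow> i < n \<Longrightarrow> pow_pr C n A i \<in> hom C (pow_ob C n A) A"
  using is_power_pow by (simp add: is_power_def)

lemma pow_pr_Ar [simp]: "A \<in> Ob C \<Longrightarrow> i < n \<Longrightarrow> pow_pr C n A i \<in> Ar C"
  and pow_pr_Dom [simp]: "A \<in> Ob C \<Longrightarrow> i < n \<Longrightarrow> Dom C (pow_pr C n A i) = pow_ob C n A"
  and pow_pr_Cod [simp]: "A \<in> Ob C \<Longrightarrow> i < n \<Longrightarrow> Cod C (pow_pr C n A i) = A"
  using pow_pr_hom by (auto simp: hom_def)

lemma pr0_hom [simp]: "A \<in> Ob C \<Longrightarrow> pow_pr C 2 A 0 \<in> hom C (pow_ob C 2 A) A"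
  and pr1_hom [simp]: "A \<in> Ob C \<Longrightarrow> pow_pr C 2 A (Suc 0) \<in> hom C (pow_ob C 2 A) A"
  by simp_all

lemma tuple_ex1:
  assumes "A \<in> Ob C" "Q \<in> Ob C" "\<And>i. i < n \<Longrightarrow> q i \<in> hom C Q A"
  shows "\<exists>!k. k \<in> hom C Q (pow_ob C n A) \<and> (\<forall>i<n. pow_pr C n A i \<cdot> k = q i)"
  using is_power_pow[OF assms(1), of n] assms unfolding is_power_def by blast

lemma
  assumes "A \<in> Ob C" "Q \<in> Ob C" "\<And>i. i < n \<Longrightarrow> q i \<in> hom C Q A"
  shows tuple_hom: "tuple C n A Q q \<in> hom C Q (pow_ob C n A)"
    and pr_tuple: "i < n \<Longrightarrow> pow_pr C n A i \<cdot> tuple C n A Q q = q i"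
  using theI'[OF tuple_ex1[of A Q n q, OF assms]] unfolding tuple_def by blast+

text \<open>The projections are jointly monic: \<open>k'\<close> mediates its own cone of
  components, and \<open>k\<close> is a second mediator of that cone.\<close>

lemma pow_eqI:
  assumes "A \<in> Ob C" "k \<in> hom C Q (pow_ob C n A)" "k' \<in> hom C Q (pow_ob C n A)"
    and "\<And>i. i < n \<Longrightarrow> pow_pr C n A i \<cdot> k = pow_pr C n A i \<cdot> k'"
  shows "k = k'"
proof -
  have Q: "Q \<in> Ob C" using assms(2) by (rule hom_Ob)
  have "\<exists>!k. k \<in> hom C Q (pow_ob C n A) \<and> (\<forall>i<n. pow_pr C n A i \<cdot> k = pow_pr C n A i \<cdot> k')"
    using assms(1,3) Q by (intro tuple_ex1) (auto intro: comp_hom pow_pr_hom)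
  then show ?thesis using assms by blast
qed

text \<open>Families are total functions on \<open>nat\<close>. The description behind
  \<open>tuple\<close> inspects them below \<open>n\<close>, so families that agree there may be
  exchanged.\<close>

lemma tuple_cong: "(\<And>i. i < n \<Longrightarrow> q i = q' i) \<Longrightarrow> tuple C n A Q q = tuple C n A Q q'"
  unfolding tuple_def by (rule arg_cong[where f = The]) (simp add: fun_eq_iff)

lemma tuple_pr:
  assumes "A \<in> Ob C" "k \<in> hom C Q (pow_ob C n A)"
  shows "tuple C n A Q (\<lambda>i. pow_pr C n A i \<cdot> k) = k"
proof -
  have "Q \<in> Ob C" using assms(2) by (rule hom_Ob)
  then show ?thesis
    using assms by (rule_tac pow_eqI[of A _ Q n]) (auto intro!: tuple_hom pr_tuple intro: comp_hom pow_pr_hom)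
qed

lemma tuple_comp:
  assumes "A \<in> Ob C" "\<And>i. i < n \<Longrightarrow> q i \<in> hom C Q A" "u \<in> hom C Q' Q"
  shows "tuple C n A Q q \<cdot> u = tuple C n A Q' (\<lambda>i. q i \<cdot> u)"
proof -
  have Q: "Q \<in> Ob C" "Q' \<in> Ob C" using assms(3) by (auto dest: hom_Ob)
  note t = tuple_hom[of A Q n q, OF assms(1) Q(1) assms(2)]
  show ?thesis
  proof (rule pow_eqI[OF assms(1)])
    show "tuple C n A Q q \<cdot> u \<in> hom C Q' (pow_ob C n A)"
      using t assms(3) by (rule comp_hom)
    show "tuple C n A Q' (\<lambda>i. q i \<cdot> u) \<in> hom C Q' (pow_ob C n A)"
      using assms Q by (intro tuple_hom comp_hom)
    fix i assume i: "i < n"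
    have "pow_pr C n A i \<cdot> (tuple C n A Q q \<cdot> u) = q i \<cdot> u"
      using assms Q t i by (simp add: comp_assoc[OF assms(3) t pow_pr_hom] pr_tuple)
    also have "\<dots> = pow_pr C n A i \<cdot> tuple C n A Q' (\<lambda>i. q i \<cdot> u)"
      using assms Q i by (subst pr_tuple) (auto intro: comp_hom)
    finally show "pow_pr C n A i \<cdot> (tuple C n A Q q \<cdot> u) = pow_pr C n A i \<cdot> tuple C n A Q' (\<lambda>i. q i \<cdot> u)" .
  qed
qed

lemma pow_map_eq:
  "f \<in> hom C A B \<Longrightarrow> pow_map C n f = tuple C n B (pow_ob C n A) (\<lambda>i. f \<cdot> pow_pr C n A i)"
  by (simp add: pow_map_def hom_def)

lemma pow_map_hom:
  assumes "f \<in> hom C A B"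
  shows "pow_map C n f \<in> hom C (pow_ob C n A) (pow_ob C n B)"
  using assms hom_Ob[OF assms] unfolding pow_map_eq[OF assms]
  by (intro tuple_hom) (auto intro: comp_hom pow_pr_hom)

lemma pr_pow_map:
  assumes "f \<in> hom C A B" "i < n"
  shows "pow_pr C n B i \<cdot> pow_map C n f = f \<cdot> pow_pr C n A i"
  using assms hom_Ob[OF assms(1)] unfolding pow_map_eq[OF assms(1)]
  by (subst pr_tuple) (auto intro: comp_hom pow_pr_hom)

lemma pow_map_comp_eq_tuple:
  assumes "f \<in> hom C A B" "k \<in> hom C Q (pow_ob C n A)"
  shows "pow_map C n f \<cdot> k = tuple C n B Q (\<lambda>i. f \<cdot> (pow_pr C n A i \<cdot> k))"
proof -
  note O = hom_Ob[OF assms(1)]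
  have "pow_map C n f \<cdot> k = tuple C n B Q (\<lambda>i. f \<cdot> pow_pr C n A i \<cdot> k)"
    unfolding pow_map_eq[OF assms(1)] using O assms
    by (intro tuple_comp) (auto intro: comp_hom pow_pr_hom)
  also have "\<dots> = tuple C n B Q (\<lambda>i. f \<cdot> (pow_pr C n A i \<cdot> k))"
    using O assms by (auto intro!: tuple_cong comp_assoc[symmetric] intro: pow_pr_hom)
  finally show ?thesis .
qed

lemma pr_pow_map_comp:
  assumes "f \<in> hom C A B" "k \<in> hom C Q (pow_ob C n A)" "i < n"
  shows "pow_pr C n B i \<cdot> (pow_map C n f \<cdot> k) = f \<cdot> (pow_pr C n A i \<cdot> k)"
  using assms hom_Ob[OF assms(1)] hom_Ob[OF assms(2)]
  unfolding pow_map_comp_eq_tuple[OF assms(1,2)]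
  by (subst pr_tuple) (auto intro!: comp_hom pow_pr_hom)

lemma pow_map_tuple:
  assumes "f \<in> hom C A B" "Q \<in> Ob C" "\<And>i. i < n \<Longrightarrow> q i \<in> hom C Q A"
  shows "pow_map C n f \<cdot> tuple C n A Q q = tuple C n B Q (\<lambda>i. f \<cdot> q i)"
proof -
  note O = hom_Ob[OF assms(1)]
  show ?thesis
    using pow_map_comp_eq_tuple[OF assms(1) tuple_hom[of A Q n q]] O assms
    by (auto intro!: tuple_cong simp: pr_tuple)
qed

lemma pow_map_comp:
  assumes "f \<in> hom C A B" "g \<in> hom C B D"
  shows "pow_map C n (g \<cdot> f) = pow_map C n g \<cdot> pow_map C n f"
proof -
  note O = hom_Ob[OF assms(1)] hom_Ob[OF assms(2)]
  have "pow_map C n g \<cdot> pow_map C n f = tuple C n D (pow_ob C n A) (\<lambda>i. g \<cdot> (f \<cdot> pow_pr C n A i))"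
    unfolding pow_map_comp_eq_tuple[OF assms(2) pow_map_hom[OF assms(1)]]
    using assms by (intro tuple_cong) (simp add: pr_pow_map)
  also have "\<dots> = pow_map C n (g \<cdot> f)"
    unfolding pow_map_eq[OF comp_hom[OF assms(2,1)]]
    using O assms by (intro tuple_cong) (simp add: comp_assoc[OF pow_pr_hom])
  finally show ?thesis ..
qed

lemma pow_map_ident: "A \<in> Ob C \<Longrightarrow> pow_map C n (Ident C A) = Ident C (pow_ob C n A)"
  using tuple_pr[of A "Ident C (pow_ob C n A)" "pow_ob C n A" n]
  by (simp add: pow_map_eq[OF ident_hom] cong: tuple_cong)

lemma
  assumes "f \<in> hom C Q A" "g \<in> hom C Q A"
  shows pair_hom: "pair C f g \<in> hom C Q (pow_ob C 2 A)"
    and pr0_pair: "pow_pr C 2 A 0 \<cdot> pair C f g = f"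
    and pr1_pair: "pow_pr C 2 A (Suc 0) \<cdot> pair C f g = g"
    and pair_eq_tuple: "pair C f g = tuple C 2 A Q (\<lambda>i. if i = 0 then f else g)"
  using assms hom_Ob[OF assms(1)] by (auto simp: pair_def homD intro!: tuple_hom pr_tuple[THEN trans])

lemma pair_eqI:
  assumes "A \<in> Ob C" "k \<in> hom C Q (pow_ob C 2 A)"
    and "pow_pr C 2 A 0 \<cdot> k = f" "pow_pr C 2 A (Suc 0) \<cdot> k = g"
  shows "pair C f g = k"
proof -
  have h: "f \<in> hom C Q A" "g \<in> hom C Q A"
    using assms comp_hom[OF pr0_hom] comp_hom[OF pr1_hom] by metis+
  show ?thesis
  proof (rule pow_eqI[OF assms(1) pair_hom[OF h] assms(2)])
    fix i :: nat
    assume "i < 2"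
    then show "pow_pr C 2 A i \<cdot> pair C f g = pow_pr C 2 A i \<cdot> k"
      using assms(3,4) pr0_pair[OF h] pr1_pair[OF h] by (auto simp: less_2_cases_iff)
  qed
qed

lemma pair_comp:
  assumes "f \<in> hom C Q A" "g \<in> hom C Q A" "u \<in> hom C Q' Q"
  shows "pair C f g \<cdot> u = pair C (f \<cdot> u) (g \<cdot> u)"
proof -
  have A: "A \<in> Ob C" using assms(1) by (rule hom_Ob)
  note p = pair_hom[OF assms(1,2)]
  show ?thesis
  proof (rule pair_eqI[of A, symmetric, OF A comp_hom[OF p assms(3)]])
    show "pow_pr C 2 A 0 \<cdot> (pair C f g \<cdot> u) = f \<cdot> u"
      using comp_assoc[OF assms(3) p pr0_hom[OF A]] pr0_pair[OF assms(1,2)] by simp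
    show "pow_pr C 2 A (Suc 0) \<cdot> (pair C f g \<cdot> u) = g \<cdot> u"
      using comp_assoc[OF assms(3) p pr1_hom[OF A]] pr1_pair[OF assms(1,2)] by simp
  qed
qed

lemma pair_pr: "A \<in> Ob C \<Longrightarrow> pair C (pow_pr C 2 A 0) (pow_pr C 2 A (Suc 0)) = Ident C (pow_ob C 2 A)"
  by (rule pair_eqI[of A _ "pow_ob C 2 A"]) auto

lemma pow_map_pair:
  assumes "h \<in> hom C A B" "f \<in> hom C Q A" "g \<in> hom C Q A"
  shows "pow_map C 2 h \<cdot> pair C f g = pair C (h \<cdot> f) (h \<cdot> g)"
proof -
  note O = hom_Ob[OF assms(1)]
  show ?thesis
    using O assms pair_hom[OF assms(2,3)] pow_map_hom[OF assms(1), of 2]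
    by (rule_tac pair_eqI[of B, symmetric]) (auto simp: pr_pow_map_comp pr0_pair pr1_pair)
qed

lemma is_pullback_pb:
  assumes f: "f \<in> hom C A B" and g: "g \<in> hom C A' B"
  shows "is_pullback C f g (pb_ob C f g) (pb_fst C f g) (pb_snd C f g)"
proof -
  \<comment> \<open>The cospan as a category on natural numbers: 0, 1, 2 name both the vertices and
    their identities, and 3 and 4 are the two legs into 2. If a leg is applied last, the composite
    is that leg, since it can only follow an identity; otherwise it is the arrow applied
    first.\<close>
  define J :: "(nat, nat) cat" where
    "J = \<lparr>Ob = {0, 1, 2}, Ar = {0, 1, 2, 3, 4},
          Dom = \<lambda>x. if x = 3 then 0 else if x = 4 then 1 else x,
          Cod = \<lambda>x. if x = 3 \<or> x = 4 then 2 else x,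
          Ident = \<lambda>x. x, Comp = \<lambda>g f. if g = 3 \<or> g = 4 then g else f\<rparr>"
  define D where
    "D = \<lparr>FO = \<lambda>j::nat. if j = 0 then A else if j = 1 then A' else B,
          FA = \<lambda>u::nat. if u = 3 then f else if u = 4 then g else
                   Ident C (if u = 0 then A else if u = 1 then A' else B)\<rparr>"
  have O: "A \<in> Ob C" "A' \<in> Ob C" "B \<in> Ob C"
    using f g by (auto dest: hom_Ob)
  have "category J"
    unfolding category_def J_def hom_def by simp
  moreover have "is_functor J C D"
    using f g O unfolding is_functor_def J_def D_def by (simp add: hom_def)
  moreover have "finite (Ob J)" "finite (Ar J)"
    by (simp_all add: J_def)
  ultimately obtain L c where lim: "is_limit J C D L c"
    using ex_limit by blast
  \<comment> \<open>The leg of a cone at vertex 2 is the common composite of the other two with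
    \<open>f\<close> and \<open>g\<close>, so cones over this diagram are commutative squares. The
    resulting extra equation for mediating arrows is absorbed below.\<close>
  have cone: "is_cone J C D L' c' \<longleftrightarrow> c' 0 \<in> hom C L' A \<and> c' 1 \<in> hom C L' A' \<and> c' 2 \<in> hom C L' B \<and>
     f \<cdot> c' 0 = c' 2 \<and> g \<cdot> c' 1 = c' 2" for L' c'
    using O by (auto simp: is_cone_def J_def D_def hom_def)
  have "is_pullback C f g L (c 0) (c 1)"
    unfolding is_pullback_def
  proof (intro conjI allI impI)
    show "c 0 \<in> hom C L (Dom C f)" "c 1 \<in> hom C L (Dom C g)" "f \<cdot> c 0 = g \<cdot> c 1"
      using lim f g unfolding is_limit_def cone by (auto simp: homD)
    fix Q u v
    assume uv: "u \<in> hom C Q (Dom C f) \<and> v \<in> hom C Q (Dom C g) \<and> f \<cdot> u = g \<cdot> v"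
    then have "is_cone J C D Q (\<lambda>j. if j = 0 then u else if j = 1 then v else f \<cdot> u)"
      using f g comp_hom[OF f] unfolding cone by (auto simp: homD)
    with lim have ex1: "\<exists>!k. k \<in> hom C Q L \<and> (\<forall>j\<in>Ob J. c j \<cdot> k = (if j = 0 then u else if j = 1 then v else f \<cdot> u))"
      unfolding is_limit_def by blast
    have c: "c 0 \<in> hom C L A" "c 1 \<in> hom C L A'" "c 2 \<in> hom C L B" "f \<cdot> c 0 = c 2"
      using lim unfolding is_limit_def cone by auto
    have "c 2 \<cdot> k = f \<cdot> (c 0 \<cdot> k)" if "k \<in> hom C Q L" for k
      using c f comp_assoc[OF that c(1) f] by simp
    then have "(k \<in> hom C Q L \<and> (\<forall>j\<in>Ob J. c j \<cdot> k = (if j = 0 then u else if j = 1 then v else f \<cdot> u))) \<longleftrightarrow>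
        (k \<in> hom C Q L \<and> c 0 \<cdot> k = u \<and> c 1 \<cdot> k = v)" for k
      by (auto simp: J_def)
    with ex1 show "\<exists>!k. k \<in> hom C Q L \<and> c 0 \<cdot> k = u \<and> c 1 \<cdot> k = v"
      by simp
  qed
  then have "\<exists>c. is_pullback C f g (fst c) (fst (snd c)) (snd (snd c))"
    by (metis fst_conv snd_conv)
  then show ?thesis
    unfolding pb_ob_def pb_fst_def pb_snd_def pullback_cone_def by (rule someI_ex)
qed

lemma
  assumes "f \<in> hom C A B" "g \<in> hom C A' B"
  shows pb_fst_hom: "pb_fst C f g \<in> hom C (pb_ob C f g) A"
    and pb_snd_hom: "pb_snd C f g \<in> hom C (pb_ob C f g) A'"
    and pb_square: "f \<cdot> pb_fst C f g = g \<cdot> pb_snd C f g"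
  using is_pullback_pb[OF assms] assms by (auto simp: is_pullback_def homD)

lemma
  assumes "f \<in> hom C A B" "g \<in> hom C A' B" "u \<in> hom C Q A" "v \<in> hom C Q A'" "f \<cdot> u = g \<cdot> v"
  shows pb_pair_hom: "pb_pair C f g u v \<in> hom C Q (pb_ob C f g)"
    and pb_fst_pair: "pb_fst C f g \<cdot> pb_pair C f g u v = u"
    and pb_snd_pair: "pb_snd C f g \<cdot> pb_pair C f g u v = v"
    and pb_pair_eqI: "k \<in> hom C Q (pb_ob C f g) \<Longrightarrow> pb_fst C f g \<cdot> k = u \<Longrightarrow> pb_snd C f g \<cdot> k = v \<Longrightarrow>
      pb_pair C f g u v = k"
proof -
  have "\<exists>!k. k \<in> hom C (Dom C u) (pb_ob C f g) \<and> pb_fst C f g \<cdot> k = u \<and> pb_snd C f g \<cdot> k = v"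
    using is_pullback_pb[OF assms(1,2)] assms unfolding is_pullback_def by (simp add: homD)
  with assms(3) have ex: "\<exists>!k. k \<in> hom C Q (pb_ob C f g) \<and> pb_fst C f g \<cdot> k = u \<and> pb_snd C f g \<cdot> k = v"
    by (simp add: homD)
  have eq: "pb_pair C f g u v = (THE k. k \<in> hom C Q (pb_ob C f g) \<and> pb_fst C f g \<cdot> k = u \<and> pb_snd C f g \<cdot> k = v)"
    using assms(3) by (simp add: pb_pair_def homD)
  show "pb_pair C f g u v \<in> hom C Q (pb_ob C f g)"
    "pb_fst C f g \<cdot> pb_pair C f g u v = u" "pb_snd C f g \<cdot> pb_pair C f g u v = v"
    "k \<in> hom C Q (pb_ob C f g) \<Longrightarrow> pb_fst C f g \<cdot> k = u \<Longrightarrow> pb_snd C f g \<cdot> k = v \<Longrightarrow>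
      pb_pair C f g u v = k"
    using theI'[OF ex] the1_equality[OF ex] unfolding eq by blast+
qed

lemma pb_pair_comp:
  assumes "f \<in> hom C A B" "g \<in> hom C A' B" "u \<in> hom C Q A" "v \<in> hom C Q A'" "f \<cdot> u = g \<cdot> v"
    and "w \<in> hom C Q' Q"
  shows "pb_pair C f g u v \<cdot> w = pb_pair C f g (u \<cdot> w) (v \<cdot> w)"
proof -
  note p = pb_pair_hom[OF assms(1-5)]
  have "f \<cdot> (u \<cdot> w) = g \<cdot> (v \<cdot> w)"
    using assms by (simp add: comp_assoc[OF assms(6)])
  then show ?thesis
    using assms p
    by (rule_tac pb_pair_eqI[symmetric, OF assms(1,2)])
      (auto simp: comp_assoc[OF assms(6) p] pb_fst_hom pb_snd_hom pb_fst_pair pb_snd_pair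
          comp_assoc[OF assms(6) p pb_fst_hom] comp_assoc[OF assms(6) p pb_snd_hom])
qed

end

section \<open>Internal categories and functors\<close>

locale icategory = fincat +
  fixes X :: "('o, 'a) icat"
  assumes internal: "internal_category C X"
begin

lemma iob_Ob [simp]: "iob X \<in> Ob C"
  and imor_Ob [simp]: "imor X \<in> Ob C"
  and src_hom [simp]: "src X \<in> hom C (imor X) (iob X)"
  and tgt_hom [simp]: "tgt X \<in> hom C (imor X) (iob X)"
  and idn_hom [simp]: "idn X \<in> hom C (iob X) (imor X)"
  and cmp_hom [simp]: "cmp X \<in> hom C (pb_ob C (src X) (tgt X)) (imor X)"
  and src_idn: "src X \<cdot> idn X = Ident C (iob X)"
  and tgt_idn: "tgt X \<cdot> idn X = Ident C (iob X)"
  and src_cmp: "src X \<cdot> cmp X = src X \<cdot> pb_snd C (src X) (tgt X)"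
  and tgt_cmp: "tgt X \<cdot> cmp X = tgt X \<cdot> pb_fst C (src X) (tgt X)"
  using internal unfolding internal_category_def by blast+

lemma ihomI:
  "f \<in> hom C J (imor X) \<Longrightarrow> src X \<cdot> f = A \<Longrightarrow> tgt X \<cdot> f = B \<Longrightarrow> f \<in> ihom C X A B"
  using src_hom by (auto simp: ihom_def hom_def)

text \<open>\<open>ihom\<close> keeps the stage only as the domain of the source object. That the
  target object lives at the same stage has to be recovered from \<open>f\<close>.\<close>

lemma
  assumes "f \<in> ihom C X A B"
  shows ihom_hom: "f \<in> hom C (Dom C A) (imor X)"
    and ihom_src: "src X \<cdot> f = A"
    and ihom_tgt: "tgt X \<cdot> f = B"
    and ihom_src_hom: "A \<in> hom C (Dom C A) (iob X)"
    and ihom_tgt_hom: "B \<in> hom C (Dom C A) (iob X)"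
    and ihom_Dom_eq: "Dom C B = Dom C A"
proof -
  show "f \<in> hom C (Dom C A) (imor X)" "src X \<cdot> f = A" "tgt X \<cdot> f = B"
    using assms by (auto simp: ihom_def)
  then show "A \<in> hom C (Dom C A) (iob X)" "B \<in> hom C (Dom C A) (iob X)"
    using comp_hom[OF src_hom] comp_hom[OF tgt_hom] by auto
  then show "Dom C B = Dom C A"
    by (rule_tac homD(2))
qed

lemma ihom_at:
  "f \<in> ihom C X A B \<Longrightarrow> A \<in> hom C J (iob X) \<Longrightarrow> f \<in> hom C J (imor X)"
  using ihom_hom homD(2) by metis

lemma idn_ihom: "A \<in> hom C J (iob X) \<Longrightarrow> idn X \<cdot> A \<in> ihom C X A A"
  by (rule ihomI[of _ J])
    (auto simp: comp_assoc[OF _ idn_hom src_hom] comp_assoc[OF _ idn_hom tgt_hom]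
      src_idn tgt_idn homD intro: comp_hom[OF idn_hom])

lemma idn_comp: "A \<in> hom C J (iob X) \<Longrightarrow> u \<in> hom C J' J \<Longrightarrow> idn X \<cdot> A \<cdot> u = idn X \<cdot> (A \<cdot> u)"
  by (rule comp_assoc[symmetric, OF _ _ idn_hom])

lemma icomp_ihom:
  assumes g: "g \<in> ihom C X B D" and f: "f \<in> ihom C X A B"
  shows "icomp C X g f \<in> ihom C X A D"
proof (rule ihomI)
  let ?J = "Dom C A" and ?k = "pb_pair C (src X) (tgt X) g f"
  have f': "f \<in> hom C ?J (imor X)" and g': "g \<in> hom C ?J (imor X)"
    and e: "src X \<cdot> g = tgt X \<cdot> f"
    using f g ihom_hom[OF f] ihom_hom[OF g] ihom_Dom_eq[OF f] by (auto simp: ihom_src ihom_tgt)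
  note pb = pb_pair_hom[OF src_hom tgt_hom g' f' e] pb_fst_pair[OF src_hom tgt_hom g' f' e]
    pb_snd_pair[OF src_hom tgt_hom g' f' e]
  show "icomp C X g f \<in> hom C ?J (imor X)"
    unfolding icomp_def using pb(1) by (rule comp_hom[OF cmp_hom])
  show "src X \<cdot> icomp C X g f = A"
    using pb ihom_src[OF f] comp_assoc[OF pb(1) cmp_hom src_hom]
      comp_assoc[OF pb(1) pb_snd_hom[OF src_hom tgt_hom] src_hom]
    by (simp add: icomp_def src_cmp)
  show "tgt X \<cdot> icomp C X g f = D"
    using pb ihom_tgt[OF g] comp_assoc[OF pb(1) cmp_hom tgt_hom]
      comp_assoc[OF pb(1) pb_fst_hom[OF src_hom tgt_hom] tgt_hom]
    by (simp add: icomp_def tgt_cmp)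
qed

lemma icomp_idr: "f \<in> ihom C X A B \<Longrightarrow> icomp C X f (idn X \<cdot> A) = f"
  using internal ihom_hom[of f A B] ihom_src[of f A B] unfolding internal_category_def by blast

lemma icomp_idl: "f \<in> ihom C X A B \<Longrightarrow> icomp C X (idn X \<cdot> B) f = f"
  using internal ihom_hom[of f A B] ihom_tgt[of f A B] unfolding internal_category_def by blast

lemma icomp_assoc:
  assumes "f \<in> ihom C X A B" "g \<in> ihom C X B D" "h \<in> ihom C X D E"
  shows "icomp C X h (icomp C X g f) = icomp C X (icomp C X h g) f"
proof -
  have "f \<in> hom C (Dom C A) (imor X)" "g \<in> hom C (Dom C A) (imor X)" "h \<in> hom C (Dom C A) (imor X)"
    "src X \<cdot> g = tgt X \<cdot> f" "src X \<cdot> h = tgt X \<cdot> g"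
    using assms ihom_hom[OF assms(1)] ihom_hom[OF assms(2)] ihom_hom[OF assms(3)]
      ihom_Dom_eq[OF assms(1)] ihom_Dom_eq[OF assms(2)] by (simp_all add: ihom_src ihom_tgt)
  then show ?thesis
    using internal unfolding internal_category_def by metis
qed

lemma ihom_comp:
  assumes f: "f \<in> ihom C X A B" and u: "u \<in> hom C J' (Dom C A)"
  shows "f \<cdot> u \<in> ihom C X (A \<cdot> u) (B \<cdot> u)"
  using ihom_src[OF f] ihom_tgt[OF f]
  by (intro ihomI[OF comp_hom[OF ihom_hom[OF f] u]])
    (simp_all add: comp_assoc[OF u ihom_hom[OF f] src_hom] comp_assoc[OF u ihom_hom[OF f] tgt_hom])

text \<open>Composition is the single arrow \<open>cmp\<close> after pairing into a pullback, and
  pairing is natural in the stage. With \<open>ihom_comp\<close>, this lets equations between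
  composites be moved from one stage to another.\<close>

lemma icomp_comp:
  assumes f: "f \<in> ihom C X A B" and g: "g \<in> ihom C X B D" and u: "u \<in> hom C J' (Dom C A)"
  shows "icomp C X g f \<cdot> u = icomp C X (g \<cdot> u) (f \<cdot> u)"
proof -
  have f': "f \<in> hom C (Dom C A) (imor X)" and g': "g \<in> hom C (Dom C A) (imor X)"
    and e: "src X \<cdot> g = tgt X \<cdot> f"
    using f g ihom_hom[OF f] ihom_hom[OF g] ihom_Dom_eq[OF f] by (auto simp: ihom_src ihom_tgt)
  show ?thesis
    unfolding icomp_def pb_pair_comp[OF src_hom tgt_hom g' f' e u, symmetric]
    by (rule comp_assoc[OF u pb_pair_hom[OF src_hom tgt_hom g' f' e] cmp_hom, symmetric])
qed

lemma inverse_pair_iff: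
  assumes "f \<in> ihom C X A B"
  shows "inverse_pair C X f g \<longleftrightarrow>
    g \<in> ihom C X B A \<and> icomp C X g f = idn X \<cdot> A \<and> icomp C X f g = idn X \<cdot> B"
  using homD[OF ihom_hom[OF assms]] ihom_src[OF assms] ihom_tgt[OF assms]
  by (simp add: inverse_pair_def)

lemma inverse_unique:
  assumes f: "f \<in> ihom C X A B" and g: "inverse_pair C X f g" and g': "inverse_pair C X f g'"
  shows "g = g'"
proof -
  have g: "g \<in> ihom C X B A" "icomp C X g f = idn X \<cdot> A"
    and g': "g' \<in> ihom C X B A" "icomp C X f g' = idn X \<cdot> B"
    using g g' by (auto simp: inverse_pair_iff[OF f])
  have "g = icomp C X g (icomp C X f g')"
    using g' by (simp add: icomp_idr[OF g(1)])
  also have "\<dots> = icomp C X (icomp C X g f) g'"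
    by (rule icomp_assoc[OF g'(1) f g(1)])
  also have "\<dots> = g'"
    using g by (simp add: icomp_idl[OF g'(1)])
  finally show ?thesis .
qed

lemma
  assumes f: "f \<in> ihom C X A B" and iso: "iiso C X f"
  shows iinv_ihom: "iinv C X f \<in> ihom C X B A"
    and iinv_left: "icomp C X (iinv C X f) f = idn X \<cdot> A"
    and iinv_right: "icomp C X f (iinv C X f) = idn X \<cdot> B"
proof -
  have "inverse_pair C X f (iinv C X f)"
    unfolding iinv_def
    by (rule theI') (use iso inverse_unique[OF f] in \<open>auto simp: iiso_def\<close>)
  then show "iinv C X f \<in> ihom C X B A" "icomp C X (iinv C X f) f = idn X \<cdot> A"
    "icomp C X f (iinv C X f) = idn X \<cdot> B"
    by (auto simp: inverse_pair_iff[OF f])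
qed

lemma iso_cancel_right:
  assumes f: "f \<in> ihom C X A B" and iso: "iiso C X f"
    and g: "g \<in> ihom C X B D" and g': "g' \<in> ihom C X B D"
    and eq: "icomp C X g f = icomp C X g' f"
  shows "g = g'"
proof -
  note inv = iinv_ihom[OF f iso]
  have "icomp C X g (icomp C X f (iinv C X f)) = icomp C X g' (icomp C X f (iinv C X f))"
    using eq by (simp add: icomp_assoc[OF inv f g] icomp_assoc[OF inv f g'])
  then show ?thesis
    by (simp add: iinv_right[OF f iso] icomp_idr[OF g] icomp_idr[OF g'])
qed

end

section \<open>Action of internal functors on generalized morphisms\<close>

locale ifunctor = fincat +
  fixes H :: "('o, 'a) ifun"
  assumes functorial: "internal_functor C H"
begin

sublocale D: icategory C "idom H"
  using functorial by unfold_locales (simp add: internal_functor_def Let_def)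

sublocale E: icategory C "icod H"
  using functorial by unfold_locales (simp add: internal_functor_def Let_def)

lemma fo_hom: "fo H \<in> hom C (iob (idom H)) (iob (icod H))"
  and fm_hom: "fm H \<in> hom C (imor (idom H)) (imor (icod H))"
  and src_fm: "src (icod H) \<cdot> fm H = fo H \<cdot> src (idom H)"
  and tgt_fm: "tgt (icod H) \<cdot> fm H = fo H \<cdot> tgt (idom H)"
  and fm_idn_eq: "fm H \<cdot> idn (idom H) = idn (icod H) \<cdot> fo H"
  and fm_cmp: "fm H \<cdot> cmp (idom H) =
    icomp C (icod H) (fm H \<cdot> pb_fst C (src (idom H)) (tgt (idom H)))
      (fm H \<cdot> pb_snd C (src (idom H)) (tgt (idom H)))"
  using functorial by (auto simp: internal_functor_def Let_def)

lemma fm_ihom: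
  assumes f: "f \<in> ihom C (idom H) A B"
  shows "fm H \<cdot> f \<in> ihom C (icod H) (fo H \<cdot> A) (fo H \<cdot> B)"
proof -
  note f' = D.ihom_hom[OF f]
  show ?thesis
    using f D.ihom_src[OF f] D.ihom_tgt[OF f]
    by (intro E.ihomI[OF comp_hom[OF fm_hom f']])
      (auto simp: comp_assoc[OF f' fm_hom E.src_hom] comp_assoc[OF f' fm_hom E.tgt_hom] src_fm tgt_fm
        comp_assoc[OF f' D.src_hom fo_hom, symmetric] comp_assoc[OF f' D.tgt_hom fo_hom, symmetric])
qed

lemma fm_idn: "A \<in> hom C J (iob (idom H)) \<Longrightarrow> fm H \<cdot> (idn (idom H) \<cdot> A) = idn (icod H) \<cdot> (fo H \<cdot> A)"
  by (simp add: comp_assoc[OF _ D.idn_hom fm_hom] comp_assoc[OF _ fo_hom E.idn_hom] fm_idn_eq)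

text \<open>\<open>fm_cmp\<close> is this equation for the generic composable pair, the two pullback
  projections; precomposing with the pairing of \<open>g\<close> and \<open>f\<close> gives the
  general case.\<close>

lemma fm_icomp:
  assumes f: "f \<in> ihom C (idom H) A B" and g: "g \<in> ihom C (idom H) B D"
  shows "fm H \<cdot> icomp C (idom H) g f = icomp C (icod H) (fm H \<cdot> g) (fm H \<cdot> f)"
proof -
  let ?X = "idom H" and ?Y = "icod H" and ?J = "Dom C A"
  let ?k = "pb_pair C (src ?X) (tgt ?X) g f"
  have f': "f \<in> hom C ?J (imor ?X)" and g': "g \<in> hom C ?J (imor ?X)"
    and e: "src ?X \<cdot> g = tgt ?X \<cdot> f"
    using f g D.ihom_hom[OF f] D.ihom_hom[OF g] D.ihom_Dom_eq[OF f] by (auto simp: D.ihom_src D.ihom_tgt)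
  note k = pb_pair_hom[OF D.src_hom D.tgt_hom g' f' e]
  note p = pb_fst_hom[OF D.src_hom D.tgt_hom] pb_snd_hom[OF D.src_hom D.tgt_hom]
  have sf: "pb_snd C (src ?X) (tgt ?X) \<in>
      ihom C ?X (src ?X \<cdot> pb_snd C (src ?X) (tgt ?X)) (tgt ?X \<cdot> pb_snd C (src ?X) (tgt ?X))"
    by (rule D.ihomI[OF p(2)]) auto
  have ff: "pb_fst C (src ?X) (tgt ?X) \<in>
      ihom C ?X (tgt ?X \<cdot> pb_snd C (src ?X) (tgt ?X)) (tgt ?X \<cdot> pb_fst C (src ?X) (tgt ?X))"
    by (rule D.ihomI[OF p(1)]) (auto simp: pb_square[OF D.src_hom D.tgt_hom])
  have d: "Dom C (fo H \<cdot> (src ?X \<cdot> pb_snd C (src ?X) (tgt ?X))) = pb_ob C (src ?X) (tgt ?X)"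
    using comp_hom[OF fo_hom comp_hom[OF D.src_hom p(2)]] by (rule homD)
  have "fm H \<cdot> icomp C ?X g f = fm H \<cdot> cmp ?X \<cdot> ?k"
    unfolding icomp_def by (rule comp_assoc[OF k D.cmp_hom fm_hom])
  also have "\<dots> = icomp C ?Y (fm H \<cdot> pb_fst C (src ?X) (tgt ?X) \<cdot> ?k) (fm H \<cdot> pb_snd C (src ?X) (tgt ?X) \<cdot> ?k)"
    unfolding fm_cmp by (rule E.icomp_comp[OF fm_ihom[OF sf] fm_ihom[OF ff]]) (use k d in simp)
  also have "\<dots> = icomp C ?Y (fm H \<cdot> g) (fm H \<cdot> f)"
    by (simp add: comp_assoc[OF k p(1) fm_hom, symmetric] comp_assoc[OF k p(2) fm_hom, symmetric]
        pb_fst_pair[OF D.src_hom D.tgt_hom g' f' e] pb_snd_pair[OF D.src_hom D.tgt_hom g' f' e])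
  finally show ?thesis .
qed

end

subsection \<open>Products and exponentials in an internal category\<close>

lemma (in fincat) at2_hom:
  "m \<in> hom C (pow_ob C 2 Y) Z \<Longrightarrow> A \<in> hom C J Y \<Longrightarrow> B \<in> hom C J Y \<Longrightarrow> at2 C m A B \<in> hom C J Z"
  unfolding at2_def using pair_hom by blast

lemma (in fincat) at2_comp:
  assumes "m \<in> hom C (pow_ob C 2 Y) Z" "A \<in> hom C J Y" "B \<in> hom C J Y" "u \<in> hom C J' J"
  shows "at2 C m A B \<cdot> u = at2 C m (A \<cdot> u) (B \<cdot> u)"
  unfolding at2_def pair_comp[OF assms(2-4), symmetric]
  by (rule comp_assoc[OF assms(4) pair_hom[OF assms(2,3)] assms(1), symmetric])

locale iproduct_category = icategory +
  fixes P :: "'a icc"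
  assumes products: "iproducts C X P"
begin

abbreviation "prd \<equiv> at2 C (iprd P)"
abbreviation "prj1 \<equiv> at2 C (ifst P)"
abbreviation "prj2 \<equiv> at2 C (isnd P)"
abbreviation "pmap \<equiv> iprod_map C X P"

lemma iprd_hom: "iprd P \<in> hom C (pow_ob C 2 (iob X)) (iob X)"
  and ifst_hom: "ifst P \<in> hom C (pow_ob C 2 (iob X)) (imor X)"
  and isnd_hom: "isnd P \<in> hom C (pow_ob C 2 (iob X)) (imor X)"
  using products by (auto simp: iproducts_def)

lemma prd_hom: "A \<in> hom C J (iob X) \<Longrightarrow> B \<in> hom C J (iob X) \<Longrightarrow> prd A B \<in> hom C J (iob X)"
  by (rule at2_hom[OF iprd_hom])

lemma prd_Dom: "A \<in> hom C J (iob X) \<Longrightarrow> B \<in> hom C J (iob X) \<Longrightarrow> Dom C (prd A B) = J"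
  by (rule homD[OF prd_hom])

lemma
  assumes "A \<in> hom C J (iob X)" "B \<in> hom C J (iob X)"
  shows prj1_ihom: "prj1 A B \<in> ihom C X (prd A B) A"
    and prj2_ihom: "prj2 A B \<in> ihom C X (prd A B) B"
  using products assms unfolding iproducts_def by blast+

lemma prod_ex1:
  assumes f: "f \<in> ihom C X Z A" and g: "g \<in> ihom C X Z B"
  shows "\<exists>!k. k \<in> ihom C X Z (prd A B) \<and> icomp C X (prj1 A B) k = f \<and> icomp C X (prj2 A B) k = g"
  using products f g ihom_src_hom[OF f] ihom_tgt_hom[OF f] ihom_tgt_hom[OF g]
  unfolding iproducts_def by blast

lemma prod_eqI:
  assumes "k \<in> ihom C X Z (prd A B)" "k' \<in> ihom C X Z (prd A B)"
    and A: "A \<in> hom C J (iob X)" and B: "B \<in> hom C J (iob X)"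
    and "icomp C X (prj1 A B) k = icomp C X (prj1 A B) k'"
    and "icomp C X (prj2 A B) k = icomp C X (prj2 A B) k'"
  shows "k = k'"
  using prod_ex1[OF icomp_ihom[OF prj1_ihom[OF A B] assms(2)] icomp_ihom[OF prj2_ihom[OF A B] assms(2)]]
    assms by blast

text \<open>The description in \<open>iprod_map\<close> is unfolded once, here. Afterwards
  \<open>pmap\<close> is used only through its two projection equations and
  \<open>pmap_eqI\<close>.\<close>

lemma
  assumes f: "f \<in> ihom C X A A'" and g: "g \<in> ihom C X B B'" and d: "Dom C A = Dom C B"
  shows pmap_ihom: "pmap f g \<in> ihom C X (prd A B) (prd A' B')"
    and prj1_pmap: "icomp C X (prj1 A' B') (pmap f g) = icomp C X f (prj1 A B)"
    and prj2_pmap: "icomp C X (prj2 A' B') (pmap f g) = icomp C X g (prj2 A B)"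
    and pmap_eqI: "k \<in> ihom C X (prd A B) (prd A' B') \<Longrightarrow>
      icomp C X (prj1 A' B') k = icomp C X f (prj1 A B) \<Longrightarrow>
      icomp C X (prj2 A' B') k = icomp C X g (prj2 A B) \<Longrightarrow> pmap f g = k"
proof -
  have A: "A \<in> hom C (Dom C A) (iob X)" and B: "B \<in> hom C (Dom C A) (iob X)"
    using ihom_src_hom[OF f] ihom_src_hom[OF g] d by auto
  note ex = prod_ex1[OF icomp_ihom[OF f prj1_ihom[OF A B]] icomp_ihom[OF g prj2_ihom[OF A B]]]
  have eq: "pmap f g = (THE k. k \<in> ihom C X (prd A B) (prd A' B') \<and>
      icomp C X (prj1 A' B') k = icomp C X f (prj1 A B) \<and>
      icomp C X (prj2 A' B') k = icomp C X g (prj2 A B))"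
    by (simp add: iprod_map_def Let_def ihom_src[OF f] ihom_src[OF g] ihom_tgt[OF f] ihom_tgt[OF g])
  show "pmap f g \<in> ihom C X (prd A B) (prd A' B')"
    "icomp C X (prj1 A' B') (pmap f g) = icomp C X f (prj1 A B)"
    "icomp C X (prj2 A' B') (pmap f g) = icomp C X g (prj2 A B)"
    "k \<in> ihom C X (prd A B) (prd A' B') \<Longrightarrow>
      icomp C X (prj1 A' B') k = icomp C X f (prj1 A B) \<Longrightarrow>
      icomp C X (prj2 A' B') k = icomp C X g (prj2 A B) \<Longrightarrow> pmap f g = k"
    using theI'[OF ex] the1_equality[OF ex] unfolding eq by blast+
qed

lemma pmap_idn:
  assumes A: "A \<in> hom C J (iob X)" and B: "B \<in> hom C J (iob X)"
  shows "pmap (idn X \<cdot> A) (idn X \<cdot> B) = idn X \<cdot> prd A B"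
proof (rule pmap_eqI[OF idn_ihom[OF A] idn_ihom[OF B]])
  note p = prj1_ihom[OF A B] prj2_ihom[OF A B]
  show "Dom C A = Dom C B" using A B by (simp add: homD)
  show "idn X \<cdot> prd A B \<in> ihom C X (prd A B) (prd A B)"
    by (rule idn_ihom[OF prd_hom[OF A B]])
  show "icomp C X (prj1 A B) (idn X \<cdot> prd A B) = icomp C X (idn X \<cdot> A) (prj1 A B)"
    "icomp C X (prj2 A B) (idn X \<cdot> prd A B) = icomp C X (idn X \<cdot> B) (prj2 A B)"
    by (simp_all add: icomp_idl[OF p(1)] icomp_idr[OF p(1)] icomp_idl[OF p(2)] icomp_idr[OF p(2)])
qed

lemma pmap_icomp:
  assumes f: "f \<in> ihom C X A A'" and g: "g \<in> ihom C X B B'" and d: "Dom C A = Dom C B"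
    and f': "f' \<in> ihom C X A' A''" and g': "g' \<in> ihom C X B' B''"
  shows "pmap (icomp C X f' f) (icomp C X g' g) = icomp C X (pmap f' g') (pmap f g)"
proof (rule pmap_eqI[OF icomp_ihom[OF f' f] icomp_ihom[OF g' g] d])
  have d': "Dom C A' = Dom C B'"
    using d by (simp add: ihom_Dom_eq[OF f] ihom_Dom_eq[OF g])
  have A: "A \<in> hom C (Dom C A) (iob X)" "B \<in> hom C (Dom C A) (iob X)"
      "A' \<in> hom C (Dom C A) (iob X)" "B' \<in> hom C (Dom C A) (iob X)"
      "A'' \<in> hom C (Dom C A) (iob X)" "B'' \<in> hom C (Dom C A) (iob X)"
    using ihom_src_hom[OF f] ihom_src_hom[OF g] ihom_tgt_hom[OF f] ihom_tgt_hom[OF g]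
      ihom_tgt_hom[OF f'] ihom_tgt_hom[OF g'] d ihom_Dom_eq[OF f] ihom_Dom_eq[OF g] by auto
  note p = pmap_ihom[OF f g d] and p' = pmap_ihom[OF f' g' d']
  show "icomp C X (pmap f' g') (pmap f g) \<in> ihom C X (prd A B) (prd A'' B'')"
    by (rule icomp_ihom[OF p' p])
  note j1 = prj1_ihom[OF A(1,2)] prj1_ihom[OF A(3,4)] prj1_ihom[OF A(5,6)]
  note j2 = prj2_ihom[OF A(1,2)] prj2_ihom[OF A(3,4)] prj2_ihom[OF A(5,6)]
  show "icomp C X (prj1 A'' B'') (icomp C X (pmap f' g') (pmap f g)) = icomp C X (icomp C X f' f) (prj1 A B)"
    by (simp add: icomp_assoc[OF p p' j1(3)] prj1_pmap[OF f' g' d'] icomp_assoc[OF p j1(2) f', symmetric]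
        prj1_pmap[OF f g d] icomp_assoc[OF j1(1) f f'])
  show "icomp C X (prj2 A'' B'') (icomp C X (pmap f' g') (pmap f g)) = icomp C X (icomp C X g' g) (prj2 A B)"
    by (simp add: icomp_assoc[OF p p' j2(3)] prj2_pmap[OF f' g' d'] icomp_assoc[OF p j2(2) g', symmetric]
        prj2_pmap[OF f g d] icomp_assoc[OF j2(1) g g'])
qed

text \<open>The universal property is available at every stage, and the reindexed arrow satisfies
  the projection equations that determine the right-hand side.\<close>

lemma pmap_comp:
  assumes f: "f \<in> ihom C X A A'" and g: "g \<in> ihom C X B B'" and d: "Dom C A = Dom C B"
    and u: "u \<in> hom C J (Dom C A)"
  shows "pmap f g \<cdot> u = pmap (f \<cdot> u) (g \<cdot> u)"
proof -
  have A: "A \<in> hom C (Dom C A) (iob X)" "B \<in> hom C (Dom C A) (iob X)"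
      "A' \<in> hom C (Dom C A) (iob X)" "B' \<in> hom C (Dom C A) (iob X)"
    using ihom_src_hom[OF f] ihom_src_hom[OF g] ihom_tgt_hom[OF f] ihom_tgt_hom[OF g] d by auto
  have u': "u \<in> hom C J (Dom C B)" "u \<in> hom C J (Dom C (prd A B))"
    using u d by (simp_all add: prd_Dom[OF A(1,2)])
  have d': "Dom C (A \<cdot> u) = Dom C (B \<cdot> u)"
    using homD[OF comp_hom[OF A(1) u]] homD[OF comp_hom[OF A(2) u]] by simp
  note p = pmap_ihom[OF f g d]
  note c = at2_comp[OF iprd_hom _ _ u] at2_comp[OF ifst_hom _ _ u] at2_comp[OF isnd_hom _ _ u]
  note j = prj1_ihom[OF A(1,2)] prj2_ihom[OF A(1,2)] prj1_ihom[OF A(3,4)] prj2_ihom[OF A(3,4)]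
  show ?thesis
  proof (rule pmap_eqI[symmetric, OF ihom_comp[OF f u] ihom_comp[OF g u'(1)] d'])
    show "pmap f g \<cdot> u \<in> ihom C X (prd (A \<cdot> u) (B \<cdot> u)) (prd (A' \<cdot> u) (B' \<cdot> u))"
      using ihom_comp[OF p u'(2)] by (simp add: c A)
    have "icomp C X (prj1 A' B' \<cdot> u) (pmap f g \<cdot> u) = icomp C X (f \<cdot> u) (prj1 A B \<cdot> u)"
      using prj1_pmap[OF f g d] icomp_comp[OF p j(3) u'(2)] icomp_comp[OF j(1) f u'(2)] by simp
    then show "icomp C X (prj1 (A' \<cdot> u) (B' \<cdot> u)) (pmap f g \<cdot> u) = icomp C X (f \<cdot> u) (prj1 (A \<cdot> u) (B \<cdot> u))"
      by (simp add: c A)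
    have "icomp C X (prj2 A' B' \<cdot> u) (pmap f g \<cdot> u) = icomp C X (g \<cdot> u) (prj2 A B \<cdot> u)"
      using prj2_pmap[OF f g d] icomp_comp[OF p j(4) u'(2)] icomp_comp[OF j(2) g u'(2)] by simp
    then show "icomp C X (prj2 (A' \<cdot> u) (B' \<cdot> u)) (pmap f g \<cdot> u) = icomp C X (g \<cdot> u) (prj2 (A \<cdot> u) (B \<cdot> u))"
      by (simp add: c A)
  qed
qed

end

section \<open>Internal exponentials and their action on isomorphisms\<close>

locale iexponential_category = iproduct_category +
  assumes exponentials: "iexponentials C X P"
begin

abbreviation "expo \<equiv> at2 C (iexp P)"
abbreviation "evl \<equiv> at2 C (ievl P)"
abbreviation "emap \<equiv> iexp_map C X P"

lemma iexp_hom: "iexp P \<in> hom C (pow_ob C 2 (iob X)) (iob X)"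
  and ievl_hom: "ievl P \<in> hom C (pow_ob C 2 (iob X)) (imor X)"
  using exponentials by (auto simp: iexponentials_def)

lemma expo_hom: "A \<in> hom C J (iob X) \<Longrightarrow> B \<in> hom C J (iob X) \<Longrightarrow> expo A B \<in> hom C J (iob X)"
  by (rule at2_hom[OF iexp_hom])

lemma expo_Dom: "A \<in> hom C J (iob X) \<Longrightarrow> B \<in> hom C J (iob X) \<Longrightarrow> Dom C (expo A B) = J"
  by (rule homD[OF expo_hom])

lemma evl_ihom:
  assumes "A \<in> hom C J (iob X)" "B \<in> hom C J (iob X)"
  shows "evl A B \<in> ihom C X (prd (expo A B) A) B"
  using exponentials assms unfolding iexponentials_def by blast

lemma curry_ex1:
  assumes "A \<in> hom C J (iob X)" "Z \<in> hom C J (iob X)" "f \<in> ihom C X (prd Z A) B"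
  shows "\<exists>!k. k \<in> ihom C X Z (expo A B) \<and> icomp C X (evl A B) (pmap k (idn X \<cdot> A)) = f"
proof -
  have "B \<in> hom C J (iob X)"
    using ihom_tgt_hom[OF assms(3)] prd_Dom[OF assms(2,1)] by simp
  then show ?thesis
    using exponentials assms unfolding iexponentials_def by blast
qed

lemma exp_eqI:
  assumes A: "A \<in> hom C J (iob X)" and Z: "Z \<in> hom C J (iob X)" and B: "B \<in> hom C J (iob X)"
    and k: "k \<in> ihom C X Z (expo A B)" and k': "k' \<in> ihom C X Z (expo A B)"
    and eq: "icomp C X (evl A B) (pmap k (idn X \<cdot> A)) = icomp C X (evl A B) (pmap k' (idn X \<cdot> A))"
  shows "k = k'"
proof -
  have "pmap k' (idn X \<cdot> A) \<in> ihom C X (prd Z A) (prd (expo A B) A)"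
    using A Z by (intro pmap_ihom[OF k' idn_ihom]) (auto simp: homD)
  from icomp_ihom[OF evl_ihom[OF A B] this] curry_ex1[OF A Z] k k' eq
  show ?thesis by blast
qed

text \<open>Transposes may be tested against \<open>k \<times> f\<close> for an isomorphism
  \<open>f\<close> instead of \<open>k \<times> 1\<close>, since composing on the right with
  \<open>1 \<times> iinv f\<close> leads back to the usual test. The variant is needed because the
  witness for a degeneracy acts on the argument of a function type as well as on the
  function.\<close>

lemma exp_eqI_iso:
  assumes f: "f \<in> ihom C X A A'" and iso: "iiso C X f"
    and Z: "Z \<in> hom C (Dom C A) (iob X)" and B: "B \<in> hom C (Dom C A) (iob X)"
    and k: "k \<in> ihom C X Z (expo A' B)" and k': "k' \<in> ihom C X Z (expo A' B)"
    and eq: "icomp C X (evl A' B) (pmap k f) = icomp C X (evl A' B) (pmap k' f)"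
  shows "k = k'"
proof (rule exp_eqI[OF ihom_tgt_hom[OF f] Z B k k'])
  note A' = ihom_tgt_hom[OF f]
  note inv = iinv_ihom[OF f iso]
  have dZ: "Dom C Z = Dom C A" using Z by (rule homD)
  have d': "Dom C A' = Dom C A" by (rule ihom_Dom_eq[OF f])
  have m: "icomp C X (evl A' B) (pmap j (idn X \<cdot> A')) =
      icomp C X (icomp C X (evl A' B) (pmap j f)) (pmap (idn X \<cdot> Z) (iinv C X f))"
    if j: "j \<in> ihom C X Z (expo A' B)" for j
  proof -
    have p1: "pmap j f \<in> ihom C X (prd Z A) (prd (expo A' B) A')"
      by (rule pmap_ihom[OF j f dZ])
    have p2: "pmap (idn X \<cdot> Z) (iinv C X f) \<in> ihom C X (prd Z A') (prd Z A)"
      by (rule pmap_ihom[OF idn_ihom[OF Z] inv]) (simp add: dZ d')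
    have "icomp C X (pmap j f) (pmap (idn X \<cdot> Z) (iinv C X f)) =
        pmap (icomp C X j (idn X \<cdot> Z)) (icomp C X f (iinv C X f))"
      by (rule pmap_icomp[symmetric, OF idn_ihom[OF Z] inv _ j f]) (simp add: dZ d')
    also have "\<dots> = pmap j (idn X \<cdot> A')"
      by (simp add: icomp_idr[OF j] iinv_right[OF f iso])
    finally show ?thesis
      by (simp add: icomp_assoc[OF p2 p1 evl_ihom[OF A' B], symmetric])
  qed
  show "icomp C X (evl A' B) (pmap k (idn X \<cdot> A')) = icomp C X (evl A' B) (pmap k' (idn X \<cdot> A'))"
    unfolding m[OF k] m[OF k'] eq ..
qed

text \<open>The definition of \<open>iexp_map\<close> evaluates against an identity and mentions the
  inverse of \<open>f\<close>; precomposing with \<open>1 \<times> f\<close> removes that inverse.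
  The resulting \<open>evl_emap\<close> is a commuting square of evaluations, and together with
  \<open>emap_eqI\<close> it replaces the definition from here on.\<close>

lemma
  assumes f: "f \<in> ihom C X A A'" and iso: "iiso C X f" and g: "g \<in> ihom C X B B'"
    and d: "Dom C A = Dom C B"
  shows emap_ihom: "emap f g \<in> ihom C X (expo A B) (expo A' B')"
    and evl_emap: "icomp C X (evl A' B') (pmap (emap f g) f) = icomp C X g (evl A B)"
proof -
  note inv = iinv_ihom[OF f iso]
  have A: "A \<in> hom C (Dom C A) (iob X)" "B \<in> hom C (Dom C A) (iob X)"
      "A' \<in> hom C (Dom C A) (iob X)" "B' \<in> hom C (Dom C A) (iob X)"
    using ihom_src_hom[OF f] ihom_src_hom[OF g] ihom_tgt_hom[OF f] ihom_tgt_hom[OF g] d by auto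
  let ?E = "expo A B"
  note E = expo_hom[OF A(1,2)]
  have dE: "Dom C ?E = Dom C A" by (rule homD[OF E])
  have d': "Dom C A' = Dom C A" by (rule ihom_Dom_eq[OF f])
  have p: "pmap (idn X \<cdot> ?E) (iinv C X f) \<in> ihom C X (prd ?E A') (prd ?E A)"
    by (rule pmap_ihom[OF idn_ihom[OF E] inv]) (simp add: dE d')
  note ev = evl_ihom[OF A(1,2)] and ev' = evl_ihom[OF A(3,4)]
  note ex = curry_ex1[OF A(3) E icomp_ihom[OF g icomp_ihom[OF ev p]]]
  have eq: "emap f g = (THE k. k \<in> ihom C X ?E (expo A' B') \<and>
      icomp C X (evl A' B') (pmap k (idn X \<cdot> A')) =
      icomp C X g (icomp C X (evl A B) (pmap (idn X \<cdot> ?E) (iinv C X f))))"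
    by (simp add: iexp_map_def Let_def ihom_src[OF f] ihom_src[OF g] ihom_tgt[OF f] ihom_tgt[OF g])
  show e: "emap f g \<in> ihom C X ?E (expo A' B')"
    using theI'[OF ex] unfolding eq by blast
  have 1: "icomp C X (evl A' B') (pmap (emap f g) (idn X \<cdot> A')) =
      icomp C X g (icomp C X (evl A B) (pmap (idn X \<cdot> ?E) (iinv C X f)))"
    using theI'[OF ex] unfolding eq by blast
  have q: "pmap (idn X \<cdot> ?E) f \<in> ihom C X (prd ?E A) (prd ?E A')"
    by (rule pmap_ihom[OF idn_ihom[OF E] f dE])
  have r: "pmap (emap f g) (idn X \<cdot> A') \<in> ihom C X (prd ?E A') (prd (expo A' B') A')"
    by (rule pmap_ihom[OF e idn_ihom[OF A(3)]]) (simp add: dE d')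
  have "pmap (emap f g) f = icomp C X (pmap (emap f g) (idn X \<cdot> A')) (pmap (idn X \<cdot> ?E) f)"
    using pmap_icomp[OF idn_ihom[OF E] f dE e idn_ihom[OF A(3)]] by (simp add: icomp_idr[OF e] icomp_idl[OF f])
  then have "icomp C X (evl A' B') (pmap (emap f g) f) =
      icomp C X (icomp C X g (icomp C X (evl A B) (pmap (idn X \<cdot> ?E) (iinv C X f)))) (pmap (idn X \<cdot> ?E) f)"
    by (simp add: icomp_assoc[OF q r ev'] 1)
  also have "\<dots> = icomp C X g (icomp C X (evl A B) (icomp C X (pmap (idn X \<cdot> ?E) (iinv C X f)) (pmap (idn X \<cdot> ?E) f)))"
    by (simp add: icomp_assoc[OF q icomp_ihom[OF ev p] g] icomp_assoc[OF q p ev])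
  also have "icomp C X (pmap (idn X \<cdot> ?E) (iinv C X f)) (pmap (idn X \<cdot> ?E) f) = idn X \<cdot> prd ?E A"
    using pmap_icomp[OF idn_ihom[OF E] f dE idn_ihom[OF E] inv]
    by (simp add: icomp_idr[OF idn_ihom[OF E]] iinv_left[OF f iso] pmap_idn[OF E A(1)])
  finally show "icomp C X (evl A' B') (pmap (emap f g) f) = icomp C X g (evl A B)"
    by (simp add: icomp_idr[OF ev])
qed

lemma emap_eqI:
  assumes f: "f \<in> ihom C X A A'" and iso: "iiso C X f" and g: "g \<in> ihom C X B B'"
    and d: "Dom C A = Dom C B"
    and k: "k \<in> ihom C X (expo A B) (expo A' B')"
    and eq: "icomp C X (evl A' B') (pmap k f) = icomp C X g (evl A B)"
  shows "emap f g = k"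
proof (rule exp_eqI_iso[OF f iso _ _ emap_ihom[OF f iso g d] k])
  show "expo A B \<in> hom C (Dom C A) (iob X)" "B' \<in> hom C (Dom C A) (iob X)"
    using ihom_src_hom[OF f] ihom_src_hom[OF g] ihom_tgt_hom[OF g] d by (auto intro: expo_hom)
  show "icomp C X (evl A' B') (pmap (emap f g) f) = icomp C X (evl A' B') (pmap k f)"
    using evl_emap[OF f iso g d] eq by simp
qed

lemma emap_idn:
  assumes A: "A \<in> hom C J (iob X)" and B: "B \<in> hom C J (iob X)" and iso: "iiso C X (idn X \<cdot> A)"
  shows "emap (idn X \<cdot> A) (idn X \<cdot> B) = idn X \<cdot> expo A B"
proof (rule emap_eqI[OF idn_ihom[OF A] iso idn_ihom[OF B]])
  note E = expo_hom[OF A B]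
  show "Dom C A = Dom C B" using A B by (simp add: homD)
  show "idn X \<cdot> expo A B \<in> ihom C X (expo A B) (expo A B)"
    by (rule idn_ihom[OF E])
  show "icomp C X (evl A B) (pmap (idn X \<cdot> expo A B) (idn X \<cdot> A)) = icomp C X (idn X \<cdot> B) (evl A B)"
    by (simp add: pmap_idn[OF E A] icomp_idl[OF evl_ihom[OF A B]] icomp_idr[OF evl_ihom[OF A B]])
qed

text \<open>The action is covariant in both arguments, since the contravariant one is inverted. The
  isomorphism hypotheses are listed separately because \<open>emap\<close> is controlled only for
  invertible first arguments; the closure properties of \<open>M\<close> will supply them.\<close>

lemma emap_icomp:
  assumes f: "f \<in> ihom C X A A'" and g: "g \<in> ihom C X B B'" and d: "Dom C A = Dom C B"
    and f': "f' \<in> ihom C X A' A''" and g': "g' \<in> ihom C X B' B''"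
    and iso: "iiso C X f" "iiso C X f'" "iiso C X (icomp C X f' f)"
  shows "emap (icomp C X f' f) (icomp C X g' g) = icomp C X (emap f' g') (emap f g)"
proof (rule emap_eqI[OF icomp_ihom[OF f' f] iso(3) icomp_ihom[OF g' g] d])
  have d': "Dom C A' = Dom C B'"
    using d by (simp add: ihom_Dom_eq[OF f] ihom_Dom_eq[OF g])
  have A: "A \<in> hom C (Dom C A) (iob X)" "B \<in> hom C (Dom C A) (iob X)"
      "A' \<in> hom C (Dom C A) (iob X)" "B' \<in> hom C (Dom C A) (iob X)"
      "A'' \<in> hom C (Dom C A) (iob X)" "B'' \<in> hom C (Dom C A) (iob X)"
    using ihom_src_hom[OF f] ihom_src_hom[OF g] ihom_tgt_hom[OF f] ihom_tgt_hom[OF g]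
      ihom_tgt_hom[OF f'] ihom_tgt_hom[OF g'] d ihom_Dom_eq[OF f] ihom_Dom_eq[OF g] by auto
  note e = emap_ihom[OF f iso(1) g d] and e' = emap_ihom[OF f' iso(2) g' d']
  have dE: "Dom C (expo A B) = Dom C A" "Dom C (expo A' B') = Dom C A'"
    using expo_Dom[OF A(1,2)] expo_Dom[OF A(3,4)] ihom_Dom_eq[OF f] by simp_all
  show "icomp C X (emap f' g') (emap f g) \<in> ihom C X (expo A B) (expo A'' B'')"
    by (rule icomp_ihom[OF e' e])
  note p = pmap_ihom[OF e f dE(1)] and p' = pmap_ihom[OF e' f' dE(2)]
  note ev = evl_ihom[OF A(1,2)] evl_ihom[OF A(3,4)] evl_ihom[OF A(5,6)]
  show "icomp C X (evl A'' B'') (pmap (icomp C X (emap f' g') (emap f g)) (icomp C X f' f)) =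
      icomp C X (icomp C X g' g) (evl A B)"
    by (simp add: pmap_icomp[OF e f dE(1) e' f'] icomp_assoc[OF p p' ev(3)] evl_emap[OF f' iso(2) g' d']
        icomp_assoc[OF p ev(2) g', symmetric] evl_emap[OF f iso(1) g d] icomp_assoc[OF ev(1) g g'])
qed

lemma emap_comp:
  assumes f: "f \<in> ihom C X A A'" and g: "g \<in> ihom C X B B'" and d: "Dom C A = Dom C B"
    and u: "u \<in> hom C J (Dom C A)"
    and iso: "iiso C X f" "iiso C X (f \<cdot> u)"
  shows "emap f g \<cdot> u = emap (f \<cdot> u) (g \<cdot> u)"
proof -
  have A: "A \<in> hom C (Dom C A) (iob X)" "B \<in> hom C (Dom C A) (iob X)"
      "A' \<in> hom C (Dom C A) (iob X)" "B' \<in> hom C (Dom C A) (iob X)"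
    using ihom_src_hom[OF f] ihom_src_hom[OF g] ihom_tgt_hom[OF f] ihom_tgt_hom[OF g] d by auto
  note E = expo_hom[OF A(1,2)] and E' = expo_hom[OF A(3,4)]
  have dE: "Dom C (expo A B) = Dom C A"
    by (rule homD[OF E])
  have u': "u \<in> hom C J (Dom C B)" "u \<in> hom C J (Dom C (expo A B))" "u \<in> hom C J (Dom C (prd (expo A B) A))"
    using u d by (simp_all add: dE prd_Dom[OF E A(1)])
  have d': "Dom C (A \<cdot> u) = Dom C (B \<cdot> u)"
    using homD[OF comp_hom[OF A(1) u]] homD[OF comp_hom[OF A(2) u]] by simp
  note e = emap_ihom[OF f iso(1) g d]
  note c = at2_comp[OF iexp_hom _ _ u] at2_comp[OF ievl_hom _ _ u] at2_comp[OF iprd_hom _ _ u]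
  note ev = evl_ihom[OF A(1,2)] evl_ihom[OF A(3,4)]
  note p = pmap_ihom[OF e f dE]
  show ?thesis
  proof (rule emap_eqI[symmetric, OF ihom_comp[OF f u] iso(2) ihom_comp[OF g u'(1)] d'])
    show "emap f g \<cdot> u \<in> ihom C X (expo (A \<cdot> u) (B \<cdot> u)) (expo (A' \<cdot> u) (B' \<cdot> u))"
      using ihom_comp[OF e u'(2)] by (simp add: c A)
    have "icomp C X (evl A' B' \<cdot> u) (pmap (emap f g) f \<cdot> u) = icomp C X (g \<cdot> u) (evl A B \<cdot> u)"
      using evl_emap[OF f iso(1) g d] icomp_comp[OF p ev(2) u'(3)] icomp_comp[OF ev(1) g u'(3)] by simp
    then show "icomp C X (evl (A' \<cdot> u) (B' \<cdot> u)) (pmap (emap f g \<cdot> u) (f \<cdot> u)) =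
        icomp C X (g \<cdot> u) (evl (A \<cdot> u) (B \<cdot> u))"
      using pmap_comp[OF e f dE u'(2)] by (simp add: c A)
  qed
qed

end

subsection \<open>Powers and discrete internal categories\<close>

context icategory
begin

lemma src_tuple:
  assumes J: "J \<in> Ob C" and A: "\<And>i. i < n \<Longrightarrow> A i \<in> hom C J (iob X)"
    and f: "\<And>i. i < n \<Longrightarrow> fs i \<in> ihom C X (A i) (B i)"
  shows "pow_map C n (src X) \<cdot> tuple C n (imor X) J fs = tuple C n (iob X) J A"
  by (subst pow_map_tuple[OF src_hom J ihom_at[OF f A]]) (auto intro!: tuple_cong simp: ihom_src[OF f])

lemma tgt_tuple:
  assumes J: "J \<in> Ob C" and A: "\<And>i. i < n \<Longrightarrow> A i \<in> hom C J (iob X)"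
    and f: "\<And>i. i < n \<Longrightarrow> fs i \<in> ihom C X (A i) (B i)"
  shows "pow_map C n (tgt X) \<cdot> tuple C n (imor X) J fs = tuple C n (iob X) J B"
  by (subst pow_map_tuple[OF tgt_hom J ihom_at[OF f A]]) (auto intro!: tuple_cong simp: ihom_tgt[OF f])

lemma idn_tuple:
  assumes J: "J \<in> Ob C" and A: "\<And>i. i < n \<Longrightarrow> A i \<in> hom C J (iob X)"
  shows "pow_map C n (idn X) \<cdot> tuple C n (iob X) J A = tuple C n (imor X) J (\<lambda>i. idn X \<cdot> A i)"
  by (rule pow_map_tuple[OF idn_hom J A])

lemma ihom_tgt_at: "f \<in> ihom C X A B \<Longrightarrow> A \<in> hom C J (iob X) \<Longrightarrow> B \<in> hom C J (iob X)"
  using ihom_tgt_hom homD(2) by metis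

text \<open>Composition in the power is defined as the tuple of composites over the generic
  composable pair, so precomposing with the pairing of the two tuples makes it
  componentwise.\<close>

lemma icomp_ipow:
  assumes J: "J \<in> Ob C" and A: "\<And>i. i < n \<Longrightarrow> A i \<in> hom C J (iob X)"
    and f: "\<And>i. i < n \<Longrightarrow> fs i \<in> ihom C X (A i) (B i)"
    and g: "\<And>i. i < n \<Longrightarrow> gs i \<in> ihom C X (B i) (D i)"
  shows "icomp C (ipow C n X) (tuple C n (imor X) J gs) (tuple C n (imor X) J fs) =
    tuple C n (imor X) J (\<lambda>i. icomp C X (gs i) (fs i))"
proof -
  have B: "B i \<in> hom C J (iob X)" if "i < n" for i
    using ihom_tgt_at[OF f A] that by blast
  let ?s = "pow_map C n (src X)" and ?t = "pow_map C n (tgt X)"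
  let ?F = "tuple C n (imor X) J fs" and ?G = "tuple C n (imor X) J gs"
  let ?p = "pow_pr C n (imor X)"
  let ?Q = "pb_ob C ?s ?t"
  note s = pow_map_hom[OF src_hom, of n] and t = pow_map_hom[OF tgt_hom, of n]
  have F: "?F \<in> hom C J (pow_ob C n (imor X))" and G: "?G \<in> hom C J (pow_ob C n (imor X))"
    using J ihom_at[OF f A] ihom_at[OF g B] by (auto intro!: tuple_hom)
  have e: "?s \<cdot> ?G = ?t \<cdot> ?F"
    using src_tuple[OF J B g] tgt_tuple[OF J A f] by simp
  let ?k = "pb_pair C ?s ?t ?G ?F"
  note k = pb_pair_hom[OF s t G F e]
  note q1 = pb_fst_hom[OF s t] and q2 = pb_snd_hom[OF s t]
  note Q = hom_Ob(1)[OF q1]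
  \<comment> \<open>The generic pair is composable in each component because sources and targets in
    a power are computed componentwise.\<close>
  have ih: "?p i \<cdot> pb_fst C ?s ?t \<in> ihom C X (src X \<cdot> (?p i \<cdot> pb_fst C ?s ?t)) (tgt X \<cdot> (?p i \<cdot> pb_fst C ?s ?t))"
    "?p i \<cdot> pb_snd C ?s ?t \<in> ihom C X (src X \<cdot> (?p i \<cdot> pb_snd C ?s ?t)) (src X \<cdot> (?p i \<cdot> pb_fst C ?s ?t))"
    if "i < n" for i
  proof -
    note h = comp_hom[OF pow_pr_hom[OF imor_Ob that] q1] comp_hom[OF pow_pr_hom[OF imor_Ob that] q2]
    have "src X \<cdot> (?p i \<cdot> pb_fst C ?s ?t) = tgt X \<cdot> (?p i \<cdot> pb_snd C ?s ?t)"
      using pr_pow_map_comp[OF src_hom q1 that] pr_pow_map_comp[OF tgt_hom q2 that] pb_square[OF s t]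
      by simp
    then show "?p i \<cdot> pb_fst C ?s ?t \<in> ihom C X (src X \<cdot> (?p i \<cdot> pb_fst C ?s ?t)) (tgt X \<cdot> (?p i \<cdot> pb_fst C ?s ?t))"
      "?p i \<cdot> pb_snd C ?s ?t \<in> ihom C X (src X \<cdot> (?p i \<cdot> pb_snd C ?s ?t)) (src X \<cdot> (?p i \<cdot> pb_fst C ?s ?t))"
      by (auto intro: ihomI[OF h(1)] ihomI[OF h(2)])
  qed
  have d: "Dom C (src X \<cdot> (?p i \<cdot> pb_snd C ?s ?t)) = ?Q" if "i < n" for i
    by (rule homD[OF comp_hom[OF src_hom comp_hom[OF pow_pr_hom[OF imor_Ob that] q2]]])
  have "icomp C (ipow C n X) ?G ?F =
      tuple C n (imor X) ?Q (\<lambda>i. icomp C X (?p i \<cdot> pb_fst C ?s ?t) (?p i \<cdot> pb_snd C ?s ?t)) \<cdot> ?k"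
    unfolding icomp_def[of C "ipow C n X"] by (simp add: ipow_def Let_def)
  also have "\<dots> = tuple C n (imor X) J (\<lambda>i. icomp C X (?p i \<cdot> pb_fst C ?s ?t) (?p i \<cdot> pb_snd C ?s ?t) \<cdot> ?k)"
  proof (rule tuple_comp[OF imor_Ob _ k])
    fix i assume i: "i < n"
    show "icomp C X (?p i \<cdot> pb_fst C ?s ?t) (?p i \<cdot> pb_snd C ?s ?t) \<in> hom C ?Q (imor X)"
      using ihom_hom[OF icomp_ihom[OF ih[OF i]]] d[OF i] by simp
  qed
  also have "\<dots> = tuple C n (imor X) J (\<lambda>i. icomp C X (gs i) (fs i))"
  proof (rule tuple_cong)
    fix i assume i: "i < n"
    note p = pow_pr_hom[OF imor_Ob i]
    have k': "?k \<in> hom C J (Dom C (src X \<cdot> (?p i \<cdot> pb_snd C ?s ?t)))"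
      using k d[OF i] by simp
    have "?p i \<cdot> pb_fst C ?s ?t \<cdot> ?k = gs i" "?p i \<cdot> pb_snd C ?s ?t \<cdot> ?k = fs i"
      using i J ihom_at[OF f A] ihom_at[OF g B]
      by (simp_all add: comp_assoc[OF k q1 p, symmetric] comp_assoc[OF k q2 p, symmetric]
          pb_fst_pair[OF s t G F e] pb_snd_pair[OF s t G F e] pr_tuple)
    then show "icomp C X (?p i \<cdot> pb_fst C ?s ?t) (?p i \<cdot> pb_snd C ?s ?t) \<cdot> ?k = icomp C X (gs i) (fs i)"
      by (simp add: icomp_comp[OF ih(2)[OF i] ih(1)[OF i] k'])
  qed
  finally show ?thesis .
qed

text \<open>Inverses are formed componentwise. This is what turns a family of good isomorphisms into
  an admissible argument of \<upsilon>.\<close>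

lemma iiso_ipow:
  assumes J: "J \<in> Ob C" and A: "\<And>i. i < n \<Longrightarrow> A i \<in> hom C J (iob X)"
    and f: "\<And>i. i < n \<Longrightarrow> fs i \<in> ihom C X (A i) (B i)"
    and iso: "\<And>i. i < n \<Longrightarrow> iiso C X (fs i)"
  shows "iiso C (ipow C n X) (tuple C n (imor X) J fs)"
proof -
  have B: "B i \<in> hom C J (iob X)" if "i < n" for i
    using ihom_tgt_at[OF f A] that by blast
  let ?F = "tuple C n (imor X) J fs" and ?G = "tuple C n (imor X) J (\<lambda>i. iinv C X (fs i))"
  note inv = iinv_ihom[OF f iso]
  have F: "?F \<in> hom C J (pow_ob C n (imor X))" and G: "?G \<in> hom C J (pow_ob C n (imor X))"
    using J ihom_at[OF f A] ihom_at[OF inv B] by (auto intro!: tuple_hom)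
  have tB: "Dom C (tuple C n (iob X) J B) = J"
    using J B by (intro homD(2)[OF tuple_hom]) auto
  have "inverse_pair C (ipow C n X) ?F ?G"
    using F G J src_tuple[OF J A f] tgt_tuple[OF J A f] src_tuple[OF J B inv] tgt_tuple[OF J B inv]
      icomp_ipow[OF J A f inv] icomp_ipow[OF J B inv f] idn_tuple[OF J A] idn_tuple[OF J B] tB
    unfolding inverse_pair_def
    by (auto simp: homD ihom_def iinv_left[OF f iso] iinv_right[OF f iso] ipow_def Let_def cong: tuple_cong)
  then show ?thesis
    by (auto simp: iiso_def)
qed

end

text \<open>The argument is a bare object because \<open>idisc\<close> retains nothing else of a
  category. In this form powers of discrete categories are discrete on the nose
  (\<open>ipow_disc_cat\<close>).\<close>

definition disc_cat :: "('o, 'a) cat \<Rightarrow> 'o \<Rightarrow> ('o, 'a) icat" where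
  "disc_cat C A = \<lparr>iob = A, imor = A, src = Ident C A, tgt = Ident C A, idn = Ident C A,
     cmp = pb_fst C (Ident C A) (Ident C A)\<rparr>"

text \<open>Normal form of a functor out of a discrete category: its morphism part is forced to
  consist of identities.\<close>

definition disc_fun :: "('o, 'a) cat \<Rightarrow> 'o \<Rightarrow> ('o, 'a) icat \<Rightarrow> 'a \<Rightarrow> ('o, 'a) ifun" where
  "disc_fun C A Y a = \<lparr>idom = disc_cat C A, icod = Y, fo = a, fm = Comp C (idn Y) a\<rparr>"

lemma disc_cat_simps [simp]:
  "iob (disc_cat C A) = A" "imor (disc_cat C A) = A" "src (disc_cat C A) = Ident C A"
  "tgt (disc_cat C A) = Ident C A" "idn (disc_cat C A) = Ident C A"
  "cmp (disc_cat C A) = pb_fst C (Ident C A) (Ident C A)"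
  by (simp_all add: disc_cat_def)

lemma disc_fun_simps [simp]:
  "idom (disc_fun C A Y a) = disc_cat C A" "icod (disc_fun C A Y a) = Y" "fo (disc_fun C A Y a) = a"
  "fm (disc_fun C A Y a) = Comp C (idn Y) a"
  by (simp_all add: disc_fun_def)

lemma idisc_eq_disc_cat: "idisc C X = disc_cat C (iob X)"
  by (simp add: idisc_def disc_cat_def Let_def)

section \<open>Functors and transformations out of discrete internal categories\<close>

context fincat
begin

lemma icomp_disc_cat:
  assumes "A \<in> Ob C" "f \<in> hom C J A"
  shows "icomp C (disc_cat C A) f f = f"
  using pb_fst_pair[OF ident_hom[OF assms(1)] ident_hom[OF assms(1)] assms(2,2)]
  by (simp add: icomp_def)

lemma pb_fst_eq_snd:
  assumes "A \<in> Ob C"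
  shows "pb_fst C (Ident C A) (Ident C A) = pb_snd C (Ident C A) (Ident C A)"
proof -
  note i = ident_hom[OF assms]
  show ?thesis
    using pb_square[OF i i] homD[OF pb_fst_hom[OF i i]] homD[OF pb_snd_hom[OF i i]] by simp
qed

lemma internal_disc_cat:
  assumes A: "A \<in> Ob C"
  shows "internal_category C (disc_cat C A)"
  unfolding internal_category_def disc_cat_simps
proof (intro conjI allI ballI impI)
  note i = ident_hom[OF A]
  show "pb_fst C (Ident C A) (Ident C A) \<in> hom C (pb_ob C (Ident C A) (Ident C A)) A"
    by (rule pb_fst_hom[OF i i])
  show "Ident C A \<cdot> pb_fst C (Ident C A) (Ident C A) = Ident C A \<cdot> pb_snd C (Ident C A) (Ident C A)"
    by (simp add: pb_fst_eq_snd[OF A])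
  fix J f
  assume f: "f \<in> hom C J A"
  then have 1: "Ident C A \<cdot> f = f" by (simp add: homD)
  show "icomp C (disc_cat C A) f (Ident C A \<cdot> (Ident C A \<cdot> f)) = f"
    "icomp C (disc_cat C A) (Ident C A \<cdot> (Ident C A \<cdot> f)) f = f"
    using icomp_disc_cat[OF A f] by (simp_all add: 1)
  fix g h
  assume "g \<in> hom C J A" "h \<in> hom C J A" "Ident C A \<cdot> g = Ident C A \<cdot> f \<and> Ident C A \<cdot> h = Ident C A \<cdot> g"
  then have "g = f" "h = f" using f by (auto simp: homD)
  then show "icomp C (disc_cat C A) (icomp C (disc_cat C A) h g) f =
      icomp C (disc_cat C A) h (icomp C (disc_cat C A) g f)"
    by (simp add: icomp_disc_cat[OF A f])
qed (use A in auto)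

text \<open>An equality of records, not an isomorphism: \<open>pow_map\<close> of an identity is an
  identity, so both sides use the same chosen pullback, and componentwise composition of a pair with
  equal entries returns that entry.\<close>

lemma ipow_disc_cat:
  assumes A: "A \<in> Ob C"
  shows "ipow C n (disc_cat C A) = disc_cat C (pow_ob C n A)"
proof -
  let ?P = "pow_ob C n A"
  have P: "?P \<in> Ob C" using A by simp
  note i = ident_hom[OF P]
  let ?q = "pb_fst C (Ident C ?P) (Ident C ?P)"
  note q = pb_fst_hom[OF i i]
  have "tuple C n A (pb_ob C (Ident C ?P) (Ident C ?P))
      (\<lambda>j. icomp C (disc_cat C A) (pow_pr C n A j \<cdot> ?q)
         (pow_pr C n A j \<cdot> pb_snd C (Ident C ?P) (Ident C ?P))) = ?q"
    unfolding pb_fst_eq_snd[OF P, symmetric]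
    using comp_hom[OF pow_pr_hom[OF A] q]
    by (subst tuple_cong[where q' = "\<lambda>j. pow_pr C n A j \<cdot> ?q"])
      (auto intro: icomp_disc_cat[OF A] tuple_pr[OF A q])
  then show ?thesis
    by (simp add: ipow_def pow_map_ident[OF A] Let_def disc_cat_def)
qed

lemma internal_disc_fun:
  assumes Y: "internal_category C Y" and a: "a \<in> hom C A (iob Y)"
  shows "internal_functor C (disc_fun C A Y a)"
proof -
  interpret Y: icategory C Y using Y by unfold_locales
  have A: "A \<in> Ob C" using a by (rule hom_Ob)
  note i = ident_hom[OF A]
  note q = pb_fst_hom[OF i i]
  have "Dom C (a \<cdot> pb_fst C (Ident C A) (Ident C A)) = pb_ob C (Ident C A) (Ident C A)"
    using comp_hom[OF a q] by (rule homD)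
  then have "idn Y \<cdot> a \<cdot> pb_fst C (Ident C A) (Ident C A) =
    icomp C Y (idn Y \<cdot> a \<cdot> pb_fst C (Ident C A) (Ident C A)) (idn Y \<cdot> a \<cdot> pb_fst C (Ident C A) (Ident C A))"
    using Y.icomp_idr[OF Y.idn_ihom[OF comp_hom[OF a q]]] by (simp add: comp_assoc[OF q a Y.idn_hom])
  then show ?thesis
    unfolding internal_functor_def Let_def disc_fun_simps disc_cat_simps
    using a A internal_disc_cat[OF A] Y comp_hom[OF Y.idn_hom a] pb_fst_eq_snd[OF A]
      Y.ihom_src[OF Y.idn_ihom[OF a]] Y.ihom_tgt[OF Y.idn_ihom[OF a]]
    by (simp add: homD)
qed

text \<open>In \<open>disc_cat C A\<close> the arrow \<open>idn\<close> is the identity of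
  \<open>A\<close>, so preservation of identities already determines \<open>fm\<close> from
  \<open>fo\<close>.\<close>

lemma internal_functor_disc_cat_iff:
  assumes Y: "internal_category C Y" and A: "A \<in> Ob C"
  shows "F \<in> hom (CAT C) (disc_cat C A) Y \<longleftrightarrow> F = disc_fun C A Y (fo F) \<and> fo F \<in> hom C A (iob Y)"
proof
  assume "F \<in> hom (CAT C) (disc_cat C A) Y"
  then have F: "internal_functor C F" "idom F = disc_cat C A" "icod F = Y"
    by (auto simp: hom_def CAT_def)
  interpret F: ifunctor C F using F by unfold_locales
  show "F = disc_fun C A Y (fo F) \<and> fo F \<in> hom C A (iob Y)"
    using F.fm_idn_eq F.fo_hom F.fm_hom F by (auto simp: disc_fun_def homD A)
next
  assume "F = disc_fun C A Y (fo F) \<and> fo F \<in> hom C A (iob Y)"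
  then obtain a where "F = disc_fun C A Y a" "a \<in> hom C A (iob Y)"
    by blast
  then show "F \<in> hom (CAT C) (disc_cat C A) Y"
    using internal_disc_fun[OF Y, of a A] by (simp add: hom_def CAT_def)
qed

text \<open>Naturality is tested only against identities and therefore follows from the unit
  laws.\<close>

lemma internal_nat_disc_fun_iff:
  assumes Y: "internal_category C Y" and a: "a \<in> hom C A (iob Y)" and b: "b \<in> hom C A (iob Y)"
  shows "internal_nat C (disc_fun C A Y a) (disc_fun C A Y b) t \<longleftrightarrow> t \<in> ihom C Y a b"
proof -
  interpret Y: icategory C Y using Y by unfold_locales
  have "icomp C Y (t \<cdot> Ident C A) (idn Y \<cdot> a) = icomp C Y (idn Y \<cdot> b) (t \<cdot> Ident C A)"
    if t: "t \<in> ihom C Y a b"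
    using Y.icomp_idl[OF t] Y.icomp_idr[OF t] homD[OF Y.ihom_at[OF t a]] by simp
  then show ?thesis
    using internal_disc_fun[OF Y a] internal_disc_fun[OF Y b]
    by (auto simp: internal_nat_def Let_def)
qed

end

section \<open>Cubes\<close>

lemma box_face [simp]: "Dom box (face s l k) = Suc l" "Cod box (face s l k) = l"
  by (simp_all add: box_def face_def)

lemma box_degen [simp]: "Dom box (degen l k) = l" "Cod box (degen l k) = Suc l"
  by (simp_all add: box_def degen_def)

lemma box_ident [simp]: "Dom box (Ident box l) = l" "Cod box (Ident box l) = l"
  by (simp_all add: box_def)

lemma box_comp [simp]: "Dom box (g \<cdot>\<^bsub>box\<^esub> f) = Dom box f" "Cod box (g \<cdot>\<^bsub>box\<^esub> f) = Cod box g"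
  by (simp_all add: box_def split: prod.splits)

lemma face_degen: "k \<le> l \<Longrightarrow> face s l k \<cdot>\<^bsub>box\<^esub> degen l k = Ident box l"
  by (auto simp: box_def face_def degen_def nth_append simp del: upt_Suc)

lemma box_ars_levels: "h \<in> box_ars p \<Longrightarrow> Dom box h \<in> levels p \<and> Cod box h \<in> levels p"
  by (induction rule: box_ars.induct)
    (auto simp: faces_def degens_def levels_def Suc_ile_eq order_less_imp_le)

lemma retraction:
  assumes "h \<in> degens p"
  shows "retraction p h \<in> faces p" "Dom box (retraction p h) = Cod box h"
    "Cod box (retraction p h) = Dom box h" "retraction p h \<cdot>\<^bsub>box\<^esub> h = Ident box (Dom box h)"
proof -
  obtain l k where "h = degen l k" "enat l < p" "k \<le> l"
    using assms by (auto simp: degens_def)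
  \<comment> \<open>The face in the direction that the degeneracy skips is a retraction;
    \<open>Top\<close> is one of the two ends, chosen arbitrarily.\<close>
  then have "\<exists>r. r \<in> faces p \<and> Dom box r = Cod box h \<and> Cod box r = Dom box h \<and>
      r \<cdot>\<^bsub>box\<^esub> h = Ident box (Dom box h)"
    by (intro exI[of _ "face Top l k"]) (auto simp: faces_def face_degen)
  then show "retraction p h \<in> faces p" "Dom box (retraction p h) = Cod box h"
    "Cod box (retraction p h) = Dom box h" "retraction p h \<cdot>\<^bsub>box\<^esub> h = Ident box (Dom box h)"
    unfolding retraction_def by (metis (mono_tags, lifting) someI_ex)+
qed

section \<open>The categories of relational types\<close>

locale cubical_model = fincat C for C :: "('o, 'a) cat" (structure) +
  fixes p :: enat and R :: "('o, 'a) cubcat" and M :: "nat \<Rightarrow> 'a set"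
  assumes cubical: "cubical_category C p R" and good: "good_isos C p R M"
begin

section \<open>Face maps and degeneracies acting on powers of the objects of objects\<close>

abbreviation "X0 l \<equiv> iob (FO R l)"
abbreviation "X1 l \<equiv> imor (FO R l)"
abbreviation "Pw n l \<equiv> pow_ob C n (iob (FO R l))"
abbreviation "Rh h \<equiv> fo (FA R h)"
abbreviation "Rn n h \<equiv> pow_map C n (fo (FA R h))"

lemma internal_at: "l \<in> levels p \<Longrightarrow> internal_category C (FO R l)"
  using cubical by (simp add: cubical_category_def is_functor_def box_upto_def CAT_def)

lemma icategory_at: "l \<in> levels p \<Longrightarrow> icategory C (FO R l)"
  using internal_at by unfold_locales

lemma X0_Ob [simp]: "l \<in> levels p \<Longrightarrow> X0 l \<in> Ob C"
  and X1_Ob [simp]: "l \<in> levels p \<Longrightarrow> X1 l \<in> Ob C"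
  using icategory.iob_Ob[OF icategory_at] icategory.imor_Ob[OF icategory_at] by auto

lemma functor_at:
  assumes "h \<in> box_ars p"
  shows "internal_functor C (FA R h)" "idom (FA R h) = FO R (Dom box h)" "icod (FA R h) = FO R (Cod box h)"
  using cubical assms
  by (auto simp: cubical_category_def is_functor_def box_upto_def CAT_def hom_def)

lemma ifunctor_at: "h \<in> box_ars p \<Longrightarrow> ifunctor C (FA R h)"
  using functor_at(1) by unfold_locales

lemma faces_box: "h \<in> faces p \<Longrightarrow> h \<in> box_ars p"
  and degens_box: "h \<in> degens p \<Longrightarrow> h \<in> box_ars p"
  by (auto intro: box_ars.intros)

lemma box_levels:
  "h \<in> box_ars p \<Longrightarrow> Dom box h \<in> levels p"
  "h \<in> box_ars p \<Longrightarrow> Cod box h \<in> levels p"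
  "h \<in> faces p \<Longrightarrow> Dom box h \<in> levels p"
  "h \<in> faces p \<Longrightarrow> Cod box h \<in> levels p"
  "h \<in> degens p \<Longrightarrow> Dom box h \<in> levels p"
  "h \<in> degens p \<Longrightarrow> Cod box h \<in> levels p"
  using box_ars_levels faces_box degens_box by blast+

lemma Rh_hom: "h \<in> box_ars p \<Longrightarrow> Rh h \<in> hom C (X0 (Dom box h)) (X0 (Cod box h))"
  using ifunctor.fo_hom[OF ifunctor_at] functor_at by metis

lemma Rn_hom: "h \<in> box_ars p \<Longrightarrow> Rn n h \<in> hom C (Pw n (Dom box h)) (Pw n (Cod box h))"
  by (rule pow_map_hom[OF Rh_hom])

lemma R_ihom: "h \<in> box_ars p \<Longrightarrow> f \<in> ihom C (FO R (Dom box h)) A B \<Longrightarrow>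
    fm (FA R h) \<cdot> f \<in> ihom C (FO R (Cod box h)) (Rh h \<cdot> A) (Rh h \<cdot> B)"
  using ifunctor.fm_ihom[OF ifunctor_at] functor_at by metis

lemma R_icomp: "h \<in> box_ars p \<Longrightarrow> f \<in> ihom C (FO R (Dom box h)) A B \<Longrightarrow> g \<in> ihom C (FO R (Dom box h)) B D \<Longrightarrow>
    fm (FA R h) \<cdot> icomp C (FO R (Dom box h)) g f =
    icomp C (FO R (Cod box h)) (fm (FA R h) \<cdot> g) (fm (FA R h) \<cdot> f)"
  using ifunctor.fm_icomp[OF ifunctor_at] functor_at by metis

lemma R_idn: "h \<in> box_ars p \<Longrightarrow> A \<in> hom C J (X0 (Dom box h)) \<Longrightarrow>
    fm (FA R h) \<cdot> (idn (FO R (Dom box h)) \<cdot> A) = idn (FO R (Cod box h)) \<cdot> (Rh h \<cdot> A)"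
  using ifunctor.fm_idn[OF ifunctor_at] functor_at by metis

lemma R_fm_hom: "h \<in> box_ars p \<Longrightarrow> fm (FA R h) \<in> hom C (X1 (Dom box h)) (X1 (Cod box h))"
  using ifunctor.fm_hom[OF ifunctor_at] functor_at by metis

lemma retraction_box:
  assumes "h \<in> degens p"
  shows "retraction p h \<in> box_ars p"
  using retraction[OF assms] by (auto intro: box_ars.intros)

text \<open>Functoriality of \<open>R\<close> turns the retraction of cubes into a retraction in
  \<open>C\<close>, and powers preserve it. Each degeneracy thus becomes a split monomorphism
  between powers, which is what allows actions to be extended along it.\<close>

lemma Rn_retraction:
  assumes h: "h \<in> degens p"
  shows "Rn n (retraction p h) \<in> hom C (Pw n (Cod box h)) (Pw n (Dom box h))"
    and "Rn n (retraction p h) \<cdot> Rn n h = Ident C (Pw n (Dom box h))"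
proof -
  let ?r = "retraction p h"
  note b = degens_box[OF h] and r = retraction_box[OF h]
  note l = box_levels(5)[OF h]
  show 1: "Rn n ?r \<in> hom C (Pw n (Cod box h)) (Pw n (Dom box h))"
    using Rn_hom[OF r, of n] retraction[OF h] by simp
  have "\<forall>f\<in>box_ars p. \<forall>g\<in>box_ars p. Dom box g = Cod box f \<longrightarrow>
      FA R (g \<cdot>\<^bsub>box\<^esub> f) = FA R g \<cdot>\<^bsub>CAT C\<^esub> FA R f"
    using cubical by (simp add: cubical_category_def is_functor_def box_upto_def)
  then have "FA R (?r \<cdot>\<^bsub>box\<^esub> h) = FA R ?r \<cdot>\<^bsub>CAT C\<^esub> FA R h"
    using b r retraction(2)[OF h] by blast
  moreover have "FA R (Ident box (Dom box h)) = Ident (CAT C) (FO R (Dom box h))"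
    using cubical l by (auto simp: cubical_category_def is_functor_def box_upto_def)
  ultimately have "Rh ?r \<cdot> Rh h = Ident C (X0 (Dom box h))"
    using retraction[OF h] by (auto simp: CAT_def)
  then show "Rn n ?r \<cdot> Rn n h = Ident C (Pw n (Dom box h))"
    using pow_map_comp[OF Rh_hom[OF b], of "Rh ?r" "X0 (Dom box h)" n] Rh_hom[OF r] retraction[OF h] l
    by (simp add: pow_map_ident)
qed

lemma FO_dpow: "l \<in> levels p \<Longrightarrow> FO (dpow C R n) l = disc_cat C (Pw n l)"
  by (simp add: cpow_def disc_def idisc_eq_disc_cat ipow_disc_cat)

lemma FA_dpow: "h \<in> box_ars p \<Longrightarrow> FA (dpow C R n) h =
    \<lparr>idom = disc_cat C (Pw n (Dom box h)), icod = disc_cat C (Pw n (Cod box h)), fo = Rn n h, fm = Rn n h\<rparr>"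
  by (simp add: cpow_def disc_def fpow_def fdisc_def idisc_eq_disc_cat ipow_disc_cat functor_at box_levels)

lemma R_comp_disc_fun:
  assumes h: "h \<in> box_ars p" and a: "a \<in> hom C A (X0 (Dom box h))"
  shows "FA R h \<cdot>\<^bsub>CAT C\<^esub> disc_fun C A (FO R (Dom box h)) a = disc_fun C A (FO R (Cod box h)) (Rh h \<cdot> a)"
  using R_idn[OF h a] functor_at[OF h] by (simp add: CAT_def disc_fun_def)

lemma disc_fun_comp_dpow:
  assumes h: "h \<in> box_ars p" and Y: "internal_category C Y" and a: "a \<in> hom C (Pw n (Cod box h)) (iob Y)"
  shows "disc_fun C (Pw n (Cod box h)) Y a \<cdot>\<^bsub>CAT C\<^esub> FA (dpow C R n) h =
    disc_fun C (Pw n (Dom box h)) Y (a \<cdot> Rn n h)"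
proof -
  interpret Y: icategory C Y using Y by unfold_locales
  show ?thesis
    using comp_assoc[OF Rn_hom[OF h] a Y.idn_hom] by (simp add: FA_dpow[OF h] CAT_def disc_fun_def)
qed

lemma
  assumes "l \<in> levels p"
  shows M_iso: "f \<in> M l \<Longrightarrow> iiso C (FO R l) f"
    and M_idn: "A \<in> hom C J (X0 l) \<Longrightarrow> idn (FO R l) \<cdot> A \<in> M l"
    and M_icomp: "f \<in> M l \<Longrightarrow> g \<in> M l \<Longrightarrow> f \<in> ihom C (FO R l) A B \<Longrightarrow> g \<in> ihom C (FO R l) B D \<Longrightarrow>
      icomp C (FO R l) g f \<in> M l"
    and M_comp: "f \<in> M l \<Longrightarrow> f \<in> ihom C (FO R l) A B \<Longrightarrow> u \<in> hom C J (Dom C A) \<Longrightarrow> f \<cdot> u \<in> M l"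
proof -
  interpret icategory C "FO R l" by (rule icategory_at[OF assms])
  note g = good[unfolded good_isos_def Let_def, rule_format, OF assms]
  show "f \<in> M l \<Longrightarrow> iiso C (FO R l) f" "A \<in> hom C J (X0 l) \<Longrightarrow> idn (FO R l) \<cdot> A \<in> M l"
    using g by blast+
  { assume "f \<in> M l" "g \<in> M l" and f: "f \<in> ihom C (FO R l) A B" and g': "g \<in> ihom C (FO R l) B D"
    moreover have "Dom C g = Dom C f" "src (FO R l) \<cdot> g = tgt (FO R l) \<cdot> f"
      using homD(2)[OF ihom_hom[OF f]] homD(2)[OF ihom_hom[OF g']] ihom_Dom_eq[OF f]
      by (simp_all add: ihom_src[OF g'] ihom_tgt[OF f])
    ultimately show "icomp C (FO R l) g f \<in> M l"
      using g by blast }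
  show "f \<in> M l \<Longrightarrow> f \<in> ihom C (FO R l) A B \<Longrightarrow> u \<in> hom C J (Dom C A) \<Longrightarrow> f \<cdot> u \<in> M l"
    using g homD(2)[OF ihom_hom] by metis
qed

subsection \<open>Actions on good isomorphisms\<close>

text \<open>A good isomorphism of the \<open>n\<close>-fold power at stage \<open>J\<close>, kept as
  a family of components together with its end points. Entries from \<open>n\<close> on are
  unconstrained.\<close>

definition good_vec :: "nat \<Rightarrow> nat \<Rightarrow> 'o \<Rightarrow> (nat \<Rightarrow> 'a) \<Rightarrow> (nat \<Rightarrow> 'a) \<Rightarrow> (nat \<Rightarrow> 'a) \<Rightarrow> bool" where
  "good_vec l n J fs A B \<longleftrightarrow> J \<in> Ob C \<and>
     (\<forall>i<n. A i \<in> hom C J (X0 l) \<and> fs i \<in> M l \<and> fs i \<in> ihom C (FO R l) (A i) (B i))"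

lemma good_vecD:
  assumes "good_vec l n J fs A B"
  shows "J \<in> Ob C" "i < n \<Longrightarrow> A i \<in> hom C J (X0 l)" "i < n \<Longrightarrow> fs i \<in> M l"
    "i < n \<Longrightarrow> fs i \<in> ihom C (FO R l) (A i) (B i)"
  using assms by (auto simp: good_vec_def)

lemma good_vec_tgt:
  assumes "good_vec l n J fs A B" "l \<in> levels p" "i < n"
  shows "B i \<in> hom C J (X0 l)"
  using icategory.ihom_tgt_at[OF icategory_at[OF assms(2)] good_vecD(4)[OF assms(1,3)] good_vecD(2)[OF assms(1,3)]] .

lemma good_vec_hom:
  assumes "good_vec l n J fs A B" "l \<in> levels p" "i < n"
  shows "fs i \<in> hom C J (X1 l)"
  using icategory.ihom_at[OF icategory_at[OF assms(2)] good_vecD(4)[OF assms(1,3)] good_vecD(2)[OF assms(1,3)]] .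

lemma good_vec_idn:
  "l \<in> levels p \<Longrightarrow> J \<in> Ob C \<Longrightarrow> (\<And>i. i < n \<Longrightarrow> A i \<in> hom C J (X0 l)) \<Longrightarrow>
    good_vec l n J (\<lambda>i. idn (FO R l) \<cdot> A i) A A"
  unfolding good_vec_def using icategory.idn_ihom[OF icategory_at] M_idn by metis

lemma good_vec_icomp:
  assumes "good_vec l n J fs A B" "good_vec l n J gs B D" "l \<in> levels p"
  shows "good_vec l n J (\<lambda>i. icomp C (FO R l) (gs i) (fs i)) A D"
  using assms icategory.icomp_ihom[OF icategory_at[OF assms(3)]] M_icomp[OF assms(3)]
  unfolding good_vec_def by metis

lemma good_vec_comp:
  assumes v: "good_vec l n J fs A B" and u: "u \<in> hom C J' J" and l: "l \<in> levels p"
  shows "good_vec l n J' (\<lambda>i. fs i \<cdot> u) (\<lambda>i. A i \<cdot> u) (\<lambda>i. B i \<cdot> u)"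
  unfolding good_vec_def
proof (intro conjI allI impI)
  show "J' \<in> Ob C" using u by (rule hom_Ob)
  fix i assume i: "i < n"
  note f = good_vecD(2-4)[OF v i]
  have u': "u \<in> hom C J' (Dom C (A i))" using u f by (simp add: homD)
  show "A i \<cdot> u \<in> hom C J' (X0 l)" using f(1) u by (rule comp_hom)
  show "fs i \<cdot> u \<in> M l" by (rule M_comp[OF l f(2,3) u'])
  show "fs i \<cdot> u \<in> ihom C (FO R l) (A i \<cdot> u) (B i \<cdot> u)"
    by (rule icategory.ihom_comp[OF icategory_at[OF l] f(3) u'])
qed

lemma good_vec_tuple:
  assumes "good_vec l n J fs A B" "l \<in> levels p"
  shows "tuple C n (X1 l) J fs \<in> hom C J (pow_ob C n (X1 l))"
    and "tuple C n (X0 l) J A \<in> hom C J (Pw n l)"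
    and "tuple C n (X0 l) J B \<in> hom C J (Pw n l)"
  using good_vecD[OF assms(1)] good_vec_hom[OF assms] good_vec_tgt[OF assms] assms(2)
  by (auto intro!: tuple_hom)

lemma
  assumes v: "good_vec l n J fs A B" and l: "l \<in> levels p"
  shows good_vec_src: "pow_map C n (src (FO R l)) \<cdot> tuple C n (X1 l) J fs = tuple C n (X0 l) J A"
    and good_vec_tgt_eq: "pow_map C n (tgt (FO R l)) \<cdot> tuple C n (X1 l) J fs = tuple C n (X0 l) J B"
  using icategory.src_tuple[OF icategory_at[OF l], of J n A fs B]
    icategory.tgt_tuple[OF icategory_at[OF l], of J n A fs B] good_vecD[OF v] by blast+

lemma good_vec_tuple_comp:
  assumes v: "good_vec l n J fs A B" and l: "l \<in> levels p" and u: "u \<in> hom C J' J"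
  shows "tuple C n (X1 l) J fs \<cdot> u = tuple C n (X1 l) J' (\<lambda>i. fs i \<cdot> u)"
  using good_vec_hom[OF v l] u l by (intro tuple_comp) auto

lemma good_vec_icomp_ipow:
  assumes v: "good_vec l n J fs A B" and w: "good_vec l n J gs B D" and l: "l \<in> levels p"
  shows "icomp C (ipow C n (FO R l)) (tuple C n (X1 l) J gs) (tuple C n (X1 l) J fs) =
    tuple C n (X1 l) J (\<lambda>i. icomp C (FO R l) (gs i) (fs i))"
  using icategory.icomp_ipow[OF icategory_at[OF l], of J n A fs B gs D] good_vecD[OF v] good_vecD[OF w]
  by blast

lemma good_vec_ups_dom:
  assumes v: "good_vec l n (Pw m l) fs A B" and l: "l \<in> levels p"
  shows "tuple C n (X1 l) (Pw m l) fs \<in> ups_dom C R M l m n"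
proof -
  interpret icategory C "FO R l" by (rule icategory_at[OF l])
  show ?thesis
    unfolding ups_dom_def
    using good_vec_tuple(1)[OF v l] good_vecD[OF v] good_vec_hom[OF v l] l
      iiso_ipow[of "Pw m l" n A fs B] M_iso[OF l]
    by (auto simp: pr_tuple)
qed

text \<open>Converse of \<open>good_vec_ups_dom\<close>: together they identify the domain of
  \<upsilon> with the tuples of good families at the stages \<open>Pw m l\<close>.\<close>

lemma ups_dom_good_vec:
  assumes f: "f \<in> ups_dom C R M l m n" and l: "l \<in> levels p"
  defines "fs \<equiv> \<lambda>i. pow_pr C n (X1 l) i \<cdot> f"
  shows "good_vec l n (Pw m l) fs (\<lambda>i. src (FO R l) \<cdot> fs i) (\<lambda>i. tgt (FO R l) \<cdot> fs i)"
    and "tuple C n (X1 l) (Pw m l) fs = f"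
    and "Dom C f = Pw m l"
proof -
  interpret icategory C "FO R l" by (rule icategory_at[OF l])
  have f': "f \<in> hom C (Pw m l) (pow_ob C n (X1 l))" "\<And>i. i < n \<Longrightarrow> fs i \<in> M l"
    using f by (auto simp: ups_dom_def fs_def)
  show "tuple C n (X1 l) (Pw m l) fs = f"
    unfolding fs_def by (rule tuple_pr[OF imor_Ob f'(1)])
  show "Dom C f = Pw m l"
    using f'(1) by (rule homD)
  have "fs i \<in> hom C (Pw m l) (X1 l)" if "i < n" for i
    unfolding fs_def by (rule comp_hom[OF pow_pr_hom[OF imor_Ob that] f'(1)])
  then show "good_vec l n (Pw m l) fs (\<lambda>i. src (FO R l) \<cdot> fs i) (\<lambda>i. tgt (FO R l) \<cdot> fs i)"
    using f'(2) l by (auto simp: good_vec_def intro: ihomI intro: comp_hom[OF src_hom])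
qed

text \<open>This is \<open>respects_isos\<close> transported from arrows into a power to families,
  with \<open>a\<close> the object arrow being acted on. The first clause replaces what passing
  through \<open>tuple\<close> gives for free: dependence on the entries below \<open>n\<close>
  alone.\<close>

definition iso_action :: "nat \<Rightarrow> nat \<Rightarrow> 'a \<Rightarrow> ('o \<Rightarrow> (nat \<Rightarrow> 'a) \<Rightarrow> 'a) \<Rightarrow> bool" where
  "iso_action l n a U \<longleftrightarrow>
     (\<forall>J fs gs. (\<forall>i<n. fs i = gs i) \<longrightarrow> U J fs = U J gs) \<and>
     (\<forall>m fs A B. good_vec l n (Pw m l) fs A B \<longrightarrow> U (Pw m l) fs \<in> M l \<and>
        U (Pw m l) fs \<in> ihom C (FO R l) (a \<cdot> tuple C n (X0 l) (Pw m l) A) (a \<cdot> tuple C n (X0 l) (Pw m l) B)) \<and>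
     (\<forall>m A. (\<forall>i<n. A i \<in> hom C (Pw m l) (X0 l)) \<longrightarrow>
        U (Pw m l) (\<lambda>i. idn (FO R l) \<cdot> A i) = idn (FO R l) \<cdot> (a \<cdot> tuple C n (X0 l) (Pw m l) A)) \<and>
     (\<forall>m fs gs A B D. good_vec l n (Pw m l) fs A B \<and> good_vec l n (Pw m l) gs B D \<longrightarrow>
        U (Pw m l) (\<lambda>i. icomp C (FO R l) (gs i) (fs i)) =
        icomp C (FO R l) (U (Pw m l) gs) (U (Pw m l) fs)) \<and>
     (\<forall>m m' fs A B. \<forall>k\<in>hom C (Pw m' l) (Pw m l). good_vec l n (Pw m l) fs A B \<longrightarrow>
        U (Pw m l) fs \<cdot> k = U (Pw m' l) (\<lambda>i. fs i \<cdot> k))"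

lemma iso_actionD:
  assumes "iso_action l n a U"
  shows "(\<And>i. i < n \<Longrightarrow> fs i = gs i) \<Longrightarrow> U J fs = U J gs"
    and "good_vec l n (Pw m l) fs A B \<Longrightarrow> U (Pw m l) fs \<in> M l"
    and "good_vec l n (Pw m l) fs A B \<Longrightarrow>
      U (Pw m l) fs \<in> ihom C (FO R l) (a \<cdot> tuple C n (X0 l) (Pw m l) A) (a \<cdot> tuple C n (X0 l) (Pw m l) B)"
    and "(\<And>i. i < n \<Longrightarrow> A i \<in> hom C (Pw m l) (X0 l)) \<Longrightarrow>
      U (Pw m l) (\<lambda>i. idn (FO R l) \<cdot> A i) = idn (FO R l) \<cdot> (a \<cdot> tuple C n (X0 l) (Pw m l) A)"
    and "good_vec l n (Pw m l) fs A B \<Longrightarrow> good_vec l n (Pw m l) gs B D \<Longrightarrow>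
      U (Pw m l) (\<lambda>i. icomp C (FO R l) (gs i) (fs i)) = icomp C (FO R l) (U (Pw m l) gs) (U (Pw m l) fs)"
    and "good_vec l n (Pw m l) fs A B \<Longrightarrow> k \<in> hom C (Pw m' l) (Pw m l) \<Longrightarrow>
      U (Pw m l) fs \<cdot> k = U (Pw m' l) (\<lambda>i. fs i \<cdot> k)"
proof -
  show "(\<And>i. i < n \<Longrightarrow> fs i = gs i) \<Longrightarrow> U J fs = U J gs"
    using assms unfolding iso_action_def by presburger
  show "good_vec l n (Pw m l) fs A B \<Longrightarrow> U (Pw m l) fs \<in> M l"
    "good_vec l n (Pw m l) fs A B \<Longrightarrow>
      U (Pw m l) fs \<in> ihom C (FO R l) (a \<cdot> tuple C n (X0 l) (Pw m l) A) (a \<cdot> tuple C n (X0 l) (Pw m l) B)"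
    using assms unfolding iso_action_def by blast+
  show "(\<And>i. i < n \<Longrightarrow> A i \<in> hom C (Pw m l) (X0 l)) \<Longrightarrow>
      U (Pw m l) (\<lambda>i. idn (FO R l) \<cdot> A i) = idn (FO R l) \<cdot> (a \<cdot> tuple C n (X0 l) (Pw m l) A)"
    using assms unfolding iso_action_def by presburger
  show "good_vec l n (Pw m l) fs A B \<Longrightarrow> good_vec l n (Pw m l) gs B D \<Longrightarrow>
      U (Pw m l) (\<lambda>i. icomp C (FO R l) (gs i) (fs i)) = icomp C (FO R l) (U (Pw m l) gs) (U (Pw m l) fs)"
    using assms unfolding iso_action_def by blast
  show "good_vec l n (Pw m l) fs A B \<Longrightarrow> k \<in> hom C (Pw m' l) (Pw m l) \<Longrightarrow>
      U (Pw m l) fs \<cdot> k = U (Pw m' l) (\<lambda>i. fs i \<cdot> k)"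
    using assms unfolding iso_action_def by blast
qed

text \<open>Together with \<open>respects_isosD\<close> this makes the two descriptions of
  \<upsilon> interchangeable: new types are built from functions on families, and given types are
  read as such.\<close>

lemma respects_isosI:
  assumes l: "l \<in> levels p" and U: "iso_action l n a U"
    and u: "\<And>m f. f \<in> ups_dom C R M l m n \<Longrightarrow> u f = U (Pw m l) (\<lambda>i. pow_pr C n (X1 l) i \<cdot> f)"
  shows "respects_isos C R M n l (disc_fun C (Pw n l) (FO R l) a) u"
proof -
  interpret icategory C "FO R l" by (rule icategory_at[OF l])
  let ?p = "pow_pr C n (X1 l)"
  have tup: "u (tuple C n (X1 l) (Pw m l) fs) = U (Pw m l) fs" if v: "good_vec l n (Pw m l) fs A B" for m fs A B
    unfolding u[OF good_vec_ups_dom[OF v l]]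
    using l good_vec_hom[OF v l] by (intro iso_actionD(1)[OF U]) (simp add: pr_tuple)
  show ?thesis
    unfolding respects_isos_def Let_def disc_fun_simps
  proof (intro conjI allI ballI impI)
    fix m f
    assume f: "f \<in> ups_dom C R M l m n"
    note v = ups_dom_good_vec[OF f l]
    note J = good_vecD(1)[OF v(1)]
    show "u f \<in> M l"
      using iso_actionD(2)[OF U v(1)] by (simp add: u[OF f])
    have "src (ipow C n (FO R l)) \<cdot> f = tuple C n (X0 l) (Pw m l) (\<lambda>i. src (FO R l) \<cdot> (?p i \<cdot> f))"
      "tgt (ipow C n (FO R l)) \<cdot> f = tuple C n (X0 l) (Pw m l) (\<lambda>i. tgt (FO R l) \<cdot> (?p i \<cdot> f))"
      using good_vec_src[OF v(1) l] good_vec_tgt_eq[OF v(1) l]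
      by (simp_all add: v(2) ipow_def Let_def)
    then show "u f \<in> ihom C (FO R l) (a \<cdot> (src (ipow C n (FO R l)) \<cdot> f)) (a \<cdot> (tgt (ipow C n (FO R l)) \<cdot> f))"
      using iso_actionD(3)[OF U v(1)] by (simp add: u[OF f])
    { fix g
      assume g: "g \<in> ups_dom C R M l m n" and "src (ipow C n (FO R l)) \<cdot> g = tgt (ipow C n (FO R l)) \<cdot> f"
      then have eq: "pow_map C n (src (FO R l)) \<cdot> g = pow_map C n (tgt (FO R l)) \<cdot> f"
        by (simp add: ipow_def Let_def)
      note w = ups_dom_good_vec[OF g l]
      \<comment> \<open>Composability in the power is split into components before functoriality on
        families can be applied.\<close>
      have "src (FO R l) \<cdot> (?p i \<cdot> g) = tgt (FO R l) \<cdot> (?p i \<cdot> f)" if "i < n" for i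
        using pr_pow_map_comp[OF src_hom _ that, of g "Pw m l"] pr_pow_map_comp[OF tgt_hom _ that, of f "Pw m l"]
          f g eq by (simp add: ups_dom_def)
      then have w': "good_vec l n (Pw m l) (\<lambda>i. ?p i \<cdot> g) (\<lambda>i. tgt (FO R l) \<cdot> (?p i \<cdot> f)) (\<lambda>i. tgt (FO R l) \<cdot> (?p i \<cdot> g))"
        using w(1) by (simp add: good_vec_def)
      have "icomp C (ipow C n (FO R l)) g f =
          tuple C n (X1 l) (Pw m l) (\<lambda>i. icomp C (FO R l) (?p i \<cdot> g) (?p i \<cdot> f))"
        using good_vec_icomp_ipow[OF v(1) w' l]
        by (simp add: v(2) w(2))
      then show "u (icomp C (ipow C n (FO R l)) g f) = icomp C (FO R l) (u g) (u f)"
        using tup[OF good_vec_icomp[OF v(1) w' l]] iso_actionD(5)[OF U v(1) w'] by (simp add: u[OF f] u[OF g]) }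
    fix m' k
    assume k: "k \<in> hom C (Pw m' l) (Pw m l)"
    have "f \<cdot> k = tuple C n (X1 l) (Pw m' l) (\<lambda>i. ?p i \<cdot> f \<cdot> k)"
      using good_vec_tuple_comp[OF v(1) l k] by (simp add: v(2))
    then show "u (f \<cdot> k) = u f \<cdot> k"
      using tup[OF good_vec_comp[OF v(1) k l]] iso_actionD(6)[OF U v(1) k] by (simp add: u[OF f])
  next
    fix m A
    assume "A \<in> hom C (Pw m l) (iob (ipow C n (FO R l)))"
    then have A: "A \<in> hom C (Pw m l) (Pw n l)" by (simp add: ipow_def Let_def)
    have J: "Pw m l \<in> Ob C" using A by (rule hom_Ob)
    let ?A = "\<lambda>i. pow_pr C n (X0 l) i \<cdot> A"
    have tA: "tuple C n (X0 l) (Pw m l) ?A = A"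
      by (rule tuple_pr[OF iob_Ob A])
    have hA: "?A i \<in> hom C (Pw m l) (X0 l)" if "i < n" for i
      by (rule comp_hom[OF pow_pr_hom[OF iob_Ob that] A])
    have "idn (ipow C n (FO R l)) \<cdot> A = tuple C n (X1 l) (Pw m l) (\<lambda>i. idn (FO R l) \<cdot> ?A i)"
      using idn_tuple[of "Pw m l" n ?A, OF J hA] by (simp add: tA ipow_def Let_def)
    then show "u (idn (ipow C n (FO R l)) \<cdot> A) = idn (FO R l) \<cdot> (a \<cdot> A)"
      using tup[OF good_vec_idn[OF l J hA]] iso_actionD(4)[OF U hA] by (simp add: tA)
  qed
qed

lemma respects_isosD:
  assumes l: "l \<in> levels p" and u: "respects_isos C R M n l F u"
  shows "iso_action l n (fo F) (\<lambda>J fs. u (tuple C n (X1 l) J fs))"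
proof -
  interpret icategory C "FO R l" by (rule icategory_at[OF l])
  note u = u[unfolded respects_isos_def Let_def]
  have u1: "u f \<in> M l" "u f \<in> ihom C (FO R l) (fo F \<cdot> (pow_map C n (src (FO R l)) \<cdot> f)) (fo F \<cdot> (pow_map C n (tgt (FO R l)) \<cdot> f))"
    if "f \<in> ups_dom C R M l m n" for f m
    using u that by (auto simp: ipow_def Let_def)
  have u2: "u (pow_map C n (idn (FO R l)) \<cdot> A) = idn (FO R l) \<cdot> (fo F \<cdot> A)" if "A \<in> hom C (Pw m l) (Pw n l)" for m A
    using u that by (auto simp: ipow_def Let_def)
  have u3: "u (icomp C (ipow C n (FO R l)) g f) = icomp C (FO R l) (u g) (u f)"
    if "f \<in> ups_dom C R M l m n" "g \<in> ups_dom C R M l m n"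
      "pow_map C n (src (FO R l)) \<cdot> g = pow_map C n (tgt (FO R l)) \<cdot> f" for m f g
  proof -
    have "src (ipow C n (FO R l)) \<cdot> g = tgt (ipow C n (FO R l)) \<cdot> f"
      using that(3) by (simp add: ipow_def Let_def)
    then show ?thesis using u that(1,2) by blast
  qed
  have u4: "u (f \<cdot> k) = u f \<cdot> k" if "f \<in> ups_dom C R M l m n" "k \<in> hom C (Pw m' l) (Pw m l)" for m m' f k
    using u that by blast
  show ?thesis
    unfolding iso_action_def
  proof (intro conjI allI impI ballI)
    fix J :: 'o and fs gs :: "nat \<Rightarrow> 'a"
    assume "\<forall>i<n. fs i = gs i"
    then have "tuple C n (X1 l) J fs = tuple C n (X1 l) J gs"
      by (intro tuple_cong) simp
    then show "u (tuple C n (X1 l) J fs) = u (tuple C n (X1 l) J gs)" by simp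
  next
    fix m fs A B
    assume v: "good_vec l n (Pw m l) fs A B"
    note d = good_vec_ups_dom[OF v l]
    show "u (tuple C n (X1 l) (Pw m l) fs) \<in> M l"
      by (rule u1[OF d])
    show "u (tuple C n (X1 l) (Pw m l) fs) \<in>
        ihom C (FO R l) (fo F \<cdot> tuple C n (X0 l) (Pw m l) A) (fo F \<cdot> tuple C n (X0 l) (Pw m l) B)"
      using u1(2)[OF d] good_vec_src[OF v l]
        good_vec_tgt_eq[OF v l] by simp
  next
    fix m A
    assume "\<forall>i<n. A i \<in> hom C (Pw m l) (X0 l)"
    then have A: "\<And>i. i < n \<Longrightarrow> A i \<in> hom C (Pw m l) (X0 l)" by blast
    have J: "Pw m l \<in> Ob C" by simp
    show "u (tuple C n (X1 l) (Pw m l) (\<lambda>i. idn (FO R l) \<cdot> A i)) =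
        idn (FO R l) \<cdot> (fo F \<cdot> tuple C n (X0 l) (Pw m l) A)"
      using u2[OF tuple_hom[OF iob_Ob J A]] idn_tuple[OF J A] by simp
  next
    fix m fs gs A B D
    assume "good_vec l n (Pw m l) fs A B \<and> good_vec l n (Pw m l) gs B D"
    then have v: "good_vec l n (Pw m l) fs A B" and w: "good_vec l n (Pw m l) gs B D" by auto
    show "u (tuple C n (X1 l) (Pw m l) (\<lambda>i. icomp C (FO R l) (gs i) (fs i))) =
        icomp C (FO R l) (u (tuple C n (X1 l) (Pw m l) gs)) (u (tuple C n (X1 l) (Pw m l) fs))"
      using u3[OF good_vec_ups_dom[OF v l] good_vec_ups_dom[OF w l]]
        good_vec_src[OF w l]
        good_vec_tgt_eq[OF v l]
        good_vec_icomp_ipow[OF v w l] by simp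
  next
    fix m m' fs A B k
    assume k: "k \<in> hom C (Pw m' l) (Pw m l)" and v: "good_vec l n (Pw m l) fs A B"
    show "u (tuple C n (X1 l) (Pw m l) fs) \<cdot> k = u (tuple C n (X1 l) (Pw m' l) (\<lambda>i. fs i \<cdot> k))"
      using u4[OF good_vec_ups_dom[OF v l] k] good_vec_tuple_comp[OF v l k] by simp
  qed
qed

section \<open>Relational types: their components and their equality\<close>

abbreviation "relob n \<equiv> is_relob C p R M n"
abbreviation "ofo F l \<equiv> fo (rfun F l)"
abbreviation "up n F l J fs \<equiv> rups F l (tuple C n (X1 l) J fs)"

lemma relob_rfun_eq:
  assumes "relob n F" "l \<in> levels p"
  shows "rfun F l = disc_fun C (Pw n l) (FO R l) (ofo F l)"
    and "ofo F l \<in> hom C (Pw n l) (X0 l)"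
proof -
  have "rfun F l \<in> hom (CAT C) (disc_cat C (Pw n l)) (FO R l)"
    using assms by (simp add: is_relob_def cubical_functor_def FO_dpow)
  then show "rfun F l = disc_fun C (Pw n l) (FO R l) (ofo F l)" "ofo F l \<in> hom C (Pw n l) (X0 l)"
    using internal_functor_disc_cat_iff[OF internal_at[OF assms(2)] pow_ob_Ob[OF X0_Ob[OF assms(2)]]] by blast+
qed

text \<open>In the discrete normal form, the two composites that occur in the conditions on faces
  and degeneracies are given by object arrows, so these conditions become statements about arrows of
  \<open>C\<close>.\<close>

lemma R_comp_rfun:
  assumes F: "relob n F" and h: "h \<in> box_ars p"
  shows "FA R h \<cdot>\<^bsub>CAT C\<^esub> rfun F (Dom box h) =
      disc_fun C (Pw n (Dom box h)) (FO R (Cod box h)) (Rh h \<cdot> ofo F (Dom box h))"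
    and "rfun F (Cod box h) \<cdot>\<^bsub>CAT C\<^esub> FA (dpow C R n) h =
      disc_fun C (Pw n (Dom box h)) (FO R (Cod box h)) (ofo F (Cod box h) \<cdot> Rn n h)"
proof -
  note l = box_levels(1,2)[OF h]
  note d = relob_rfun_eq[OF F l(1)] and c = relob_rfun_eq[OF F l(2)]
  show "FA R h \<cdot>\<^bsub>CAT C\<^esub> rfun F (Dom box h) =
      disc_fun C (Pw n (Dom box h)) (FO R (Cod box h)) (Rh h \<cdot> ofo F (Dom box h))"
    by (subst d(1)) (rule R_comp_disc_fun[OF h d(2)])
  show "rfun F (Cod box h) \<cdot>\<^bsub>CAT C\<^esub> FA (dpow C R n) h =
      disc_fun C (Pw n (Dom box h)) (FO R (Cod box h)) (ofo F (Cod box h) \<cdot> Rn n h)"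
    by (subst c(1)) (rule disc_fun_comp_dpow[OF h internal_at[OF l(2)] c(2)])
qed

lemma relob_face:
  assumes F: "relob n F" and h: "h \<in> faces p"
  shows "Rh h \<cdot> ofo F (Dom box h) = ofo F (Cod box h) \<cdot> Rn n h"
proof -
  have "FA R h \<cdot>\<^bsub>CAT C\<^esub> rfun F (Dom box h) = rfun F (Cod box h) \<cdot>\<^bsub>CAT C\<^esub> FA (dpow C R n) h"
    using F h by (simp add: is_relob_def face_preserving_def)
  then show ?thesis
    unfolding R_comp_rfun[OF F faces_box[OF h]] by (metis disc_fun_simps(3))
qed

lemma relob_degen:
  assumes F: "relob n F" and h: "h \<in> degens p"
  shows "reps F h \<in> M (Cod box h)"
    and "reps F h \<in> ihom C (FO R (Cod box h)) (Rh h \<cdot> ofo F (Dom box h)) (ofo F (Cod box h) \<cdot> Rn n h)"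
proof -
  note b = degens_box[OF h]
  note l = box_levels(1,2)[OF b]
  show "reps F h \<in> M (Cod box h)"
    using F h by (simp add: is_relob_def)
  have "internal_nat C (FA R h \<cdot>\<^bsub>CAT C\<^esub> rfun F (Dom box h))
      (rfun F (Cod box h) \<cdot>\<^bsub>CAT C\<^esub> FA (dpow C R n) h) (reps F h)"
    using F h by (simp add: is_relob_def degen_preserving_def internal_nat_iso_def)
  then show "reps F h \<in> ihom C (FO R (Cod box h)) (Rh h \<cdot> ofo F (Dom box h)) (ofo F (Cod box h) \<cdot> Rn n h)"
    unfolding R_comp_rfun[OF F b]
    using internal_nat_disc_fun_iff[OF internal_at[OF l(2)]
        comp_hom[OF Rh_hom[OF b] relob_rfun_eq(2)[OF F l(1)]]
        comp_hom[OF relob_rfun_eq(2)[OF F l(2)] Rn_hom[OF b]]] by blast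
qed

lemma relob_action:
  "relob n F \<Longrightarrow> l \<in> levels p \<Longrightarrow> iso_action l n (ofo F l) (up n F l)"
  using respects_isosD by (simp add: is_relob_def)

lemmas up_cong = iso_actionD(1)[OF relob_action]
  and up_M = iso_actionD(2)[OF relob_action]
  and up_ihom = iso_actionD(3)[OF relob_action]
  and up_idn = iso_actionD(4)[OF relob_action]
  and up_icomp = iso_actionD(5)[OF relob_action]
  and up_comp = iso_actionD(6)[OF relob_action]

text \<open>The \<open>undefined\<close> branches match those demanded by \<open>is_relob\<close>.
  An arrow in the domain of \<upsilon> does not carry its arity \<open>m\<close>, so the stage
  handed to \<open>U\<close> is read off as \<open>Dom C f\<close>.\<close>

definition mkrel ::
  "nat \<Rightarrow> (nat \<Rightarrow> 'a) \<Rightarrow> (cube_ar \<Rightarrow> 'a) \<Rightarrow> (nat \<Rightarrow> 'o \<Rightarrow> (nat \<Rightarrow> 'a) \<Rightarrow> 'a) \<Rightarrow> ('o, 'a) relob" where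
  "mkrel n a e U = \<lparr>
     rfun = \<lambda>l. if l \<in> levels p then disc_fun C (Pw n l) (FO R l) (a l) else undefined,
     reps = \<lambda>h. if h \<in> degens p then e h else undefined,
     rups = \<lambda>l f. if l \<in> levels p \<and> (\<exists>m. f \<in> ups_dom C R M l m n)
       then U l (Dom C f) (\<lambda>i. pow_pr C n (X1 l) i \<cdot> f) else undefined\<rparr>"

lemma mkrel_simps [simp]:
  "l \<in> levels p \<Longrightarrow> rfun (mkrel n a e U) l = disc_fun C (Pw n l) (FO R l) (a l)"
  "h \<in> degens p \<Longrightarrow> reps (mkrel n a e U) h = e h"
  by (simp_all add: mkrel_def)

lemma relob_mkrel:
  assumes a: "\<And>l. l \<in> levels p \<Longrightarrow> a l \<in> hom C (Pw n l) (X0 l)"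
    and face: "\<And>h. h \<in> faces p \<Longrightarrow> Rh h \<cdot> a (Dom box h) = a (Cod box h) \<cdot> Rn n h"
    and e: "\<And>h. h \<in> degens p \<Longrightarrow> e h \<in> M (Cod box h)"
      "\<And>h. h \<in> degens p \<Longrightarrow>
        e h \<in> ihom C (FO R (Cod box h)) (Rh h \<cdot> a (Dom box h)) (a (Cod box h) \<cdot> Rn n h)"
    and U: "\<And>l. l \<in> levels p \<Longrightarrow> iso_action l n (a l) (U l)"
  shows "relob n (mkrel n a e U)"
  unfolding is_relob_def
proof (intro conjI allI ballI impI)
  let ?F = "mkrel n a e U"
  show "cubical_functor C p (dpow C R n) R (rfun ?F)"
    unfolding cubical_functor_def
    by (simp add: FO_dpow internal_functor_disc_cat_iff internal_at a)
  have comps: "FA R h \<cdot>\<^bsub>CAT C\<^esub> rfun ?F (Dom box h) =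
      disc_fun C (Pw n (Dom box h)) (FO R (Cod box h)) (Rh h \<cdot> a (Dom box h))"
    "rfun ?F (Cod box h) \<cdot>\<^bsub>CAT C\<^esub> FA (dpow C R n) h =
      disc_fun C (Pw n (Dom box h)) (FO R (Cod box h)) (a (Cod box h) \<cdot> Rn n h)"
    if "h \<in> box_ars p" for h
    using that by (simp_all add: box_levels R_comp_disc_fun disc_fun_comp_dpow internal_at a)
  show "face_preserving C p (dpow C R n) R (rfun ?F)"
    unfolding face_preserving_def by (simp add: comps faces_box face)
  show "degen_preserving C p (dpow C R n) R (rfun ?F) (reps ?F)"
    unfolding degen_preserving_def
  proof
    fix h assume h: "h \<in> degens p"
    note b = degens_box[OF h]
    note l = box_levels(1,2)[OF b]
    show "internal_nat_iso C (FA R h \<cdot>\<^bsub>CAT C\<^esub> rfun ?F (Dom box h))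
        (rfun ?F (Cod box h) \<cdot>\<^bsub>CAT C\<^esub> FA (dpow C R n) h) (reps ?F h)"
      unfolding comps[OF b] internal_nat_iso_def
      using h e(2)[OF h] M_iso[OF l(2) e(1)[OF h]]
        internal_nat_disc_fun_iff[OF internal_at[OF l(2)] comp_hom[OF Rh_hom[OF b] a[OF l(1)]]
          comp_hom[OF a[OF l(2)] Rn_hom[OF b]]] by simp
  qed
  show "reps ?F h \<in> M (Cod box h)" if "h \<in> degens p" for h
    using that e(1) by simp
  show "respects_isos C R M n l (rfun ?F l) (rups ?F l)" if l: "l \<in> levels p" for l
  proof -
    have "rups ?F l f = U l (Pw m l) (\<lambda>i. pow_pr C n (X1 l) i \<cdot> f)"
      if f: "f \<in> ups_dom C R M l m n" for m f
      using l f ups_dom_good_vec(3)[OF f l] by (auto simp: mkrel_def)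
    then show ?thesis
      using respects_isosI[OF l U[OF l]] l by simp
  qed
qed (auto simp: mkrel_def)

lemma up_mkrel:
  assumes U: "\<And>fs gs. (\<And>i. i < n \<Longrightarrow> fs i = gs i) \<Longrightarrow> U l (Pw m l) fs = U l (Pw m l) gs"
    and v: "good_vec l n (Pw m l) fs A B" and l: "l \<in> levels p"
  shows "up n (mkrel n a e U) l (Pw m l) fs = U l (Pw m l) fs"
proof -
  note d = good_vec_ups_dom[OF v l]
  have "up n (mkrel n a e U) l (Pw m l) fs =
      U l (Pw m l) (\<lambda>i. pow_pr C n (X1 l) i \<cdot> tuple C n (X1 l) (Pw m l) fs)"
    using d l ups_dom_good_vec(3)[OF d l] by (auto simp: mkrel_def)
  also have "\<dots> = U l (Pw m l) fs"
    using l good_vec_hom[OF v l] good_vecD(1)[OF v] by (intro U) (simp add: pr_tuple)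
  finally show ?thesis .
qed

text \<open>Comparing actions on good families suffices: every arrow in the domain of \<upsilon> is
  the tuple of such a family, and outside the domain both sides are
  \<open>undefined\<close>.\<close>

lemma relob_eqI:
  assumes F: "relob n F" and G: "relob n G"
    and fo: "\<And>l. l \<in> levels p \<Longrightarrow> ofo F l = ofo G l"
    and eps: "\<And>h. h \<in> degens p \<Longrightarrow> reps F h = reps G h"
    and ups: "\<And>l m fs A B. l \<in> levels p \<Longrightarrow> good_vec l n (Pw m l) fs A B \<Longrightarrow>
      up n F l (Pw m l) fs = up n G l (Pw m l) fs"
  shows "F = G"
proof -
  have "rfun F l = rfun G l" for l
  proof (cases "l \<in> levels p")
    case True
    then show ?thesis
      using relob_rfun_eq(1)[OF F True] relob_rfun_eq(1)[OF G True] fo by simp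
  qed (use F G in \<open>auto simp: is_relob_def\<close>)
  moreover have "reps F h = reps G h" for h
  proof (cases "h \<in> degens p")
    case False
    then show ?thesis using F G unfolding is_relob_def by metis
  qed (rule eps)
  moreover have "rups F l f = rups G l f" for l f
  proof (cases "l \<in> levels p \<and> (\<exists>m. f \<in> ups_dom C R M l m n)")
    case True
    then obtain m where l: "l \<in> levels p" and f: "f \<in> ups_dom C R M l m n" by blast
    show ?thesis
      using ups[OF l ups_dom_good_vec(1)[OF f l]] by (simp add: ups_dom_good_vec(2)[OF f l])
  next
    case False
    then show ?thesis using F G unfolding is_relob_def by metis
  qed
  ultimately show ?thesis
    by (intro relob.equality ext) auto
qed

text \<open>For \<open>h : l\<^sub>1 \<rightarrow> l\<^sub>2\<close>, this extends the action of \<open>F\<close> at level \<open>l\<^sub>2\<close> to isomorphisms defined on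
  \<open>Rel(l\<^sub>1)\<^sub>0\<^sup>m\<close>, along the retraction of \<open>h\<close>.\<close>

definition ux :: "nat \<Rightarrow> ('o, 'a) relob \<Rightarrow> cube_ar \<Rightarrow> nat \<Rightarrow> (nat \<Rightarrow> 'a) \<Rightarrow> 'a" where
  "ux n F h m es = up n F (Cod box h) (Pw m (Cod box h)) (\<lambda>i. es i \<cdot> Rn m (retraction p h)) \<cdot> Rn m h"

context
  fixes n F h
  assumes F: "relob n F" and h: "h \<in> degens p"
begin

lemma levels_h: "Dom box h \<in> levels p" "Cod box h \<in> levels p"
  using box_levels h by auto

lemma ux_cong: "(\<And>i. i < n \<Longrightarrow> es i = fs i) \<Longrightarrow> ux n F h m es = ux n F h m fs"
  unfolding ux_def by (rule arg_cong[where f = "\<lambda>x. x \<cdot> _"], rule up_cong[OF F levels_h(2)]) simp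

lemma good_vec_retract:
  "good_vec (Cod box h) k (Pw m (Dom box h)) es A B \<Longrightarrow>
    good_vec (Cod box h) k (Pw m (Cod box h)) (\<lambda>i. es i \<cdot> Rn m (retraction p h))
      (\<lambda>i. A i \<cdot> Rn m (retraction p h)) (\<lambda>i. B i \<cdot> Rn m (retraction p h))"
  by (rule good_vec_comp[OF _ Rn_retraction(1)[OF h] levels_h(2)])

lemma section_cancel:
  assumes "f \<in> hom C (Pw m (Dom box h)) Y"
  shows "f \<cdot> Rn m (retraction p h) \<cdot> Rn m h = f"
  using comp_assoc[OF Rn_hom[OF degens_box[OF h]] Rn_retraction(1)[OF h] assms] assms
  by (simp add: Rn_retraction(2)[OF h] homD)

text \<open>Although \<open>?s \<cdot> ?r\<close> is merely idempotent,
  \<open>es i \<cdot> ?r\<close> already absorbs it, so nothing is lost by restricting along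
  \<open>Rn m h\<close> and extending back.\<close>

lemma ux_retract:
  assumes v: "good_vec (Cod box h) n (Pw m (Dom box h)) es A B"
  shows "ux n F h m es \<cdot> Rn m (retraction p h) =
    up n F (Cod box h) (Pw m (Cod box h)) (\<lambda>i. es i \<cdot> Rn m (retraction p h))"
proof -
  let ?r = "Rn m (retraction p h)" and ?s = "Rn m h" and ?l = "Cod box h"
  note r = Rn_retraction(1)[OF h, of m] and s = Rn_hom[OF degens_box[OF h], of m]
  note w = good_vec_retract[OF v]
  have u: "up n F ?l (Pw m ?l) (\<lambda>i. es i \<cdot> ?r) \<in> hom C (Pw m ?l) (X1 ?l)"
    using icategory.ihom_at[OF icategory_at[OF levels_h(2)] up_ihom[OF F levels_h(2) w]]
      relob_rfun_eq(2)[OF F levels_h(2)] good_vec_tuple(2)[OF w levels_h(2)] by blast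
  have "ux n F h m es \<cdot> ?r = up n F ?l (Pw m ?l) (\<lambda>i. es i \<cdot> ?r) \<cdot> (?s \<cdot> ?r)"
    by (simp add: ux_def comp_assoc[OF r s u])
  also have "\<dots> = up n F ?l (Pw m ?l) (\<lambda>i. es i \<cdot> ?r \<cdot> (?s \<cdot> ?r))"
    by (rule up_comp[OF F levels_h(2) w comp_hom[OF s r]])
  also have "\<dots> = up n F ?l (Pw m ?l) (\<lambda>i. es i \<cdot> ?r)"
  proof (rule up_cong[OF F levels_h(2)])
    fix i assume i: "i < n"
    have e: "es i \<in> hom C (Pw m (Dom box h)) (X1 ?l)"
      by (rule good_vec_hom[OF v levels_h(2) i])
    show "es i \<cdot> ?r \<cdot> (?s \<cdot> ?r) = es i \<cdot> ?r"
      using comp_assoc[OF r s comp_hom[OF e r]] section_cancel[OF e] by simp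
  qed
  finally show ?thesis .
qed

lemma
  assumes v: "good_vec (Cod box h) n (Pw m (Dom box h)) es A B"
  shows ux_M: "ux n F h m es \<in> M (Cod box h)"
    and ux_ihom: "ux n F h m es \<in> ihom C (FO R (Cod box h))
      (ofo F (Cod box h) \<cdot> tuple C n (X0 (Cod box h)) (Pw m (Dom box h)) A)
      (ofo F (Cod box h) \<cdot> tuple C n (X0 (Cod box h)) (Pw m (Dom box h)) B)"
proof -
  let ?r = "Rn m (retraction p h)" and ?s = "Rn m h" and ?l = "Cod box h"
  note r = Rn_retraction(1)[OF h, of m] and s = Rn_hom[OF degens_box[OF h], of m]
  note w = good_vec_retract[OF v]
  note a = relob_rfun_eq(2)[OF F levels_h(2)]
  note t = good_vec_tuple[OF v levels_h(2)] and tw = good_vec_tuple[OF w levels_h(2)]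
  note u = up_ihom[OF F levels_h(2) w]
  have s': "?s \<in> hom C (Pw m (Dom box h)) (Dom C (ofo F ?l \<cdot> tuple C n (X0 ?l) (Pw m ?l) (\<lambda>i. A i \<cdot> ?r)))"
    using s homD(2)[OF comp_hom[OF a tw(2)]] by simp
  \<comment> \<open>Restriction along \<open>?s\<close> also undoes the detour through the
    retraction on the end points.\<close>
  have *: "ofo F ?l \<cdot> tuple C n (X0 ?l) (Pw m ?l) (\<lambda>i. D i \<cdot> ?r) \<cdot> ?s =
      ofo F ?l \<cdot> tuple C n (X0 ?l) (Pw m (Dom box h)) D"
    if D: "\<And>i. i < n \<Longrightarrow> D i \<in> hom C (Pw m (Dom box h)) (X0 ?l)" for D
  proof -
    have "tuple C n (X0 ?l) (Pw m ?l) (\<lambda>i. D i \<cdot> ?r) = tuple C n (X0 ?l) (Pw m (Dom box h)) D \<cdot> ?r"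
      by (rule tuple_comp[symmetric, OF X0_Ob[OF levels_h(2)] _ r]) (rule D)
    moreover have tD: "tuple C n (X0 ?l) (Pw m (Dom box h)) D \<in> hom C (Pw m (Dom box h)) (Pw n ?l)"
      using D levels_h by (intro tuple_hom) auto
    ultimately show ?thesis
      using section_cancel[OF tD] comp_assoc[OF s comp_hom[OF tD r] a] by simp
  qed
  show "ux n F h m es \<in> M ?l"
    unfolding ux_def by (rule M_comp[OF levels_h(2) up_M[OF F levels_h(2) w] u s'])
  show "ux n F h m es \<in> ihom C (FO R ?l)
      (ofo F ?l \<cdot> tuple C n (X0 ?l) (Pw m (Dom box h)) A)
      (ofo F ?l \<cdot> tuple C n (X0 ?l) (Pw m (Dom box h)) B)"
    using icategory.ihom_comp[OF icategory_at[OF levels_h(2)] u s'] *[of A] *[of B]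
      good_vecD(2)[OF v] good_vec_tgt[OF v levels_h(2)]
    by (simp add: ux_def)
qed

lemma ux_icomp:
  assumes v: "good_vec (Cod box h) n (Pw m (Dom box h)) es A B"
    and w: "good_vec (Cod box h) n (Pw m (Dom box h)) fs B D"
  shows "ux n F h m (\<lambda>i. icomp C (FO R (Cod box h)) (fs i) (es i)) =
    icomp C (FO R (Cod box h)) (ux n F h m fs) (ux n F h m es)"
proof -
  let ?r = "Rn m (retraction p h)" and ?s = "Rn m h" and ?l = "Cod box h"
  interpret icategory C "FO R ?l" by (rule icategory_at[OF levels_h(2)])
  note r = Rn_retraction(1)[OF h, of m] and s = Rn_hom[OF degens_box[OF h], of m]
  note v' = good_vec_retract[OF v] and w' = good_vec_retract[OF w]
  note u = up_ihom[OF F levels_h(2) v'] up_ihom[OF F levels_h(2) w']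
  have s': "?s \<in> hom C (Pw m (Dom box h)) (Dom C (ofo F ?l \<cdot> tuple C n (X0 ?l) (Pw m ?l) (\<lambda>i. A i \<cdot> ?r)))"
    using s homD(2)[OF comp_hom[OF relob_rfun_eq(2)[OF F levels_h(2)] good_vec_tuple(2)[OF v' levels_h(2)]]]
    by simp
  have "up n F ?l (Pw m ?l) (\<lambda>i. icomp C (FO R ?l) (fs i) (es i) \<cdot> ?r) =
      up n F ?l (Pw m ?l) (\<lambda>i. icomp C (FO R ?l) (fs i \<cdot> ?r) (es i \<cdot> ?r))"
  proof (rule up_cong[OF F levels_h(2)])
    fix i assume i: "i < n"
    have "?r \<in> hom C (Pw m ?l) (Dom C (A i))"
      using r good_vecD(2)[OF v i] by (simp add: homD)
    then show "icomp C (FO R ?l) (fs i) (es i) \<cdot> ?r = icomp C (FO R ?l) (fs i \<cdot> ?r) (es i \<cdot> ?r)"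
      by (rule icomp_comp[OF good_vecD(4)[OF v i] good_vecD(4)[OF w i]])
  qed
  also have "\<dots> = icomp C (FO R ?l) (up n F ?l (Pw m ?l) (\<lambda>i. fs i \<cdot> ?r)) (up n F ?l (Pw m ?l) (\<lambda>i. es i \<cdot> ?r))"
    by (rule up_icomp[OF F levels_h(2) v' w'])
  finally show ?thesis
    by (simp add: ux_def icomp_comp[OF u s'])
qed

lemma ux_idn:
  assumes A: "\<And>i. i < n \<Longrightarrow> A i \<in> hom C (Pw m (Dom box h)) (X0 (Cod box h))"
  shows "ux n F h m (\<lambda>i. idn (FO R (Cod box h)) \<cdot> A i) =
    idn (FO R (Cod box h)) \<cdot> (ofo F (Cod box h) \<cdot> tuple C n (X0 (Cod box h)) (Pw m (Dom box h)) A)"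
proof -
  let ?r = "Rn m (retraction p h)" and ?s = "Rn m h" and ?l = "Cod box h"
  interpret icategory C "FO R ?l" by (rule icategory_at[OF levels_h(2)])
  note r = Rn_retraction(1)[OF h, of m] and s = Rn_hom[OF degens_box[OF h], of m]
  let ?T = "tuple C n (X0 ?l) (Pw m (Dom box h)) A"
  have T: "?T \<in> hom C (Pw m (Dom box h)) (Pw n ?l)"
    using A levels_h by (intro tuple_hom) auto
  note a = relob_rfun_eq(2)[OF F levels_h(2)]
  have "up n F ?l (Pw m ?l) (\<lambda>i. idn (FO R ?l) \<cdot> A i \<cdot> ?r) =
      up n F ?l (Pw m ?l) (\<lambda>i. idn (FO R ?l) \<cdot> (A i \<cdot> ?r))"
    by (rule up_cong[OF F levels_h(2)]) (rule idn_comp[OF A r])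
  also have "\<dots> = idn (FO R ?l) \<cdot> (ofo F ?l \<cdot> tuple C n (X0 ?l) (Pw m ?l) (\<lambda>i. A i \<cdot> ?r))"
    by (rule up_idn[OF F levels_h(2)]) (rule comp_hom[OF A r])
  also have "tuple C n (X0 ?l) (Pw m ?l) (\<lambda>i. A i \<cdot> ?r) = ?T \<cdot> ?r"
    by (rule tuple_comp[symmetric, OF iob_Ob _ r]) (rule A)
  finally show ?thesis
    using section_cancel[OF comp_hom[OF idn_hom comp_hom[OF a T]]]
    by (simp add: ux_def comp_assoc[OF r T a] comp_assoc[OF r comp_hom[OF a T] idn_hom])
qed

text \<open>The arrow \<open>k\<close> relates powers of the lower level, whereas stability of the
  action is known for powers of the upper one. Its conjugate \<open>?s \<cdot> k \<cdot> ?r'\<close>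
  lives at the upper level. This covers arbitrary \<open>k\<close>, in particular
  \<open>tob\<close>, which meets degeneracies only up to isomorphism.\<close>

lemma ux_comp:
  assumes v: "good_vec (Cod box h) n (Pw m (Dom box h)) es A B"
    and k: "k \<in> hom C (Pw m' (Dom box h)) (Pw m (Dom box h))"
  shows "ux n F h m es \<cdot> k = ux n F h m' (\<lambda>i. es i \<cdot> k)"
proof -
  let ?l = "Cod box h"
  interpret icategory C "FO R ?l" by (rule icategory_at[OF levels_h(2)])
  note r = Rn_retraction(1)[OF h, of m] and s = Rn_hom[OF degens_box[OF h], of m]
  note r' = Rn_retraction(1)[OF h, of m'] and s' = Rn_hom[OF degens_box[OF h], of m']
  let ?r = "Rn m (retraction p h)" and ?s = "Rn m h"
  let ?r' = "Rn m' (retraction p h)" and ?s' = "Rn m' h"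
  note w = good_vec_retract[OF v]
  note a = relob_rfun_eq(2)[OF F levels_h(2)]
  have x: "ux n F h m es \<in> hom C (Pw m (Dom box h)) (X1 ?l)"
    by (rule ihom_at[OF ux_ihom[OF v] comp_hom[OF a good_vec_tuple(2)[OF v levels_h(2)]]])
  have y: "up n F ?l (Pw m ?l) (\<lambda>i. es i \<cdot> ?r) \<in> hom C (Pw m ?l) (X1 ?l)"
    by (rule ihom_at[OF up_ihom[OF F levels_h(2) w] comp_hom[OF a good_vec_tuple(2)[OF w levels_h(2)]]])
  have "ux n F h m es \<cdot> k \<cdot> ?r' = up n F ?l (Pw m ?l) (\<lambda>i. es i \<cdot> ?r) \<cdot> (?s \<cdot> k \<cdot> ?r')"
    by (simp add: ux_def comp_assoc[OF comp_hom[OF k r'] s y] comp_assoc[OF r' k s, symmetric]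
        comp_assoc[OF r' k comp_hom[OF y s], symmetric])
  also have "\<dots> = up n F ?l (Pw m' ?l) (\<lambda>i. es i \<cdot> ?r \<cdot> (?s \<cdot> k \<cdot> ?r'))"
    by (rule up_comp[OF F levels_h(2) w comp_hom[OF comp_hom[OF s k] r']])
  also have "\<dots> = up n F ?l (Pw m' ?l) (\<lambda>i. es i \<cdot> k \<cdot> ?r')"
  proof (rule up_cong[OF F levels_h(2)])
    fix i assume i: "i < n"
    have e: "es i \<in> hom C (Pw m (Dom box h)) (X1 ?l)"
      by (rule good_vec_hom[OF v levels_h(2) i])
    show "es i \<cdot> ?r \<cdot> (?s \<cdot> k \<cdot> ?r') = es i \<cdot> k \<cdot> ?r'"
      using section_cancel[OF e] by (simp add: comp_assoc[OF comp_hom[OF k r'] s comp_hom[OF e r]]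
          comp_assoc[OF r' k s, symmetric] comp_assoc[OF r' k e, symmetric])
  qed
  finally show ?thesis
    using section_cancel[OF comp_hom[OF x k]] by (simp add: ux_def)
qed

end

subsection \<open>Substitution\<close>

abbreviation "relobs m Fs \<equiv> (\<forall>F\<in>set Fs. relob m F)"
abbreviation "tob m Fs l \<equiv> tuple_ob C R m Fs l"

lemma relobs_nth: "relobs m Fs \<Longrightarrow> i < length Fs \<Longrightarrow> relob m (Fs ! i)"
  by simp

lemma ofo_nth_hom:
  "relobs m Fs \<Longrightarrow> l \<in> levels p \<Longrightarrow> i < length Fs \<Longrightarrow> ofo (Fs ! i) l \<in> hom C (Pw m l) (X0 l)"
  using relob_rfun_eq(2)[OF relobs_nth] .

lemma tob_hom:
  assumes "relobs m Fs" "l \<in> levels p"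
  shows "tob m Fs l \<in> hom C (Pw m l) (Pw (length Fs) l)"
  unfolding tuple_ob_def using ofo_nth_hom[OF assms] assms(2) by (intro tuple_hom) auto

lemma pr_tob:
  assumes "relobs m Fs" "l \<in> levels p" "i < length Fs"
  shows "pow_pr C (length Fs) (X0 l) i \<cdot> tob m Fs l = ofo (Fs ! i) l"
  unfolding tuple_ob_def using ofo_nth_hom[OF assms(1,2)] assms by (intro pr_tuple) auto

lemma tob_comp:
  assumes "relobs m Fs" "l \<in> levels p" "u \<in> hom C J (Pw m l)"
  shows "tob m Fs l \<cdot> u = tuple C (length Fs) (X0 l) J (\<lambda>i. ofo (Fs ! i) l \<cdot> u)"
  unfolding tuple_ob_def by (rule tuple_comp[OF X0_Ob[OF assms(2)] ofo_nth_hom[OF assms(1,2)] assms(3)])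

lemma Rn_tob:
  assumes "relobs m Fs" "h \<in> box_ars p"
  shows "Rn (length Fs) h \<cdot> tob m Fs (Dom box h) =
    tuple C (length Fs) (X0 (Cod box h)) (Pw m (Dom box h)) (\<lambda>i. Rh h \<cdot> ofo (Fs ! i) (Dom box h))"
  unfolding tuple_ob_def
  by (rule pow_map_tuple[OF Rh_hom[OF assms(2)] _ ofo_nth_hom[OF assms(1)]])
    (use box_levels(1)[OF assms(2)] in auto)

text \<open>Context morphisms commute with faces on the nose because their components do. For
  degeneracies, the family in \<open>good_vec_reps\<close> takes the place of this equation.\<close>

lemma tob_face:
  assumes "relobs m Fs" "h \<in> faces p"
  shows "Rn (length Fs) h \<cdot> tob m Fs (Dom box h) = tob m Fs (Cod box h) \<cdot> Rn m h"
  unfolding Rn_tob[OF assms(1) faces_box[OF assms(2)]]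
    tob_comp[OF assms(1) box_levels(4)[OF assms(2)] Rn_hom[OF faces_box[OF assms(2)]]]
  using relob_face[OF relobs_nth[OF assms(1)] assms(2)] by (rule tuple_cong)

text \<open>The witnesses of a context morphism form one good family whose stage is a power of the
  lower level and whose values lie at the upper level: the kind of argument for which
  \<open>ux\<close> was introduced.\<close>

lemma good_vec_reps:
  assumes Fs: "relobs m Fs" and h: "h \<in> degens p"
  shows "good_vec (Cod box h) (length Fs) (Pw m (Dom box h)) (\<lambda>i. reps (Fs ! i) h)
    (\<lambda>i. Rh h \<cdot> ofo (Fs ! i) (Dom box h)) (\<lambda>i. ofo (Fs ! i) (Cod box h) \<cdot> Rn m h)"
  unfolding good_vec_def
  using relob_degen[OF relobs_nth[OF Fs] h] ofo_nth_hom[OF Fs box_levels(5)[OF h]] box_levels(5)[OF h]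
    comp_hom[OF Rh_hom[OF degens_box[OF h]]] by auto

lemma good_vec_up:
  assumes Fs: "relobs m Fs" and l: "l \<in> levels p" and v: "good_vec l m (Pw k l) fs A B"
  shows "good_vec l (length Fs) (Pw k l) (\<lambda>i. up m (Fs ! i) l (Pw k l) fs)
    (\<lambda>i. ofo (Fs ! i) l \<cdot> tuple C m (X0 l) (Pw k l) A) (\<lambda>i. ofo (Fs ! i) l \<cdot> tuple C m (X0 l) (Pw k l) B)"
  unfolding good_vec_def
  using up_M[OF relobs_nth[OF Fs] l v] up_ihom[OF relobs_nth[OF Fs] l v] good_vecD(1)[OF v]
    comp_hom[OF ofo_nth_hom[OF Fs l] good_vec_tuple(2)[OF v l]] by auto

text \<open>\<open>subst\<close> in the language of families: \<open>mkrel\<close> provides the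
  defaults, and \<open>ux\<close> stands for the reindexing along the retraction that
  \<open>subst\<close> writes out. Agreement with \<open>subst\<close> is shown for well-formed
  arguments.\<close>

definition sbst :: "('o, 'a) relob \<Rightarrow> nat \<Rightarrow> ('o, 'a) relob list \<Rightarrow> ('o, 'a) relob" where
  "sbst F m Fs = mkrel m (\<lambda>l. ofo F l \<cdot> tob m Fs l)
     (\<lambda>h. icomp C (FO R (Cod box h)) (ux (length Fs) F h m (\<lambda>i. reps (Fs ! i) h))
        (reps F h \<cdot> tob m Fs (Dom box h)))
     (\<lambda>l J fs. up (length Fs) F l J (\<lambda>i. up m (Fs ! i) l J fs))"

lemma subst_eq_sbst:
  assumes F: "relob (length Fs) F" and Fs: "relobs m Fs"
  shows "subst C p R M F (m, Fs) = sbst F m Fs"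
proof -
  let ?n = "length Fs"
  have 1: "rfun (subst C p R M F (m, Fs)) l = rfun (sbst F m Fs) l" for l
  proof (cases "l \<in> levels p")
    case True
    interpret icategory C "FO R l" by (rule icategory_at[OF True])
    note r = relob_rfun_eq[OF F True]
    have "fm (rfun F l) \<cdot> tob m Fs l = idn (FO R l) \<cdot> (ofo F l \<cdot> tob m Fs l)"
      by (subst r(1)) (simp add: comp_assoc[OF tob_hom[OF Fs True] r(2) idn_hom])
    then show ?thesis
      using True by (simp add: subst_def sbst_def Let_def FO_dpow disc_fun_def)
  qed (simp add: subst_def sbst_def Let_def mkrel_def)
  have 2: "reps (subst C p R M F (m, Fs)) h = reps (sbst F m Fs) h" for h
  proof (cases "h \<in> degens p")
    case True
    let ?r = "Rn m (retraction p h)" and ?l = "Cod box h"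
    have "tuple C ?n (X1 ?l) (Pw m (Dom box h)) (\<lambda>i. reps (Fs ! i) h) \<cdot> ?r =
        tuple C ?n (X1 ?l) (Pw m ?l) (\<lambda>i. reps (Fs ! i) h \<cdot> ?r)"
      by (rule good_vec_tuple_comp[OF good_vec_reps[OF Fs True] box_levels(6)[OF True] Rn_retraction(1)[OF True]])
    then show ?thesis
      using True by (simp add: subst_def sbst_def Let_def ux_def FA_dpow degens_box retraction_box)
  qed (simp add: subst_def sbst_def Let_def mkrel_def)
  have 3: "rups (subst C p R M F (m, Fs)) l f = rups (sbst F m Fs) l f" for l f
  proof (cases "l \<in> levels p \<and> (\<exists>k. f \<in> ups_dom C R M l k m)")
    case True
    then obtain k where l: "l \<in> levels p" and f: "f \<in> ups_dom C R M l k m" by blast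
    show ?thesis
      using True ups_dom_good_vec(2,3)[OF f l] by (simp add: subst_def sbst_def Let_def mkrel_def)
  qed (auto simp: subst_def sbst_def Let_def mkrel_def)
  show ?thesis
    by (intro relob.equality ext) (simp_all add: 1 2 3)
qed

context
  fixes F m Fs
  assumes F: "relob (length Fs) F" and Fs: "relobs m Fs"
begin

lemma ofo_sbst: "l \<in> levels p \<Longrightarrow> ofo (sbst F m Fs) l = ofo F l \<cdot> tob m Fs l"
  by (simp add: sbst_def)

lemma reps_sbst: "h \<in> degens p \<Longrightarrow> reps (sbst F m Fs) h =
    icomp C (FO R (Cod box h)) (ux (length Fs) F h m (\<lambda>i. reps (Fs ! i) h))
        (reps F h \<cdot> tob m Fs (Dom box h))"
  by (simp add: sbst_def)

lemma sbst_up_cong: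
  assumes "l \<in> levels p" "\<And>i. i < m \<Longrightarrow> fs i = gs i"
  shows "up (length Fs) F l J (\<lambda>i. up m (Fs ! i) l J fs) = up (length Fs) F l J (\<lambda>i. up m (Fs ! i) l J gs)"
  using assms by (intro up_cong[OF F] up_cong[OF relobs_nth[OF Fs]]) auto

lemma up_sbst:
  assumes v: "good_vec l m (Pw k l) fs A B" and l: "l \<in> levels p"
  shows "up m (sbst F m Fs) l (Pw k l) fs = up (length Fs) F l (Pw k l) (\<lambda>i. up m (Fs ! i) l (Pw k l) fs)"
  unfolding sbst_def using sbst_up_cong[OF l] by (rule up_mkrel[OF _ v l])

text \<open>The two halves of the composite witness meet at \<open>ofo F\<close> applied to the
  degenerated tuple: \<epsilon> of the outer type first pulls the degeneracy inside, and the action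
  of that type then applies the inner witnesses.\<close>

lemma
  assumes h: "h \<in> degens p"
  shows reps_comp_tob: "reps F h \<cdot> tob m Fs (Dom box h) \<in>
      ihom C (FO R (Cod box h)) (Rh h \<cdot> (ofo F (Dom box h) \<cdot> tob m Fs (Dom box h)))
        (ofo F (Cod box h) \<cdot> (Rn (length Fs) h \<cdot> tob m Fs (Dom box h)))"
    and reps_comp_tob_M: "reps F h \<cdot> tob m Fs (Dom box h) \<in> M (Cod box h)"
    and ux_reps: "ux (length Fs) F h m (\<lambda>i. reps (Fs ! i) h) \<in>
      ihom C (FO R (Cod box h)) (ofo F (Cod box h) \<cdot> (Rn (length Fs) h \<cdot> tob m Fs (Dom box h)))
        (ofo F (Cod box h) \<cdot> (tob m Fs (Cod box h) \<cdot> Rn m h))"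
    and ux_reps_M: "ux (length Fs) F h m (\<lambda>i. reps (Fs ! i) h) \<in> M (Cod box h)"
proof -
  note b = degens_box[OF h] and l = box_levels(5,6)[OF h]
  note t = tob_hom[OF Fs l(1)] and a = relob_rfun_eq(2)[OF F l(1)] and a' = relob_rfun_eq(2)[OF F l(2)]
  note e = relob_degen[OF F h]
  have t': "tob m Fs (Dom box h) \<in> hom C (Pw m (Dom box h)) (Dom C (Rh h \<cdot> ofo F (Dom box h)))"
    using t homD(2)[OF comp_hom[OF Rh_hom[OF b] a]] by simp
  show "reps F h \<cdot> tob m Fs (Dom box h) \<in>
      ihom C (FO R (Cod box h)) (Rh h \<cdot> (ofo F (Dom box h) \<cdot> tob m Fs (Dom box h)))
        (ofo F (Cod box h) \<cdot> (Rn (length Fs) h \<cdot> tob m Fs (Dom box h)))"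
    using icategory.ihom_comp[OF icategory_at[OF l(2)] e(2) t']
    by (simp add: comp_assoc[OF t a Rh_hom[OF b]] comp_assoc[OF t Rn_hom[OF b] a'])
  show "reps F h \<cdot> tob m Fs (Dom box h) \<in> M (Cod box h)"
    by (rule M_comp[OF l(2) e t'])
  note v = good_vec_reps[OF Fs h]
  show "ux (length Fs) F h m (\<lambda>i. reps (Fs ! i) h) \<in>
      ihom C (FO R (Cod box h)) (ofo F (Cod box h) \<cdot> (Rn (length Fs) h \<cdot> tob m Fs (Dom box h)))
        (ofo F (Cod box h) \<cdot> (tob m Fs (Cod box h) \<cdot> Rn m h))"
    using ux_ihom[OF F h v] by (simp add: Rn_tob[OF Fs b] tob_comp[OF Fs l(2) Rn_hom[OF b]])
  show "ux (length Fs) F h m (\<lambda>i. reps (Fs ! i) h) \<in> M (Cod box h)"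
    by (rule ux_M[OF F h v])
qed

lemma relob_sbst: "relob m (sbst F m Fs)"
  unfolding sbst_def
proof (rule relob_mkrel)
  fix l assume l: "l \<in> levels p"
  interpret icategory C "FO R l" by (rule icategory_at[OF l])
  note a = relob_rfun_eq(2)[OF F l] and t = tob_hom[OF Fs l]
  show "ofo F l \<cdot> tob m Fs l \<in> hom C (Pw m l) (X0 l)"
    by (rule comp_hom[OF a t])
  \<comment> \<open>End points of the nested action: the inner types applied to \<open>A\<close>
    form \<open>tob\<close> after the tuple of \<open>A\<close>, so the end points are those of the
    composite object arrow.\<close>
  have T: "ofo F l \<cdot> tuple C (length Fs) (X0 l) (Pw k l) (\<lambda>i. ofo (Fs ! i) l \<cdot> tuple C m (X0 l) (Pw k l) A) =
      ofo F l \<cdot> tob m Fs l \<cdot> tuple C m (X0 l) (Pw k l) A"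
    if "\<And>i. i < m \<Longrightarrow> A i \<in> hom C (Pw k l) (X0 l)" for A k
  proof -
    have u: "tuple C m (X0 l) (Pw k l) A \<in> hom C (Pw k l) (Pw m l)"
      using that l by (intro tuple_hom) auto
    show ?thesis
      by (simp add: tob_comp[OF Fs l u, symmetric] comp_assoc[OF u t a])
  qed
  show "iso_action l m (ofo F l \<cdot> tob m Fs l) (\<lambda>J fs. up (length Fs) F l J (\<lambda>i. up m (Fs ! i) l J fs))"
    unfolding iso_action_def
  proof (intro conjI allI impI ballI)
    fix J :: 'o and fs gs :: "nat \<Rightarrow> 'a"
    assume "\<forall>i<m. fs i = gs i"
    then show "up (length Fs) F l J (\<lambda>i. up m (Fs ! i) l J fs) = up (length Fs) F l J (\<lambda>i. up m (Fs ! i) l J gs)"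
      by (intro sbst_up_cong[OF l]) simp
  next
    fix k fs A B
    assume v: "good_vec l m (Pw k l) fs A B"
    note w = good_vec_up[OF Fs l v]
    show "up (length Fs) F l (Pw k l) (\<lambda>i. up m (Fs ! i) l (Pw k l) fs) \<in> M l"
      by (rule up_M[OF F l w])
    show "up (length Fs) F l (Pw k l) (\<lambda>i. up m (Fs ! i) l (Pw k l) fs) \<in>
        ihom C (FO R l) (ofo F l \<cdot> tob m Fs l \<cdot> tuple C m (X0 l) (Pw k l) A)
          (ofo F l \<cdot> tob m Fs l \<cdot> tuple C m (X0 l) (Pw k l) B)"
      using up_ihom[OF F l w] T[of A k] T[of B k] good_vecD(2)[OF v] good_vec_tgt[OF v l] by simp
  next
    fix k A
    assume "\<forall>i<m. A i \<in> hom C (Pw k l) (X0 l)"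
    then have A: "\<And>i. i < m \<Longrightarrow> A i \<in> hom C (Pw k l) (X0 l)" by blast
    have u: "tuple C m (X0 l) (Pw k l) A \<in> hom C (Pw k l) (Pw m l)"
      using A l by (intro tuple_hom) auto
    have "up (length Fs) F l (Pw k l) (\<lambda>i. up m (Fs ! i) l (Pw k l) (\<lambda>i. idn (FO R l) \<cdot> A i)) =
        up (length Fs) F l (Pw k l) (\<lambda>i. idn (FO R l) \<cdot> (ofo (Fs ! i) l \<cdot> tuple C m (X0 l) (Pw k l) A))"
      by (rule up_cong[OF F l]) (rule up_idn[OF relobs_nth[OF Fs] l A])
    also have "\<dots> = idn (FO R l) \<cdot> (ofo F l \<cdot> tob m Fs l \<cdot> tuple C m (X0 l) (Pw k l) A)"
      using up_idn[OF F l comp_hom[OF ofo_nth_hom[OF Fs l] u]] T[OF A] by simp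
    finally show "up (length Fs) F l (Pw k l) (\<lambda>i. up m (Fs ! i) l (Pw k l) (\<lambda>i. idn (FO R l) \<cdot> A i)) =
        idn (FO R l) \<cdot> (ofo F l \<cdot> tob m Fs l \<cdot> tuple C m (X0 l) (Pw k l) A)" .
  next
    fix k fs gs A B D
    assume "good_vec l m (Pw k l) fs A B \<and> good_vec l m (Pw k l) gs B D"
    then have v: "good_vec l m (Pw k l) fs A B" and w: "good_vec l m (Pw k l) gs B D" by auto
    have "up (length Fs) F l (Pw k l) (\<lambda>i. up m (Fs ! i) l (Pw k l) (\<lambda>i. icomp C (FO R l) (gs i) (fs i))) =
        up (length Fs) F l (Pw k l) (\<lambda>i. icomp C (FO R l) (up m (Fs ! i) l (Pw k l) gs) (up m (Fs ! i) l (Pw k l) fs))"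
      by (rule up_cong[OF F l]) (rule up_icomp[OF relobs_nth[OF Fs] l v w])
    also have "\<dots> = icomp C (FO R l) (up (length Fs) F l (Pw k l) (\<lambda>i. up m (Fs ! i) l (Pw k l) gs))
        (up (length Fs) F l (Pw k l) (\<lambda>i. up m (Fs ! i) l (Pw k l) fs))"
      by (rule up_icomp[OF F l good_vec_up[OF Fs l v] good_vec_up[OF Fs l w]])
    finally show "up (length Fs) F l (Pw k l) (\<lambda>i. up m (Fs ! i) l (Pw k l) (\<lambda>i. icomp C (FO R l) (gs i) (fs i))) =
        icomp C (FO R l) (up (length Fs) F l (Pw k l) (\<lambda>i. up m (Fs ! i) l (Pw k l) gs))
        (up (length Fs) F l (Pw k l) (\<lambda>i. up m (Fs ! i) l (Pw k l) fs))" .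
  next
    fix k k' fs A B u
    assume u: "u \<in> hom C (Pw k' l) (Pw k l)" and v: "good_vec l m (Pw k l) fs A B"
    have "up (length Fs) F l (Pw k l) (\<lambda>i. up m (Fs ! i) l (Pw k l) fs) \<cdot> u =
        up (length Fs) F l (Pw k' l) (\<lambda>i. up m (Fs ! i) l (Pw k l) fs \<cdot> u)"
      by (rule up_comp[OF F l good_vec_up[OF Fs l v] u])
    also have "\<dots> = up (length Fs) F l (Pw k' l) (\<lambda>i. up m (Fs ! i) l (Pw k' l) (\<lambda>i. fs i \<cdot> u))"
      by (rule up_cong[OF F l]) (rule up_comp[OF relobs_nth[OF Fs] l v u])
    finally show "up (length Fs) F l (Pw k l) (\<lambda>i. up m (Fs ! i) l (Pw k l) fs) \<cdot> u =
        up (length Fs) F l (Pw k' l) (\<lambda>i. up m (Fs ! i) l (Pw k' l) (\<lambda>i. fs i \<cdot> u))" .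
  qed
next
  fix h assume h: "h \<in> faces p"
  note b = faces_box[OF h] and l = box_levels(3,4)[OF h]
  note t = tob_hom[OF Fs] and a = relob_rfun_eq(2)[OF F]
  have "Rh h \<cdot> (ofo F (Dom box h) \<cdot> tob m Fs (Dom box h)) =
      ofo F (Cod box h) \<cdot> (Rn (length Fs) h \<cdot> tob m Fs (Dom box h))"
    by (simp add: comp_assoc[OF t[OF l(1)] a[OF l(1)] Rh_hom[OF b]] relob_face[OF F h]
        comp_assoc[OF t[OF l(1)] Rn_hom[OF b] a[OF l(2)]])
  then show "Rh h \<cdot> (ofo F (Dom box h) \<cdot> tob m Fs (Dom box h)) = ofo F (Cod box h) \<cdot> tob m Fs (Cod box h) \<cdot> Rn m h"
    by (simp add: tob_face[OF Fs h] comp_assoc[OF Rn_hom[OF b] t[OF l(2)] a[OF l(2)]])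
next
  fix h assume h: "h \<in> degens p"
  note b = degens_box[OF h] and l = box_levels(5,6)[OF h]
  let ?e = "icomp C (FO R (Cod box h)) (ux (length Fs) F h m (\<lambda>i. reps (Fs ! i) h)) (reps F h \<cdot> tob m Fs (Dom box h))"
  show "?e \<in> M (Cod box h)"
    by (rule M_icomp[OF l(2) reps_comp_tob_M[OF h] ux_reps_M[OF h] reps_comp_tob[OF h] ux_reps[OF h]])
  show "?e \<in> ihom C (FO R (Cod box h)) (Rh h \<cdot> (ofo F (Dom box h) \<cdot> tob m Fs (Dom box h)))
      (ofo F (Cod box h) \<cdot> tob m Fs (Cod box h) \<cdot> Rn m h)"
    using icategory.icomp_ihom[OF icategory_at[OF l(2)] ux_reps[OF h] reps_comp_tob[OF h]]
    by (simp add: comp_assoc[OF Rn_hom[OF b] tob_hom[OF Fs l(2)] relob_rfun_eq(2)[OF F l(2)]])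
qed

text \<open>At the upper level the action of a composite is a nested action.
  \<open>ux_retract\<close> identifies the inner actions on retracted families with the retracted
  inner extensions, so the nesting passes to the extension.\<close>

lemma ux_sbst:
  assumes h: "h \<in> degens p" and v: "good_vec (Cod box h) m (Pw k (Dom box h)) es A B"
  shows "ux m (sbst F m Fs) h k es = ux (length Fs) F h k (\<lambda>i. ux m (Fs ! i) h k es)"
proof -
  let ?r = "Rn k (retraction p h)" and ?l = "Cod box h"
  note l = box_levels(6)[OF h]
  note w = good_vec_retract[OF F h v]
  have "up (length Fs) F ?l (Pw k ?l) (\<lambda>i. up m (Fs ! i) ?l (Pw k ?l) (\<lambda>i. es i \<cdot> ?r)) =
    up (length Fs) F ?l (Pw k ?l) (\<lambda>i. ux m (Fs ! i) h k es \<cdot> ?r)"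
    by (rule up_cong[OF F l]) (rule ux_retract[OF relobs_nth[OF Fs] h v, symmetric])
  then show ?thesis
    by (simp add: ux_def[of m "sbst F m Fs"] ux_def[of "length Fs" F] up_sbst[OF w l])
qed

end

lemma good_vec_ux:
  assumes Fs: "relobs m Fs" and h: "h \<in> degens p" and v: "good_vec (Cod box h) m (Pw k (Dom box h)) es A B"
  shows "good_vec (Cod box h) (length Fs) (Pw k (Dom box h)) (\<lambda>i. ux m (Fs ! i) h k es)
    (\<lambda>i. ofo (Fs ! i) (Cod box h) \<cdot> tuple C m (X0 (Cod box h)) (Pw k (Dom box h)) A)
    (\<lambda>i. ofo (Fs ! i) (Cod box h) \<cdot> tuple C m (X0 (Cod box h)) (Pw k (Dom box h)) B)"
  unfolding good_vec_def
  using ux_M[OF relobs_nth[OF Fs] h v] ux_ihom[OF relobs_nth[OF Fs] h v] good_vecD(1)[OF v]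
    comp_hom[OF ofo_nth_hom[OF Fs] good_vec_tuple(2)[OF v]] box_levels(6)[OF h] by auto

lemma relobs_sbst:
  "relobs (length Es) Fs \<Longrightarrow> relobs k Es \<Longrightarrow> relobs k (map (\<lambda>F. sbst F k Es) Fs)"
  using relob_sbst by auto

lemma tob_sbst:
  assumes Fs: "relobs (length Es) Fs" and Es: "relobs k Es" and l: "l \<in> levels p"
  shows "tob k (map (\<lambda>F. sbst F k Es) Fs) l = tob (length Es) Fs l \<cdot> tob k Es l"
  unfolding tob_comp[OF Fs l tob_hom[OF Es l]]
  unfolding tuple_ob_def using ofo_sbst[OF relobs_nth[OF Fs] Es l] by (auto intro!: tuple_cong simp: tuple_ob_def)

text \<open>Both witnesses are threefold composites: \<epsilon> of \<open>G\<close>, the image under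
  \<open>G\<close> of the \<epsilon> of \<open>Fs\<close>, and the image under \<open>G\<close> and
  \<open>Fs\<close> of the \<epsilon> of \<open>Es\<close>. They differ in bracketing and in where
  functoriality of \<open>G\<close> and reindexing along \<open>Es\<close> are applied;
  \<open>ux_sbst\<close>, \<open>ux_comp\<close> and \<open>ux_icomp\<close> provide these
  moves.\<close>

lemma sbst_assoc:
  assumes G: "relob (length Fs) G" and Fs: "relobs (length Es) Fs" and Es: "relobs k Es"
  shows "sbst (sbst G (length Es) Fs) k Es = sbst G k (map (\<lambda>F. sbst F k Es) Fs)"
proof (rule relob_eqI)
  let ?m = "length Es" and ?n = "length Fs"
  let ?GF = "sbst G (length Es) Fs" and ?FE = "map (\<lambda>F. sbst F k Es) Fs"
  have GF: "relob (length Es) ?GF"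
    by (rule relob_sbst[OF G Fs])
  have FE: "relobs k ?FE"
    by (rule relobs_sbst[OF Fs Es])
  have G': "relob (length ?FE) G"
    using G by simp
  show "relob k (sbst ?GF k Es)"
    by (rule relob_sbst[OF GF Es])
  show "relob k (sbst G k ?FE)"
    by (rule relob_sbst[OF G' FE])
  { fix l assume l: "l \<in> levels p"
    show "ofo (sbst ?GF k Es) l = ofo (sbst G k ?FE) l"
      by (simp add: ofo_sbst[OF GF Es l] ofo_sbst[OF G Fs l] ofo_sbst[OF G' FE l] tob_sbst[OF Fs Es l]
          comp_assoc[OF tob_hom[OF Es l] tob_hom[OF Fs l] relob_rfun_eq(2)[OF G l]])
    fix j fs A B
    assume v: "good_vec l k (Pw j l) fs A B"
    note w = good_vec_up[OF Es l v]
    have "up ?n G l (Pw j l) (\<lambda>i. up ?m (Fs ! i) l (Pw j l) (\<lambda>i. up k (Es ! i) l (Pw j l) fs)) =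
        up ?n G l (Pw j l) (\<lambda>i. up k (?FE ! i) l (Pw j l) fs)"
      by (rule up_cong[OF G l]) (simp add: up_sbst[OF relobs_nth[OF Fs] Es v l])
    then show "up k (sbst ?GF k Es) l (Pw j l) fs = up k (sbst G k ?FE) l (Pw j l) fs"
      by (simp add: up_sbst[OF GF Es v l] up_sbst[OF G Fs w l] up_sbst[OF G' FE v l]) }
  fix h assume h: "h \<in> degens p"
  note b = degens_box[OF h] and l = box_levels(5,6)[OF h]
  interpret icategory C "FO R (Cod box h)" by (rule icategory_at[OF l(2)])
  let ?l1 = "Dom box h" and ?l2 = "Cod box h"
  let ?icomp = "icomp C (FO R ?l2)"
  let ?eE = "\<lambda>i. reps (Es ! i) h" and ?eF = "\<lambda>i. reps (Fs ! i) h"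
  let ?x = "\<lambda>i. ux ?m (Fs ! i) h k ?eE" and ?y = "\<lambda>i. ?eF i \<cdot> tob k Es ?l1"
  note tE = tob_hom[OF Es l(1)] and tF = tob_hom[OF Fs l(1)]
  note vE = good_vec_reps[OF Es h] and vF = good_vec_reps[OF Fs h]
  have eFE: "reps (?FE ! i) h = ?icomp (?x i) (?y i)" if "i < ?n" for i
    using that reps_sbst[OF relobs_nth[OF Fs that] Es h] by simp
  have vx: "good_vec ?l2 ?n (Pw k ?l1) ?x (\<lambda>i. ofo (Fs ! i) ?l2 \<cdot> (Rn ?m h \<cdot> tob k Es ?l1))
      (\<lambda>i. ofo (Fs ! i) ?l2 \<cdot> (tob k Es ?l2 \<cdot> Rn k h))"
    using good_vec_ux[OF Fs h vE] by (simp add: Rn_tob[OF Es b] tob_comp[OF Es l(2) Rn_hom[OF b]])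
  have vy: "good_vec ?l2 ?n (Pw k ?l1) ?y (\<lambda>i. Rh h \<cdot> ofo (Fs ! i) ?l1 \<cdot> tob k Es ?l1)
      (\<lambda>i. ofo (Fs ! i) ?l2 \<cdot> (Rn ?m h \<cdot> tob k Es ?l1))"
    using good_vec_comp[OF vF tE l(2)]
    by (simp add: good_vec_def comp_assoc[OF tE Rn_hom[OF b] ofo_nth_hom[OF Fs l(2)]])
  note a = reps_comp_tob[OF G Fs h]
  have tE': "tob k Es ?l1 \<in> hom C (Pw k ?l1) (Dom C (Rh h \<cdot> (ofo G ?l1 \<cdot> tob ?m Fs ?l1)))"
    using tE homD(2)[OF comp_hom[OF Rh_hom[OF b] comp_hom[OF relob_rfun_eq(2)[OF G l(1)] tF]]] by simp
  have tR: "tuple C ?n (X0 ?l2) (Pw ?m ?l1) (\<lambda>i. Rh h \<cdot> ofo (Fs ! i) ?l1) \<in> hom C (Pw ?m ?l1) (Pw ?n ?l2)"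
    using comp_hom[OF Rn_hom[OF b] tF] by (simp add: Rn_tob[OF Fs b])
  have q: "tuple C ?n (X0 ?l2) (Pw ?m ?l1) (\<lambda>i. Rh h \<cdot> ofo (Fs ! i) ?l1) \<cdot> tob k Es ?l1 =
      tuple C ?n (X0 ?l2) (Pw k ?l1) (\<lambda>i. Rh h \<cdot> ofo (Fs ! i) ?l1 \<cdot> tob k Es ?l1)"
    by (rule tuple_comp[OF X0_Ob[OF l(2)] _ tE]) (rule comp_hom[OF Rh_hom[OF b] ofo_nth_hom[OF Fs l(1)]])
  have eG: "reps G h \<in> hom C (Pw ?n ?l1) (X1 ?l2)"
    by (rule ihom_at[OF relob_degen(2)[OF G h] comp_hom[OF Rh_hom[OF b] relob_rfun_eq(2)[OF G l(1)]]])
  have "reps (sbst ?GF k Es) h = ?icomp (ux ?n G h k ?x) (?icomp (ux ?n G h ?m ?eF) (reps G h \<cdot> tob ?m Fs ?l1) \<cdot> tob k Es ?l1)"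
    by (simp add: reps_sbst[OF GF Es h] reps_sbst[OF G Fs h] ux_sbst[OF G Fs h vE])
  \<comment> \<open>Reindexing along \<open>tob k Es\<close> enters first the composite and then the
    action of \<open>G\<close>.\<close>
  also have "\<dots> = ?icomp (ux ?n G h k ?x) (?icomp (ux ?n G h k ?y) (reps G h \<cdot> tob ?m Fs ?l1 \<cdot> tob k Es ?l1))"
    by (simp add: icomp_comp[OF a ux_reps[OF G Fs h] tE'] ux_comp[OF G h vF tE])
  also have "\<dots> = ?icomp (?icomp (ux ?n G h k ?x) (ux ?n G h k ?y)) (reps G h \<cdot> tob ?m Fs ?l1 \<cdot> tob k Es ?l1)"
  proof (rule icomp_assoc)
    show "reps G h \<cdot> tob ?m Fs ?l1 \<cdot> tob k Es ?l1 \<in> ihom C (FO R ?l2)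
        (Rh h \<cdot> (ofo G ?l1 \<cdot> tob ?m Fs ?l1) \<cdot> tob k Es ?l1)
        (ofo G ?l2 \<cdot> tuple C ?n (X0 ?l2) (Pw k ?l1) (\<lambda>i. Rh h \<cdot> ofo (Fs ! i) ?l1 \<cdot> tob k Es ?l1))"
      using ihom_comp[OF a tE'] q
      by (simp add: Rn_tob[OF Fs b] comp_assoc[OF tE tR relob_rfun_eq(2)[OF G l(2)], symmetric])
    show "ux ?n G h k ?y \<in> ihom C (FO R ?l2)
        (ofo G ?l2 \<cdot> tuple C ?n (X0 ?l2) (Pw k ?l1) (\<lambda>i. Rh h \<cdot> ofo (Fs ! i) ?l1 \<cdot> tob k Es ?l1))
        (ofo G ?l2 \<cdot> tuple C ?n (X0 ?l2) (Pw k ?l1) (\<lambda>i. ofo (Fs ! i) ?l2 \<cdot> (Rn ?m h \<cdot> tob k Es ?l1)))"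
      by (rule ux_ihom[OF G h vy])
    show "ux ?n G h k ?x \<in> ihom C (FO R ?l2)
        (ofo G ?l2 \<cdot> tuple C ?n (X0 ?l2) (Pw k ?l1) (\<lambda>i. ofo (Fs ! i) ?l2 \<cdot> (Rn ?m h \<cdot> tob k Es ?l1)))
        (ofo G ?l2 \<cdot> tuple C ?n (X0 ?l2) (Pw k ?l1) (\<lambda>i. ofo (Fs ! i) ?l2 \<cdot> (tob k Es ?l2 \<cdot> Rn k h)))"
      by (rule ux_ihom[OF G h vx])
  qed
  \<comment> \<open>Functoriality merges the two images under \<open>G\<close> into the image of the
    composites, which by \<open>eFE\<close> are the witnesses of the substituted
    \<open>Fs\<close>.\<close>
  also have "?icomp (ux ?n G h k ?x) (ux ?n G h k ?y) = ux ?n G h k (\<lambda>i. ?icomp (?x i) (?y i))"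
    by (rule ux_icomp[OF G h vy vx, symmetric])
  also have "\<dots> = ux ?n G h k (\<lambda>i. reps (?FE ! i) h)"
    by (rule ux_cong[OF G h]) (simp only: eFE)
  finally show "reps (sbst ?GF k Es) h = reps (sbst G k ?FE) h"
    by (simp add: reps_sbst[OF G' FE h] tob_sbst[OF Fs Es l(1)] comp_assoc[OF tE tF eG])
qed

section \<open>Projections as units for substitution\<close>

abbreviation "prj n i \<equiv> proj C p R M n i"
abbreviation "prjs n \<equiv> map (proj C p R M n) [0..<n]"

lemma proj_eq_mkrel:
  "prj n i = mkrel n (\<lambda>l. pow_pr C n (X0 l) i)
     (\<lambda>h. idn (FO R (Cod box h)) \<cdot> (Rh h \<cdot> pow_pr C n (X0 (Dom box h)) i)) (\<lambda>l J fs. fs i)"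
  unfolding proj_def mkrel_def
  by (intro relob.equality ext) (auto simp: FO_dpow Let_def disc_fun_def)

lemma ofo_proj: "l \<in> levels p \<Longrightarrow> ofo (prj n i) l = pow_pr C n (X0 l) i"
  by (simp add: proj_eq_mkrel)

lemma reps_proj: "h \<in> degens p \<Longrightarrow> reps (prj n i) h =
    idn (FO R (Cod box h)) \<cdot> (Rh h \<cdot> pow_pr C n (X0 (Dom box h)) i)"
  by (simp add: proj_eq_mkrel)

lemma relob_proj:
  assumes i: "i < n"
  shows "relob n (prj n i)"
  unfolding proj_eq_mkrel
proof (rule relob_mkrel)
  fix l assume l: "l \<in> levels p"
  show "pow_pr C n (X0 l) i \<in> hom C (Pw n l) (X0 l)"
    using l i by simp
  have t: "pow_pr C n (X0 l) i \<cdot> tuple C n (X0 l) J A = A i"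
    if "J \<in> Ob C" "\<And>i. i < n \<Longrightarrow> A i \<in> hom C J (X0 l)" for J A
    using that l i by (simp add: pr_tuple)
  show "iso_action l n (pow_pr C n (X0 l) i) (\<lambda>J fs. fs i)"
    unfolding iso_action_def
  proof (intro conjI allI impI ballI)
    fix m fs A B
    assume v: "good_vec l n (Pw m l) fs A B"
    show "fs i \<in> M l"
      using good_vecD(3)[OF v i] .
    show "fs i \<in> ihom C (FO R l) (pow_pr C n (X0 l) i \<cdot> tuple C n (X0 l) (Pw m l) A)
        (pow_pr C n (X0 l) i \<cdot> tuple C n (X0 l) (Pw m l) B)"
      using good_vecD(4)[OF v i] t[OF good_vecD(1,2)[OF v]] t[OF good_vecD(1)[OF v] good_vec_tgt[OF v l]]
      by simp
  qed (use i t l in auto)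
next
  fix h assume h: "h \<in> faces p"
  show "Rh h \<cdot> pow_pr C n (X0 (Dom box h)) i = pow_pr C n (X0 (Cod box h)) i \<cdot> Rn n h"
    by (rule pr_pow_map[OF Rh_hom[OF faces_box[OF h]] i, symmetric])
next
  fix h assume h: "h \<in> degens p"
  note b = degens_box[OF h] and l = box_levels(5,6)[OF h]
  note c = comp_hom[OF Rh_hom[OF b] pow_pr_hom[OF X0_Ob[OF l(1)] i]]
  show "idn (FO R (Cod box h)) \<cdot> (Rh h \<cdot> pow_pr C n (X0 (Dom box h)) i) \<in> M (Cod box h)"
    by (rule M_idn[OF l(2) c])
  show "idn (FO R (Cod box h)) \<cdot> (Rh h \<cdot> pow_pr C n (X0 (Dom box h)) i) \<in>
      ihom C (FO R (Cod box h)) (Rh h \<cdot> pow_pr C n (X0 (Dom box h)) i) (pow_pr C n (X0 (Cod box h)) i \<cdot> Rn n h)"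
    using icategory.idn_ihom[OF icategory_at[OF l(2)] c] pr_pow_map[OF Rh_hom[OF b] i] by simp
qed

lemma up_proj:
  assumes "i < n" "good_vec l n (Pw m l) fs A B" "l \<in> levels p"
  shows "up n (prj n i) l (Pw m l) fs = fs i"
  unfolding proj_eq_mkrel using assms by (intro up_mkrel) auto

lemma ux_proj:
  assumes i: "i < n" and h: "h \<in> degens p" and v: "good_vec (Cod box h) n (Pw m (Dom box h)) es A B"
  shows "ux n (prj n i) h m es = es i"
  using up_proj[OF i good_vec_retract[OF relob_proj[OF i] h v] box_levels(6)[OF h]]
    section_cancel[OF relob_proj[OF i] h good_vec_hom[OF v box_levels(6)[OF h] i]]
  by (simp add: ux_def)

lemma relobs_prjs: "relobs n (prjs n)" "k \<le> n \<Longrightarrow> relobs n (map (prj n) [0..<k])"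
  using relob_proj by auto

lemma tob_prjs:
  assumes l: "l \<in> levels p"
  shows "tob n (prjs n) l = Ident C (Pw n l)"
proof -
  have "tob n (prjs n) l = tuple C n (X0 l) (Pw n l) (\<lambda>i. pow_pr C n (X0 l) i \<cdot> Ident C (Pw n l))"
    unfolding tuple_ob_def using l by (auto intro!: tuple_cong simp: ofo_proj)
  then show ?thesis
    using tuple_pr[of "X0 l" "Ident C (Pw n l)" "Pw n l" n] l by simp
qed

text \<open>The witnesses of projections are identities, so the action of \<open>F\<close> sends
  them to an identity and only \<epsilon> of \<open>F\<close> remains.\<close>

lemma sbst_prjs:
  assumes F: "relob n F"
  shows "sbst F n (prjs n) = F"
proof (rule relob_eqI[OF _ F])
  have F': "relob (length (prjs n)) F" using F by simp
  show "relob n (sbst F n (prjs n))"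
    by (rule relob_sbst[OF F' relobs_prjs(1)])
  { fix l assume l: "l \<in> levels p"
    show "ofo (sbst F n (prjs n)) l = ofo F l"
      using homD[OF relob_rfun_eq(2)[OF F l]] by (simp add: ofo_sbst[OF F' relobs_prjs(1) l] tob_prjs[OF l])
    fix m fs A B
    assume v: "good_vec l n (Pw m l) fs A B"
    have "up n F l (Pw m l) (\<lambda>i. up n (prjs n ! i) l (Pw m l) fs) = up n F l (Pw m l) fs"
      by (rule up_cong[OF F l]) (simp add: up_proj[OF _ v l])
    then show "up n (sbst F n (prjs n)) l (Pw m l) fs = up n F l (Pw m l) fs"
      by (simp add: up_sbst[OF F' relobs_prjs(1) v l]) }
  fix h assume h: "h \<in> degens p"
  note b = degens_box[OF h] and l = box_levels(5,6)[OF h]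
  interpret icategory C "FO R (Cod box h)" by (rule icategory_at[OF l(2)])
  let ?c = "\<lambda>i. Rh h \<cdot> pow_pr C n (X0 (Dom box h)) i"
  have c: "?c i \<in> hom C (Pw n (Dom box h)) (X0 (Cod box h))" if "i < n" for i
    by (rule comp_hom[OF Rh_hom[OF b] pow_pr_hom[OF X0_Ob[OF l(1)] that]])
  have "ux n F h n (\<lambda>i. reps (prjs n ! i) h) = ux n F h n (\<lambda>i. idn (FO R (Cod box h)) \<cdot> ?c i)"
    by (rule ux_cong[OF F h]) (simp add: reps_proj[OF h])
  also have "\<dots> = idn (FO R (Cod box h)) \<cdot> (ofo F (Cod box h) \<cdot> Rn n h)"
    using ux_idn[OF F h c] by (simp add: pow_map_eq[OF Rh_hom[OF b]])
  finally show "reps (sbst F n (prjs n)) h = reps F h"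
    using relob_degen(2)[OF F h]
      ihom_at[OF relob_degen(2)[OF F h] comp_hom[OF Rh_hom[OF b] relob_rfun_eq(2)[OF F l(1)]]]
    by (simp add: reps_sbst[OF F' relobs_prjs(1) h] tob_prjs[OF l(1)] homD icomp_idl)
qed

lemma sbst_proj:
  assumes Fs: "relobs m Fs" and i: "i < length Fs"
  shows "sbst (prj (length Fs) i) m Fs = Fs ! i"
proof (rule relob_eqI[OF _ relobs_nth[OF Fs i]])
  let ?n = "length Fs"
  note P = relob_proj[OF i]
  show "relob m (sbst (prj ?n i) m Fs)"
    by (rule relob_sbst[OF P Fs])
  { fix l assume l: "l \<in> levels p"
    show "ofo (sbst (prj ?n i) m Fs) l = ofo (Fs ! i) l"
      by (simp add: ofo_sbst[OF P Fs l] ofo_proj[OF l] pr_tob[OF Fs l i])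
    fix k fs A B
    assume v: "good_vec l m (Pw k l) fs A B"
    show "up m (sbst (prj ?n i) m Fs) l (Pw k l) fs = up m (Fs ! i) l (Pw k l) fs"
      by (simp add: up_sbst[OF P Fs v l] up_proj[OF i good_vec_up[OF Fs l v] l]) }
  fix h assume h: "h \<in> degens p"
  note b = degens_box[OF h] and l = box_levels(5,6)[OF h]
  interpret icategory C "FO R (Cod box h)" by (rule icategory_at[OF l(2)])
  note pr = pow_pr_hom[OF X0_Ob[OF l(1)] i] and t = tob_hom[OF Fs l(1)]
  have "idn (FO R (Cod box h)) \<cdot> (Rh h \<cdot> pow_pr C ?n (X0 (Dom box h)) i) \<cdot> tob m Fs (Dom box h) =
      idn (FO R (Cod box h)) \<cdot> (Rh h \<cdot> ofo (Fs ! i) (Dom box h))"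
    using idn_comp[OF comp_hom[OF Rh_hom[OF b] pr] t] pr_tob[OF Fs l(1) i]
    by (simp add: comp_assoc[OF t pr Rh_hom[OF b], symmetric])
  then show "reps (sbst (prj ?n i) m Fs) h = reps (Fs ! i) h"
    by (simp add: reps_sbst[OF P Fs h] reps_proj[OF h] ux_proj[OF i h good_vec_reps[OF Fs h]]
        icomp_idr[OF relob_degen(2)[OF relobs_nth[OF Fs i] h]])
qed

subsection \<open>The category of contexts\<close>

abbreviation "CTX \<equiv> Ctx C p R M"

lemma Ctx_simps [simp]:
  "Ob CTX = UNIV" "Dom CTX u = fst u" "Cod CTX u = length (snd u)" "Ident CTX n = (n, prjs n)"
  by (simp_all add: Ctx_def split: prod.splits)

lemma Ctx_Ar [simp]: "(n, Fs) \<in> Ar CTX \<longleftrightarrow> relobs n Fs"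
  by (simp add: Ctx_def RelCat_def)

lemma Ctx_hom: "u \<in> hom CTX n m \<longleftrightarrow> (\<exists>Fs. u = (n, Fs) \<and> length Fs = m \<and> relobs n Fs)"
  by (cases u) (auto simp: hom_def)

lemma Ctx_comp:
  assumes "relobs (length Fs) Gs" "relobs n Fs"
  shows "(length Fs, Gs) \<cdot>\<^bsub>CTX\<^esub> (n, Fs) = (n, map (\<lambda>G. sbst G n Fs) Gs)"
  using assms by (auto simp: Ctx_def subst_eq_sbst)

lemma map_sbst_prjs: "relobs n Fs \<Longrightarrow> map (\<lambda>F. sbst F n (prjs n)) Fs = Fs"
  by (auto intro!: map_idI sbst_prjs)

text \<open>Truncation at \<open>k\<close> covers two uses: the full length gives the left unit law
  of contexts, and one less gives the first projection of a context extension.\<close>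

lemma map_sbst_proj:
  assumes "relobs m Fs" "k \<le> length Fs"
  shows "map (\<lambda>F. sbst F m Fs) (map (prj (length Fs)) [0..<k]) = take k Fs"
  using assms by (intro nth_equalityI) (auto simp: sbst_proj)

lemma category_Ctx: "category CTX"
  unfolding category_def
proof (intro conjI ballI impI)
  fix f assume f: "f \<in> Ar CTX"
  obtain n Fs where f_eq: "f = (n, Fs)" by (cases f)
  have Fs: "relobs n Fs" using f by (simp add: f_eq)
  show "f \<cdot>\<^bsub>CTX\<^esub> Ident CTX (Dom CTX f) = f"
    using Ctx_comp[of Fs "prjs n" n] Fs relobs_prjs(1)[of n] map_sbst_prjs[OF Fs] by (simp add: f_eq)
  show "Ident CTX (Cod CTX f) \<cdot>\<^bsub>CTX\<^esub> f = f"
    using Ctx_comp[of "prjs (length Fs)" Fs n] Fs relobs_prjs(1)[of "length Fs"] map_sbst_proj[OF Fs order_refl]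
    by (simp add: f_eq)
  fix g assume g: "g \<in> Ar CTX"
  obtain m Gs where g_eq: "g = (m, Gs)" by (cases g)
  { assume "Dom CTX g = Cod CTX f"
    then have m: "m = length Fs" by (simp add: f_eq g_eq)
    then have Gs: "relobs (length Fs) Gs" using g by (simp add: g_eq)
    have G: "relobs n (map (\<lambda>G. sbst G n Fs) Gs)"
      by (rule relobs_sbst[OF Gs Fs])
    show "g \<cdot>\<^bsub>CTX\<^esub> f \<in> hom CTX (Dom CTX f) (Cod CTX g)"
      using G by (simp add: f_eq g_eq m Ctx_comp[OF Gs Fs] Ctx_hom) }
  fix h assume h: "h \<in> Ar CTX" and "Dom CTX g = Cod CTX f \<and> Dom CTX h = Cod CTX g"
  moreover obtain k Hs where h_eq: "h = (k, Hs)" by (cases h)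
  ultimately have m: "m = length Fs" and k: "k = length Gs" by (simp_all add: f_eq g_eq h_eq)
  have Gs: "relobs (length Fs) Gs" and Hs: "relobs (length Gs) Hs" using g h by (auto simp: g_eq h_eq m k)
  have Hs': "relobs (length (map (\<lambda>G. sbst G n Fs) Gs)) Hs" using Hs by simp
  have "h \<cdot>\<^bsub>CTX\<^esub> g \<cdot>\<^bsub>CTX\<^esub> f = (n, map (\<lambda>F. sbst F n Fs) (map (\<lambda>F. sbst F (length Fs) Gs) Hs))"
    by (simp only: f_eq g_eq h_eq m k Ctx_comp[OF Hs Gs] Ctx_comp[OF relobs_sbst[OF Hs Gs] Fs])
  also have "\<dots> = (n, map (\<lambda>F. sbst F n (map (\<lambda>G. sbst G n Fs) Gs)) Hs)"
    using sbst_assoc[OF _ Gs Fs] Hs by simp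
  also have "\<dots> = h \<cdot>\<^bsub>CTX\<^esub> (g \<cdot>\<^bsub>CTX\<^esub> f)"
    using Ctx_comp[OF Hs' relobs_sbst[OF Gs Fs]] by (simp add: f_eq g_eq h_eq m k Ctx_comp[OF Gs Fs])
  finally show "h \<cdot>\<^bsub>CTX\<^esub> g \<cdot>\<^bsub>CTX\<^esub> f = h \<cdot>\<^bsub>CTX\<^esub> (g \<cdot>\<^bsub>CTX\<^esub> f)" .
qed (use relobs_prjs in \<open>auto simp: Ctx_hom\<close>)

lemma Ctx_terminal: "is_terminal CTX 0"
  unfolding is_terminal_def by (auto simp: Ctx_hom)

lemma Ctx_products: "products_with CTX 1 (\<lambda>n. n + 1) (ctx_fst C p R M) (ctx_snd C p R M)"
  unfolding products_with_def is_product_def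
proof (intro ballI conjI)
  fix n :: nat
  show "n + 1 \<in> Ob CTX" by simp
  show "ctx_fst C p R M n \<in> hom CTX (n + 1) n" "ctx_snd C p R M n \<in> hom CTX (n + 1) 1"
    using relob_proj[of _ "n + 1"] by (auto simp: ctx_fst_def ctx_snd_def Ctx_hom)
  have Q: "relobs (n + 1) (map (prj (n + 1)) [0..<n])" "relobs (n + 1) [prj (n + 1) n]"
    using relob_proj[of _ "n + 1"] by auto
  fix k f g
  assume "f \<in> hom CTX k n" "g \<in> hom CTX k 1"
  then obtain Fs Gs where f: "f = (k, Fs)" "length Fs = n" "relobs k Fs"
    and g: "g = (k, Gs)" "length Gs = 1" "relobs k Gs" by (auto simp: Ctx_hom)
  have proj: "ctx_fst C p R M n \<cdot>\<^bsub>CTX\<^esub> (k, Hs) = (k, take n Hs)"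
    "ctx_snd C p R M n \<cdot>\<^bsub>CTX\<^esub> (k, Hs) = (k, [Hs ! n])"
    if "length Hs = n + 1" "relobs k Hs" for Hs
    using Ctx_comp[of _ Hs k] that Q map_sbst_proj[OF that(2), of n] sbst_proj[OF that(2), of n]
    by (simp_all add: ctx_fst_def ctx_snd_def)
  show "\<exists>!u. u \<in> hom CTX k (n + 1) \<and> ctx_fst C p R M n \<cdot>\<^bsub>CTX\<^esub> u = f \<and> ctx_snd C p R M n \<cdot>\<^bsub>CTX\<^esub> u = g"
  \<comment> \<open>Pairing is concatenation, and the two projections take a list of length
    \<open>n + 1\<close> apart again.\<close>
  proof (rule ex1I[of _ "(k, Fs @ Gs)"])
    show "(k, Fs @ Gs) \<in> hom CTX k (n + 1) \<and> ctx_fst C p R M n \<cdot>\<^bsub>CTX\<^esub> (k, Fs @ Gs) = f \<and>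
        ctx_snd C p R M n \<cdot>\<^bsub>CTX\<^esub> (k, Fs @ Gs) = g"
      using f g proj[of "Fs @ Gs"] by (cases Gs) (auto simp: Ctx_hom nth_append)
  next
    fix u
    assume u: "u \<in> hom CTX k (n + 1) \<and> ctx_fst C p R M n \<cdot>\<^bsub>CTX\<^esub> u = f \<and> ctx_snd C p R M n \<cdot>\<^bsub>CTX\<^esub> u = g"
    then obtain Hs where H: "u = (k, Hs)" "length Hs = n + 1" "relobs k Hs" by (auto simp: Ctx_hom)
    have "Fs = take n Hs" "Gs = [Hs ! n]"
      using u proj[OF H(2,3)] f g by (auto simp: H)
    then show "u = (k, Fs @ Gs)"
      using H by (simp flip: take_Suc_conv_app_nth)
  qed
qed

section \<open>The split fibration\<close>

abbreviation "relar n \<equiv> is_relar C p R n"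
abbreviation "GRO \<equiv> IntRel C p R M"
abbreviation "lft \<equiv> subst_lift C p R M"
abbreviation "nid \<equiv> nat_ident C p R"
abbreviation "ncmp \<equiv> nat_comp C p R"

text \<open>Naturality has vanished: the domain is discrete, so at each level a transformation is
  just a morphism between the object arrows. Preservation of faces and degeneracies by
  \<open>F\<close> and \<open>G\<close> is part of their being relational types.\<close>

lemma is_relar_iff:
  assumes F: "relob n F" and G: "relob n G"
  shows "relar n F t G \<longleftrightarrow>
    (\<forall>l\<in>levels p. t l \<in> ihom C (FO R l) (ofo F l) (ofo G l)) \<and>
    (\<forall>h\<in>faces p. fm (FA R h) \<cdot> t (Dom box h) = t (Cod box h) \<cdot> Rn n h) \<and>
    (\<forall>h\<in>degens p. icomp C (FO R (Cod box h)) (t (Cod box h) \<cdot> Rn n h) (reps F h) =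
       icomp C (FO R (Cod box h)) (reps G h) (fm (FA R h) \<cdot> t (Dom box h))) \<and>
    (\<forall>l. l \<notin> levels p \<longrightarrow> t l = undefined)"
proof -
  have "internal_nat C (rfun F l) (rfun G l) (t l) \<longleftrightarrow> t l \<in> ihom C (FO R l) (ofo F l) (ofo G l)"
    if l: "l \<in> levels p" for l
    using internal_nat_disc_fun_iff[OF internal_at[OF l] relob_rfun_eq(2)[OF F l] relob_rfun_eq(2)[OF G l]]
      relob_rfun_eq(1)[OF F l] relob_rfun_eq(1)[OF G l] by simp
  moreover have "face_preserving C p (dpow C R n) R (rfun F)" "face_preserving C p (dpow C R n) R (rfun G)"
    "degen_preserving C p (dpow C R n) R (rfun F) (reps F)"
    "degen_preserving C p (dpow C R n) R (rfun G) (reps G)"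
    using F G by (auto simp: is_relob_def)
  moreover have "fo (FA (dpow C R n) h) = Rn n h" for h
    by (simp add: cpow_def disc_def fpow_def fdisc_def)
  ultimately show ?thesis
    by (simp add: is_relar_def cubical_nat_def face_preserving_nat_def degen_preserving_nat_def)
qed

lemma relarI:
  assumes "relob n F" "relob n G"
    and "\<And>l. l \<in> levels p \<Longrightarrow> t l \<in> ihom C (FO R l) (ofo F l) (ofo G l)"
    and "\<And>h. h \<in> faces p \<Longrightarrow> fm (FA R h) \<cdot> t (Dom box h) = t (Cod box h) \<cdot> Rn n h"
    and "\<And>h. h \<in> degens p \<Longrightarrow> icomp C (FO R (Cod box h)) (t (Cod box h) \<cdot> Rn n h) (reps F h) =
       icomp C (FO R (Cod box h)) (reps G h) (fm (FA R h) \<cdot> t (Dom box h))"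
    and "\<And>l. l \<notin> levels p \<Longrightarrow> t l = undefined"
  shows "relar n F t G"
  using assms by (simp add: is_relar_iff)

lemma relarD:
  assumes "relob n F" "relob n G" "relar n F t G"
  shows "l \<in> levels p \<Longrightarrow> t l \<in> ihom C (FO R l) (ofo F l) (ofo G l)"
    and "h \<in> faces p \<Longrightarrow> fm (FA R h) \<cdot> t (Dom box h) = t (Cod box h) \<cdot> Rn n h"
    and "h \<in> degens p \<Longrightarrow> icomp C (FO R (Cod box h)) (t (Cod box h) \<cdot> Rn n h) (reps F h) =
       icomp C (FO R (Cod box h)) (reps G h) (fm (FA R h) \<cdot> t (Dom box h))"
    and "l \<notin> levels p \<Longrightarrow> t l = undefined"
  using assms by (simp_all add: is_relar_iff)

lemma relar_nid:
  assumes F: "relob n F"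
  shows "relar n F (nid F) F"
proof (rule relarI[OF F F])
  note a = relob_rfun_eq(2)[OF F]
  show "nid F l \<in> ihom C (FO R l) (ofo F l) (ofo F l)" if l: "l \<in> levels p" for l
    using icategory.idn_ihom[OF icategory_at[OF l] a[OF l]] l by (simp add: nat_ident_def)
  show "fm (FA R h) \<cdot> nid F (Dom box h) = nid F (Cod box h) \<cdot> Rn n h" if h: "h \<in> faces p" for h
    using R_idn[OF faces_box[OF h] a[OF box_levels(3)[OF h]]] relob_face[OF F h]
      icategory.idn_comp[OF icategory_at[OF box_levels(4)[OF h]] a[OF box_levels(4)[OF h]] Rn_hom[OF faces_box[OF h]]]
    by (simp add: nat_ident_def box_levels[of h] h)
  show "icomp C (FO R (Cod box h)) (nid F (Cod box h) \<cdot> Rn n h) (reps F h) =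
      icomp C (FO R (Cod box h)) (reps F h) (fm (FA R h) \<cdot> nid F (Dom box h))" if h: "h \<in> degens p" for h
  proof -
    note b = degens_box[OF h] and l = box_levels(5,6)[OF h]
    interpret icategory C "FO R (Cod box h)" by (rule icategory_at[OF l(2)])
    show ?thesis
      using R_idn[OF b a[OF l(1)]] idn_comp[OF a[OF l(2)] Rn_hom[OF b]] l
        icomp_idl[OF relob_degen(2)[OF F h]] icomp_idr[OF relob_degen(2)[OF F h]]
      by (simp add: nat_ident_def)
  qed
qed (simp add: nat_ident_def)

lemma nid_tob:
  assumes F: "relob (length Us) F" and U: "relobs k Us" and l: "l \<in> levels p"
  shows "nid F l \<cdot> tob k Us l = nid (sbst F k Us) l"
  using icategory.idn_comp[OF icategory_at[OF l] relob_rfun_eq(2)[OF F l] tob_hom[OF U l]]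
  by (simp add: nat_ident_def l ofo_sbst[OF F U l])

text \<open>Agreement of \<open>s\<close> with \<open>nid\<close> is demanded only on
  \<open>levels p\<close>: in a composite with a lift, \<open>s\<close> is a reindexed identity,
  which is not normalized to \<open>undefined\<close> elsewhere.\<close>

lemma ncmp_nid_left:
  assumes "relob n F" "relob n G" "relar n F t G" "\<And>l. l \<in> levels p \<Longrightarrow> s l = nid G l"
  shows "ncmp s t = t"
proof
  fix l
  show "ncmp s t l = t l"
    using icategory.icomp_idl[OF icategory_at relarD(1)[OF assms(1-3)], of l] assms(4)[of l] relarD(4)[OF assms(1-3), of l]
    by (simp add: nat_comp_def nat_ident_def)
qed

lemma GRO_Ob [simp]: "(n, F) \<in> Ob GRO \<longleftrightarrow> relob n F"
  by (simp add: IntRel_def RelCat_def)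

lemma GRO_simps [simp]:
  "Dom GRO (a, c, b) = a" "Cod GRO (a, c, b) = b"
  "Ident GRO (n, F) = ((n, F), ((n, prjs n), nid F), (n, F))"
  by (simp_all add: IntRel_def)

lemma GRO_Ar:
  "((n, F), ((k, Us), t), (m, G)) \<in> Ar GRO \<longleftrightarrow>
    k = n \<and> m = length Us \<and> relob n F \<and> relob m G \<and> relobs n Us \<and> relar n F t (sbst G n Us)"
proof -
  have *: "relob n (subst C p R M G (n, Us))" "subst C p R M G (n, Us) = sbst G n Us"
    if "relob (length Us) G" "relobs n Us"
    using subst_eq_sbst[OF that] relob_sbst[OF that] by simp_all
  show ?thesis
    unfolding IntRel_def RelCat_def using * by (auto simp: Ctx_hom)
qed

lemma GRO_ArE:
  assumes "f \<in> Ar GRO"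
  obtains n F Us t G where "f = ((n, F), ((n, Us), t), (length Us, G))" "relob n F" "relob (length Us) G"
    "relobs n Us" "relar n F t (sbst G n Us)"
proof -
  obtain n F k Us t m G where "f = ((n, F), ((k, Us), t), (m, G))"
    by (metis prod.exhaust)
  with assms that show ?thesis by (auto simp: GRO_Ar)
qed

lemma GRO_comp:
  assumes "relobs (length Us) Vs" "relobs n Us"
  shows "(b, ((length Us, Vs), t), c) \<cdot>\<^bsub>GRO\<^esub> (a, ((n, Us), s), b') =
    (a, ((n, map (\<lambda>V. sbst V n Us) Vs), ncmp (\<lambda>l. t l \<cdot> tob n Us l) s), c)"
  by (simp add: IntRel_def Ctx_comp[OF assms])

lemma forget_simps [simp]: "FO forget (n, F) = n" "FA forget (a, (u, t), b) = u"
  by (simp_all add: forget_def)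

lemma lft_eq:
  "relob (length Us) G \<Longrightarrow> relobs n Us \<Longrightarrow>
    lft (n, Us) (length Us, G) = ((n, sbst G n Us), ((n, Us), nid (sbst G n Us)), (length Us, G))"
  by (simp add: subst_lift_def Let_def subst_eq_sbst)

lemma lft_Ar: "relob (length Us) G \<Longrightarrow> relobs n Us \<Longrightarrow> lft (n, Us) (length Us, G) \<in> Ar GRO"
  by (simp add: lft_eq GRO_Ar relob_sbst relar_nid)

text \<open>A lift carries the identity transformation, so composing with it alters the base arrow
  and leaves \<open>t\<close> untouched.\<close>

lemma lft_comp:
  assumes U: "relobs n Us" and G: "relob (length Us) G" and F: "relob k F" and W: "relobs k Ws" "length Ws = n"
    and t: "relar k F t (sbst (sbst G n Us) k Ws)"
  shows "lft (n, Us) (length Us, G) \<cdot>\<^bsub>GRO\<^esub> ((k, F), ((k, Ws), t), b) =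
    ((k, F), ((k, map (\<lambda>V. sbst V k Ws) Us), t), (length Us, G))"
proof -
  have U': "relobs (length Ws) Us" using U W by simp
  have GU: "relob (length Ws) (sbst G n Us)" using relob_sbst[OF G U] W by simp
  have "ncmp (\<lambda>l. nid (sbst G n Us) l \<cdot> tob k Ws l) t = t"
    by (rule ncmp_nid_left[OF F relob_sbst[OF GU W(1)] t]) (rule nid_tob[OF GU W(1)])
  then show ?thesis
    using GRO_comp[OF U' W(1)] by (simp add: lft_eq[OF G U] W(2))
qed

text \<open>By associativity of substitution, \<open>t\<close> has the same type over the composite
  base arrow as over the factor \<open>w\<close>. The filler is therefore \<open>t\<close> itself
  placed over \<open>w\<close>, and \<open>lft_comp\<close> leaves no other choice.\<close>

lemma cartesian_lft:
  assumes U: "relobs n Us" and G: "relob (length Us) G"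
  shows "cartesian GRO CTX forget (lft (n, Us) (length Us, G))"
  unfolding cartesian_def
proof (intro conjI ballI impI)
  let ?f = "lft (n, Us) (length Us, G)"
  show "?f \<in> Ar GRO" by (rule lft_Ar[OF G U])
  fix g w
  assume "g \<in> Ar GRO" and cod: "Cod GRO g = Cod GRO ?f"
    and w: "w \<in> hom CTX (FO forget (Dom GRO g)) (FO forget (Dom GRO ?f))"
    and eq: "FA forget ?f \<cdot>\<^bsub>CTX\<^esub> w = FA forget g"
  from this(1) obtain k F Vs t H where g: "g = ((k, F), ((k, Vs), t), (length Vs, H))"
    and F: "relob k F" and H: "relob (length Vs) H" and V: "relobs k Vs" and t: "relar k F t (sbst H k Vs)"
    by (rule GRO_ArE)
  have len: "length Vs = length Us" and HG: "H = G"
    using cod by (simp_all add: g lft_eq[OF G U])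
  obtain Ws where w_eq: "w = (k, Ws)" and W: "length Ws = n" "relobs k Ws"
    using w by (auto simp: Ctx_hom g lft_eq[OF G U])
  have Vs: "Vs = map (\<lambda>V. sbst V k Ws) Us"
    using eq Ctx_comp[of Us Ws k] W U by (simp add: g lft_eq[OF G U] w_eq)
  have GUW: "sbst (sbst G n Us) k Ws = sbst G k Vs"
    using sbst_assoc[of Us G Ws k] G U W Vs by simp
  have GU: "relob n (sbst G n Us)" by (rule relob_sbst[OF G U])
  show "\<exists>!j. j \<in> hom GRO (Dom GRO g) (Dom GRO ?f) \<and> FA forget j = w \<and> ?f \<cdot>\<^bsub>GRO\<^esub> j = g"
  proof (rule ex1I[of _ "((k, F), ((k, Ws), t), (n, sbst G n Us))"])
    show "((k, F), ((k, Ws), t), (n, sbst G n Us)) \<in> hom GRO (Dom GRO g) (Dom GRO ?f) \<and>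
        FA forget ((k, F), ((k, Ws), t), (n, sbst G n Us)) = w \<and>
        ?f \<cdot>\<^bsub>GRO\<^esub> ((k, F), ((k, Ws), t), (n, sbst G n Us)) = g"
      using lft_comp[OF U G F W(2,1)] t F GU W GUW
      by (simp add: hom_def g w_eq GRO_Ar lft_eq[OF G U] HG len Vs)
  next
    fix j
    assume j: "j \<in> hom GRO (Dom GRO g) (Dom GRO ?f) \<and> FA forget j = w \<and> ?f \<cdot>\<^bsub>GRO\<^esub> j = g"
    then have "j \<in> Ar GRO" by (simp add: hom_def)
    then obtain k' F' Ws' t' X where j_eq: "j = ((k', F'), ((k', Ws'), t'), (length Ws', X))"
      and t': "relar k' F' t' (sbst X k' Ws')"
      by (rule GRO_ArE)
    then have *: "j = ((k, F), ((k, Ws), t'), (n, sbst G n Us))"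
      using j by (auto simp: hom_def g w_eq lft_eq[OF G U])
    then have "relar k F t' (sbst (sbst G n Us) k Ws)"
      using t' j_eq by simp
    then have "t' = t"
      using lft_comp[OF U G F W(2,1)] j by (simp add: * g)
    then show "j = ((k, F), ((k, Ws), t), (n, sbst G n Us))"
      by (simp add: *)
  qed
qed

lemma functor_forget:
  shows "is_functor GRO CTX forget"
  unfolding is_functor_def
proof (intro conjI ballI impI)
  fix f assume "f \<in> Ar GRO"
  then obtain n F Us s G where f: "f = ((n, F), ((n, Us), s), (length Us, G))" "relobs n Us"
    by (rule GRO_ArE)
  then show "FA forget f \<in> hom CTX (FO forget (Dom GRO f)) (FO forget (Cod GRO f))"
    by (simp add: Ctx_hom)
  fix g assume "g \<in> Ar GRO" and d: "Dom GRO g = Cod GRO f"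
  from this(1) obtain m G' Vs t H where g: "g = ((m, G'), ((m, Vs), t), (length Vs, H))" "relobs m Vs"
    by (rule GRO_ArE)
  then show "FA forget (g \<cdot>\<^bsub>GRO\<^esub> f) = FA forget g \<cdot>\<^bsub>CTX\<^esub> FA forget f"
    using f d GRO_comp[of Vs Us n] Ctx_comp[of Vs Us n] by simp
qed auto

text \<open>Splitness asks for equalities, not isomorphisms: the unit and associativity laws for
  \<open>sbst\<close> identify the domains of the lifts, and the transformations are identities on
  both sides.\<close>

lemma split_fibration_forget:
  assumes "category GRO"
  shows "split_fibration GRO CTX forget lft"
  unfolding split_fibration_def
proof (intro conjI ballI impI)
  show "category GRO" "category CTX" "is_functor GRO CTX forget"
    using assms category_Ctx functor_forget by auto
  fix X assume X: "X \<in> Ob GRO"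
  obtain m G where X_eq: "X = (m, G)" by (cases X)
  have G: "relob m G" using X by (simp add: X_eq)
  show "lft (Ident CTX (FO forget X)) X = Ident GRO X"
    using lft_eq[of "prjs m" G m] G relobs_prjs(1)[of m] by (simp add: X_eq sbst_prjs)
  { fix u assume u: "u \<in> Ar CTX" "FO forget X = Cod CTX u"
    then obtain n Us where "u = (n, Us)" "relobs n Us" "m = length Us"
      by (cases u) (auto simp: X_eq)
    then show "cartesian GRO CTX forget (lft u X)" "Cod GRO (lft u X) = X" "FA forget (lft u X) = u"
      using G cartesian_lft by (simp_all add: X_eq lft_eq) }
  fix u v
  assume uv: "u \<in> Ar CTX" "v \<in> Ar CTX" "Dom CTX v = Cod CTX u \<and> FO forget X = Cod CTX v"
  then obtain n Us Vs where u: "u = (n, Us)" "relobs n Us" and v: "v = (length Us, Vs)" "relobs (length Us) Vs"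
    and m: "m = length Vs"
    by (cases u; cases v) (auto simp: X_eq)
  have G': "relob (length Vs) G" using G m by simp
  have GV: "relob (length Us) (sbst G (length Us) Vs)" by (rule relob_sbst[OF G' v(2)])
  note a = sbst_assoc[OF G' v(2) u(2)]
  have n: "relar n (sbst (sbst G (length Us) Vs) n Us) (nid (sbst (sbst G (length Us) Vs) n Us))
      (sbst (sbst G (length Us) Vs) n Us)"
    by (rule relar_nid[OF relob_sbst[OF GV u(2)]])
  have "relobs n (map (\<lambda>V. sbst V n Us) Vs)"
    by (rule relobs_sbst[OF v(2) u(2)])
  then show "lft (v \<cdot>\<^bsub>CTX\<^esub> u) X = lft v X \<cdot>\<^bsub>GRO\<^esub> lft u (Dom GRO (lft v X))"
    using lft_comp[OF v(2) G' relob_sbst[OF GV u(2)] u(2) refl n]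
      lft_eq[of "map (\<lambda>V. sbst V n Us) Vs" G n] G'
    by (simp add: u v m X_eq Ctx_comp[OF v(2) u(2)] lft_eq[OF G' v(2)] lft_eq[OF GV u(2)] a)
qed

lemma FO_reindex:
  "relob (length Us) G \<Longrightarrow> relobs n Us \<Longrightarrow>
    FO (reindex GRO CTX forget lft (n, Us)) (length Us, G) = (n, sbst G n Us)"
  by (simp add: reindex_def lft_eq)

lemma split_generic: "split_generic_object GRO CTX forget lft 1"
  unfolding split_generic_object_def
\<comment> \<open>An arrow into 1 is a one-element list, so taking its head is a bijection onto the
  objects over \<open>n\<close>. Naturality then unfolds to composition in the base.\<close>
proof (intro conjI exI[of _ "\<lambda>n u. (n, hd (snd u))"] ballI)
  show "1 \<in> Ob CTX" by simp
  fix n :: nat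
  show "bij_betw (\<lambda>u. (n, hd (snd u))) (hom CTX n 1) (Ob (fibre GRO CTX forget n))"
    by (rule bij_betw_byWitness[where f' = "\<lambda>X. (n, [snd X])"])
      (auto simp: Ctx_hom fibre_def length_Suc_conv)
next
  fix u w assume "u \<in> Ar CTX" "w \<in> hom CTX (Cod CTX u) 1"
  then obtain n Us F where u: "u = (n, Us)" "relobs n Us" and w: "w = (length Us, [F])" "relob (length Us) F"
    by (cases u) (auto simp: Ctx_hom length_Suc_conv)
  then show "(Dom CTX u, hd (snd (w \<cdot>\<^bsub>CTX\<^esub> u))) =
      FO (reindex GRO CTX forget lft u) (Cod CTX u, hd (snd w))"
    using Ctx_comp[of "[F]" Us n] by (simp add: FO_reindex)
qed

lemma comp_Rn_ihom:
  assumes F: "relob n F" and h: "h \<in> box_ars p" and t: "t \<in> ihom C (FO R (Cod box h)) (ofo F (Cod box h)) B"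
  shows "t \<cdot> Rn n h \<in> ihom C (FO R (Cod box h)) (ofo F (Cod box h) \<cdot> Rn n h) (B \<cdot> Rn n h)"
  using Rn_hom[OF h, of n] relob_rfun_eq(2)[OF F box_levels(2)[OF h]]
  by (intro icategory.ihom_comp[OF icategory_at[OF box_levels(2)[OF h]] t]) (simp add: homD)

lemma icomp_Rn:
  assumes F: "relob n F" and h: "h \<in> box_ars p" and s: "s \<in> ihom C (FO R (Cod box h)) (ofo F (Cod box h)) B"
    and t: "t \<in> ihom C (FO R (Cod box h)) B D"
  shows "icomp C (FO R (Cod box h)) t s \<cdot> Rn n h = icomp C (FO R (Cod box h)) (t \<cdot> Rn n h) (s \<cdot> Rn n h)"
  using Rn_hom[OF h, of n] relob_rfun_eq(2)[OF F box_levels(2)[OF h]]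
  by (intro icategory.icomp_comp[OF icategory_at[OF box_levels(2)[OF h]] s t]) (simp add: homD)

subsection \<open>The fibres\<close>

definition farr :: "nat \<Rightarrow> ('o, 'a) relob \<Rightarrow> (nat \<Rightarrow> 'a) \<Rightarrow> ('o, 'a) relob \<Rightarrow> ('o, 'a) intar" where
  "farr n F t G = ((n, F), ((n, prjs n), t), (n, G))"

abbreviation "FIB n \<equiv> fibre GRO CTX forget n"

lemma FIB_Ob [simp]: "X \<in> Ob (FIB n) \<longleftrightarrow> (\<exists>F. X = (n, F) \<and> relob n F)"
  by (cases X) (auto simp: fibre_def)

lemma FIB_simps [simp]: "Dom (FIB n) = Dom GRO" "Cod (FIB n) = Cod GRO" "Ident (FIB n) = Ident GRO"
  "Comp (FIB n) = Comp GRO"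
  by (simp_all add: fibre_def)

text \<open>\<open>sbst G n (prjs n)\<close> is \<open>G\<close>, so a vertical arrow is an ordinary
  morphism of relational types in context \<open>n\<close>.\<close>

lemma FIB_Ar: "f \<in> Ar (FIB n) \<longleftrightarrow> (\<exists>F t G. f = farr n F t G \<and> relob n F \<and> relob n G \<and> relar n F t G)"
proof
  assume "f \<in> Ar (FIB n)"
  then have f: "f \<in> Ar GRO" "FA forget f = (n, prjs n)" by (auto simp: fibre_def)
  from f(1) obtain k F Us t G where *: "f = ((k, F), ((k, Us), t), (length Us, G))" "relob k F"
    "relob (length Us) G" "relar k F t (sbst G k Us)"
    by (rule GRO_ArE)
  then have "k = n" "Us = prjs n" using f(2) by auto
  then show "\<exists>F t G. f = farr n F t G \<and> relob n F \<and> relob n G \<and> relar n F t G"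
    using * by (auto simp: farr_def sbst_prjs)
next
  assume "\<exists>F t G. f = farr n F t G \<and> relob n F \<and> relob n G \<and> relar n F t G"
  then show "f \<in> Ar (FIB n)"
    using relobs_prjs(1)[of n] by (auto simp: fibre_def farr_def GRO_Ar sbst_prjs)
qed

lemma FIB_hom:
  "f \<in> hom (FIB n) (n, F) (n, G) \<longleftrightarrow> (\<exists>t. f = farr n F t G \<and> relob n F \<and> relob n G \<and> relar n F t G)"
  unfolding hom_def FIB_simps by (auto simp: FIB_Ar) (auto simp: farr_def)

lemma farr_inject [simp]: "farr n F t G = farr n F s G \<longleftrightarrow> t = s"
  by (simp add: farr_def)

text \<open>Composition in \<open>GRO\<close> reindexes the second transformation along the base
  arrow. Here that is the identity context, and \<open>tob\<close> of the projections is an identity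
  of \<open>C\<close>.\<close>

lemma FIB_comp:
  assumes "relob n F" "relob n G" "relob n H" "relar n F s G" "relar n G t H"
  shows "farr n G t H \<cdot>\<^bsub>GRO\<^esub> farr n F s G = farr n F (ncmp t s) H"
proof -
  have "ncmp (\<lambda>l. t l \<cdot> tob n (prjs n) l) s = ncmp t s"
  proof
    fix l
    show "ncmp (\<lambda>l. t l \<cdot> tob n (prjs n) l) s l = ncmp t s l"
      using icategory.ihom_at[OF icategory_at relarD(1)[OF assms(2,3,5)] relob_rfun_eq(2)[OF assms(2)], of l]
      by (auto simp: nat_comp_def tob_prjs homD)
  qed
  then show ?thesis
    using GRO_comp[of "prjs n" "prjs n" n] relobs_prjs(1)[of n] map_sbst_prjs[OF relobs_prjs(1), of n]
    by (simp add: farr_def)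
qed

end

text \<open>Separated from \<open>cubical_model\<close> to mark what rests on \<open>GRO\<close>
  being a category: composition of vertical arrows and reindexing of transformations.\<close>

locale cubical_fibration = cubical_model C p R M
  for C :: "('o, 'a) cat" (structure) and p and R :: "('o, 'a) cubcat" and M :: "nat \<Rightarrow> 'a set" +
  assumes GRO_cat: "category GRO"
begin

sublocale GRO: ccat GRO
  by unfold_locales (rule GRO_cat)

lemma FIB_cat: "category (FIB n)"
proof -
  have "Ident GRO X \<in> hom (FIB n) X X" if X: "X \<in> Ob (FIB n)" for X
    using X relar_nid by (auto simp: FIB_hom farr_def)
  moreover have "Comp GRO g f \<in> hom (FIB n) (Dom GRO f) (Cod GRO g)"
    if f: "f \<in> Ar (FIB n)" and g: "g \<in> Ar (FIB n)" and d: "Dom GRO g = Cod GRO f" for f g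
  proof -
    obtain F s G where f': "f = farr n F s G" "relob n F" "relob n G" "relar n F s G"
      using f by (auto simp: FIB_Ar)
    then obtain t H where g': "g = farr n G t H" "relob n H" "relar n G t H"
      using g d by (auto simp: FIB_Ar farr_def)
    \<comment> \<open>Membership in \<open>GRO\<close> is what yields that the composite is again a
      morphism of relational types.\<close>
    have "Comp GRO g f \<in> Ar GRO"
      using f g d by (intro GRO.comp_Ar) (auto simp: fibre_def)
    then have "farr n F (ncmp t s) H \<in> Ar GRO"
      using f' g' by (simp add: FIB_comp)
    then have "relar n F (ncmp t s) H"
      using g' by (simp add: farr_def GRO_Ar sbst_prjs)
    then show ?thesis
      using f' g' by (auto simp: FIB_hom FIB_comp) (auto simp: farr_def FIB_hom[unfolded farr_def])
  qed
  moreover have "Ar (FIB n) \<subseteq> Ar GRO" by (auto simp: fibre_def)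
  moreover have "Dom GRO f \<in> Ob (FIB n) \<and> Cod GRO f \<in> Ob (FIB n)" if "f \<in> Ar (FIB n)" for f
    using that by (auto simp: FIB_Ar farr_def)
  ultimately show ?thesis
    unfolding category_def FIB_simps
    by (intro conjI ballI impI GRO.id_left GRO.id_right GRO.assoc[symmetric]) auto
qed

lemma relar_ncmp:
  assumes "relob n F" "relob n G" "relob n H" "relar n F s G" "relar n G t H"
  shows "relar n F (ncmp t s) H"
proof -
  interpret F: ccat "FIB n" by unfold_locales (rule FIB_cat)
  have "farr n G t H \<cdot>\<^bsub>FIB n\<^esub> farr n F s G \<in> hom (FIB n) (n, F) (n, H)"
    by (rule F.comp_hom[of _ "(n, G)"]) (use assms in \<open>auto simp: FIB_hom\<close>)
  then show ?thesis
    using FIB_comp[OF assms] by (simp add: FIB_hom)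
qed

text \<open>The reindexed transformation \<open>t[U]\<close>. The explicit default restores the
  normal form that \<open>is_relar\<close> demands outside the levels.\<close>

definition tsub :: "nat \<Rightarrow> ('o, 'a) relob list \<Rightarrow> (nat \<Rightarrow> 'a) \<Rightarrow> nat \<Rightarrow> 'a" where
  "tsub n Us t l = (if l \<in> levels p then t l \<cdot> tob n Us l else undefined)"

context
  fixes n Us F t G
  assumes U: "relobs n Us" and F: "relob (length Us) F" and G: "relob (length Us) G"
    and t: "relar (length Us) F t G"
begin

lemma comp_lft:
  "farr (length Us) F t G \<cdot>\<^bsub>GRO\<^esub> lft (n, Us) (length Us, F) =
    ((n, sbst F n Us), ((n, Us), tsub n Us t), (length Us, G))"
proof -
  have "ncmp (\<lambda>l. t l \<cdot> tob n Us l) (nid (sbst F n Us)) = tsub n Us t"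
  proof
    fix l
    show "ncmp (\<lambda>l. t l \<cdot> tob n Us l) (nid (sbst F n Us)) l = tsub n Us t l"
    proof (cases "l \<in> levels p")
      case True
      interpret icategory C "FO R l" by (rule icategory_at[OF True])
      have "tob n Us l \<in> hom C (Pw n l) (Dom C (ofo F l))"
        using tob_hom[OF U True] relob_rfun_eq(2)[OF F True] by (simp add: homD)
      from icomp_idr[OF ihom_comp[OF relarD(1)[OF F G t True] this]]
      show ?thesis
        using True by (simp add: nat_comp_def tsub_def nat_ident_def ofo_sbst[OF F U True])
    qed (simp add: nat_comp_def tsub_def)
  qed
  then show ?thesis
    using GRO_comp[of "prjs (length Us)" Us n] relobs_prjs(1)[of "length Us"] U map_sbst_proj[OF U order_refl]
    by (simp add: farr_def lft_eq[OF F U])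
qed

text \<open>A direct check on degeneracies would compare \<open>t\<close> with the action of
  \<upsilon> on the witnesses of \<open>Us\<close>, with which it need not commute. Instead,
  \<open>t[U]\<close> is recognized as the transformation of the composite of a vertical arrow with
  a lift, and that composite is an arrow of \<open>GRO\<close>.\<close>

lemma relar_tsub: "relar n (sbst F n Us) (tsub n Us t) (sbst G n Us)"
proof -
  have "farr (length Us) F t G \<in> Ar GRO"
    using F G t relobs_prjs(1)[of "length Us"] by (simp add: farr_def GRO_Ar sbst_prjs)
  then have "farr (length Us) F t G \<cdot>\<^bsub>GRO\<^esub> lft (n, Us) (length Us, F) \<in> Ar GRO"
    using lft_Ar[OF F U] by (intro GRO.comp_Ar) (simp_all add: farr_def lft_eq[OF F U])
  then show ?thesis
    by (simp add: comp_lft GRO_Ar)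
qed

text \<open>The vertical arrow in the description of \<open>reindex\<close> is unique because
  composing it with a lift does not change its transformation.\<close>

lemma FA_reindex:
  "FA (reindex GRO CTX forget lft (n, Us)) (farr (length Us) F t G) =
    farr n (sbst F n Us) (tsub n Us t) (sbst G n Us)"
proof -
  note FU = relob_sbst[OF F U] and GU = relob_sbst[OF G U]
  have *: "lft (n, Us) (length Us, G) \<cdot>\<^bsub>GRO\<^esub> farr n (sbst F n Us) s (sbst G n Us) =
      ((n, sbst F n Us), ((n, Us), s), (length Us, G))"
    if "relar n (sbst F n Us) s (sbst G n Us)" for s
    using lft_comp[OF U G FU relobs_prjs(1), of s] that map_sbst_prjs[OF U] by (simp add: farr_def sbst_prjs[OF GU])
  show ?thesis
    unfolding reindex_def fctr.simps
  proof (rule the_equality)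
    show "farr n (sbst F n Us) (tsub n Us t) (sbst G n Us) \<in> hom (FIB (Dom CTX (n, Us)))
         (Dom GRO (lft (n, Us) (Dom GRO (farr (length Us) F t G))))
         (Dom GRO (lft (n, Us) (Cod GRO (farr (length Us) F t G)))) \<and>
       lft (n, Us) (Cod GRO (farr (length Us) F t G)) \<cdot>\<^bsub>GRO\<^esub> farr n (sbst F n Us) (tsub n Us t) (sbst G n Us) =
       farr (length Us) F t G \<cdot>\<^bsub>GRO\<^esub> lft (n, Us) (Dom GRO (farr (length Us) F t G))"
      using *[OF relar_tsub] comp_lft relar_tsub FU GU
      by (simp add: farr_def lft_eq[OF F U] lft_eq[OF G U] FIB_hom)
  next
    fix g
    assume g: "g \<in> hom (FIB (Dom CTX (n, Us)))
         (Dom GRO (lft (n, Us) (Dom GRO (farr (length Us) F t G))))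
         (Dom GRO (lft (n, Us) (Cod GRO (farr (length Us) F t G)))) \<and>
       lft (n, Us) (Cod GRO (farr (length Us) F t G)) \<cdot>\<^bsub>GRO\<^esub> g =
       farr (length Us) F t G \<cdot>\<^bsub>GRO\<^esub> lft (n, Us) (Dom GRO (farr (length Us) F t G))"
    then have "g \<in> hom (FIB n) (n, sbst F n Us) (n, sbst G n Us)"
      by (simp add: farr_def lft_eq[OF F U] lft_eq[OF G U])
    then obtain s where s: "g = farr n (sbst F n Us) s (sbst G n Us)" "relar n (sbst F n Us) s (sbst G n Us)"
      by (auto simp: FIB_hom)
    have "lft (n, Us) (length Us, G) \<cdot>\<^bsub>GRO\<^esub> g =
       farr (length Us) F t G \<cdot>\<^bsub>GRO\<^esub> lft (n, Us) (length Us, F)"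
      using g by (simp add: farr_def)
    then show "g = farr n (sbst F n Us) (tsub n Us t) (sbst G n Us)"
      using *[OF s(2)] by (simp add: comp_lft s(1))
  qed
qed

end

end

section \<open>Type constructors as relational types\<close>

text \<open>Common interface to \<open>\<times>\<close> and \<open>\<Rightarrow>\<close>.
  Restricting the action to good isomorphisms makes it covariant in both arguments, also for
  \<open>\<Rightarrow>\<close>. The comparison \<open>ep h\<close> is a single arrow, namely the
  isomorphism at the generic pair of objects.\<close>

locale binary_connective = cubical_model C p R M
  for C :: "('o, 'a) cat" (structure) and p and R :: "('o, 'a) cubcat" and M :: "nat \<Rightarrow> 'a set" +
  fixes op :: "nat \<Rightarrow> 'a" and ep :: "cube_ar \<Rightarrow> 'a" and act :: "nat \<Rightarrow> 'a \<Rightarrow> 'a \<Rightarrow> 'a"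
  assumes op_hom: "l \<in> levels p \<Longrightarrow> op l \<in> hom C (Pw 2 l) (X0 l)"
    and op_face: "h \<in> faces p \<Longrightarrow> A \<in> hom C J (X0 (Dom box h)) \<Longrightarrow> B \<in> hom C J (X0 (Dom box h)) \<Longrightarrow>
      Rh h \<cdot> at2 C (op (Dom box h)) A B = at2 C (op (Cod box h)) (Rh h \<cdot> A) (Rh h \<cdot> B)"
    and ep_M: "h \<in> degens p \<Longrightarrow> ep h \<in> M (Cod box h)"
    and ep_ihom: "h \<in> degens p \<Longrightarrow> ep h \<in> ihom C (FO R (Cod box h)) (Rh h \<cdot> op (Dom box h)) (op (Cod box h) \<cdot> Rn 2 h)"
    and act_M: "l \<in> levels p \<Longrightarrow> f \<in> M l \<Longrightarrow> g \<in> M l \<Longrightarrow> f \<in> ihom C (FO R l) A A' \<Longrightarrow>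
      g \<in> ihom C (FO R l) B B' \<Longrightarrow> Dom C A = Dom C B \<Longrightarrow> act l f g \<in> M l"
    and act_ihom: "l \<in> levels p \<Longrightarrow> f \<in> M l \<Longrightarrow> g \<in> M l \<Longrightarrow> f \<in> ihom C (FO R l) A A' \<Longrightarrow>
      g \<in> ihom C (FO R l) B B' \<Longrightarrow> Dom C A = Dom C B \<Longrightarrow>
      act l f g \<in> ihom C (FO R l) (at2 C (op l) A B) (at2 C (op l) A' B')"
    and act_idn: "l \<in> levels p \<Longrightarrow> A \<in> hom C J (X0 l) \<Longrightarrow> B \<in> hom C J (X0 l) \<Longrightarrow>
      act l (idn (FO R l) \<cdot> A) (idn (FO R l) \<cdot> B) = idn (FO R l) \<cdot> at2 C (op l) A B"
    and act_icomp: "l \<in> levels p \<Longrightarrow> f \<in> M l \<Longrightarrow> g \<in> M l \<Longrightarrow> f' \<in> M l \<Longrightarrow> g' \<in> M l \<Longrightarrow>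
      f \<in> ihom C (FO R l) A A' \<Longrightarrow> g \<in> ihom C (FO R l) B B' \<Longrightarrow> Dom C A = Dom C B \<Longrightarrow>
      f' \<in> ihom C (FO R l) A' A'' \<Longrightarrow> g' \<in> ihom C (FO R l) B' B'' \<Longrightarrow>
      act l (icomp C (FO R l) f' f) (icomp C (FO R l) g' g) = icomp C (FO R l) (act l f' g') (act l f g)"
    and act_comp: "l \<in> levels p \<Longrightarrow> f \<in> M l \<Longrightarrow> g \<in> M l \<Longrightarrow> f \<in> ihom C (FO R l) A A' \<Longrightarrow>
      g \<in> ihom C (FO R l) B B' \<Longrightarrow> Dom C A = Dom C B \<Longrightarrow> u \<in> hom C J (Dom C A) \<Longrightarrow>
      act l f g \<cdot> u = act l (f \<cdot> u) (g \<cdot> u)"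
begin

definition bop :: "('o, 'a) relob" where
  "bop = mkrel 2 op ep (\<lambda>l J fs. act l (fs 0) (fs (Suc 0)))"

lemma tuple2:
  assumes "f 0 \<in> hom C J Y" "f (Suc 0) \<in> hom C J Y"
  shows "tuple C 2 Y J f = pair C (f 0) (f (Suc 0))"
  unfolding pair_eq_tuple[OF assms] by (rule tuple_cong) (auto simp: less_2_cases_iff)

lemma good_vec2:
  assumes "good_vec l 2 J fs A B" "l \<in> levels p"
  shows "fs 0 \<in> M l" "fs (Suc 0) \<in> M l" "fs 0 \<in> ihom C (FO R l) (A 0) (B 0)"
    "fs (Suc 0) \<in> ihom C (FO R l) (A (Suc 0)) (B (Suc 0))" "Dom C (A 0) = Dom C (A (Suc 0))"
    "Dom C (A 0) = J"
    "op l \<cdot> tuple C 2 (X0 l) J A = at2 C (op l) (A 0) (A (Suc 0))"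
    "op l \<cdot> tuple C 2 (X0 l) J B = at2 C (op l) (B 0) (B (Suc 0))"
  using good_vecD(2-4)[OF assms(1), where i = 0] good_vecD(2-4)[OF assms(1), where i = "Suc 0"]
    good_vec_tgt[OF assms, of 0] good_vec_tgt[OF assms, of "Suc 0"]
  by (simp_all add: homD at2_def tuple2)

lemma relob_bop: "relob 2 bop"
  unfolding bop_def
proof (rule relob_mkrel)
  fix l assume l: "l \<in> levels p"
  show "op l \<in> hom C (Pw 2 l) (X0 l)" by (rule op_hom[OF l])
  show "iso_action l 2 (op l) (\<lambda>J fs. act l (fs 0) (fs (Suc 0)))"
    unfolding iso_action_def
  proof (intro conjI allI impI ballI)
    fix m fs A B
    assume v: "good_vec l 2 (Pw m l) fs A B"
    note w = good_vec2[OF v l]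
    show "act l (fs 0) (fs (Suc 0)) \<in> M l"
      by (rule act_M[OF l w(1-5)])
    show "act l (fs 0) (fs (Suc 0)) \<in> ihom C (FO R l) (op l \<cdot> tuple C 2 (X0 l) (Pw m l) A) (op l \<cdot> tuple C 2 (X0 l) (Pw m l) B)"
      unfolding w(7,8) by (rule act_ihom[OF l w(1-5)])
  next
    fix m and A :: "nat \<Rightarrow> 'a"
    assume "\<forall>i<2. A i \<in> hom C (Pw m l) (X0 l)"
    then have A: "A 0 \<in> hom C (Pw m l) (X0 l)" "A (Suc 0) \<in> hom C (Pw m l) (X0 l)" by auto
    show "act l (idn (FO R l) \<cdot> A 0) (idn (FO R l) \<cdot> A (Suc 0)) =
        idn (FO R l) \<cdot> (op l \<cdot> tuple C 2 (X0 l) (Pw m l) A)"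
      using act_idn[OF l A] by (simp add: tuple2[of A, OF A] at2_def)
  next
    fix m fs gs A B D
    assume "good_vec l 2 (Pw m l) fs A B \<and> good_vec l 2 (Pw m l) gs B D"
    then have v: "good_vec l 2 (Pw m l) fs A B" and w: "good_vec l 2 (Pw m l) gs B D" by auto
    note v = good_vec2[OF v l] and w = good_vec2[OF w l]
    show "act l (icomp C (FO R l) (gs 0) (fs 0)) (icomp C (FO R l) (gs (Suc 0)) (fs (Suc 0))) =
        icomp C (FO R l) (act l (gs 0) (gs (Suc 0))) (act l (fs 0) (fs (Suc 0)))"
      by (rule act_icomp[OF l v(1,2) w(1,2) v(3-5) w(3,4)])
  next
    fix m m' fs A B k
    assume k: "k \<in> hom C (Pw m' l) (Pw m l)" and v: "good_vec l 2 (Pw m l) fs A B"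
    note w = good_vec2[OF v l]
    show "act l (fs 0) (fs (Suc 0)) \<cdot> k = act l (fs 0 \<cdot> k) (fs (Suc 0) \<cdot> k)"
      using k by (intro act_comp[OF l w(1-5)]) (simp add: w(6))
  qed simp
next
  fix h assume h: "h \<in> faces p"
  note l = box_levels(3,4)[OF h]
  let ?X = "X0 (Dom box h)"
  note r = Rh_hom[OF faces_box[OF h]]
  \<comment> \<open>Evaluating at the two projections recovers \<open>op\<close> itself, as their
    pairing is the identity of \<open>Pw 2\<close>.\<close>
  have "Rh h \<cdot> at2 C (op (Dom box h)) (pow_pr C 2 ?X 0) (pow_pr C 2 ?X (Suc 0)) =
      op (Cod box h) \<cdot> (Rn 2 h \<cdot> pair C (pow_pr C 2 ?X 0) (pow_pr C 2 ?X (Suc 0)))"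
    using op_face[OF h pr0_hom pr1_hom] l pow_map_pair[OF r pr0_hom pr1_hom] by (simp add: at2_def)
  then show "Rh h \<cdot> op (Dom box h) = op (Cod box h) \<cdot> Rn 2 h"
    using l op_hom[OF l(1)] Rn_hom[OF faces_box[OF h], of 2] by (simp add: at2_def pair_pr homD)
qed (auto intro: ep_M ep_ihom)

text \<open>\<open>act\<close> is stable under reindexing at every stage, so the detour through the
  retraction cancels.\<close>

lemma ux_bop:
  assumes h: "h \<in> degens p" and v: "good_vec (Cod box h) 2 (Pw m (Dom box h)) es A B"
  shows "ux 2 bop h m es = act (Cod box h) (es 0) (es (Suc 0))"
proof -
  let ?r = "Rn m (retraction p h)" and ?l = "Cod box h"
  note l = box_levels(6)[OF h]
  note w = good_vec_retract[OF relob_bop h v]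
  note w2 = good_vec2[OF w l]
  have "up 2 bop ?l (Pw m ?l) (\<lambda>i. es i \<cdot> ?r) = act ?l (es 0 \<cdot> ?r) (es (Suc 0) \<cdot> ?r)"
    unfolding bop_def by (rule up_mkrel[OF _ w l]) simp
  moreover have "act ?l (es 0 \<cdot> ?r) (es (Suc 0) \<cdot> ?r) \<cdot> Rn m h = act ?l (es 0 \<cdot> ?r \<cdot> Rn m h) (es (Suc 0) \<cdot> ?r \<cdot> Rn m h)"
    using Rn_hom[OF degens_box[OF h], of m] by (intro act_comp[OF l w2(1-5)]) (simp add: w2(6))
  ultimately show ?thesis
    using section_cancel[OF relob_bop h good_vec_hom[OF v l]] by (simp add: ux_def)
qed

definition bapp :: "nat \<Rightarrow> ('o, 'a) relob \<Rightarrow> ('o, 'a) relob \<Rightarrow> ('o, 'a) relob" where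
  "bapp n F G = sbst bop n [F, G]"

lemma bapp_sbst:
  assumes "relobs n Us" "relob (length Us) F" "relob (length Us) G"
  shows "sbst (bapp (length Us) F G) n Us = bapp n (sbst F n Us) (sbst G n Us)"
  using sbst_assoc[of "[F, G]" bop Us n] assms relob_bop by (simp add: bapp_def numeral_2_eq_2)

context
  fixes n F G
  assumes F: "relob n F" and G: "relob n G"
begin

lemma relobs_FG: "relob (length [F, G]) bop" "relobs n [F, G]"
  using F G relob_bop by (simp_all add: numeral_2_eq_2)

lemma relob_bapp: "relob n (bapp n F G)"
  unfolding bapp_def by (rule relob_sbst[OF relobs_FG])

lemma tob_FG: "l \<in> levels p \<Longrightarrow> tob n [F, G] l = pair C (ofo F l) (ofo G l)"
  using tuple2[of "\<lambda>i. ofo ([F, G] ! i) l" "Pw n l" "X0 l"] relob_rfun_eq(2)[OF F] relob_rfun_eq(2)[OF G]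
  by (simp add: tuple_ob_def numeral_2_eq_2)

lemma ofo_bapp: "l \<in> levels p \<Longrightarrow> ofo (bapp n F G) l = at2 C (op l) (ofo F l) (ofo G l)"
  using ofo_sbst[OF relobs_FG] by (simp add: bapp_def tob_FG at2_def) (simp add: bop_def)

lemma reps_bapp:
  assumes h: "h \<in> degens p"
  shows "reps (bapp n F G) h = icomp C (FO R (Cod box h)) (act (Cod box h) (reps F h) (reps G h))
    (ep h \<cdot> pair C (ofo F (Dom box h)) (ofo G (Dom box h)))"
proof -
  have "reps bop h = ep h" using h by (simp add: bop_def)
  then show ?thesis
    using reps_sbst[OF relobs_FG h] ux_bop[OF h, of n "\<lambda>i. reps ([F, G] ! i) h"] good_vec_reps[OF relobs_FG(2) h]
      tob_FG[OF box_levels(5)[OF h]]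
    by (simp add: bapp_def numeral_2_eq_2)
qed

end

end

text \<open>The choices hidden in the stability conditions are made parameters, except for the
  exponential comparisons, which are chosen later, at the generic pair.\<close>

locale parametric_cubical = cubical_fibration C p R M
  for C :: "('o, 'a) cat" (structure) and p and R :: "('o, 'a) cubcat" and M :: "nat \<Rightarrow> 'a set" +
  fixes T :: "nat \<Rightarrow> 'a" and i :: "cube_ar \<Rightarrow> 'a" and P :: "nat \<Rightarrow> 'a icc" and e :: "cube_ar \<Rightarrow> 'a \<Rightarrow> 'a \<Rightarrow> 'a"
  assumes T: "l \<in> levels p \<Longrightarrow> iterminal C (FO R l) (T l)"
    and T_face: "h \<in> faces p \<Longrightarrow> Rh h \<cdot> T (Dom box h) = T (Cod box h)"
    and i_M: "h \<in> degens p \<Longrightarrow> i h \<in> M (Cod box h)"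
    and i_ihom: "h \<in> degens p \<Longrightarrow> i h \<in> ihom C (FO R (Cod box h)) (Rh h \<cdot> T (Dom box h)) (T (Cod box h))"
    and stable_prod: "stable_products C p R M P e"
    and stable_exp: "stable_exponentials C p R M P e"
begin

lemma iexp_at: "l \<in> levels p \<Longrightarrow> iexponential_category C (FO R l) (P l)"
  using stable_prod stable_exp internal_at
  by unfold_locales (auto simp: stable_products_def stable_exponentials_def)

lemma iprod_at: "l \<in> levels p \<Longrightarrow> iproduct_category C (FO R l) (P l)"
  using iexp_at by (simp add: iexponential_category_def)

lemma M_pmap: "l \<in> levels p \<Longrightarrow> f \<in> M l \<Longrightarrow> g \<in> M l \<Longrightarrow> Dom C f = Dom C g \<Longrightarrow>
    iprod_map C (FO R l) (P l) f g \<in> M l"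
  using stable_prod by (simp add: stable_products_def)

lemma M_emap: "l \<in> levels p \<Longrightarrow> f \<in> M l \<Longrightarrow> g \<in> M l \<Longrightarrow> Dom C f = Dom C g \<Longrightarrow>
    iexp_map C (FO R l) (P l) f g \<in> M l"
  using stable_exp by (simp add: stable_exponentials_def)

lemma ihom_Dom:
  assumes "l \<in> levels p" "f \<in> ihom C (FO R l) A A'" "g \<in> ihom C (FO R l) B B'" "Dom C A = Dom C B"
  shows "Dom C f = Dom C g"
  using homD(2)[OF icategory.ihom_hom[OF icategory_at[OF assms(1)] assms(2)]]
    homD(2)[OF icategory.ihom_hom[OF icategory_at[OF assms(1)] assms(3)]] assms(4) by simp

section \<open>Comparison isomorphisms for products and exponentials\<close>

context
  fixes h J A B
  assumes A: "A \<in> hom C J (X0 (Dom box h))" and B: "B \<in> hom C J (X0 (Dom box h))"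
begin

lemma
  assumes h: "h \<in> faces p"
  shows prd_face: "Rh h \<cdot> at2 C (iprd (P (Dom box h))) A B = at2 C (iprd (P (Cod box h))) (Rh h \<cdot> A) (Rh h \<cdot> B)"
    and fst_face: "fm (FA R h) \<cdot> at2 C (ifst (P (Dom box h))) A B = at2 C (ifst (P (Cod box h))) (Rh h \<cdot> A) (Rh h \<cdot> B)"
    and snd_face: "fm (FA R h) \<cdot> at2 C (isnd (P (Dom box h))) A B = at2 C (isnd (P (Cod box h))) (Rh h \<cdot> A) (Rh h \<cdot> B)"
    and exp_face: "Rh h \<cdot> at2 C (iexp (P (Dom box h))) A B = at2 C (iexp (P (Cod box h))) (Rh h \<cdot> A) (Rh h \<cdot> B)"
    and evl_face: "fm (FA R h) \<cdot> at2 C (ievl (P (Dom box h))) A B = at2 C (ievl (P (Cod box h))) (Rh h \<cdot> A) (Rh h \<cdot> B)"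
  using stable_prod stable_exp h A B unfolding stable_products_def stable_exponentials_def Let_def by blast+

lemma
  assumes h: "h \<in> degens p"
  shows e_M: "e h A B \<in> M (Cod box h)"
    and e_ihom: "e h A B \<in> ihom C (FO R (Cod box h)) (Rh h \<cdot> at2 C (iprd (P (Dom box h))) A B)
      (at2 C (iprd (P (Cod box h))) (Rh h \<cdot> A) (Rh h \<cdot> B))"
    and e_fst: "icomp C (FO R (Cod box h)) (at2 C (ifst (P (Cod box h))) (Rh h \<cdot> A) (Rh h \<cdot> B)) (e h A B) =
      fm (FA R h) \<cdot> at2 C (ifst (P (Dom box h))) A B"
    and e_snd: "icomp C (FO R (Cod box h)) (at2 C (isnd (P (Cod box h))) (Rh h \<cdot> A) (Rh h \<cdot> B)) (e h A B) =
      fm (FA R h) \<cdot> at2 C (isnd (P (Dom box h))) A B"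
    and v_ex: "\<exists>v\<in>M (Cod box h). v \<in> ihom C (FO R (Cod box h)) (Rh h \<cdot> at2 C (iexp (P (Dom box h))) A B)
            (at2 C (iexp (P (Cod box h))) (Rh h \<cdot> A) (Rh h \<cdot> B)) \<and>
          icomp C (FO R (Cod box h)) (at2 C (ievl (P (Cod box h))) (Rh h \<cdot> A) (Rh h \<cdot> B))
            (icomp C (FO R (Cod box h))
               (iprod_map C (FO R (Cod box h)) (P (Cod box h)) v (idn (FO R (Cod box h)) \<cdot> (Rh h \<cdot> A)))
               (e h (at2 C (iexp (P (Dom box h))) A B) A)) =
          fm (FA R h) \<cdot> at2 C (ievl (P (Dom box h))) A B"
  using stable_prod stable_exp h A B unfolding stable_products_def stable_exponentials_def Let_def by blast+

end

text \<open>The comparison isomorphisms at the generic pair of objects \<open>(\<pi>\<^sub>0, \<pi>\<^sub>1)\<close>; all others are reindexings of these.\<close>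

abbreviation "g0 h \<equiv> pow_pr C 2 (X0 (Dom box h)) 0"
abbreviation "g1 h \<equiv> pow_pr C 2 (X0 (Dom box h)) (Suc 0)"

definition vexp :: "cube_ar \<Rightarrow> 'a" where
  "vexp h = (SOME v. v \<in> M (Cod box h) \<and>
     v \<in> ihom C (FO R (Cod box h)) (Rh h \<cdot> at2 C (iexp (P (Dom box h))) (g0 h) (g1 h))
       (at2 C (iexp (P (Cod box h))) (Rh h \<cdot> g0 h) (Rh h \<cdot> g1 h)) \<and>
     icomp C (FO R (Cod box h)) (at2 C (ievl (P (Cod box h))) (Rh h \<cdot> g0 h) (Rh h \<cdot> g1 h))
       (icomp C (FO R (Cod box h))
          (iprod_map C (FO R (Cod box h)) (P (Cod box h)) v (idn (FO R (Cod box h)) \<cdot> (Rh h \<cdot> g0 h)))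
          (e h (at2 C (iexp (P (Dom box h))) (g0 h) (g1 h)) (g0 h))) =
     fm (FA R h) \<cdot> at2 C (ievl (P (Dom box h))) (g0 h) (g1 h))"

context
  fixes h
  assumes h: "h \<in> degens p"
begin

lemma h_levels: "Dom box h \<in> levels p" "Cod box h \<in> levels p"
  using box_levels h by auto

lemma g_hom: "g0 h \<in> hom C (Pw 2 (Dom box h)) (X0 (Dom box h))" "g1 h \<in> hom C (Pw 2 (Dom box h)) (X0 (Dom box h))"
  using h_levels by auto

lemma
  shows v_M: "vexp h \<in> M (Cod box h)"
    and v_ihom: "vexp h \<in> ihom C (FO R (Cod box h)) (Rh h \<cdot> at2 C (iexp (P (Dom box h))) (g0 h) (g1 h))
       (at2 C (iexp (P (Cod box h))) (Rh h \<cdot> g0 h) (Rh h \<cdot> g1 h))"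
    and v_evl: "icomp C (FO R (Cod box h)) (at2 C (ievl (P (Cod box h))) (Rh h \<cdot> g0 h) (Rh h \<cdot> g1 h))
       (icomp C (FO R (Cod box h))
          (iprod_map C (FO R (Cod box h)) (P (Cod box h)) (vexp h) (idn (FO R (Cod box h)) \<cdot> (Rh h \<cdot> g0 h)))
          (e h (at2 C (iexp (P (Dom box h))) (g0 h) (g1 h)) (g0 h))) =
     fm (FA R h) \<cdot> at2 C (ievl (P (Dom box h))) (g0 h) (g1 h)"
proof -
  have "\<exists>v. v \<in> M (Cod box h) \<and>
     v \<in> ihom C (FO R (Cod box h)) (Rh h \<cdot> at2 C (iexp (P (Dom box h))) (g0 h) (g1 h))
       (at2 C (iexp (P (Cod box h))) (Rh h \<cdot> g0 h) (Rh h \<cdot> g1 h)) \<and>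
     icomp C (FO R (Cod box h)) (at2 C (ievl (P (Cod box h))) (Rh h \<cdot> g0 h) (Rh h \<cdot> g1 h))
       (icomp C (FO R (Cod box h))
          (iprod_map C (FO R (Cod box h)) (P (Cod box h)) v (idn (FO R (Cod box h)) \<cdot> (Rh h \<cdot> g0 h)))
          (e h (at2 C (iexp (P (Dom box h))) (g0 h) (g1 h)) (g0 h))) =
     fm (FA R h) \<cdot> at2 C (ievl (P (Dom box h))) (g0 h) (g1 h)"
    using v_ex[OF g_hom h] unfolding Bex_def .
  from someI_ex[OF this, folded vexp_def]
  show "vexp h \<in> M (Cod box h)"
    "vexp h \<in> ihom C (FO R (Cod box h)) (Rh h \<cdot> at2 C (iexp (P (Dom box h))) (g0 h) (g1 h))
       (at2 C (iexp (P (Cod box h))) (Rh h \<cdot> g0 h) (Rh h \<cdot> g1 h))"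
    "icomp C (FO R (Cod box h)) (at2 C (ievl (P (Cod box h))) (Rh h \<cdot> g0 h) (Rh h \<cdot> g1 h))
       (icomp C (FO R (Cod box h))
          (iprod_map C (FO R (Cod box h)) (P (Cod box h)) (vexp h) (idn (FO R (Cod box h)) \<cdot> (Rh h \<cdot> g0 h)))
          (e h (at2 C (iexp (P (Dom box h))) (g0 h) (g1 h)) (g0 h))) =
     fm (FA R h) \<cdot> at2 C (ievl (P (Dom box h))) (g0 h) (g1 h)"
    by blast+
qed

text \<open>Naturality of \<open>e\<close> is not among the assumptions. It follows because the two
  projections determine \<open>e h A B\<close> and their values, given by \<open>e_fst\<close> and
  \<open>e_snd\<close>, are stable under reindexing.\<close>

lemma e_comp:
  assumes A: "A \<in> hom C J (X0 (Dom box h))" and B: "B \<in> hom C J (X0 (Dom box h))" and u: "u \<in> hom C J' J"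
  shows "e h A B \<cdot> u = e h (A \<cdot> u) (B \<cdot> u)"
proof -
  let ?l1 = "Dom box h" and ?l2 = "Cod box h"
  interpret L1: iproduct_category C "FO R ?l1" "P ?l1" by (rule iprod_at[OF h_levels(1)])
  interpret L2: iproduct_category C "FO R ?l2" "P ?l2" by (rule iprod_at[OF h_levels(2)])
  note b = degens_box[OF h]
  note r = Rh_hom[OF b] and rm = R_fm_hom[OF b]
  note Au = comp_hom[OF A u] and Bu = comp_hom[OF B u]
  note RA = comp_hom[OF r A] and RB = comp_hom[OF r B]
  note RAu = comp_hom[OF r Au] and RBu = comp_hom[OF r Bu]
  note eq = comp_assoc[OF u A r] comp_assoc[OF u B r]
  have d: "Dom C (Rh h \<cdot> L1.prd A B) = J"
    by (rule homD[OF comp_hom[OF r L1.prd_hom[OF A B]]])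
  then have u': "u \<in> hom C J' (Dom C (Rh h \<cdot> L1.prd A B))" using u by simp
  note ei = e_ihom[OF A B h]
  show ?thesis
  proof (rule L2.prod_eqI[OF _ e_ihom[OF Au Bu h] RAu RBu])
    show "e h A B \<cdot> u \<in> ihom C (FO R ?l2) (Rh h \<cdot> L1.prd (A \<cdot> u) (B \<cdot> u)) (L2.prd (Rh h \<cdot> (A \<cdot> u)) (Rh h \<cdot> (B \<cdot> u)))"
      using L2.ihom_comp[OF ei u'] at2_comp[OF L2.iprd_hom RA RB u] at2_comp[OF L1.iprd_hom A B u]
      by (simp add: eq comp_assoc[OF u L1.prd_hom[OF A B] r, symmetric])
    have p: "L2.prj1 (Rh h \<cdot> A) (Rh h \<cdot> B) \<cdot> u = L2.prj1 (Rh h \<cdot> (A \<cdot> u)) (Rh h \<cdot> (B \<cdot> u))"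
      "L2.prj2 (Rh h \<cdot> A) (Rh h \<cdot> B) \<cdot> u = L2.prj2 (Rh h \<cdot> (A \<cdot> u)) (Rh h \<cdot> (B \<cdot> u))"
      using at2_comp[OF L2.ifst_hom RA RB u] at2_comp[OF L2.isnd_hom RA RB u] by (simp_all add: eq)
    have q: "fm (FA R h) \<cdot> L1.prj1 A B \<cdot> u = fm (FA R h) \<cdot> L1.prj1 (A \<cdot> u) (B \<cdot> u)"
      "fm (FA R h) \<cdot> L1.prj2 A B \<cdot> u = fm (FA R h) \<cdot> L1.prj2 (A \<cdot> u) (B \<cdot> u)"
      using at2_comp[OF L1.ifst_hom A B u] at2_comp[OF L1.isnd_hom A B u]
      by (simp_all add: comp_assoc[OF u at2_hom[OF L1.ifst_hom A B] rm, symmetric]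
          comp_assoc[OF u at2_hom[OF L1.isnd_hom A B] rm, symmetric])
    show "icomp C (FO R ?l2) (L2.prj1 (Rh h \<cdot> (A \<cdot> u)) (Rh h \<cdot> (B \<cdot> u))) (e h A B \<cdot> u) =
        icomp C (FO R ?l2) (L2.prj1 (Rh h \<cdot> (A \<cdot> u)) (Rh h \<cdot> (B \<cdot> u))) (e h (A \<cdot> u) (B \<cdot> u))"
      using L2.icomp_comp[OF ei L2.prj1_ihom[OF RA RB] u'] e_fst[OF A B h] e_fst[OF Au Bu h] by (simp add: p q)
    show "icomp C (FO R ?l2) (L2.prj2 (Rh h \<cdot> (A \<cdot> u)) (Rh h \<cdot> (B \<cdot> u))) (e h A B \<cdot> u) =
        icomp C (FO R ?l2) (L2.prj2 (Rh h \<cdot> (A \<cdot> u)) (Rh h \<cdot> (B \<cdot> u))) (e h (A \<cdot> u) (B \<cdot> u))"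
      using L2.icomp_comp[OF ei L2.prj2_ihom[OF RA RB] u'] e_snd[OF A B h] e_snd[OF Au Bu h] by (simp add: p q)
  qed
qed

lemma g_pair:
  assumes A: "A \<in> hom C J (X0 (Dom box h))" and B: "B \<in> hom C J (X0 (Dom box h))"
  shows "g0 h \<cdot> pair C A B = A" "g1 h \<cdot> pair C A B = B"
    "Rh h \<cdot> g0 h \<cdot> pair C A B = Rh h \<cdot> A" "Rh h \<cdot> g1 h \<cdot> pair C A B = Rh h \<cdot> B"
    "e h (g0 h) (g1 h) \<cdot> pair C A B = e h A B"
  using e_comp[OF g_hom pair_hom[OF A B]] Rh_hom[OF degens_box[OF h]]
    comp_assoc[OF pair_hom[OF A B] g_hom(1)] comp_assoc[OF pair_hom[OF A B] g_hom(2)]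
  by (simp_all add: pr0_pair[OF A B] pr1_pair[OF A B])

text \<open>The evaluation equation is transported from the generic pair, each of its constituents
  commuting with reindexing along \<open>pair C A B\<close>. The reindexed \<open>vexp\<close> thus
  replaces the mutually unrelated comparisons that the hypothesis supplies for the individual
  pairs.\<close>

lemma
  assumes A: "A \<in> hom C J (X0 (Dom box h))" and B: "B \<in> hom C J (X0 (Dom box h))"
  shows v_pair_ihom: "vexp h \<cdot> pair C A B \<in> ihom C (FO R (Cod box h)) (Rh h \<cdot> at2 C (iexp (P (Dom box h))) A B)
       (at2 C (iexp (P (Cod box h))) (Rh h \<cdot> A) (Rh h \<cdot> B))"
    and v_pair_evl: "icomp C (FO R (Cod box h)) (at2 C (ievl (P (Cod box h))) (Rh h \<cdot> A) (Rh h \<cdot> B))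
       (icomp C (FO R (Cod box h))
          (iprod_map C (FO R (Cod box h)) (P (Cod box h)) (vexp h \<cdot> pair C A B) (idn (FO R (Cod box h)) \<cdot> (Rh h \<cdot> A)))
          (e h (at2 C (iexp (P (Dom box h))) A B) A)) =
     fm (FA R h) \<cdot> at2 C (ievl (P (Dom box h))) A B"
proof -
  let ?l1 = "Dom box h" and ?l2 = "Cod box h"
  interpret L1: iexponential_category C "FO R ?l1" "P ?l1" by (rule iexp_at[OF h_levels(1)])
  interpret L2: iexponential_category C "FO R ?l2" "P ?l2" by (rule iexp_at[OF h_levels(2)])
  note b = degens_box[OF h]
  note r = Rh_hom[OF b] and rm = R_fm_hom[OF b]
  note g = g_hom and u = pair_hom[OF A B]
  note Rg = comp_hom[OF r g(1)] comp_hom[OF r g(2)]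
  note E = L1.expo_hom[OF g]
  have dE: "Dom C (Rh h \<cdot> L1.expo (g0 h) (g1 h)) = Pw 2 ?l1"
    by (rule homD[OF comp_hom[OF r E]])
  have d: "Dom C (Rh h \<cdot> L1.prd (L1.expo (g0 h) (g1 h)) (g0 h)) = Pw 2 ?l1"
    by (rule homD[OF comp_hom[OF r L1.prd_hom[OF E g(1)]]])
  have dg: "Dom C (Rh h \<cdot> g0 h) = Pw 2 ?l1"
    by (rule homD[OF Rg(1)])
  have u1: "pair C A B \<in> hom C J (Dom C (Rh h \<cdot> L1.expo (g0 h) (g1 h)))"
    and u2: "pair C A B \<in> hom C J (Dom C (Rh h \<cdot> L1.prd (L1.expo (g0 h) (g1 h)) (g0 h)))"
    using u by (simp_all add: dE d)
  note id = L2.idn_ihom[OF Rg(1)]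
  have gp: "g0 h \<cdot> pair C A B = A" "g1 h \<cdot> pair C A B = B"
      "Rh h \<cdot> g0 h \<cdot> pair C A B = Rh h \<cdot> A" "Rh h \<cdot> g1 h \<cdot> pair C A B = Rh h \<cdot> B"
    by (rule g_pair[OF A B])+
  have E_u: "L1.expo (g0 h) (g1 h) \<cdot> pair C A B = L1.expo A B"
    using at2_comp[OF L1.iexp_hom g u] by (simp add: gp)
  have vi: "vexp h \<in> ihom C (FO R ?l2) (Rh h \<cdot> L1.expo (g0 h) (g1 h)) (L2.expo (Rh h \<cdot> g0 h) (Rh h \<cdot> g1 h))"
    by (rule v_ihom)
  show "vexp h \<cdot> pair C A B \<in> ihom C (FO R ?l2) (Rh h \<cdot> L1.expo A B) (L2.expo (Rh h \<cdot> A) (Rh h \<cdot> B))"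
    using L2.ihom_comp[OF vi u1] at2_comp[OF L2.iexp_hom Rg u]
    by (simp add: gp E_u comp_assoc[OF u E r, symmetric])
  have pm: "L2.pmap (vexp h) (idn (FO R ?l2) \<cdot> (Rh h \<cdot> g0 h)) \<in>
      ihom C (FO R ?l2) (L2.prd (Rh h \<cdot> L1.expo (g0 h) (g1 h)) (Rh h \<cdot> g0 h))
        (L2.prd (L2.expo (Rh h \<cdot> g0 h) (Rh h \<cdot> g1 h)) (Rh h \<cdot> g0 h))"
    by (rule L2.pmap_ihom[OF vi id]) (simp add: dE dg)
  have pmu: "L2.pmap (vexp h) (idn (FO R ?l2) \<cdot> (Rh h \<cdot> g0 h)) \<cdot> pair C A B =
      L2.pmap (vexp h \<cdot> pair C A B) (idn (FO R ?l2) \<cdot> (Rh h \<cdot> A))"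
    using L2.pmap_comp[OF vi id _ u1] L2.idn_comp[OF Rg(1) u] by (simp add: dE dg gp)
  have ei: "e h (L1.expo (g0 h) (g1 h)) (g0 h) \<in>
      ihom C (FO R ?l2) (Rh h \<cdot> L1.prd (L1.expo (g0 h) (g1 h)) (g0 h))
        (L2.prd (Rh h \<cdot> L1.expo (g0 h) (g1 h)) (Rh h \<cdot> g0 h))"
    by (rule e_ihom[OF E g(1) h])
  have eu: "e h (L1.expo (g0 h) (g1 h)) (g0 h) \<cdot> pair C A B = e h (L1.expo A B) A"
    using e_comp[OF E g(1) u] by (simp add: E_u gp)
  have "icomp C (FO R ?l2) (L2.evl (Rh h \<cdot> g0 h) (Rh h \<cdot> g1 h) \<cdot> pair C A B)
       (icomp C (FO R ?l2) (L2.pmap (vexp h) (idn (FO R ?l2) \<cdot> (Rh h \<cdot> g0 h)) \<cdot> pair C A B)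
          (e h (L1.expo (g0 h) (g1 h)) (g0 h) \<cdot> pair C A B)) =
     fm (FA R h) \<cdot> L1.evl (g0 h) (g1 h) \<cdot> pair C A B"
    using v_evl L2.icomp_comp[OF L2.icomp_ihom[OF pm ei] L2.evl_ihom[OF Rg] u2] L2.icomp_comp[OF ei pm u2]
    by simp
  then show "icomp C (FO R ?l2) (L2.evl (Rh h \<cdot> A) (Rh h \<cdot> B))
       (icomp C (FO R ?l2) (L2.pmap (vexp h \<cdot> pair C A B) (idn (FO R ?l2) \<cdot> (Rh h \<cdot> A)))
          (e h (L1.expo A B) A)) =
     fm (FA R h) \<cdot> L1.evl A B"
    using at2_comp[OF L2.ievl_hom Rg u] at2_comp[OF L1.ievl_hom g u]
      comp_assoc[OF u at2_hom[OF L1.ievl_hom g] rm]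
    by (simp add: pmu eu gp)
qed

end

sublocale prod: binary_connective C p R M "\<lambda>l. iprd (P l)" "\<lambda>h. e h (g0 h) (g1 h)"
  "\<lambda>l. iprod_map C (FO R l) (P l)"
proof unfold_locales
  fix l assume l: "l \<in> levels p"
  interpret iproduct_category C "FO R l" "P l" by (rule iprod_at[OF l])
  show "iprd (P l) \<in> hom C (Pw 2 l) (X0 l)" by (rule iprd_hom)
  fix f g A A' B B'
  assume M: "f \<in> M l" "g \<in> M l"
    and f: "f \<in> ihom C (FO R l) A A'" and g: "g \<in> ihom C (FO R l) B B'" and d: "Dom C A = Dom C B"
  show "iprod_map C (FO R l) (P l) f g \<in> M l"
    by (rule M_pmap[OF l M ihom_Dom[OF l f g d]])
  show "iprod_map C (FO R l) (P l) f g \<in> ihom C (FO R l) (at2 C (iprd (P l)) A B) (at2 C (iprd (P l)) A' B')"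
    by (rule pmap_ihom[OF f g d])
  show "iprod_map C (FO R l) (P l) f g \<cdot> u = iprod_map C (FO R l) (P l) (f \<cdot> u) (g \<cdot> u)"
    if "u \<in> hom C J (Dom C A)" for u J
    by (rule pmap_comp[OF f g d that])
  show "iprod_map C (FO R l) (P l) (icomp C (FO R l) f' f) (icomp C (FO R l) g' g) =
      icomp C (FO R l) (iprod_map C (FO R l) (P l) f' g') (iprod_map C (FO R l) (P l) f g)"
    if "f' \<in> ihom C (FO R l) A' A''" "g' \<in> ihom C (FO R l) B' B''" for f' g' A'' B''
    by (rule pmap_icomp[OF f g d that])
next
  fix l J A B
  assume l: "l \<in> levels p" and A: "A \<in> hom C J (X0 l)" "B \<in> hom C J (X0 l)"
  interpret iproduct_category C "FO R l" "P l" by (rule iprod_at[OF l])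
  show "iprod_map C (FO R l) (P l) (idn (FO R l) \<cdot> A) (idn (FO R l) \<cdot> B) = idn (FO R l) \<cdot> at2 C (iprd (P l)) A B"
    by (rule pmap_idn[OF A])
next
  fix h assume h: "h \<in> degens p"
  show "e h (g0 h) (g1 h) \<in> M (Cod box h)"
    by (rule e_M[OF g_hom[OF h] h])
  interpret L1: iproduct_category C "FO R (Dom box h)" "P (Dom box h)" by (rule iprod_at[OF h_levels(1)[OF h]])
  show "e h (g0 h) (g1 h) \<in> ihom C (FO R (Cod box h)) (Rh h \<cdot> iprd (P (Dom box h))) (iprd (P (Cod box h)) \<cdot> Rn 2 h)"
    using e_ihom[OF g_hom[OF h] h] pow_map_pair[OF Rh_hom[OF degens_box[OF h]] g_hom[OF h]] L1.iprd_hom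
      homD[OF Rn_hom[OF degens_box[OF h]], of 2] h_levels[OF h]
    by (simp add: at2_def pair_pr homD)
qed (rule prd_face)

sublocale exp: binary_connective C p R M "\<lambda>l. iexp (P l)" vexp "\<lambda>l. iexp_map C (FO R l) (P l)"
proof unfold_locales
  fix l assume l: "l \<in> levels p"
  interpret iexponential_category C "FO R l" "P l" by (rule iexp_at[OF l])
  show "iexp (P l) \<in> hom C (Pw 2 l) (X0 l)" by (rule iexp_hom)
  fix f g A A' B B'
  assume M: "f \<in> M l" "g \<in> M l"
    and f: "f \<in> ihom C (FO R l) A A'" and g: "g \<in> ihom C (FO R l) B B'" and d: "Dom C A = Dom C B"
  \<comment> \<open>Good isomorphisms are invertible, which is what the lemmas on
    \<open>emap\<close> ask of the first argument.\<close>
  note iso = M_iso[OF l M(1)]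
  show "iexp_map C (FO R l) (P l) f g \<in> M l"
    by (rule M_emap[OF l M ihom_Dom[OF l f g d]])
  show "iexp_map C (FO R l) (P l) f g \<in> ihom C (FO R l) (at2 C (iexp (P l)) A B) (at2 C (iexp (P l)) A' B')"
    by (rule emap_ihom[OF f iso g d])
  show "iexp_map C (FO R l) (P l) f g \<cdot> u = iexp_map C (FO R l) (P l) (f \<cdot> u) (g \<cdot> u)"
    if u: "u \<in> hom C J (Dom C A)" for u J
    by (rule emap_comp[OF f g d u iso M_iso[OF l M_comp[OF l M(1) f u]]])
  show "iexp_map C (FO R l) (P l) (icomp C (FO R l) f' f) (icomp C (FO R l) g' g) =
      icomp C (FO R l) (iexp_map C (FO R l) (P l) f' g') (iexp_map C (FO R l) (P l) f g)"
    if "f' \<in> M l" "g' \<in> M l" "f' \<in> ihom C (FO R l) A' A''" "g' \<in> ihom C (FO R l) B' B''" for f' g' A'' B''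
    by (rule emap_icomp[OF f g d that(3,4) iso M_iso[OF l that(1)] M_iso[OF l M_icomp[OF l M(1) that(1) f that(3)]]])
next
  fix l J A B
  assume l: "l \<in> levels p" and A: "A \<in> hom C J (X0 l)" "B \<in> hom C J (X0 l)"
  interpret iexponential_category C "FO R l" "P l" by (rule iexp_at[OF l])
  show "iexp_map C (FO R l) (P l) (idn (FO R l) \<cdot> A) (idn (FO R l) \<cdot> B) = idn (FO R l) \<cdot> at2 C (iexp (P l)) A B"
    by (rule emap_idn[OF A M_iso[OF l M_idn[OF l A(1)]]])
next
  fix h assume h: "h \<in> degens p"
  show "vexp h \<in> M (Cod box h)"
    by (rule v_M[OF h])
  interpret L1: iexponential_category C "FO R (Dom box h)" "P (Dom box h)" by (rule iexp_at[OF h_levels(1)[OF h]])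
  show "vexp h \<in> ihom C (FO R (Cod box h)) (Rh h \<cdot> iexp (P (Dom box h))) (iexp (P (Cod box h)) \<cdot> Rn 2 h)"
    using v_ihom[OF h] pow_map_pair[OF Rh_hom[OF degens_box[OF h]] g_hom[OF h]] L1.iexp_hom
      homD[OF Rn_hom[OF degens_box[OF h]], of 2] h_levels[OF h]
    by (simp add: at2_def pair_pr homD)
qed (rule exp_face)

text \<open>Arity 0 means that the domain is \<open>Pw 0 l\<close>, which is terminal but need not
  be the chosen \<open>one C\<close>; hence the precompositions with \<open>bang\<close>. The action
  is constantly an identity.\<close>

definition oneR :: "('o, 'a) relob" where
  "oneR = mkrel 0 (\<lambda>l. T l \<cdot> bang C (Pw 0 l)) (\<lambda>h. i h \<cdot> bang C (Pw 0 (Dom box h)))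
     (\<lambda>l J fs. idn (FO R l) \<cdot> (T l \<cdot> bang C J))"

lemma T_hom: "l \<in> levels p \<Longrightarrow> T l \<in> hom C (one C) (X0 l)"
  using T by (simp add: iterminal_def)

lemma T_bang_hom: "l \<in> levels p \<Longrightarrow> J \<in> Ob C \<Longrightarrow> T l \<cdot> bang C J \<in> hom C J (X0 l)"
  by (rule comp_hom[OF T_hom bang_hom])

lemma T_bang_comp: "l \<in> levels p \<Longrightarrow> u \<in> hom C J' J \<Longrightarrow> T l \<cdot> bang C J \<cdot> u = T l \<cdot> bang C J'"
  using comp_assoc[OF _ bang_hom T_hom, of u J' J] bang_comp[of u J' J] hom_Ob(2)[of u J' J] by simp

lemma T_bang_ex1: "l \<in> levels p \<Longrightarrow> Z \<in> hom C J (X0 l) \<Longrightarrow> \<exists>!k. k \<in> ihom C (FO R l) Z (T l \<cdot> bang C J)"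
  using T by (simp add: iterminal_def)

lemma relob_oneR: "relob 0 oneR"
  unfolding oneR_def
proof (rule relob_mkrel)
  fix l assume l: "l \<in> levels p"
  interpret icategory C "FO R l" by (rule icategory_at[OF l])
  show "T l \<cdot> bang C (Pw 0 l) \<in> hom C (Pw 0 l) (X0 l)"
    using l by (intro T_bang_hom) auto
  have tT: "T l \<cdot> bang C (Pw 0 l) \<cdot> tuple C 0 (X0 l) (Pw m l) A = T l \<cdot> bang C (Pw m l)" for m A
    using l by (intro T_bang_comp tuple_hom) auto
  have id: "idn (FO R l) \<cdot> (T l \<cdot> bang C (Pw m l)) \<in>
      ihom C (FO R l) (T l \<cdot> bang C (Pw m l)) (T l \<cdot> bang C (Pw m l))" for m
    using idn_ihom[OF T_bang_hom[OF l, of "Pw m l"]] l by simp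
  show "iso_action l 0 (T l \<cdot> bang C (Pw 0 l)) (\<lambda>J fs. idn (FO R l) \<cdot> (T l \<cdot> bang C J))"
    unfolding iso_action_def
  proof (intro conjI allI impI ballI)
    fix m
    show "idn (FO R l) \<cdot> (T l \<cdot> bang C (Pw m l)) \<in> M l"
      using M_idn[OF l T_bang_hom[OF l, of "Pw m l"]] l by simp
    show "idn (FO R l) \<cdot> (T l \<cdot> bang C (Pw m l)) =
        icomp C (FO R l) (idn (FO R l) \<cdot> (T l \<cdot> bang C (Pw m l))) (idn (FO R l) \<cdot> (T l \<cdot> bang C (Pw m l)))"
      using icomp_idl[OF id] by simp
  next
    fix m m' k
    assume k: "k \<in> hom C (Pw m' l) (Pw m l)"
    show "idn (FO R l) \<cdot> (T l \<cdot> bang C (Pw m l)) \<cdot> k = idn (FO R l) \<cdot> (T l \<cdot> bang C (Pw m' l))"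
      using idn_comp[OF T_bang_hom[OF l] k] T_bang_comp[OF l k] l by simp
  qed (simp_all add: tT id)
next
  fix h assume h: "h \<in> faces p"
  note b = faces_box[OF h] and l = box_levels(3,4)[OF h]
  have J: "Pw 0 (Dom box h) \<in> Ob C" using l by simp
  show "Rh h \<cdot> (T (Dom box h) \<cdot> bang C (Pw 0 (Dom box h))) = T (Cod box h) \<cdot> bang C (Pw 0 (Cod box h)) \<cdot> Rn 0 h"
    using T_bang_comp[OF l(2) Rn_hom[OF b]] comp_assoc[OF bang_hom[OF J] T_hom[OF l(1)] Rh_hom[OF b]] T_face[OF h]
    by simp
next
  fix h assume h: "h \<in> degens p"
  note b = degens_box[OF h] and l = box_levels(5,6)[OF h]
  have J: "Pw 0 (Dom box h) \<in> Ob C" using l by simp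
  note r = comp_hom[OF Rh_hom[OF b] T_hom[OF l(1)]]
  have u: "bang C (Pw 0 (Dom box h)) \<in> hom C (Pw 0 (Dom box h)) (Dom C (Rh h \<cdot> T (Dom box h)))"
    using J r by (simp add: homD)
  show "i h \<cdot> bang C (Pw 0 (Dom box h)) \<in> M (Cod box h)"
    by (rule M_comp[OF l(2) i_M[OF h] i_ihom[OF h] u])
  show "i h \<cdot> bang C (Pw 0 (Dom box h)) \<in> ihom C (FO R (Cod box h))
      (Rh h \<cdot> (T (Dom box h) \<cdot> bang C (Pw 0 (Dom box h)))) (T (Cod box h) \<cdot> bang C (Pw 0 (Cod box h)) \<cdot> Rn 0 h)"
    using icategory.ihom_comp[OF icategory_at[OF l(2)] i_ihom[OF h] u] T_bang_comp[OF l(2) Rn_hom[OF b]]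
      comp_assoc[OF bang_hom[OF J] T_hom[OF l(1)] Rh_hom[OF b]] by simp
qed

section \<open>Cartesian closed structure of the fibres\<close>

definition oneF :: "nat \<Rightarrow> ('o, 'a) relob" where
  "oneF n = sbst oneR n []"

lemma relob_oneF: "relob n (oneF n)"
  unfolding oneF_def using relob_oneR by (intro relob_sbst) auto

lemma oneF_sbst: "relobs n Us \<Longrightarrow> sbst (oneF (length Us)) n Us = oneF n"
  using sbst_assoc[of "[]" oneR Us n] relob_oneR by (simp add: oneF_def)

lemma ofo_oneF: "l \<in> levels p \<Longrightarrow> ofo (oneF n) l = T l \<cdot> bang C (Pw n l)"
  using ofo_sbst[of "[]" oneR n l] relob_oneR T_bang_comp[OF _ tob_hom[of "[]" n l]]
  by (simp add: oneF_def) (simp add: oneR_def)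

text \<open>Both sides of each compatibility condition are arrows into a terminal object, hence
  equal. The work lies in recognizing their targets as reindexings of \<open>T\<close>.\<close>

lemma terminal_FIB: "is_terminal (FIB n) (n, oneF n)"
  unfolding is_terminal_def
proof (intro conjI ballI)
  show "(n, oneF n) \<in> Ob (FIB n)" using relob_oneF by simp
  fix X assume "X \<in> Ob (FIB n)"
  then obtain F where X: "X = (n, F)" and F: "relob n F" by auto
  note O = relob_oneF[of n]
  define t where "t l = (if l \<in> levels p then THE k. k \<in> ihom C (FO R l) (ofo F l) (T l \<cdot> bang C (Pw n l))
      else undefined)" for l
  have t: "t l \<in> ihom C (FO R l) (ofo F l) (ofo (oneF n) l)" if l: "l \<in> levels p" for l
    using theI'[OF T_bang_ex1[OF l relob_rfun_eq(2)[OF F l]]] l by (simp add: t_def ofo_oneF)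
  have uniq: "j = k" if "l \<in> levels p" "j \<in> ihom C (FO R l) A (T l \<cdot> bang C J)"
    "k \<in> ihom C (FO R l) A (T l \<cdot> bang C J)" "A \<in> hom C J (X0 l)" for l j k A J
    using T_bang_ex1[OF that(1,4)] that(2,3) by blast
  have tgt: "T (Cod box h) \<cdot> bang C (Pw n (Dom box h)) = ofo (oneF n) (Cod box h) \<cdot> Rn n h" if h: "h \<in> box_ars p" for h
    using T_bang_comp[OF box_levels(2)[OF h] Rn_hom[OF h]] ofo_oneF[OF box_levels(2)[OF h]] by simp
  have "relar n F t (oneF n)"
  proof (rule relarI[OF F O t])
    fix h assume h: "h \<in> faces p"
    note b = faces_box[OF h] and l = box_levels(3,4)[OF h]
    show "fm (FA R h) \<cdot> t (Dom box h) = t (Cod box h) \<cdot> Rn n h"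
      using R_ihom[OF b t[OF l(1)]] comp_Rn_ihom[OF F b t[OF l(2)]]
        comp_hom[OF relob_rfun_eq(2)[OF F l(2)] Rn_hom[OF b]]
      by (intro uniq[OF l(2)]) (auto simp: relob_face[OF F h] relob_face[OF O h] tgt[OF b])
  next
    fix h assume h: "h \<in> degens p"
    note b = degens_box[OF h] and l = box_levels(5,6)[OF h]
    interpret icategory C "FO R (Cod box h)" by (rule icategory_at[OF l(2)])
    show "icomp C (FO R (Cod box h)) (t (Cod box h) \<cdot> Rn n h) (reps F h) =
       icomp C (FO R (Cod box h)) (reps (oneF n) h) (fm (FA R h) \<cdot> t (Dom box h))"
      using icomp_ihom[OF comp_Rn_ihom[OF F b t[OF l(2)]] relob_degen(2)[OF F h]]
        icomp_ihom[OF relob_degen(2)[OF O h] R_ihom[OF b t[OF l(1)]]]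
        comp_hom[OF Rh_hom[OF b] relob_rfun_eq(2)[OF F l(1)]]
      by (intro uniq[OF l(2)]) (auto simp: tgt[OF b])
  qed (simp_all add: t_def)
  moreover have "s = t" if s: "relar n F s (oneF n)" for s
  proof
    fix l show "s l = t l"
    proof (cases "l \<in> levels p")
      case True
      show ?thesis
        using relarD(1)[OF F O s True] t[OF True] relob_rfun_eq(2)[OF F True]
        by (intro uniq[OF True]) (auto simp: ofo_oneF[OF True])
    next
      case False
      then show ?thesis using relarD(4)[OF F O s] by (simp add: t_def)
    qed
  qed
  ultimately show "\<exists>!f. f \<in> hom (FIB n) X (n, oneF n)"
    unfolding X FIB_hom using F O by blast
qed

section \<open>Binary products in the fibres\<close>

abbreviation "prF \<equiv> prod.bapp"
abbreviation "exF \<equiv> exp.bapp"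

definition pr1A :: "('o, 'a) relob \<Rightarrow> ('o, 'a) relob \<Rightarrow> nat \<Rightarrow> 'a" where
  "pr1A F G l = (if l \<in> levels p then at2 C (ifst (P l)) (ofo F l) (ofo G l) else undefined)"

definition pr2A :: "('o, 'a) relob \<Rightarrow> ('o, 'a) relob \<Rightarrow> nat \<Rightarrow> 'a" where
  "pr2A F G l = (if l \<in> levels p then at2 C (isnd (P l)) (ofo F l) (ofo G l) else undefined)"

definition evA :: "('o, 'a) relob \<Rightarrow> ('o, 'a) relob \<Rightarrow> nat \<Rightarrow> 'a" where
  "evA F G l = (if l \<in> levels p then at2 C (ievl (P l)) (ofo F l) (ofo G l) else undefined)"

lemma reps_prF:
  assumes F: "relob n F" and G: "relob n G" and h: "h \<in> degens p"
  shows "reps (prF n F G) h = icomp C (FO R (Cod box h))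
    (iprod_map C (FO R (Cod box h)) (P (Cod box h)) (reps F h) (reps G h))
    (e h (ofo F (Dom box h)) (ofo G (Dom box h)))"
  using prod.reps_bapp[OF F G h]
    g_pair(5)[OF h relob_rfun_eq(2)[OF F h_levels(1)[OF h]] relob_rfun_eq(2)[OF G h_levels(1)[OF h]]]
  by simp

context
  fixes n F G
  assumes F: "relob n F" and G: "relob n G"
begin

lemma ofo_homs: "l \<in> levels p \<Longrightarrow> ofo F l \<in> hom C (Pw n l) (X0 l)" "l \<in> levels p \<Longrightarrow> ofo G l \<in> hom C (Pw n l) (X0 l)"
  using relob_rfun_eq(2)[OF F] relob_rfun_eq(2)[OF G] by auto

lemma R_ofo_homs: "h \<in> box_ars p \<Longrightarrow> Rh h \<cdot> ofo F (Dom box h) \<in> hom C (Pw n (Dom box h)) (X0 (Cod box h))"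
    "h \<in> box_ars p \<Longrightarrow> Rh h \<cdot> ofo G (Dom box h) \<in> hom C (Pw n (Dom box h)) (X0 (Cod box h))"
  using comp_hom[OF Rh_hom ofo_homs(1)] comp_hom[OF Rh_hom ofo_homs(2)] box_levels(1) by auto

lemma ofo_Rn_homs: "h \<in> box_ars p \<Longrightarrow> ofo F (Cod box h) \<cdot> Rn n h \<in> hom C (Pw n (Dom box h)) (X0 (Cod box h))"
    "h \<in> box_ars p \<Longrightarrow> ofo G (Cod box h) \<cdot> Rn n h \<in> hom C (Pw n (Dom box h)) (X0 (Cod box h))"
  using comp_hom[OF ofo_homs(1) Rn_hom] comp_hom[OF ofo_homs(2) Rn_hom] box_levels(2) by auto

lemma at2_Rn:
  assumes "h \<in> box_ars p" "m \<in> hom C (Pw 2 (Cod box h)) Y"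
  shows "at2 C m (ofo F (Cod box h)) (ofo G (Cod box h)) \<cdot> Rn n h =
    at2 C m (ofo F (Cod box h) \<cdot> Rn n h) (ofo G (Cod box h) \<cdot> Rn n h)"
  by (rule at2_comp[OF assms(2) ofo_homs[OF box_levels(2)[OF assms(1)]] Rn_hom[OF assms(1)]])

text \<open>On a degeneracy, the witness of the product is the product of the witnesses after
  \<open>e\<close>. A projection turns the former into the witness of the factor
  (\<open>prj1_pmap\<close>, \<open>prj2_pmap\<close>) and the latter into the degenerated
  projection (\<open>e_fst\<close>, \<open>e_snd\<close>).\<close>

lemma
  shows relar_pr1A: "relar n (prF n F G) (pr1A F G) F"
    and relar_pr2A: "relar n (prF n F G) (pr2A F G) G"
proof -
  note FG = prod.relob_bapp[OF F G]
  have faces: "fm (FA R h) \<cdot> pr1A F G (Dom box h) = pr1A F G (Cod box h) \<cdot> Rn n h"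
    "fm (FA R h) \<cdot> pr2A F G (Dom box h) = pr2A F G (Cod box h) \<cdot> Rn n h" if h: "h \<in> faces p" for h
  proof -
    note b = faces_box[OF h] and l = box_levels(3,4)[OF h]
    interpret L2: iproduct_category C "FO R (Cod box h)" "P (Cod box h)" by (rule iprod_at[OF l(2)])
    show "fm (FA R h) \<cdot> pr1A F G (Dom box h) = pr1A F G (Cod box h) \<cdot> Rn n h"
      "fm (FA R h) \<cdot> pr2A F G (Dom box h) = pr2A F G (Cod box h) \<cdot> Rn n h"
      using fst_face[OF ofo_homs[OF l(1)] h] snd_face[OF ofo_homs[OF l(1)] h]
        at2_Rn[OF b L2.ifst_hom] at2_Rn[OF b L2.isnd_hom] relob_face[OF F h] relob_face[OF G h]
      by (simp_all add: pr1A_def pr2A_def l)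
  qed
  have degens: "icomp C (FO R (Cod box h)) (pr1A F G (Cod box h) \<cdot> Rn n h) (reps (prF n F G) h) =
      icomp C (FO R (Cod box h)) (reps F h) (fm (FA R h) \<cdot> pr1A F G (Dom box h))"
    "icomp C (FO R (Cod box h)) (pr2A F G (Cod box h) \<cdot> Rn n h) (reps (prF n F G) h) =
      icomp C (FO R (Cod box h)) (reps G h) (fm (FA R h) \<cdot> pr2A F G (Dom box h))" if h: "h \<in> degens p" for h
  proof -
    note b = degens_box[OF h] and l = box_levels(5,6)[OF h]
    interpret L2: iproduct_category C "FO R (Cod box h)" "P (Cod box h)" by (rule iprod_at[OF l(2)])
    note eF = relob_degen(2)[OF F h] and eG = relob_degen(2)[OF G h]
    note R = R_ofo_homs[OF b] and S = ofo_Rn_homs[OF b]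
    have d: "Dom C (Rh h \<cdot> ofo F (Dom box h)) = Dom C (Rh h \<cdot> ofo G (Dom box h))"
      using R by (simp add: homD)
    note pm = L2.pmap_ihom[OF eF eG d]
    note ee = e_ihom[OF ofo_homs[OF l(1)] h]
    show "icomp C (FO R (Cod box h)) (pr1A F G (Cod box h) \<cdot> Rn n h) (reps (prF n F G) h) =
        icomp C (FO R (Cod box h)) (reps F h) (fm (FA R h) \<cdot> pr1A F G (Dom box h))"
      using L2.icomp_assoc[OF ee pm L2.prj1_ihom[OF S]] L2.icomp_assoc[OF ee L2.prj1_ihom[OF R] eF]
      by (simp add: pr1A_def l reps_prF[OF F G h] at2_Rn[OF b L2.ifst_hom] L2.prj1_pmap[OF eF eG d]
          e_fst[OF ofo_homs[OF l(1)] h])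
    show "icomp C (FO R (Cod box h)) (pr2A F G (Cod box h) \<cdot> Rn n h) (reps (prF n F G) h) =
        icomp C (FO R (Cod box h)) (reps G h) (fm (FA R h) \<cdot> pr2A F G (Dom box h))"
      using L2.icomp_assoc[OF ee pm L2.prj2_ihom[OF S]] L2.icomp_assoc[OF ee L2.prj2_ihom[OF R] eG]
      by (simp add: pr2A_def l reps_prF[OF F G h] at2_Rn[OF b L2.isnd_hom] L2.prj2_pmap[OF eF eG d]
          e_snd[OF ofo_homs[OF l(1)] h])
  qed
  show "relar n (prF n F G) (pr1A F G) F"
    using iproduct_category.prj1_ihom[OF iprod_at ofo_homs]
    by (intro relarI[OF FG F] faces degens) (auto simp: pr1A_def prod.ofo_bapp[OF F G])
  show "relar n (prF n F G) (pr2A F G) G"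
    using iproduct_category.prj2_ihom[OF iprod_at ofo_homs]
    by (intro relarI[OF FG G] faces degens) (auto simp: pr2A_def prod.ofo_bapp[OF F G])
qed

lemma pairing_ex1:
  assumes Z: "relob n Z" and f: "relar n Z f F" and g: "relar n Z g G"
  shows "\<exists>!k. relar n Z k (prF n F G) \<and> ncmp (pr1A F G) k = f \<and> ncmp (pr2A F G) k = g"
proof -
  note FG = prod.relob_bapp[OF F G]
  note r1 = relar_pr1A and r2 = relar_pr2A
  define k where "k l = (if l \<in> levels p then THE k. k \<in> ihom C (FO R l) (ofo Z l) (ofo (prF n F G) l) \<and>
      icomp C (FO R l) (pr1A F G l) k = f l \<and> icomp C (FO R l) (pr2A F G l) k = g l else undefined)" for l
  have ex: "\<exists>!k. k \<in> ihom C (FO R l) (ofo Z l) (ofo (prF n F G) l) \<and>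
      icomp C (FO R l) (pr1A F G l) k = f l \<and> icomp C (FO R l) (pr2A F G l) k = g l" if l: "l \<in> levels p" for l
    using iproduct_category.prod_ex1[OF iprod_at[OF l] relarD(1)[OF Z F f l] relarD(1)[OF Z G g l]] l
    by (simp add: prod.ofo_bapp[OF F G] pr1A_def pr2A_def)
  have k: "k l \<in> ihom C (FO R l) (ofo Z l) (ofo (prF n F G) l)" "icomp C (FO R l) (pr1A F G l) (k l) = f l"
      "icomp C (FO R l) (pr2A F G l) (k l) = g l" if l: "l \<in> levels p" for l
    using theI'[OF ex[OF l]] l by (auto simp: k_def)
  \<comment> \<open>The projections reindexed along \<open>Rn n h\<close> are jointly monic. This
    reduces both the face and the degeneracy condition for \<open>k\<close> to those for
    \<open>f\<close> and \<open>g\<close>.\<close>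
  have eqI: "a = b" if h: "h \<in> box_ars p"
    and ab: "a \<in> ihom C (FO R (Cod box h)) D (ofo (prF n F G) (Cod box h) \<cdot> Rn n h)"
      "b \<in> ihom C (FO R (Cod box h)) D (ofo (prF n F G) (Cod box h) \<cdot> Rn n h)"
      "icomp C (FO R (Cod box h)) (pr1A F G (Cod box h) \<cdot> Rn n h) a =
        icomp C (FO R (Cod box h)) (pr1A F G (Cod box h) \<cdot> Rn n h) b"
      "icomp C (FO R (Cod box h)) (pr2A F G (Cod box h) \<cdot> Rn n h) a =
        icomp C (FO R (Cod box h)) (pr2A F G (Cod box h) \<cdot> Rn n h) b" for h a b D
  proof -
    interpret L2: iproduct_category C "FO R (Cod box h)" "P (Cod box h)" by (rule iprod_at[OF box_levels(2)[OF h]])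
    show ?thesis
      using ab by (rule_tac L2.prod_eqI[OF _ _ ofo_Rn_homs[OF h]])
        (simp_all add: prod.ofo_bapp[OF F G] pr1A_def pr2A_def box_levels h at2_Rn[OF h L2.iprd_hom]
          at2_Rn[OF h L2.ifst_hom] at2_Rn[OF h L2.isnd_hom])
  qed
  \<comment> \<open>The cube map \<open>h\<close> meets the defining equations of \<open>k\<close>
    in two ways: by restriction along \<open>Rn\<close> at the upper level here, and by applying
    \<open>Rel(h)\<close> at the lower level in \<open>R_k\<close>; upper and lower refer to the
    codomain and domain of \<open>h\<close>.\<close>
  have k_Rn: "icomp C (FO R (Cod box h)) (pr1A F G (Cod box h) \<cdot> Rn n h) (k (Cod box h) \<cdot> Rn n h) = f (Cod box h) \<cdot> Rn n h"
    "icomp C (FO R (Cod box h)) (pr2A F G (Cod box h) \<cdot> Rn n h) (k (Cod box h) \<cdot> Rn n h) = g (Cod box h) \<cdot> Rn n h"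
    if h: "h \<in> box_ars p" for h
    using icomp_Rn[OF Z h k(1)[OF box_levels(2)[OF h]] relarD(1)[OF FG F r1 box_levels(2)[OF h]]]
      icomp_Rn[OF Z h k(1)[OF box_levels(2)[OF h]] relarD(1)[OF FG G r2 box_levels(2)[OF h]]]
      k(2,3)[OF box_levels(2)[OF h]]
    by simp_all
  have R_k: "icomp C (FO R (Cod box h)) (fm (FA R h) \<cdot> pr1A F G (Dom box h)) (fm (FA R h) \<cdot> k (Dom box h)) =
      fm (FA R h) \<cdot> f (Dom box h)"
    "icomp C (FO R (Cod box h)) (fm (FA R h) \<cdot> pr2A F G (Dom box h)) (fm (FA R h) \<cdot> k (Dom box h)) =
      fm (FA R h) \<cdot> g (Dom box h)" if h: "h \<in> box_ars p" for h
    using R_icomp[OF h k(1)[OF box_levels(1)[OF h]] relarD(1)[OF FG F r1 box_levels(1)[OF h]]]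
      R_icomp[OF h k(1)[OF box_levels(1)[OF h]] relarD(1)[OF FG G r2 box_levels(1)[OF h]]]
      k(2,3)[OF box_levels(1)[OF h]]
    by simp_all
  have "relar n Z k (prF n F G)"
  proof (rule relarI[OF Z FG k(1)])
    fix h assume h: "h \<in> faces p"
    note b = faces_box[OF h] and l = box_levels(3,4)[OF h]
    show "fm (FA R h) \<cdot> k (Dom box h) = k (Cod box h) \<cdot> Rn n h"
    proof (rule eqI[OF b])
      show "fm (FA R h) \<cdot> k (Dom box h) \<in>
          ihom C (FO R (Cod box h)) (ofo Z (Cod box h) \<cdot> Rn n h) (ofo (prF n F G) (Cod box h) \<cdot> Rn n h)"
        using R_ihom[OF b k(1)[OF l(1)]] by (simp add: relob_face[OF Z h] relob_face[OF FG h])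
      show "k (Cod box h) \<cdot> Rn n h \<in>
          ihom C (FO R (Cod box h)) (ofo Z (Cod box h) \<cdot> Rn n h) (ofo (prF n F G) (Cod box h) \<cdot> Rn n h)"
        by (rule comp_Rn_ihom[OF Z b k(1)[OF l(2)]])
    qed (use R_k[OF b] k_Rn[OF b] relarD(2)[OF Z F f h] relarD(2)[OF Z G g h]
        relarD(2)[OF FG F r1 h] relarD(2)[OF FG G r2 h] in simp_all)
  next
    fix h assume h: "h \<in> degens p"
    note b = degens_box[OF h] and l = box_levels(5,6)[OF h]
    interpret icategory C "FO R (Cod box h)" by (rule icategory_at[OF l(2)])
    note eZ = relob_degen(2)[OF Z h] and eFG = relob_degen(2)[OF FG h]
      and kR = comp_Rn_ihom[OF Z b k(1)[OF l(2)]] and Rk = R_ihom[OF b k(1)[OF l(1)]]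
      and p1 = comp_Rn_ihom[OF FG b relarD(1)[OF FG F r1 l(2)]] and p2 = comp_Rn_ihom[OF FG b relarD(1)[OF FG G r2 l(2)]]
      and q1 = R_ihom[OF b relarD(1)[OF FG F r1 l(1)]] and q2 = R_ihom[OF b relarD(1)[OF FG G r2 l(1)]]
    show "icomp C (FO R (Cod box h)) (k (Cod box h) \<cdot> Rn n h) (reps Z h) =
       icomp C (FO R (Cod box h)) (reps (prF n F G) h) (fm (FA R h) \<cdot> k (Dom box h))"
      \<comment> \<open>The degeneracy condition of a projection exchanges it with the witness of
        the product. After that, both sides are related by the degeneracy condition of
        \<open>f\<close> or of \<open>g\<close>.\<close>
      by (rule eqI[OF b icomp_ihom[OF kR eZ] icomp_ihom[OF eFG Rk]])
        (simp_all add: icomp_assoc[OF eZ kR p1] icomp_assoc[OF eZ kR p2] icomp_assoc[OF Rk eFG p1]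
          icomp_assoc[OF Rk eFG p2] k_Rn[OF b] relarD(3)[OF FG F r1 h] relarD(3)[OF FG G r2 h]
          icomp_assoc[OF Rk q1 relob_degen(2)[OF F h], symmetric]
          icomp_assoc[OF Rk q2 relob_degen(2)[OF G h], symmetric]
          R_k[OF b] relarD(3)[OF Z F f h] relarD(3)[OF Z G g h])
  qed (simp_all add: k_def)
  moreover have "ncmp (pr1A F G) k = f" "ncmp (pr2A F G) k = g"
    using k(2,3) relarD(4)[OF Z F f] relarD(4)[OF Z G g] by (auto simp: nat_comp_def)
  moreover have "j = k" if j: "relar n Z j (prF n F G)" "ncmp (pr1A F G) j = f" "ncmp (pr2A F G) j = g" for j
  proof
    fix l show "j l = k l"
    proof (cases "l \<in> levels p")
      case True
      have "icomp C (FO R l) (pr1A F G l) (j l) = f l" "icomp C (FO R l) (pr2A F G l) (j l) = g l"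
        using fun_cong[OF j(2), of l] fun_cong[OF j(3), of l] True by (simp_all add: nat_comp_def)
      then show ?thesis
        using ex[OF True] relarD(1)[OF Z FG j(1) True] k[OF True] by blast
    next
      case False
      then show ?thesis using relarD(4)[OF Z FG j(1)] by (simp add: k_def)
    qed
  qed
  ultimately show ?thesis by blast
qed

end

definition ccF :: "nat \<Rightarrow> (('o, 'a) intob, ('o, 'a) intar) ccs" where
  "ccF n = \<lparr>cone1 = (n, oneF n),
     cprd = \<lambda>X Y. (n, prF n (snd X) (snd Y)),
     cfst = \<lambda>X Y. farr n (prF n (snd X) (snd Y)) (pr1A (snd X) (snd Y)) (snd X),
     csnd = \<lambda>X Y. farr n (prF n (snd X) (snd Y)) (pr2A (snd X) (snd Y)) (snd Y),
     cexp = \<lambda>X Y. (n, exF n (snd X) (snd Y)),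
     cevl = \<lambda>X Y. farr n (prF n (exF n (snd X) (snd Y)) (snd X)) (evA (snd X) (snd Y)) (snd Y)\<rparr>"

lemma ccF_simps [simp]:
  "cone1 (ccF n) = (n, oneF n)"
  "cprd (ccF n) (n, F) (n, G) = (n, prF n F G)"
  "cfst (ccF n) (n, F) (n, G) = farr n (prF n F G) (pr1A F G) F"
  "csnd (ccF n) (n, F) (n, G) = farr n (prF n F G) (pr2A F G) G"
  "cexp (ccF n) (n, F) (n, G) = (n, exF n F G)"
  "cevl (ccF n) (n, F) (n, G) = farr n (prF n (exF n F G) F) (evA F G) G"
  by (simp_all add: ccF_def)

lemma product_FIB:
  assumes F: "relob n F" and G: "relob n G"
  shows "is_product (FIB n) (n, F) (n, G) (n, prF n F G) (farr n (prF n F G) (pr1A F G) F) (farr n (prF n F G) (pr2A F G) G)"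
  unfolding is_product_def
proof (intro conjI ballI)
  note FG = prod.relob_bapp[OF F G] and r = relar_pr1A[OF F G] relar_pr2A[OF F G]
  show "(n, prF n F G) \<in> Ob (FIB n)" using FG by simp
  show "farr n (prF n F G) (pr1A F G) F \<in> hom (FIB n) (n, prF n F G) (n, F)"
    "farr n (prF n F G) (pr2A F G) G \<in> hom (FIB n) (n, prF n F G) (n, G)"
    using FG F G r by (auto simp: FIB_hom)
  fix X f g
  assume "X \<in> Ob (FIB n)" "f \<in> hom (FIB n) X (n, F)" "g \<in> hom (FIB n) X (n, G)"
  then obtain Z s t where X: "X = (n, Z)" and Z: "relob n Z" and f: "f = farr n Z s F" "relar n Z s F"
    and g: "g = farr n Z t G" "relar n Z t G"
    by (auto simp: FIB_hom)
  from pairing_ex1[OF F G Z f(2) g(2)] obtain k where k: "relar n Z k (prF n F G)"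
    "ncmp (pr1A F G) k = s" "ncmp (pr2A F G) k = t"
    and uniq: "\<And>j. relar n Z j (prF n F G) \<Longrightarrow> ncmp (pr1A F G) j = s \<Longrightarrow> ncmp (pr2A F G) j = t \<Longrightarrow> j = k"
    by blast
  show "\<exists>!k. k \<in> hom (FIB n) X (n, prF n F G) \<and> farr n (prF n F G) (pr1A F G) F \<cdot>\<^bsub>FIB n\<^esub> k = f \<and>
      farr n (prF n F G) (pr2A F G) G \<cdot>\<^bsub>FIB n\<^esub> k = g"
  proof (rule ex1I[of _ "farr n Z k (prF n F G)"])
    show "farr n Z k (prF n F G) \<in> hom (FIB n) X (n, prF n F G) \<and>
        farr n (prF n F G) (pr1A F G) F \<cdot>\<^bsub>FIB n\<^esub> farr n Z k (prF n F G) = f \<and>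
        farr n (prF n F G) (pr2A F G) G \<cdot>\<^bsub>FIB n\<^esub> farr n Z k (prF n F G) = g"
      using k Z FG by (simp add: X FIB_hom FIB_comp[OF Z FG F k(1) r(1)] FIB_comp[OF Z FG G k(1) r(2)] f g)
  next
    fix j
    assume j: "j \<in> hom (FIB n) X (n, prF n F G) \<and> farr n (prF n F G) (pr1A F G) F \<cdot>\<^bsub>FIB n\<^esub> j = f \<and>
        farr n (prF n F G) (pr2A F G) G \<cdot>\<^bsub>FIB n\<^esub> j = g"
    then obtain s' where s': "j = farr n Z s' (prF n F G)" "relar n Z s' (prF n F G)"
      by (auto simp: X FIB_hom)
    then show "j = farr n Z k (prF n F G)"
      using j uniq[OF s'(2)] by (simp add: FIB_comp[OF Z FG F s'(2) r(1)] FIB_comp[OF Z FG G s'(2) r(2)] f g)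
  qed
qed

text \<open>The description in \<open>cprod_left\<close> lives in the fibre. Its levels turn out to
  be \<open>k \<times> 1\<close> in \<open>Rel(l)\<close>, so exponentials in the fibre can be
  tested levelwise.\<close>

lemma cprod_left_FIB:
  assumes Z: "relob n Z" and E: "relob n E" and A: "relob n A" and k: "relar n Z k E"
  obtains s where "cprod_left (FIB n) (ccF n) (farr n Z k E) (n, A) = farr n (prF n Z A) s (prF n E A)"
    "relar n (prF n Z A) s (prF n E A)"
    "\<And>l. l \<in> levels p \<Longrightarrow> s l = iprod_map C (FO R l) (P l) (k l) (idn (FO R l) \<cdot> ofo A l)"
proof -
  note ZA = prod.relob_bapp[OF Z A] and EA = prod.relob_bapp[OF E A]
  note rZ = relar_pr1A[OF Z A] relar_pr2A[OF Z A] and rE = relar_pr1A[OF E A] relar_pr2A[OF E A]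
  have "\<exists>!u. relar n (prF n Z A) u (prF n E A) \<and> ncmp (pr1A E A) u = ncmp k (pr1A Z A) \<and> ncmp (pr2A E A) u = pr2A Z A"
    by (rule pairing_ex1[OF E A ZA relar_ncmp[OF ZA Z E rZ(1) k] rZ(2)])
  then obtain s where s: "relar n (prF n Z A) s (prF n E A)" "ncmp (pr1A E A) s = ncmp k (pr1A Z A)"
    "ncmp (pr2A E A) s = pr2A Z A"
    and uniq: "\<And>u. relar n (prF n Z A) u (prF n E A) \<Longrightarrow> ncmp (pr1A E A) u = ncmp k (pr1A Z A) \<Longrightarrow>
      ncmp (pr2A E A) u = pr2A Z A \<Longrightarrow> u = s"
    by blast
  have D: "Dom (FIB n) (farr n Z k E) = (n, Z)" "Cod (FIB n) (farr n Z k E) = (n, E)"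
    by (simp_all add: farr_def)
  have "cprod_left (FIB n) (ccF n) (farr n Z k E) (n, A) = farr n (prF n Z A) s (prF n E A)"
    unfolding cprod_left_def Let_def D ccF_simps
  proof (rule the_equality)
    show "farr n (prF n Z A) s (prF n E A) \<in> hom (FIB n) (n, prF n Z A) (n, prF n E A) \<and>
        farr n (prF n E A) (pr1A E A) E \<cdot>\<^bsub>FIB n\<^esub> farr n (prF n Z A) s (prF n E A) =
          farr n Z k E \<cdot>\<^bsub>FIB n\<^esub> farr n (prF n Z A) (pr1A Z A) Z \<and>
        farr n (prF n E A) (pr2A E A) A \<cdot>\<^bsub>FIB n\<^esub> farr n (prF n Z A) s (prF n E A) =
          farr n (prF n Z A) (pr2A Z A) A"
      using s ZA EA by (simp add: FIB_hom FIB_comp[OF ZA EA E s(1) rE(1)] FIB_comp[OF ZA EA A s(1) rE(2)]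
          FIB_comp[OF ZA Z E rZ(1) k])
    fix u
    assume u: "u \<in> hom (FIB n) (n, prF n Z A) (n, prF n E A) \<and>
        farr n (prF n E A) (pr1A E A) E \<cdot>\<^bsub>FIB n\<^esub> u = farr n Z k E \<cdot>\<^bsub>FIB n\<^esub> farr n (prF n Z A) (pr1A Z A) Z \<and>
        farr n (prF n E A) (pr2A E A) A \<cdot>\<^bsub>FIB n\<^esub> u = farr n (prF n Z A) (pr2A Z A) A"
    then obtain t where t: "u = farr n (prF n Z A) t (prF n E A)" "relar n (prF n Z A) t (prF n E A)"
      by (auto simp: FIB_hom)
    then show "u = farr n (prF n Z A) s (prF n E A)"
      using u uniq[OF t(2)] by (simp add: FIB_comp[OF ZA EA E t(2) rE(1)] FIB_comp[OF ZA EA A t(2) rE(2)]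
          FIB_comp[OF ZA Z E rZ(1) k])
  qed
  moreover have "s l = iprod_map C (FO R l) (P l) (k l) (idn (FO R l) \<cdot> ofo A l)" if l: "l \<in> levels p" for l
  proof -
    interpret iproduct_category C "FO R l" "P l" by (rule iprod_at[OF l])
    note a = relob_rfun_eq(2)[OF A l] and z = relob_rfun_eq(2)[OF Z l]
    show ?thesis
    proof (rule pmap_eqI[symmetric, OF relarD(1)[OF Z E k l] idn_ihom[OF a]])
      show "Dom C (ofo Z l) = Dom C (ofo A l)" using a z by (simp add: homD)
      show "s l \<in> ihom C (FO R l) (prd (ofo Z l) (ofo A l)) (prd (ofo E l) (ofo A l))"
        using relarD(1)[OF ZA EA s(1) l] by (simp add: prod.ofo_bapp[OF Z A l] prod.ofo_bapp[OF E A l])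
      show "icomp C (FO R l) (prj1 (ofo E l) (ofo A l)) (s l) = icomp C (FO R l) (k l) (prj1 (ofo Z l) (ofo A l))"
        using fun_cong[OF s(2), of l] l by (simp add: nat_comp_def pr1A_def)
      show "icomp C (FO R l) (prj2 (ofo E l) (ofo A l)) (s l) =
          icomp C (FO R l) (idn (FO R l) \<cdot> ofo A l) (prj2 (ofo Z l) (ofo A l))"
        using fun_cong[OF s(3), of l] l icomp_idl[OF prj2_ihom[OF z a]] by (simp add: nat_comp_def pr2A_def)
    qed
  qed
  ultimately show ?thesis using that s(1) by blast
qed

lemma R_pmap_face:
  assumes h: "h \<in> faces p" and f: "f \<in> ihom C (FO R (Dom box h)) A A'" and g: "g \<in> ihom C (FO R (Dom box h)) B B'"
    and d: "Dom C A = Dom C B"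
  shows "fm (FA R h) \<cdot> iprod_map C (FO R (Dom box h)) (P (Dom box h)) f g =
    iprod_map C (FO R (Cod box h)) (P (Cod box h)) (fm (FA R h) \<cdot> f) (fm (FA R h) \<cdot> g)"
proof -
  note b = faces_box[OF h] and l = box_levels(3,4)[OF h]
  interpret L1: iproduct_category C "FO R (Dom box h)" "P (Dom box h)" by (rule iprod_at[OF l(1)])
  interpret L2: iproduct_category C "FO R (Cod box h)" "P (Cod box h)" by (rule iprod_at[OF l(2)])
  have A: "A \<in> hom C (Dom C A) (X0 (Dom box h))" "B \<in> hom C (Dom C A) (X0 (Dom box h))"
      "A' \<in> hom C (Dom C A) (X0 (Dom box h))" "B' \<in> hom C (Dom C A) (X0 (Dom box h))"
    using L1.ihom_src_hom[OF f] L1.ihom_src_hom[OF g] L1.ihom_tgt_hom[OF f] L1.ihom_tgt_hom[OF g] d by auto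
  note r = Rh_hom[OF b]
  have d': "Dom C (Rh h \<cdot> A) = Dom C (Rh h \<cdot> B)"
    using comp_hom[OF r A(1)] comp_hom[OF r A(2)] homD(2) by metis
  note pm = L1.pmap_ihom[OF f g d]
  show ?thesis
  proof (rule L2.pmap_eqI[symmetric, OF R_ihom[OF b f] R_ihom[OF b g] d'])
    show "fm (FA R h) \<cdot> L1.pmap f g \<in> ihom C (FO R (Cod box h)) (L2.prd (Rh h \<cdot> A) (Rh h \<cdot> B)) (L2.prd (Rh h \<cdot> A') (Rh h \<cdot> B'))"
      using R_ihom[OF b pm] by (simp add: prd_face[OF A(1,2) h] prd_face[OF A(3,4) h])
    show "icomp C (FO R (Cod box h)) (L2.prj1 (Rh h \<cdot> A') (Rh h \<cdot> B')) (fm (FA R h) \<cdot> L1.pmap f g) =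
        icomp C (FO R (Cod box h)) (fm (FA R h) \<cdot> f) (L2.prj1 (Rh h \<cdot> A) (Rh h \<cdot> B))"
      using R_icomp[OF b pm L1.prj1_ihom[OF A(3,4)]] R_icomp[OF b L1.prj1_ihom[OF A(1,2)] f]
      by (simp add: fst_face[OF A(1,2) h] fst_face[OF A(3,4) h] L1.prj1_pmap[OF f g d])
    show "icomp C (FO R (Cod box h)) (L2.prj2 (Rh h \<cdot> A') (Rh h \<cdot> B')) (fm (FA R h) \<cdot> L1.pmap f g) =
        icomp C (FO R (Cod box h)) (fm (FA R h) \<cdot> g) (L2.prj2 (Rh h \<cdot> A) (Rh h \<cdot> B))"
      using R_icomp[OF b pm L1.prj2_ihom[OF A(3,4)]] R_icomp[OF b L1.prj2_ihom[OF A(1,2)] g]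
      by (simp add: snd_face[OF A(1,2) h] snd_face[OF A(3,4) h] L1.prj2_pmap[OF f g d])
  qed
qed

text \<open>Naturality in morphisms of the lower level, again forced by the projections: each of
  them turns both sides into the image under \<open>Rel(h)\<close> of \<open>f\<close> or
  \<open>g\<close> after a projection.\<close>

lemma e_natural:
  assumes h: "h \<in> degens p" and f: "f \<in> ihom C (FO R (Dom box h)) A A'" and g: "g \<in> ihom C (FO R (Dom box h)) B B'"
    and d: "Dom C A = Dom C B"
  shows "icomp C (FO R (Cod box h)) (e h A' B') (fm (FA R h) \<cdot> iprod_map C (FO R (Dom box h)) (P (Dom box h)) f g) =
    icomp C (FO R (Cod box h))
      (iprod_map C (FO R (Cod box h)) (P (Cod box h)) (fm (FA R h) \<cdot> f) (fm (FA R h) \<cdot> g)) (e h A B)"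
proof -
  note b = degens_box[OF h] and l = h_levels[OF h]
  interpret L1: iproduct_category C "FO R (Dom box h)" "P (Dom box h)" by (rule iprod_at[OF l(1)])
  interpret L2: iproduct_category C "FO R (Cod box h)" "P (Cod box h)" by (rule iprod_at[OF l(2)])
  have A: "A \<in> hom C (Dom C A) (X0 (Dom box h))" "B \<in> hom C (Dom C A) (X0 (Dom box h))"
      "A' \<in> hom C (Dom C A) (X0 (Dom box h))" "B' \<in> hom C (Dom C A) (X0 (Dom box h))"
    using L1.ihom_src_hom[OF f] L1.ihom_src_hom[OF g] L1.ihom_tgt_hom[OF f] L1.ihom_tgt_hom[OF g] d by auto
  note r = Rh_hom[OF b]
  note RA = comp_hom[OF r A(1)] comp_hom[OF r A(2)] comp_hom[OF r A(3)] comp_hom[OF r A(4)]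
  have d': "Dom C (Rh h \<cdot> A) = Dom C (Rh h \<cdot> B)"
    using RA homD(2) by metis
  note pm = L1.pmap_ihom[OF f g d]
  note Rf = R_ihom[OF b f] and Rg = R_ihom[OF b g] and Rpm = R_ihom[OF b pm]
  note pm' = L2.pmap_ihom[OF Rf Rg d']
  note ea = e_ihom[OF A(1,2) h] and ea' = e_ihom[OF A(3,4) h]
  note j = L1.prj1_ihom[OF A(1,2)] L1.prj1_ihom[OF A(3,4)] L1.prj2_ihom[OF A(1,2)] L1.prj2_ihom[OF A(3,4)]
  show ?thesis
  proof (rule L2.prod_eqI[OF L2.icomp_ihom[OF ea' Rpm] L2.icomp_ihom[OF pm' ea] RA(3,4)])
    show "icomp C (FO R (Cod box h)) (L2.prj1 (Rh h \<cdot> A') (Rh h \<cdot> B')) (icomp C (FO R (Cod box h)) (e h A' B') (fm (FA R h) \<cdot> L1.pmap f g)) =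
        icomp C (FO R (Cod box h)) (L2.prj1 (Rh h \<cdot> A') (Rh h \<cdot> B'))
         (icomp C (FO R (Cod box h)) (L2.pmap (fm (FA R h) \<cdot> f) (fm (FA R h) \<cdot> g)) (e h A B))"
      by (simp add: L2.icomp_assoc[OF Rpm ea' L2.prj1_ihom[OF RA(3,4)]] e_fst[OF A(3,4) h]
          R_icomp[OF b pm j(2), symmetric] L1.prj1_pmap[OF f g d] R_icomp[OF b j(1) f]
          L2.icomp_assoc[OF ea pm' L2.prj1_ihom[OF RA(3,4)]] L2.prj1_pmap[OF Rf Rg d']
          L2.icomp_assoc[OF ea L2.prj1_ihom[OF RA(1,2)] Rf, symmetric] e_fst[OF A(1,2) h])
    show "icomp C (FO R (Cod box h)) (L2.prj2 (Rh h \<cdot> A') (Rh h \<cdot> B')) (icomp C (FO R (Cod box h)) (e h A' B') (fm (FA R h) \<cdot> L1.pmap f g)) =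
        icomp C (FO R (Cod box h)) (L2.prj2 (Rh h \<cdot> A') (Rh h \<cdot> B'))
         (icomp C (FO R (Cod box h)) (L2.pmap (fm (FA R h) \<cdot> f) (fm (FA R h) \<cdot> g)) (e h A B))"
      by (simp add: L2.icomp_assoc[OF Rpm ea' L2.prj2_ihom[OF RA(3,4)]] e_snd[OF A(3,4) h]
          R_icomp[OF b pm j(4), symmetric] L1.prj2_pmap[OF f g d] R_icomp[OF b j(3) g]
          L2.icomp_assoc[OF ea pm' L2.prj2_ihom[OF RA(3,4)]] L2.prj2_pmap[OF Rf Rg d']
          L2.icomp_assoc[OF ea L2.prj2_ihom[OF RA(1,2)] Rg, symmetric] e_snd[OF A(1,2) h])
  qed
qed

section \<open>Exponentials in the fibres\<close>

lemma relar_evA: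
  assumes F: "relob n F" and G: "relob n G"
  shows "relar n (prF n (exF n F G) F) (evA F G) G"
proof -
  note E = exp.relob_bapp[OF F G]
  note EF = prod.relob_bapp[OF E F]
  show ?thesis
  proof (rule relarI[OF EF G])
    fix l assume l: "l \<in> levels p"
    show "evA F G l \<in> ihom C (FO R l) (ofo (prF n (exF n F G) F) l) (ofo G l)"
      using iexponential_category.evl_ihom[OF iexp_at[OF l] ofo_homs[OF F G l]] l
      by (simp add: evA_def prod.ofo_bapp[OF E F] exp.ofo_bapp[OF F G])
  next
    fix h assume h: "h \<in> faces p"
    note b = faces_box[OF h] and l = box_levels(3,4)[OF h]
    interpret L2: iexponential_category C "FO R (Cod box h)" "P (Cod box h)" by (rule iexp_at[OF l(2)])
    show "fm (FA R h) \<cdot> evA F G (Dom box h) = evA F G (Cod box h) \<cdot> Rn n h"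
      using evl_face[OF ofo_homs[OF F G l(1)] h] at2_Rn[OF F G b L2.ievl_hom]
      by (simp add: evA_def l relob_face[OF F h] relob_face[OF G h])
  next
    fix h assume h: "h \<in> degens p"
    note b = degens_box[OF h] and l = h_levels[OF h]
    interpret L1: iexponential_category C "FO R (Dom box h)" "P (Dom box h)" by (rule iexp_at[OF l(1)])
    interpret L2: iexponential_category C "FO R (Cod box h)" "P (Cod box h)" by (rule iexp_at[OF l(2)])
    let ?A = "ofo F (Dom box h)" and ?B = "ofo G (Dom box h)"
    note A = ofo_homs[OF F G l(1)] and R = R_ofo_homs[OF F G b] and S = ofo_Rn_homs[OF F G b]
    note eF = relob_degen(2)[OF F h] and eG = relob_degen(2)[OF G h] and iso = M_iso[OF l(2) relob_degen(1)[OF F h]]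
    have d: "Dom C (Rh h \<cdot> ?A) = Dom C (Rh h \<cdot> ?B)" using R by (simp add: homD)
    note em = L2.emap_ihom[OF eF iso eG d]
    note vv = v_pair_ihom[OF h A]
    have RE: "Rh h \<cdot> L1.expo ?A ?B \<in> hom C (Pw n (Dom box h)) (X0 (Cod box h))"
      by (rule comp_hom[OF Rh_hom[OF b] L1.expo_hom[OF A]])
    have dE: "Dom C (Rh h \<cdot> L1.expo ?A ?B) = Dom C (Rh h \<cdot> ?A)"
      "Dom C (L2.expo (Rh h \<cdot> ?A) (Rh h \<cdot> ?B)) = Dom C (Rh h \<cdot> ?A)"
      using RE R L2.expo_hom[OF R] by (simp_all add: homD)
    note id = L2.idn_ihom[OF R(1)]
    note p1 = L2.pmap_ihom[OF vv id dE(1)] and p2 = L2.pmap_ihom[OF em eF dE(2)]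
    note ee = e_ihom[OF L1.expo_hom[OF A] A(1) h]
    have rE: "reps (exF n F G) h = icomp C (FO R (Cod box h)) (L2.emap (reps F h) (reps G h)) (vexp h \<cdot> pair C ?A ?B)"
      by (rule exp.reps_bapp[OF F G h])
    \<comment> \<open>The witness of \<open>F \<Rightarrow> G\<close> is \<open>emap\<close> after
      \<open>vexp\<close>. Splitting its product with the witness of \<open>F\<close> pairs the
      latter with \<open>emap\<close>, as \<open>evl_emap\<close> requires, and leaves an identity
      beside \<open>vexp\<close>.\<close>
    have "L2.pmap (reps (exF n F G) h) (reps F h) =
        icomp C (FO R (Cod box h)) (L2.pmap (L2.emap (reps F h) (reps G h)) (reps F h))
          (L2.pmap (vexp h \<cdot> pair C ?A ?B) (idn (FO R (Cod box h)) \<cdot> (Rh h \<cdot> ?A)))"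
      using L2.pmap_icomp[OF vv id dE(1) em eF] by (simp add: rE L2.icomp_idr[OF eF])
    then have r: "reps (prF n (exF n F G) F) h = icomp C (FO R (Cod box h))
        (icomp C (FO R (Cod box h)) (L2.pmap (L2.emap (reps F h) (reps G h)) (reps F h))
          (L2.pmap (vexp h \<cdot> pair C ?A ?B) (idn (FO R (Cod box h)) \<cdot> (Rh h \<cdot> ?A))))
        (e h (L1.expo ?A ?B) ?A)"
      using reps_prF[OF E F h] exp.ofo_bapp[OF F G l(1)] by simp
    note ev = L2.evl_ihom[OF S] and ev' = L2.evl_ihom[OF R]
    have "evA F G (Cod box h) \<cdot> Rn n h = L2.evl (ofo F (Cod box h) \<cdot> Rn n h) (ofo G (Cod box h) \<cdot> Rn n h)"
      using at2_Rn[OF F G b L2.ievl_hom] by (simp add: evA_def l)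
    \<comment> \<open>\<open>evl_emap\<close> trades the witnesses before evaluation for the witness
      of \<open>G\<close> after it.\<close>
    then have "icomp C (FO R (Cod box h)) (evA F G (Cod box h) \<cdot> Rn n h) (reps (prF n (exF n F G) F) h) =
        icomp C (FO R (Cod box h)) (icomp C (FO R (Cod box h)) (reps G h) (L2.evl (Rh h \<cdot> ?A) (Rh h \<cdot> ?B)))
          (icomp C (FO R (Cod box h)) (L2.pmap (vexp h \<cdot> pair C ?A ?B) (idn (FO R (Cod box h)) \<cdot> (Rh h \<cdot> ?A)))
            (e h (L1.expo ?A ?B) ?A))"
      using L2.icomp_assoc[OF L2.icomp_ihom[OF p1 ee] p2 ev] L2.evl_emap[OF eF iso eG d]
      by (simp add: r L2.icomp_assoc[OF ee p1 p2, symmetric])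
    \<comment> \<open>What remains is the comparison of \<open>Rel(h)\<close> with evaluation, which
      is the equation by which \<open>vexp\<close> was chosen.\<close>
    also have "\<dots> = icomp C (FO R (Cod box h)) (reps G h) (fm (FA R h) \<cdot> L1.evl ?A ?B)"
      using v_pair_evl[OF h A] by (simp add: L2.icomp_assoc[OF L2.icomp_ihom[OF p1 ee] ev' eG, symmetric])
    finally show "icomp C (FO R (Cod box h)) (evA F G (Cod box h) \<cdot> Rn n h) (reps (prF n (exF n F G) F) h) =
        icomp C (FO R (Cod box h)) (reps G h) (fm (FA R h) \<cdot> evA F G (Dom box h))"
      by (simp add: evA_def l)
  qed (simp add: evA_def)
qed

text \<open>The test is stated levelwise because \<open>cprod_left_FIB\<close> applies only once
  \<open>k\<close> is known to be a morphism of relational types.\<close>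

lemma curry_relar:
  assumes F: "relob n F" and G: "relob n G" and Z: "relob n Z" and f: "relar n (prF n Z F) f G"
  shows "\<exists>!k. relar n Z k (exF n F G) \<and>
    (\<forall>l\<in>levels p. icomp C (FO R l) (evA F G l) (iprod_map C (FO R l) (P l) (k l) (idn (FO R l) \<cdot> ofo F l)) = f l)"
proof -
  note E = exp.relob_bapp[OF F G] and ZF = prod.relob_bapp[OF Z F]
  note EF = prod.relob_bapp[OF E F] and ev = relar_evA[OF F G]
  define k where "k l = (if l \<in> levels p then THE k. k \<in> ihom C (FO R l) (ofo Z l) (ofo (exF n F G) l) \<and>
      icomp C (FO R l) (evA F G l) (iprod_map C (FO R l) (P l) k (idn (FO R l) \<cdot> ofo F l)) = f l else undefined)" for l
  have ex: "\<exists>!k. k \<in> ihom C (FO R l) (ofo Z l) (ofo (exF n F G) l) \<and>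
      icomp C (FO R l) (evA F G l) (iprod_map C (FO R l) (P l) k (idn (FO R l) \<cdot> ofo F l)) = f l" if l: "l \<in> levels p" for l
    using iexponential_category.curry_ex1[OF iexp_at[OF l] ofo_homs(2,1)[OF Z F l]] relarD(1)[OF ZF G f l] l
    by (simp add: exp.ofo_bapp[OF F G] prod.ofo_bapp[OF Z F] evA_def)
  have k: "k l \<in> ihom C (FO R l) (ofo Z l) (ofo (exF n F G) l)"
      "icomp C (FO R l) (evA F G l) (iprod_map C (FO R l) (P l) (k l) (idn (FO R l) \<cdot> ofo F l)) = f l"
    if l: "l \<in> levels p" for l
    using theI'[OF ex[OF l]] l by (auto simp: k_def)
  have dZF: "Dom C (ofo Z l) = Dom C (ofo F l)" if l: "l \<in> levels p" for l
    using ofo_homs[OF Z F l] by (simp add: homD)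
  have km: "iprod_map C (FO R l) (P l) (k l) (idn (FO R l) \<cdot> ofo F l) \<in>
      ihom C (FO R l) (ofo (prF n Z F) l) (ofo (prF n (exF n F G) F) l)" if l: "l \<in> levels p" for l
    using iproduct_category.pmap_ihom[OF iprod_at[OF l] k(1)[OF l]
        icategory.idn_ihom[OF icategory_at[OF l] ofo_homs(1)[OF F G l]] dZF[OF l]] l
    by (simp add: prod.ofo_bapp[OF Z F] prod.ofo_bapp[OF E F])
  have evRn: "evA F G (Cod box h) \<cdot> Rn n h =
      at2 C (ievl (P (Cod box h))) (ofo F (Cod box h) \<cdot> Rn n h) (ofo G (Cod box h) \<cdot> Rn n h)"
    and ERn: "ofo (exF n F G) (Cod box h) \<cdot> Rn n h =
      at2 C (iexp (P (Cod box h))) (ofo F (Cod box h) \<cdot> Rn n h) (ofo G (Cod box h) \<cdot> Rn n h)"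
    if h: "h \<in> box_ars p" for h
  proof -
    note l = box_levels(2)[OF h]
    interpret L2: iexponential_category C "FO R (Cod box h)" "P (Cod box h)" by (rule iexp_at[OF l])
    show "evA F G (Cod box h) \<cdot> Rn n h =
      at2 C (ievl (P (Cod box h))) (ofo F (Cod box h) \<cdot> Rn n h) (ofo G (Cod box h) \<cdot> Rn n h)"
      "ofo (exF n F G) (Cod box h) \<cdot> Rn n h =
      at2 C (iexp (P (Cod box h))) (ofo F (Cod box h) \<cdot> Rn n h) (ofo G (Cod box h) \<cdot> Rn n h)"
      using at2_Rn[OF F G h L2.ievl_hom] at2_Rn[OF F G h L2.iexp_hom] l
      by (simp_all add: evA_def exp.ofo_bapp[OF F G])
  qed
  have k_Rn: "icomp C (FO R (Cod box h)) (evA F G (Cod box h) \<cdot> Rn n h)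
      (iprod_map C (FO R (Cod box h)) (P (Cod box h)) (k (Cod box h) \<cdot> Rn n h)
        (idn (FO R (Cod box h)) \<cdot> (ofo F (Cod box h) \<cdot> Rn n h))) = f (Cod box h) \<cdot> Rn n h" if h: "h \<in> box_ars p" for h
  proof -
    note l = box_levels(2)[OF h]
    interpret L2: iexponential_category C "FO R (Cod box h)" "P (Cod box h)" by (rule iexp_at[OF l])
    have u: "Rn n h \<in> hom C (Pw n (Dom box h)) (Dom C (ofo Z (Cod box h)))"
      using Rn_hom[OF h] ofo_homs(1)[OF Z F l] by (simp add: homD)
    show ?thesis
      using icomp_Rn[OF ZF h km[OF l] relarD(1)[OF EF G ev l]] k(2)[OF l]
        L2.pmap_comp[OF k(1)[OF l] L2.idn_ihom[OF ofo_homs(1)[OF F G l]] dZF[OF l] u]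
        L2.idn_comp[OF ofo_homs(1)[OF F G l] Rn_hom[OF h]]
      by simp
  qed
  have R_k: "icomp C (FO R (Cod box h)) (fm (FA R h) \<cdot> evA F G (Dom box h))
      (fm (FA R h) \<cdot> iprod_map C (FO R (Dom box h)) (P (Dom box h)) (k (Dom box h)) (idn (FO R (Dom box h)) \<cdot> ofo F (Dom box h))) =
      fm (FA R h) \<cdot> f (Dom box h)" if h: "h \<in> box_ars p" for h
    using R_icomp[OF h km[OF box_levels(1)[OF h]] relarD(1)[OF EF G ev box_levels(1)[OF h]]] k(2)[OF box_levels(1)[OF h]]
    by simp
  have "relar n Z k (exF n F G)"
  proof (rule relarI[OF Z E k(1)])
    fix h assume h: "h \<in> faces p"
    note b = faces_box[OF h] and l = box_levels(3,4)[OF h]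
    interpret L1: iexponential_category C "FO R (Dom box h)" "P (Dom box h)" by (rule iexp_at[OF l(1)])
    interpret L2: iexponential_category C "FO R (Cod box h)" "P (Cod box h)" by (rule iexp_at[OF l(2)])
    note S = ofo_Rn_homs[OF F G b]
    \<comment> \<open>Faces preserve products strictly, so \<open>Rel(h)\<close> commutes with
      \<open>k \<times> 1\<close> and no comparison intervenes.\<close>
    have pm: "fm (FA R h) \<cdot> L1.pmap (k (Dom box h)) (idn (FO R (Dom box h)) \<cdot> ofo F (Dom box h)) =
        L2.pmap (fm (FA R h) \<cdot> k (Dom box h)) (idn (FO R (Cod box h)) \<cdot> (ofo F (Cod box h) \<cdot> Rn n h))"
      using R_pmap_face[OF h k(1)[OF l(1)] L1.idn_ihom[OF ofo_homs(1)[OF F G l(1)]] dZF[OF l(1)]]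
        R_idn[OF b ofo_homs(1)[OF F G l(1)]] relob_face[OF F h] by simp
    show "fm (FA R h) \<cdot> k (Dom box h) = k (Cod box h) \<cdot> Rn n h"
    proof (rule L2.exp_eqI[OF S(1) ofo_Rn_homs(1)[OF Z F b] S(2)])
      show "fm (FA R h) \<cdot> k (Dom box h) \<in> ihom C (FO R (Cod box h)) (ofo Z (Cod box h) \<cdot> Rn n h)
          (L2.expo (ofo F (Cod box h) \<cdot> Rn n h) (ofo G (Cod box h) \<cdot> Rn n h))"
        using R_ihom[OF b k(1)[OF l(1)]] by (simp add: relob_face[OF Z h] relob_face[OF E h] ERn[OF b])
      show "k (Cod box h) \<cdot> Rn n h \<in> ihom C (FO R (Cod box h)) (ofo Z (Cod box h) \<cdot> Rn n h)
          (L2.expo (ofo F (Cod box h) \<cdot> Rn n h) (ofo G (Cod box h) \<cdot> Rn n h))"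
        using comp_Rn_ihom[OF Z b k(1)[OF l(2)]] by (simp add: ERn[OF b])
      show "icomp C (FO R (Cod box h)) (L2.evl (ofo F (Cod box h) \<cdot> Rn n h) (ofo G (Cod box h) \<cdot> Rn n h))
           (L2.pmap (fm (FA R h) \<cdot> k (Dom box h)) (idn (FO R (Cod box h)) \<cdot> (ofo F (Cod box h) \<cdot> Rn n h))) =
         icomp C (FO R (Cod box h)) (L2.evl (ofo F (Cod box h) \<cdot> Rn n h) (ofo G (Cod box h) \<cdot> Rn n h))
           (L2.pmap (k (Cod box h) \<cdot> Rn n h) (idn (FO R (Cod box h)) \<cdot> (ofo F (Cod box h) \<cdot> Rn n h)))"
        using k_Rn[OF b] R_k[OF b] relarD(2)[OF ZF G f h] relarD(2)[OF EF G ev h] by (simp add: pm evRn[OF b])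
    qed
  next
    fix h assume h: "h \<in> degens p"
    note b = degens_box[OF h] and l = h_levels[OF h]
    interpret L1: iexponential_category C "FO R (Dom box h)" "P (Dom box h)" by (rule iexp_at[OF l(1)])
    interpret L2: iexponential_category C "FO R (Cod box h)" "P (Cod box h)" by (rule iexp_at[OF l(2)])
    let ?A = "ofo F (Dom box h)" and ?Z = "ofo Z (Dom box h)" and ?l = "Cod box h"
    let ?A' = "ofo F (Cod box h) \<cdot> Rn n h" and ?B' = "ofo G (Cod box h) \<cdot> Rn n h" and ?Z' = "ofo Z (Cod box h) \<cdot> Rn n h"
    note A = ofo_homs[OF F Z l(1)] and R = R_ofo_homs[OF F Z b] and S = ofo_Rn_homs[OF F G b] and SZ = ofo_Rn_homs[OF Z F b]
    note eF = relob_degen(2)[OF F h] and eZ = relob_degen(2)[OF Z h] and eE = relob_degen(2)[OF E h]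
      and eG = relob_degen(2)[OF G h]
    note isoF = M_iso[OF l(2) relob_degen(1)[OF F h]]
    note kR = comp_Rn_ihom[OF Z b k(1)[OF l(2)]] and Rk = R_ihom[OF b k(1)[OF l(1)]]
    let ?a = "icomp C (FO R ?l) (k ?l \<cdot> Rn n h) (reps Z h)"
    let ?b = "icomp C (FO R ?l) (reps (exF n F G) h) (fm (FA R h) \<cdot> k (Dom box h))"
    have a: "?a \<in> ihom C (FO R ?l) (Rh h \<cdot> ?Z) (L2.expo ?A' ?B')"
      using L2.icomp_ihom[OF kR eZ] by (simp add: ERn[OF b])
    have b': "?b \<in> ihom C (FO R ?l) (Rh h \<cdot> ?Z) (L2.expo ?A' ?B')"
      using L2.icomp_ihom[OF eE Rk] by (simp add: ERn[OF b])
    have dR: "Dom C (Rh h \<cdot> ?Z) = Dom C (Rh h \<cdot> ?A)" "Dom C (Rh h \<cdot> ?Z) = Pw n (Dom box h)"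
      "Dom C (Rh h \<cdot> ?A) = Pw n (Dom box h)" "Dom C ?Z' = Dom C ?A'"
      "Dom C (Rh h \<cdot> ofo (exF n F G) (Dom box h)) = Dom C (Rh h \<cdot> ?A)"
      using R SZ S R_ofo_homs(1)[OF E Z b] by (simp_all add: homD)
    note ee = e_ihom[OF A(2,1) h] and ee_iso = M_iso[OF l(2) e_M[OF A(2,1) h]]
    note idA = L2.idn_ihom[OF S(1)] and idR = L2.idn_ihom[OF R(1)]
    have pa: "L2.pmap ?a (reps F h) \<in> ihom C (FO R ?l) (L2.prd (Rh h \<cdot> ?Z) (Rh h \<cdot> ?A)) (L2.prd (L2.expo ?A' ?B') ?A')"
      by (rule L2.pmap_ihom[OF a eF dR(1)])
    have pb: "L2.pmap ?b (reps F h) \<in> ihom C (FO R ?l) (L2.prd (Rh h \<cdot> ?Z) (Rh h \<cdot> ?A)) (L2.prd (L2.expo ?A' ?B') ?A')"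
      by (rule L2.pmap_ihom[OF b' eF dR(1)])
    note evl = L2.evl_ihom[OF S]
    \<comment> \<open>For \<open>?a\<close>: the witnesses of \<open>Z\<close> and \<open>F\<close>
      after \<open>e\<close> form the witness of the product \<open>Z \<times> F\<close>, and what
      is left is the degeneracy condition of \<open>f\<close>.\<close>
    have "icomp C (FO R ?l) (icomp C (FO R ?l) (L2.evl ?A' ?B') (L2.pmap ?a (reps F h))) (e h ?Z ?A) =
        icomp C (FO R ?l) (reps G h) (fm (FA R h) \<cdot> f (Dom box h))"
    proof -
      have kR': "k ?l \<cdot> Rn n h \<in> ihom C (FO R ?l) ?Z' (L2.expo ?A' ?B')"
        using kR by (simp add: ERn[OF b])
      note p1 = L2.pmap_ihom[OF eZ eF dR(1)] and p2 = L2.pmap_ihom[OF kR' idA dR(4)]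
      have "L2.pmap ?a (reps F h) = icomp C (FO R ?l) (L2.pmap (k ?l \<cdot> Rn n h) (idn (FO R ?l) \<cdot> ?A'))
          (L2.pmap (reps Z h) (reps F h))"
        using L2.pmap_icomp[OF eZ eF dR(1) kR' idA] by (simp add: L2.icomp_idl[OF eF])
      then have "icomp C (FO R ?l) (L2.evl ?A' ?B') (L2.pmap ?a (reps F h)) =
          icomp C (FO R ?l) (f ?l \<cdot> Rn n h) (L2.pmap (reps Z h) (reps F h))"
        using k_Rn[OF b] by (simp add: L2.icomp_assoc[OF p1 p2 evl] evRn[OF b])
      moreover have "f ?l \<cdot> Rn n h \<in> ihom C (FO R ?l) (L2.prd ?Z' ?A') ?B'"
        using L2.icomp_ihom[OF evl p2] k_Rn[OF b] by (simp add: evRn[OF b])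
      ultimately show ?thesis
        using relarD(3)[OF ZF G f h] L2.icomp_assoc[OF ee p1] by (simp add: reps_prF[OF Z F h])
    qed
    \<comment> \<open>For \<open>?b\<close>: naturality of \<open>e\<close> moves
      \<open>k \<times> 1\<close> to the right of the comparison, as its image under
      \<open>Rel(h)\<close>. The degeneracy condition of evaluation then brings the witness of
      \<open>G\<close> to the front, and \<open>R_k\<close> applies.\<close>
    moreover have "icomp C (FO R ?l) (icomp C (FO R ?l) (L2.evl ?A' ?B') (L2.pmap ?b (reps F h))) (e h ?Z ?A) =
        icomp C (FO R ?l) (reps G h) (fm (FA R h) \<cdot> f (Dom box h))"
    proof -
      let ?km = "L1.pmap (k (Dom box h)) (idn (FO R (Dom box h)) \<cdot> ?A)"
      let ?E = "ofo (exF n F G) (Dom box h)"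
      have eE': "reps (exF n F G) h \<in> ihom C (FO R ?l) (Rh h \<cdot> ?E) (L2.expo ?A' ?B')"
        using eE by (simp add: ERn[OF b])
      note p1 = L2.pmap_ihom[OF Rk idR dR(1)] and p2 = L2.pmap_ihom[OF eE' eF dR(5)]
      have E1: "?E \<in> hom C (Pw n (Dom box h)) (X0 (Dom box h))"
        by (rule relob_rfun_eq(2)[OF E l(1)])
      note eE1 = e_ihom[OF E1 A(1) h]
      note id1 = L1.idn_ihom[OF A(1)]
      have Rkm: "fm (FA R h) \<cdot> ?km \<in> ihom C (FO R ?l) (Rh h \<cdot> L1.prd ?Z ?A) (Rh h \<cdot> L1.prd ?E ?A)"
        by (rule R_ihom[OF b L1.pmap_ihom[OF k(1)[OF l(1)] id1 dZF[OF l(1)]]])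
      have nat: "icomp C (FO R ?l) (L2.pmap (fm (FA R h) \<cdot> k (Dom box h)) (idn (FO R ?l) \<cdot> (Rh h \<cdot> ?A))) (e h ?Z ?A) =
          icomp C (FO R ?l) (e h ?E ?A) (fm (FA R h) \<cdot> ?km)"
        using e_natural[OF h k(1)[OF l(1)] id1 dZF[OF l(1)]] R_idn[OF b A(1)] by simp
      have ev1: "fm (FA R h) \<cdot> evA F G (Dom box h) \<in> ihom C (FO R ?l) (Rh h \<cdot> L1.prd ?E ?A) (Rh h \<cdot> ofo G (Dom box h))"
        using R_ihom[OF b relarD(1)[OF EF G ev l(1)]] prod.ofo_bapp[OF E F l(1)] by simp
      have "L2.pmap ?b (reps F h) = icomp C (FO R ?l) (L2.pmap (reps (exF n F G) h) (reps F h))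
          (L2.pmap (fm (FA R h) \<cdot> k (Dom box h)) (idn (FO R ?l) \<cdot> (Rh h \<cdot> ?A)))"
        using L2.pmap_icomp[OF Rk idR dR(1) eE' eF] by (simp add: L2.icomp_idr[OF eF])
      then have "icomp C (FO R ?l) (L2.pmap ?b (reps F h)) (e h ?Z ?A) =
          icomp C (FO R ?l) (reps (prF n (exF n F G) F) h) (fm (FA R h) \<cdot> ?km)"
        by (simp add: L2.icomp_assoc[OF ee p1 p2, symmetric] nat L2.icomp_assoc[OF Rkm eE1 p2] reps_prF[OF E F h])
      then have "icomp C (FO R ?l) (icomp C (FO R ?l) (L2.evl ?A' ?B') (L2.pmap ?b (reps F h))) (e h ?Z ?A) =
          icomp C (FO R ?l) (icomp C (FO R ?l) (L2.evl ?A' ?B') (reps (prF n (exF n F G) F) h)) (fm (FA R h) \<cdot> ?km)"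
        using L2.icomp_assoc[OF Rkm L2.icomp_ihom[OF p2 eE1] evl]
        by (simp add: L2.icomp_assoc[OF ee pb evl, symmetric] reps_prF[OF E F h])
      also have "\<dots> = icomp C (FO R ?l) (reps G h) (fm (FA R h) \<cdot> f (Dom box h))"
        using relarD(3)[OF EF G ev h] R_k[OF b] L2.icomp_assoc[OF Rkm ev1 eG] by (simp add: evRn[OF b])
      finally show ?thesis .
    qed
    \<comment> \<open>The comparison \<open>e\<close> is invertible and cancels on the
      right.\<close>
    ultimately have "icomp C (FO R ?l) (L2.evl ?A' ?B') (L2.pmap ?a (reps F h)) =
        icomp C (FO R ?l) (L2.evl ?A' ?B') (L2.pmap ?b (reps F h))"
      by (intro L2.iso_cancel_right[OF ee ee_iso L2.icomp_ihom[OF evl pa] L2.icomp_ihom[OF evl pb]]) simp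
    \<comment> \<open>Evaluation was tested against the witness of \<open>F\<close> instead of an
      identity, hence the variant of uniqueness for isomorphisms.\<close>
    then show "?a = ?b"
      using R(2) S(2) dR by (intro L2.exp_eqI_iso[OF eF isoF _ _ a b']) simp_all
  qed (simp_all add: k_def)
  moreover have "j = k" if j: "relar n Z j (exF n F G)"
    "\<forall>l\<in>levels p. icomp C (FO R l) (evA F G l) (iprod_map C (FO R l) (P l) (j l) (idn (FO R l) \<cdot> ofo F l)) = f l" for j
  proof
    fix l show "j l = k l"
    proof (cases "l \<in> levels p")
      case True
      then show ?thesis
        using ex[OF True] relarD(1)[OF Z E j(1) True] j(2) k[OF True] by blast
    next
      case False
      then show ?thesis using relarD(4)[OF Z E j(1)] by (simp add: k_def)
    qed
  qed
  ultimately show ?thesis using k(2) by blast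
qed

lemma exponential_FIB:
  assumes F: "relob n F" and G: "relob n G" and Z: "relob n Z" and f: "f \<in> hom (FIB n) (n, prF n Z F) (n, G)"
  shows "\<exists>!k. k \<in> hom (FIB n) (n, Z) (n, exF n F G) \<and>
    farr n (prF n (exF n F G) F) (evA F G) G \<cdot>\<^bsub>FIB n\<^esub> cprod_left (FIB n) (ccF n) k (n, F) = f"
proof -
  note E = exp.relob_bapp[OF F G] and ZF = prod.relob_bapp[OF Z F]
  note EF = prod.relob_bapp[OF E F] and ev = relar_evA[OF F G]
  obtain s where s: "f = farr n (prF n Z F) s G" "relar n (prF n Z F) s G"
    using f by (auto simp: FIB_hom)
  \<comment> \<open>Composing with evaluation in the fibre amounts to the family of levelwise tests,
    so existence and uniqueness transfer from \<open>curry_relar\<close>.\<close>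
  have key: "farr n (prF n (exF n F G) F) (evA F G) G \<cdot>\<^bsub>FIB n\<^esub> cprod_left (FIB n) (ccF n) (farr n Z k (exF n F G)) (n, F) = f
      \<longleftrightarrow> (\<forall>l\<in>levels p. icomp C (FO R l) (evA F G l) (iprod_map C (FO R l) (P l) (k l) (idn (FO R l) \<cdot> ofo F l)) = s l)"
    if k: "relar n Z k (exF n F G)" for k
  proof -
    obtain t where t: "cprod_left (FIB n) (ccF n) (farr n Z k (exF n F G)) (n, F) = farr n (prF n Z F) t (prF n (exF n F G) F)"
      "relar n (prF n Z F) t (prF n (exF n F G) F)"
      "\<And>l. l \<in> levels p \<Longrightarrow> t l = iprod_map C (FO R l) (P l) (k l) (idn (FO R l) \<cdot> ofo F l)"
      using cprod_left_FIB[OF Z E F k] by blast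
    have "ncmp (evA F G) t = s \<longleftrightarrow> (\<forall>l\<in>levels p. icomp C (FO R l) (evA F G l) (t l) = s l)"
      using relarD(4)[OF ZF G s(2)] by (auto simp: nat_comp_def fun_eq_iff)
    then show ?thesis
      by (simp add: t(1,3) FIB_comp[OF ZF EF G t(2) ev] s(1))
  qed
  from curry_relar[OF F G Z s(2)] obtain k where k: "relar n Z k (exF n F G)"
    "\<forall>l\<in>levels p. icomp C (FO R l) (evA F G l) (iprod_map C (FO R l) (P l) (k l) (idn (FO R l) \<cdot> ofo F l)) = s l"
    and uniq: "\<And>j. relar n Z j (exF n F G) \<Longrightarrow>
      \<forall>l\<in>levels p. icomp C (FO R l) (evA F G l) (iprod_map C (FO R l) (P l) (j l) (idn (FO R l) \<cdot> ofo F l)) = s l \<Longrightarrow> j = k"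
    by blast
  show ?thesis
  proof (rule ex1I[of _ "farr n Z k (exF n F G)"])
    show "farr n Z k (exF n F G) \<in> hom (FIB n) (n, Z) (n, exF n F G) \<and>
        farr n (prF n (exF n F G) F) (evA F G) G \<cdot>\<^bsub>FIB n\<^esub> cprod_left (FIB n) (ccF n) (farr n Z k (exF n F G)) (n, F) = f"
      using k Z E key by (simp add: FIB_hom)
  next
    fix j
    assume j: "j \<in> hom (FIB n) (n, Z) (n, exF n F G) \<and>
        farr n (prF n (exF n F G) F) (evA F G) G \<cdot>\<^bsub>FIB n\<^esub> cprod_left (FIB n) (ccF n) j (n, F) = f"
    then obtain t where t: "j = farr n Z t (exF n F G)" "relar n Z t (exF n F G)"
      by (auto simp: FIB_hom)
    then show "j = farr n Z k (exF n F G)"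
      using j uniq[OF t(2)] key[OF t(2)] by simp
  qed
qed

lemma cartesian_closed_FIB: "cartesian_closed (FIB n) (ccF n)"
  unfolding cartesian_closed_def
proof (intro conjI ballI)
  show "category (FIB n)" by (rule FIB_cat)
  show "is_terminal (FIB n) (cone1 (ccF n))" using terminal_FIB by simp
  fix X Y assume "X \<in> Ob (FIB n)" "Y \<in> Ob (FIB n)"
  then obtain F G where X: "X = (n, F)" "relob n F" and Y: "Y = (n, G)" "relob n G" by auto
  show "is_product (FIB n) X Y (cprd (ccF n) X Y) (cfst (ccF n) X Y) (csnd (ccF n) X Y)"
    using product_FIB[OF X(2) Y(2)] by (simp add: X Y)
  note E = exp.relob_bapp[OF X(2) Y(2)]
  show "cexp (ccF n) X Y \<in> Ob (FIB n)"
    using E by (simp add: X Y)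
  show "cevl (ccF n) X Y \<in> hom (FIB n) (cprd (ccF n) (cexp (ccF n) X Y) X) Y"
    using relar_evA[OF X(2) Y(2)] prod.relob_bapp[OF E X(2)] Y(2) by (simp add: X(1) Y(1) FIB_hom)
  fix Z f assume "Z \<in> Ob (FIB n)" and f: "f \<in> hom (FIB n) (cprd (ccF n) Z X) Y"
  then obtain H where Z: "Z = (n, H)" "relob n H" by auto
  show "\<exists>!k. k \<in> hom (FIB n) Z (cexp (ccF n) X Y) \<and> cevl (ccF n) X Y \<cdot>\<^bsub>FIB n\<^esub> cprod_left (FIB n) (ccF n) k X = f"
    using exponential_FIB[OF X(2) Y(2) Z(2), of f] f by (simp add: X(1) Y(1) Z(1))
qed

section \<open>Reindexing of the cartesian closed structure\<close>

lemma tsub_at2: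
  assumes U: "relobs n Us" and F: "relob (length Us) F" and G: "relob (length Us) G" and l: "l \<in> levels p"
    and m: "m \<in> hom C (Pw 2 l) Y"
  shows "at2 C m (ofo F l) (ofo G l) \<cdot> tob n Us l = at2 C m (ofo (sbst F n Us) l) (ofo (sbst G n Us) l)"
  using at2_comp[OF m ofo_homs[OF F G l] tob_hom[OF U l]] by (simp add: ofo_sbst[OF F U l] ofo_sbst[OF G U l])

text \<open>At each level, projections and evaluation are single arrows out of \<open>Pw 2\<close>,
  so reindexing only changes the pair of objects at which they are taken.\<close>

lemma tsub_structure:
  assumes U: "relobs n Us" and F: "relob (length Us) F" and G: "relob (length Us) G"
  shows "tsub n Us (pr1A F G) = pr1A (sbst F n Us) (sbst G n Us)"
    and "tsub n Us (pr2A F G) = pr2A (sbst F n Us) (sbst G n Us)"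
    and "tsub n Us (evA F G) = evA (sbst F n Us) (sbst G n Us)"
  using tsub_at2[OF U F G _ iproduct_category.ifst_hom[OF iprod_at]]
    tsub_at2[OF U F G _ iproduct_category.isnd_hom[OF iprod_at]]
    tsub_at2[OF U F G _ iexponential_category.ievl_hom[OF iexp_at]]
  by (auto simp: tsub_def pr1A_def pr2A_def evA_def fun_eq_iff)

lemma split_ccc: "split_ccc_fibration GRO CTX forget lft"
  unfolding split_ccc_fibration_def
proof (intro conjI exI[of _ ccF] ballI)
  show "split_fibration GRO CTX forget lft"
    by (rule split_fibration_forget[OF GRO_cat])
  show "cartesian_closed (FIB n) (ccF n)" for n
    by (rule cartesian_closed_FIB)
  fix u assume "u \<in> Ar CTX"
  then obtain n Us where u: "u = (n, Us)" and U: "relobs n Us" by (cases u) auto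
  let ?m = "length Us"
  show "strictly_preserves_ccs (FIB (Cod CTX u)) (reindex GRO CTX forget lft u) (ccF (Cod CTX u)) (ccF (Dom CTX u))"
    unfolding strictly_preserves_ccs_def u Ctx_simps fst_conv snd_conv
  proof (intro conjI ballI)
    show "FO (reindex GRO CTX forget lft (n, Us)) (cone1 (ccF ?m)) = cone1 (ccF n)"
      by (simp add: FO_reindex[OF relob_oneF U] oneF_sbst[OF U])
    fix X Y assume "X \<in> Ob (FIB ?m)" "Y \<in> Ob (FIB ?m)"
    then obtain F G where X: "X = (?m, F)" "relob ?m F" and Y: "Y = (?m, G)" "relob ?m G" by auto
    note FG = prod.relob_bapp[OF X(2) Y(2)] and E = exp.relob_bapp[OF X(2) Y(2)]
    note EF = prod.relob_bapp[OF E X(2)]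
    \<comment> \<open>The domain of evaluation is a product containing an exponential, so both
      connectives have to be moved past the substitution there.\<close>
    note s = prod.bapp_sbst[OF U X(2) Y(2)] exp.bapp_sbst[OF U X(2) Y(2)] prod.bapp_sbst[OF U E X(2)]
    note t = tsub_structure[OF U X(2) Y(2)]
    let ?r = "reindex GRO CTX forget lft (n, Us)"
    show "FO ?r (cprd (ccF ?m) X Y) = cprd (ccF n) (FO ?r X) (FO ?r Y)"
      "FO ?r (cexp (ccF ?m) X Y) = cexp (ccF n) (FO ?r X) (FO ?r Y)"
      by (simp_all add: X(1) Y(1) FO_reindex[OF _ U] X(2) Y(2) FG E s)
    show "FA ?r (cfst (ccF ?m) X Y) = cfst (ccF n) (FO ?r X) (FO ?r Y)"
      by (simp add: X(1) Y(1) FO_reindex[OF _ U] X(2) Y(2) s t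
          FA_reindex[OF U FG X(2) relar_pr1A[OF X(2) Y(2)]])
    show "FA ?r (csnd (ccF ?m) X Y) = csnd (ccF n) (FO ?r X) (FO ?r Y)"
      by (simp add: X(1) Y(1) FO_reindex[OF _ U] X(2) Y(2) s t
          FA_reindex[OF U FG Y(2) relar_pr2A[OF X(2) Y(2)]])
    show "FA ?r (cevl (ccF ?m) X Y) = cevl (ccF n) (FO ?r X) (FO ?r Y)"
      by (simp add: X(1) Y(1) FO_reindex[OF _ U] X(2) Y(2) s t
          FA_reindex[OF U EF Y(2) relar_evA[OF X(2) Y(2)]])
  qed
qed

end

theorem theorem25:
  fixes C :: "('o, 'a) cat" and p :: enat
    and Rel :: "('o, 'a) cubcat" and M :: "nat \<Rightarrow> 'a set"
  assumes "finitely_complete C"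
    and "cubical_category C p Rel"
    and "good_isos C p Rel M"
    and "parametric_model C p Rel M"
  shows "split_lambda2_fibration (IntRel C p Rel M) (Ctx C p Rel M) forget (subst_lift C p Rel M)
           1 (\<lambda>n. n + 1) (ctx_fst C p Rel M) (ctx_snd C p Rel M)"
proof -
  obtain T where T: "\<forall>l\<in>levels p. iterminal C (FO Rel l) (T l)"
    "\<forall>h\<in>faces p. fo (FA Rel h) \<cdot>\<^bsub>C\<^esub> T (Dom box h) = T (Cod box h)"
    "\<forall>h\<in>degens p. \<exists>i\<in>M (Cod box h).
       i \<in> ihom C (FO Rel (Cod box h)) (fo (FA Rel h) \<cdot>\<^bsub>C\<^esub> T (Dom box h)) (T (Cod box h))"
    using assms(4) by (auto simp: parametric_model_def stable_terminals_def)
  \<comment> \<open>The terminal comparisons are chosen for all degeneracies at once, as the locale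
    expects a function.\<close>
  obtain i where i: "\<forall>h\<in>degens p. i h \<in> M (Cod box h) \<and>
       i h \<in> ihom C (FO Rel (Cod box h)) (fo (FA Rel h) \<cdot>\<^bsub>C\<^esub> T (Dom box h)) (T (Cod box h))"
    using T(3) unfolding Bex_def by metis
  obtain P e where Pe: "stable_products C p Rel M P e" "stable_exponentials C p Rel M P e"
    using assms(4) by (auto simp: parametric_model_def)
  interpret parametric_cubical C p Rel M T i P e
    using assms T(1,2) i Pe by unfold_locales (auto simp: parametric_model_def)
  show ?thesis
    \<comment> \<open>The simple products are literally a conjunct of
      \<open>parametric_model\<close>, for the same lifts and context projections. The object 1
      serves both as the generic object and as the factor in the chosen products.\<close>
    unfolding split_lambda2_fibration_def
    using split_ccc Ctx_terminal split_generic Ctx_products assms(4) by (auto simp: parametric_model_def)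
qed

end
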